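(* Assume the standing hypotheses and the decomposition hypothesis of the context, $\nu_\infty:=\dim H^0_\infty>0$, the weak contraction hypothesis (with its constant $\rho_A\in(0,\infty]$), and $$\mathcal L(u)=\tfrac12 (B(\infty)u,u)_H+o(\|u\|^2)\quad\text{as }\|u\|\to\infty .$$ Then there exist $R>0$, a (unique) continuous map $h^\infty:B_{H^0_\infty}(\infty,R)\to X^\pm_\infty$ (which takes values in $\bar B_{X^\pm_\infty}(\theta,\rho_A)$ in the case $M(A)<\infty$) satisfying $$(I-P^0_\infty)A(z+h^\infty(z))=0\quad\text{for all } z\in B_{H^0_\infty}(\infty,R),$$ and a homeomorphism $\Phi:B_{H^0_\infty}(\infty,R)\oplus H^\pm_\infty\to B_{H^0_\infty}(\infty,R)\oplus H^\pm_\infty$ of the form $\Phi(z+u^++u^-)=z+h^\infty(z)+\phi_z(u^++u^-)$ with $\phi_z(u^++u^-)\in H^\pm_\infty$ and $\Phi(B_{H^0_\infty}(\infty,R)\oplus X^\pm_\infty)\subset X$, such that $$\mathcal L\circ\Phi(z+u^++u^-)=\|u^+\|^2-\|u^-\|^2+\mathcal L(z+h^\infty(z))$$ for all $z\in B_{H^0_\infty}(\infty,R)$, $u^+\in H^+_\infty$, $u^-\in H^-_\infty$. Moreover: (a) for each $z\in B_{H^0_\infty}(\infty,R)$, $\Phi(z+\theta)=z+h^\infty(z)$, and $\phi_z(u^++u^-)\in H^-_\infty$ if and only if $u^+=\theta$; (b) the restriction of $\Phi$ to $B_{H^0_\infty}(\infty,R)\oplus H^-_\infty\subset X$ is a homeomorphism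 onto its image $\Phi(B_{H^0_\infty}(\infty,R)\oplus H^-_\infty)\subset X$ even if both sets carry the topology induced by $X$. The map $h^\infty$ and the function $\mathcal L^\infty:B_{H^0_\infty}(\infty,R)\to\mathbb R$, $\mathcal L^\infty(z)=\mathcal L(z+h^\infty(z))$, also satisfy: (i) $\lim_{\|z\|_X\to\infty}\|h^\infty(z)\|_X=0$ provided $M(A)=0$; (ii) if $A$ is $C^1$, then $h^\infty$ is $C^1$ and $$dh^\infty(z)=-\bigl[(I-P^0_\infty)A'(z+h^\infty(z))|_{X^\pm_\infty}\bigr]^{-1}(I-P^0_\infty)A'(z+h^\infty(z))|_{H^0_\infty};$$ moreover $\mathcal L^\infty$ is $C^2$ and $$d\mathcal L^\infty(z_0)(z)=(A(z_0+h^\infty(z_0)),z)_H\quad\text{for all } z_0\in B_{H^0_\infty}(\infty,R),\ z\in H^0_\infty; \qquad( * )$$ (iii) if $\mathcal L$ is $C^2$, then $h^\infty$ is also $C^1$ as a map to $H^\pm_\infty$ (hence to $X^\pm_\infty$). If the weak contraction hypothesis is replaced by the strong contraction hypothesis (with $\rho_A$ the constant given there), then in addition: (iv) $h^\infty$ is Lipschitz, and has strict Fréchet derivative zero at $\infty$; (v) $\mathcal L^\infty$ is $C^1$ and $( * )$ holds; (vi) if $B(\infty)|_X\in L(X)$ and $A$ has the strict Fréchet derivative $B(\infty)|_X$ at $\infty$, then $\mathcal L^\infty$ is $C^{2-0}$ (i.e. $C^1$ with locally Lipschitz differential) and $d\mathcal L^\infty$ has strict Fréchet derivative zero at $\infty$.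 (In this case $\rho_A$ may be chosen to be any positive number, but $R$ depends on this choice.)
   Context: Conventions. $\theta$ is the zero vector. For a normed space $E$ and $R>0$: $B_E(\infty,R)=\{x\in E:\|x\|_E>R\}$, $\bar B_E(\infty,R)=\{\|x\|_E\ge R\}$; for $r\in(0,\infty]$, $B_E(\theta,r)$ and $\bar B_E(\theta,r)$ are the open and closed balls of radius $r$ (the whole space if $r=\infty$). A neighborhood of infinity contains some $B_E(\infty,R)$. A map $f$ on an open set is continuously directional differentiable if $Df(x)(u)=\lim_{t\to0}(f(x+tu)-f(x))/t$ exists for all $x$, $u$ and $x\mapsto Df(x)(u)$ is continuous for each $u$. A map $f$ from a neighborhood of infinity of a normed space $E$ to a normed space $E'$ has strict Fréchet derivative $T\in L(E,E')$ at $\infty$ if $\|f(x_1)-f(x_2)-T(x_1-x_2)\|/\|x_1-x_2\|\to0$ as $x_1\neq x_2$, $(\|x_1\|,\|x_2\|)\to(\infty,\infty)$. Standing hypotheses. $H$ is a real Hilbert space with inner product $(\cdot,\cdot)_H$ and norm $\|\cdot\|$; $X$ is a Banach space with norm $\|\cdot\|_X$, $X\subset H$ dense, $\|x\|\le\|x\|_X$ for $x\in X$. $V_\infty$ is an open neighborhood of infinity in $H$; $V_\infty^X$ is $V_\infty\cap X$ with the topology of $X$. $\mathcal L:V_\infty\to\mathbb R$ is continuous and continuously directional differentiable. There is a continuous and continuously directional differentiable $A:V^X_\infty\to X$ with $D\mathcal L(x)(u)=(A(x),u)_H$ for $x\in V_\infty\cap X$, $u\in X$. There is a map $B:(V_\infty\cap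 X)\cup\{\infty\}\to L_s(H)$ (bounded self-adjoint operators on $H$) with $B(\infty)(X)\subset X$ and $(DA(x)(u),v)_H=(B(x)u,v)_H$ for $x\in V_\infty\cap X$, $u,v\in X$. Either $0\notin\sigma(B(\infty))$ or $0$ is an isolated point of $\sigma(B(\infty))$. If $u\in H$ and $B(\infty)u\in X$, then $u\in X$. Decomposition hypothesis. $B(x)=P(x)+Q(x)$ for $x\in(V_\infty\cap X)\cup\{\infty\}$ with $P(x):H\to H$ positive definite linear and $Q(x):H\to H$ compact linear, such that: all eigenfunctions of $B(\infty)$ with negative eigenvalues lie in $X$; for every sequence $\{x_k\}\subset V_\infty\cap X$ with $\|x_k\|\to\infty$, $\|P(x_k)u-P(\infty)u\|\to0$ for all $u\in H$; $\|Q(x)-Q(\infty)\|_{L(H)}\to0$ as $x\in V_\infty\cap X$, $\|x\|\to\infty$; for every sequence $\{x_n\}\subset V_\infty\cap X$ with $\|x_n\|\to\infty$ there are $C_0>0$, $n_0$ with $(P(x_n)u,u)_H\ge C_0\|u\|^2$ for all $u\in H$, $n\ge n_0$. Notation. $H^0_\infty=\mathrm{Ker}\,B(\infty)$ (contained in $X$), $H^\pm_\infty=(H^0_\infty)^\perp=H^+_\infty\oplus H^-_\infty$, where $H^+_\infty$, $H^-_\infty$ are the positive and negative definite (spectral) subspaces of $B(\infty)$; $H^0_\infty$ and $H^-_\infty$ are finite dimensional and contained in $X$. $P^0_\infty$ is the orthogonal projection onto $H^0_\infty$. $X^\pm_\infty=H^\pm_\infty\cap X$ with norm $\|\cdot\|_X$.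 Balls in $H^0_\infty,H^+_\infty,H^-_\infty$ are taken with respect to $\|\cdot\|$. $B(\infty)|_{X^\pm_\infty}$ is a Banach isomorphism of $X^\pm_\infty$, and $C_1^\infty$ is the $L(X^\pm_\infty)$-norm of its inverse. $M(A)=\lim_{R\to\infty}\sup\{\|(I-P^0_\infty)A(z)\|_X: z\in H^0_\infty,\|z\|_X\ge R\}$. Put $N(z,x)=(I-P^0_\infty)A(z+x)-B(\infty)x$ for $z\in H^0_\infty$, $x\in X^\pm_\infty$. ($R_1$ below is always large enough that $z+x\in V_\infty\cap X$.) Weak contraction hypothesis. There are $R_1>0$, $\kappa>1$ and $\rho_A$ such that $\|N(z,x_1)-N(z,x_2)\|_X\le\frac1{\kappa C_1^\infty}\|x_1-x_2\|_X$ for all $x_1,x_2\in X^\pm_\infty$ with $\|x_i\|_X<\rho_A$ and all $z\in H^0_\infty$ with $\|z\|\ge R_1$; here either $M(A)<\infty$ and $\rho_A\in(\frac{\kappa}{\kappa-1}C_1^\infty M(A),\infty)$, or $\rho_A=\infty$ (in which case $M(A)<\infty$ is not required). Strong contraction hypothesis. The same, with the inequality replaced by $\|N(z_1,x_1)-N(z_2,x_2)\|_X\le\frac1{\kappa C_1^\infty}\|z_1+x_1-z_2-x_2\|_X$ for all such $x_i$ and all $z_1,z_2\in H^0_\infty$ with $\|z_i\|\ge R_1$.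
   Formalization: In (iv), the strict Fréchet derivative zero at infinity of h^∞ is proved for h^∞ as a map into H^±_∞ (norm of H); for the norm of X, where the claim fails in general, it is proved only under the additional hypothesis of (vi) that A has strict derivative B(∞)|_X at infinity. *)

theory Defs
  imports "HOL-Analysis.Analysis"
begin

section \<open>Calculus notions\<close>

definition dir_deriv :: "('a::real_normed_vector \<Rightarrow> 'b::real_normed_vector) \<Rightarrow> 'a \<Rightarrow> 'a \<Rightarrow> 'b"
  where "dir_deriv f x u = Lim (at 0) (\<lambda>t::real. (f (x + t *\<^sub>R u) - f x) /\<^sub>R t)"

definition cont_dir_diff_on :: "'a::real_normed_vector set \<Rightarrow> ('a \<Rightarrow> 'b::real_normed_vector) \<Rightarrow> bool"
  where "cont_dir_diff_on U f \<longleftrightarrow>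
    (\<forall>x\<in>U. \<forall>u. \<exists>d. ((\<lambda>t::real. (f (x + t *\<^sub>R u) - f x) /\<^sub>R t) \<longlongrightarrow> d) (at 0)) \<and>
    (\<forall>u. continuous_on U (\<lambda>x. dir_deriv f x u))"

text \<open>
  In the next definitions \<open>W\<close> is open in the whole space, or relatively open in a closed subspace
  \<open>E\<close> that is the range of a bounded projection \<open>p\<close> (below: \<open>E = Ker B(\<infinity>)\<close>).
  In the second case the values of a derivative at vectors outside \<open>E\<close> carry no information;
  composing with \<open>p\<close> turns a differential \<open>W \<rightarrow> L(E,F)\<close> into one with values in \<open>L('a,F)\<close>, so
  asking for some bounded linear extension to \<open>'a\<close> (continuous, Lipschitz, ... in \<open>z\<close>) is the same
  as asking for the property of the differential itself.
\<close>

definition has_differential_on ::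
  "'a::real_normed_vector set \<Rightarrow> ('a \<Rightarrow> 'b::real_normed_vector) \<Rightarrow> ('a \<Rightarrow> 'a \<Rightarrow>\<^sub>L 'b) \<Rightarrow> bool"
  where "has_differential_on W f f' \<longleftrightarrow>
    (\<forall>z\<in>W. (f has_derivative blinfun_apply (f' z)) (at z within W))"

definition C1_on :: "'a::real_normed_vector set \<Rightarrow> ('a \<Rightarrow> 'b::real_normed_vector) \<Rightarrow> bool"
  where "C1_on W f \<longleftrightarrow> (\<exists>f'. has_differential_on W f f' \<and> continuous_on W f')"

definition C2_on :: "'a::real_normed_vector set \<Rightarrow> ('a \<Rightarrow> 'b::real_normed_vector) \<Rightarrow> bool"
  where "C2_on W f \<longleftrightarrow> (\<exists>f'. has_differential_on W f f' \<and> C1_on W f')"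

definition locally_lipschitz_on ::
  "'a::metric_space set \<Rightarrow> ('a \<Rightarrow> 'b::metric_space) \<Rightarrow> bool"
  where "locally_lipschitz_on W f \<longleftrightarrow> (\<forall>z\<in>W. \<exists>r>0. \<exists>C. C-lipschitz_on (W \<inter> ball z r) f)"

definition has_strict_deriv_at_infinity ::
  "'a::real_normed_vector set \<Rightarrow> ('a \<Rightarrow> 'b::real_normed_vector) \<Rightarrow> ('a \<Rightarrow> 'b) \<Rightarrow> bool"
  where "has_strict_deriv_at_infinity W f T \<longleftrightarrow>
    ((\<lambda>(x1, x2). norm (f x1 - f x2 - T (x1 - x2)) / norm (x1 - x2)) \<longlongrightarrow> 0)
      (inf (at_infinity \<times>\<^sub>F at_infinity)
           (principal {(x1, x2). x1 \<in> W \<and> x2 \<in> W \<and> x1 \<noteq> x2}))"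


section \<open>Operators on a Hilbert space\<close>

definition selfadjoint_op :: "('h::real_inner \<Rightarrow>\<^sub>L 'h) \<Rightarrow> bool"
  where "selfadjoint_op T \<longleftrightarrow> (\<forall>u v. inner (T u) v = inner u (T v))"

definition compact_op :: "('a::real_normed_vector \<Rightarrow>\<^sub>L 'b::real_normed_vector) \<Rightarrow> bool"
  where "compact_op T \<longleftrightarrow> (\<forall>S. bounded S \<longrightarrow> compact (closure (blinfun_apply T ` S)))"

definition pos_def_map :: "('h::real_inner \<Rightarrow> 'h) \<Rightarrow> bool"
  where "pos_def_map p \<longleftrightarrow> linear p \<and> (\<forall>u. u \<noteq> 0 \<longrightarrow> inner (p u) u > 0)"

text \<open>For self-adjoint operators the spectrum of the complexification is real, so it coincides
  with the following set.\<close>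

definition op_spectrum :: "('h::real_normed_vector \<Rightarrow>\<^sub>L 'h) \<Rightarrow> real set"
  where "op_spectrum T = {r. \<not> (\<exists>S. S o\<^sub>L (T - r *\<^sub>R id_blinfun) = id_blinfun \<and>
                                     (T - r *\<^sub>R id_blinfun) o\<^sub>L S = id_blinfun)}"

definition ker_op :: "('h::real_normed_vector \<Rightarrow>\<^sub>L 'h) \<Rightarrow> 'h set"
  where "ker_op T = {u. blinfun_apply T u = 0}"

text \<open>For a self-adjoint \<open>T\<close> the spectral subspaces of \<open>T\<close> belonging to \<open>(0,\<infinity>)\<close> and to
  \<open>(-\<infinity>,0)\<close> are the largest closed invariant subspaces on which \<open>T\<close> is positive, respectively
  negative, definite.\<close>

definition pos_subspace :: "('h::real_inner \<Rightarrow>\<^sub>L 'h) \<Rightarrow> 'h set"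
  where "pos_subspace T = \<Union> {S. subspace S \<and> closed S \<and> blinfun_apply T ` S \<subseteq> S \<and>
                                 (\<forall>u\<in>S - {0}. inner (T u) u > 0)}"

definition neg_subspace :: "('h::real_inner \<Rightarrow>\<^sub>L 'h) \<Rightarrow> 'h set"
  where "neg_subspace T = \<Union> {S. subspace S \<and> closed S \<and> blinfun_apply T ` S \<subseteq> S \<and>
                                 (\<forall>u\<in>S - {0}. inner (T u) u < 0)}"

definition orth_proj :: "'h::real_inner set \<Rightarrow> 'h \<Rightarrow> 'h"
  where "orth_proj S u = (THE p. p \<in> S \<and> u - p \<in> S\<^sup>\<bottom>)"

definition onorm_on :: "'a::real_normed_vector set \<Rightarrow> ('a \<Rightarrow> 'b::real_normed_vector) \<Rightarrow> real"
  where "onorm_on S f = (SUP x\<in>S. norm (f x) / norm x)"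


section \<open>The dense subspace \<open>X\<close> of \<open>H\<close>\<close>

text \<open>
  The Banach space \<open>X\<close> is a type \<open>'x\<close> of its own, and the inclusion \<open>X \<subseteq> H\<close> is an injective
  linear map \<open>\<iota>\<close>. Thus \<open>norm x\<close> is the norm of \<open>X\<close> and \<open>norm (\<iota> x)\<close> that of \<open>H\<close>, and
  \<open>u \<in> range \<iota>\<close> expresses that \<open>u \<in> H\<close> lies in \<open>X\<close>. A family indexed by \<open>(V\<^sub>\<infinity> \<inter> X) \<union> {\<infinity>}\<close>
  is given by a function on \<open>'x\<close>, relevant only on \<open>\<iota> -` V\<close>, and a separate value at \<open>\<infinity>\<close>.
\<close>

locale standing_hypotheses =
  fixes \<iota> :: "'x::banach \<Rightarrow> 'h::{real_inner, complete_space}"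
    and V :: "'h set"
    and L :: "'h \<Rightarrow> real"
    and A :: "'x \<Rightarrow> 'x"
    and B :: "'x \<Rightarrow> 'h \<Rightarrow>\<^sub>L 'h"
    and Binf :: "'h \<Rightarrow>\<^sub>L 'h"
  assumes incl_linear: "linear \<iota>"
    and incl_inj: "inj \<iota>"
    and incl_dense: "closure (range \<iota>) = UNIV"
    and incl_norm: "\<And>x. norm (\<iota> x) \<le> norm x"
    and V_open: "open V"
    and V_nbhd_infinity: "\<exists>R>0. {u. norm u > R} \<subseteq> V"
    and L_cont: "continuous_on V L"
    and L_diff: "cont_dir_diff_on V L"
    and A_cont: "continuous_on (\<iota> -` V) A"
    and A_diff: "cont_dir_diff_on (\<iota> -` V) A"
    and A_gradient: "\<And>x u. \<iota> x \<in> V \<Longrightarrow> dir_deriv L (\<iota> x) (\<iota> u) = inner (\<iota> (A x)) (\<iota> u)"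
    and B_selfadjoint: "\<And>x. \<iota> x \<in> V \<Longrightarrow> selfadjoint_op (B x)"
    and Binf_selfadjoint: "selfadjoint_op Binf"
    and Binf_preserves: "blinfun_apply Binf ` range \<iota> \<subseteq> range \<iota>"
    and B_hessian: "\<And>x u v. \<iota> x \<in> V \<Longrightarrow>
          inner (\<iota> (dir_deriv A x u)) (\<iota> v) = inner (B x (\<iota> u)) (\<iota> v)"
    and Binf_spectrum: "0 \<notin> op_spectrum Binf \<or> 0 isolated_in op_spectrum Binf"
    and Binf_regular: "\<And>u. Binf u \<in> range \<iota> \<Longrightarrow> u \<in> range \<iota>"

locale decomposition_hypothesis =
  fixes \<iota> :: "'x::banach \<Rightarrow> 'h::{real_inner, complete_space}"
    and V :: "'h set"
    and B :: "'x \<Rightarrow> 'h \<Rightarrow>\<^sub>L 'h"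
    and Binf :: "'h \<Rightarrow>\<^sub>L 'h"
    and P :: "'x \<Rightarrow> 'h \<Rightarrow> 'h"
    and Pinf :: "'h \<Rightarrow> 'h"
    and Q :: "'x \<Rightarrow> 'h \<Rightarrow>\<^sub>L 'h"
    and Qinf :: "'h \<Rightarrow>\<^sub>L 'h"
  assumes B_decomp: "\<And>x u. \<iota> x \<in> V \<Longrightarrow> B x u = P x u + Q x u"
    and Binf_decomp: "\<And>u. Binf u = Pinf u + Qinf u"
    and P_pos_def: "\<And>x. \<iota> x \<in> V \<Longrightarrow> pos_def_map (P x)"
    and Pinf_pos_def: "pos_def_map Pinf"
    and Q_compact: "\<And>x. \<iota> x \<in> V \<Longrightarrow> compact_op (Q x)"
    and Qinf_compact: "compact_op Qinf"
    and neg_eigenvectors: "\<And>u r. r < 0 \<Longrightarrow> Binf u = r *\<^sub>R u \<Longrightarrow> u \<in> range \<iota>"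
    and P_strong_conv: "\<And>s u. (\<forall>k::nat. \<iota> (s k) \<in> V) \<Longrightarrow>
          filterlim (\<lambda>k. norm (\<iota> (s k))) at_top sequentially \<Longrightarrow>
          (\<lambda>k. norm (P (s k) u - Pinf u)) \<longlonglongrightarrow> 0"
    and Q_norm_conv: "((\<lambda>x. norm (Q x - Qinf)) \<longlongrightarrow> 0)
          (inf (filtercomap (\<lambda>x. norm (\<iota> x)) at_top) (principal (\<iota> -` V)))"
    and P_coercive: "\<And>s. (\<forall>k::nat. \<iota> (s k) \<in> V) \<Longrightarrow>
          filterlim (\<lambda>k. norm (\<iota> (s k))) at_top sequentially \<Longrightarrow>
          \<exists>C0>0. \<exists>n0. \<forall>n\<ge>n0. \<forall>u. inner (P (s n) u) u \<ge> C0 * (norm u)\<^sup>2"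


section \<open>Notation at infinity\<close>

text \<open>In this section \<open>T\<close> stands for \<open>B(\<infinity>)\<close>. Its kernel lies in \<open>X\<close> (by \<open>Binf_regular\<close>) and,
  under the decomposition hypothesis, is finite dimensional. Subspaces of \<open>X\<close> are sets in \<open>'x\<close>;
  on the kernel the two norms are equivalent.\<close>

definition restrict_X :: "('x \<Rightarrow> 'h) \<Rightarrow> ('h \<Rightarrow> 'h) \<Rightarrow> 'x \<Rightarrow> 'x"
  where "restrict_X \<iota> F x = inv \<iota> (F (\<iota> x))"

definition X_ker :: "('x \<Rightarrow> 'h::real_inner) \<Rightarrow> ('h \<Rightarrow>\<^sub>L 'h) \<Rightarrow> 'x set"
  where "X_ker \<iota> T = \<iota> -` ker_op T"

definition X_pm :: "('x \<Rightarrow> 'h::real_inner) \<Rightarrow> ('h \<Rightarrow>\<^sub>L 'h) \<Rightarrow> 'x set"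
  where "X_pm \<iota> T = \<iota> -` ((ker_op T)\<^sup>\<bottom>)"

definition co_proj :: "('x::real_normed_vector \<Rightarrow> 'h::real_inner) \<Rightarrow> ('h \<Rightarrow>\<^sub>L 'h) \<Rightarrow> 'x \<Rightarrow> 'x"
  where "co_proj \<iota> T x = x - restrict_X \<iota> (orth_proj (ker_op T)) x"

definition C1_inf :: "('x::real_normed_vector \<Rightarrow> 'h::real_inner) \<Rightarrow> ('h \<Rightarrow>\<^sub>L 'h) \<Rightarrow> real"
  where "C1_inf \<iota> T = onorm_on (X_pm \<iota> T) (inv_into (X_pm \<iota> T) (restrict_X \<iota> T))"

definition M_inf ::
  "('x::real_normed_vector \<Rightarrow> 'h::real_inner) \<Rightarrow> ('h \<Rightarrow>\<^sub>L 'h) \<Rightarrow> ('x \<Rightarrow> 'x) \<Rightarrow> ereal"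
  where "M_inf \<iota> T A =
    Lim at_top (\<lambda>R::real. SUP z\<in>{z \<in> X_ker \<iota> T. norm z \<ge> R}. ereal (norm (co_proj \<iota> T (A z))))"

definition N_map ::
  "('x::real_normed_vector \<Rightarrow> 'h::real_inner) \<Rightarrow> ('h \<Rightarrow>\<^sub>L 'h) \<Rightarrow> ('x \<Rightarrow> 'x) \<Rightarrow> 'x \<Rightarrow> 'x \<Rightarrow> 'x"
  where "N_map \<iota> T A z x = co_proj \<iota> T (A (z + x)) - restrict_X \<iota> T x"

definition admissible_radius ::
  "('x::real_normed_vector \<Rightarrow> 'h::real_inner) \<Rightarrow> ('h \<Rightarrow>\<^sub>L 'h) \<Rightarrow> ('x \<Rightarrow> 'x) \<Rightarrow> real \<Rightarrow> ereal \<Rightarrow> bool"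
  where "admissible_radius \<iota> T A \<kappa> \<rho> \<longleftrightarrow>
    (M_inf \<iota> T A < \<infinity> \<and> ereal (\<kappa> / (\<kappa> - 1) * C1_inf \<iota> T) * M_inf \<iota> T A < \<rho> \<and> \<rho> < \<infinity>) \<or> \<rho> = \<infinity>"

definition contraction_domain ::
  "('x::real_normed_vector \<Rightarrow> 'h::real_inner) \<Rightarrow> ('h \<Rightarrow>\<^sub>L 'h) \<Rightarrow> real \<Rightarrow> ereal \<Rightarrow> ('x \<times> 'x) set"
  where "contraction_domain \<iota> T R1 \<rho> =
    {(z, x). z \<in> X_ker \<iota> T \<and> norm (\<iota> z) \<ge> R1 \<and> x \<in> X_pm \<iota> T \<and> ereal (norm x) < \<rho>}"

definition weak_inequality ::
  "('x::real_normed_vector \<Rightarrow> 'h::real_inner) \<Rightarrow> 'h set \<Rightarrow> ('h \<Rightarrow>\<^sub>L 'h) \<Rightarrow> ('x \<Rightarrow> 'x) \<Rightarrow>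
    real \<Rightarrow> real \<Rightarrow> ereal \<Rightarrow> bool"
  where "weak_inequality \<iota> V T A R1 \<kappa> \<rho> \<longleftrightarrow>
    (\<forall>(z, x) \<in> contraction_domain \<iota> T R1 \<rho>. \<iota> (z + x) \<in> V) \<and>
    (\<forall>z x1 x2. (z, x1) \<in> contraction_domain \<iota> T R1 \<rho> \<and> (z, x2) \<in> contraction_domain \<iota> T R1 \<rho> \<longrightarrow>
       norm (N_map \<iota> T A z x1 - N_map \<iota> T A z x2) \<le> 1 / (\<kappa> * C1_inf \<iota> T) * norm (x1 - x2))"

definition strong_inequality ::
  "('x::real_normed_vector \<Rightarrow> 'h::real_inner) \<Rightarrow> 'h set \<Rightarrow> ('h \<Rightarrow>\<^sub>L 'h) \<Rightarrow> ('x \<Rightarrow> 'x) \<Rightarrow>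
    real \<Rightarrow> real \<Rightarrow> ereal \<Rightarrow> bool"
  where "strong_inequality \<iota> V T A R1 \<kappa> \<rho> \<longleftrightarrow>
    (\<forall>(z, x) \<in> contraction_domain \<iota> T R1 \<rho>. \<iota> (z + x) \<in> V) \<and>
    (\<forall>(z1, x1) \<in> contraction_domain \<iota> T R1 \<rho>. \<forall>(z2, x2) \<in> contraction_domain \<iota> T R1 \<rho>.
       norm (N_map \<iota> T A z1 x1 - N_map \<iota> T A z2 x2)
         \<le> 1 / (\<kappa> * C1_inf \<iota> T) * norm (z1 + x1 - z2 - x2))"

definition weak_contraction_hypothesis ::
  "('x::real_normed_vector \<Rightarrow> 'h::real_inner) \<Rightarrow> 'h set \<Rightarrow> ('h \<Rightarrow>\<^sub>L 'h) \<Rightarrow> ('x \<Rightarrow> 'x) \<Rightarrow> ereal \<Rightarrow> bool"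
  where "weak_contraction_hypothesis \<iota> V T A \<rho> \<longleftrightarrow>
    (\<exists>R1>0. \<exists>\<kappa>>1. admissible_radius \<iota> T A \<kappa> \<rho> \<and> weak_inequality \<iota> V T A R1 \<kappa> \<rho>)"

definition strong_contraction_hypothesis ::
  "('x::real_normed_vector \<Rightarrow> 'h::real_inner) \<Rightarrow> 'h set \<Rightarrow> ('h \<Rightarrow>\<^sub>L 'h) \<Rightarrow> ('x \<Rightarrow> 'x) \<Rightarrow> ereal \<Rightarrow> bool"
  where "strong_contraction_hypothesis \<iota> V T A \<rho> \<longleftrightarrow>
    (\<exists>R1>0. \<exists>\<kappa>>1. admissible_radius \<iota> T A \<kappa> \<rho> \<and> strong_inequality \<iota> V T A R1 \<kappa> \<rho>)"

definition ker_outside :: "('x \<Rightarrow> 'h::real_inner) \<Rightarrow> ('h \<Rightarrow>\<^sub>L 'h) \<Rightarrow> real \<Rightarrow> 'x set"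
  where "ker_outside \<iota> T R = {z \<in> X_ker \<iota> T. norm (\<iota> z) > R}"

definition ker_outside_plus :: "('h::real_inner \<Rightarrow>\<^sub>L 'h) \<Rightarrow> real \<Rightarrow> 'h set \<Rightarrow> 'h set"
  where "ker_outside_plus T R S = {z + u | z u. z \<in> ker_op T \<and> norm z > R \<and> u \<in> S}"

text \<open>The properties that determine \<open>h\<^sup>\<infinity>\<close>. In the hypotheses \<open>\<rho> < \<infinity>\<close> only occurs together with
  \<open>M(A) < \<infinity>\<close>, and for \<open>\<rho> = \<infinity>\<close> the norm bound is void.\<close>

definition is_reduction_map ::
  "('x::real_normed_vector \<Rightarrow> 'h::real_inner) \<Rightarrow> ('h \<Rightarrow>\<^sub>L 'h) \<Rightarrow> ('x \<Rightarrow> 'x) \<Rightarrow> ereal \<Rightarrow> real \<Rightarrow>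
    ('x \<Rightarrow> 'x) \<Rightarrow> bool"
  where "is_reduction_map \<iota> T A \<rho> R h \<longleftrightarrow>
    continuous_on (ker_outside \<iota> T R) h \<and>
    (\<forall>z\<in>ker_outside \<iota> T R. h z \<in> X_pm \<iota> T \<and> ereal (norm (h z)) \<le> \<rho> \<and>
       co_proj \<iota> T (A (z + h z)) = 0)"

end

theory Submission
  imports Defs
begin

text \<open>
Write \<open>T = B(\<infinity>)\<close>, let \<open>H\<^sup>0\<close> be its kernel and \<open>p\<close> the
projection onto its complement. The theorem combines a Lyapunov-Schmidt reduction at infinity, carried out in
\<open>X\<close>, with a Morse lemma for functions that are convex in one variable and concave in the other, carried
out in \<open>H\<close>.

Spectral part. Since \<open>T\<close> is a coercive operator plus a compact one, bounded approximate eigenvectors for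
an eigenvalue \<open>r \<le> 0\<close> have convergent subsequences. Hence a maximal orthonormal family of
eigenvectors with eigenvalues \<open>\<le> 0\<close> is finite and \<open>T\<close> is coercive on its orthogonal
complement (\<open>maximal_eigenframe\<close>); its members with eigenvalue \<open>0\<close> span
\<open>H\<^sup>0\<close>, the others span \<open>H\<^sup>-\<close>, and the complement is \<open>H\<^sup>+\<close>.
Weak compactness and the same play of coercivity against compactness make this uniform far away: \<open>B(x)\<close>
is positive on \<open>H\<^sup>+\<close> and negative on \<open>H\<^sup>-\<close> with constants independent of
\<open>x\<close>, and tends to \<open>0\<close> in norm on \<open>H\<^sup>0\<close> (\<open>B_definite_far\<close>,
\<open>B_small_on_ker_far\<close>).

Reduction. The closed graph theorem turns \<open>T\<close> into an isomorphism of \<open>X\<^sup>\<plusminus>\<close>,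
so that \<open>p A(z + x) = 0\<close> is the fixed point equation \<open>x = - T\<^sup>-\<^sup>1 N(z, x)\<close>. The
weak contraction hypothesis makes it a contraction of a ball of \<open>X\<^sup>\<plusminus>\<close>, and more:
\<open>x \<mapsto> p A(z + x)\<close> is bounded below (\<open>reduced_gradient_lower\<close>). This one inequality
gives uniqueness and continuity of \<open>h\<close>. It also bounds \<open>h(z + t v) - (h(z) + t d)\<close> by an
increment of \<open>p A\<close> along a line, which is \<open>o(t)\<close> for the \<open>d\<close> that solves the
linearised equation; so \<open>h\<close> has directional derivatives, these depend continuously on \<open>z\<close>,
and as \<open>H\<^sup>0\<close> is finite dimensional \<open>h\<close> is \<open>C\<^sup>1\<close> into
\<open>X\<close>. At the points \<open>z + h(z)\<close> the gradient \<open>A\<close> lies in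
\<open>H\<^sup>0\<close>, so the derivative of \<open>h\<close> drops out of that of \<open>z \<mapsto> \<L>(z +
h(z))\<close>.

Morse lemma. For fixed \<open>z\<close> the function \<open>J(x, y) = \<L>(z + h(z) + x + y) - \<L>(z + h(z))\<close>
is convex in \<open>x \<in> H\<^sup>+\<close> and strongly concave in \<open>y \<in> H\<^sup>-\<close>, because its
second derivative is \<open>B\<close> at far points of \<open>X\<close> and \<open>X\<close> is dense. With
\<open>m(x)\<close> the maximizer in \<open>y\<close>, both \<open>J(x, m(x))\<close> and \<open>J(x, m(x)) - J(x,
m(x) + y)\<close> are starlike and grow quadratically, so rescaling along rays turns them into
\<open>\<parallel>x\<parallel>\<^sup>2\<close> and \<open>\<parallel>y\<parallel>\<^sup>2\<close>, continuously in all
parameters (\<open>radial_homeomorphism\<close>, \<open>saddle_normal_form\<close>). Rescaling along rays preserves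
\<open>X\<close>, and \<open>H\<^sup>-\<close> is finite dimensional, whence the statements about \<open>X\<close>.

Strict derivatives at infinity. If the segment from \<open>z\<^sub>1\<close> to \<open>z\<^sub>2\<close> stays far
out, testing the increment of \<open>A\<close> with \<open>u\<^sup>+ - u\<^sup>-\<close>, where \<open>u =
h(z\<^sub>1) - h(z\<^sub>2)\<close>, bounds \<open>\<parallel>u\<parallel>\<close> by a small multiple of
\<open>\<parallel>z\<^sub>1 - z\<^sub>2\<parallel>\<close>, since \<open>B\<close> is definite on both parts and small
on \<open>H\<^sup>0\<close>; testing with the increment itself treats the differential of the reduced functional. When
the segment passes near the origin, the distance of \<open>z\<^sub>1\<close> and \<open>z\<^sub>2\<close> is so large
that sublinear growth suffices (\<open>strict_deriv_zero_from_segments\<close>).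
\<close>

section \<open>Projections and weak compactness in Hilbert spaces\<close>

lemma norm_diff_scaleR_power2:
  fixes a s :: "'h::real_inner"
  shows "(norm (a - t *\<^sub>R s))\<^sup>2 = (norm a)\<^sup>2 - 2 * t * inner a s + t\<^sup>2 * (norm s)\<^sup>2"
  unfolding power2_norm_eq_inner
  by (simp add: inner_diff_left inner_diff_right inner_commute power2_eq_square algebra_simps)

text \<open>
A minimizing sequence for the distance from \<open>u\<close> to \<open>S\<close> is Cauchy by the parallelogram law, and
moving its limit \<open>p\<close> along any \<open>s \<in> S\<close> does not shorten \<open>u - p\<close>, which is therefore orthogonal to \<open>S\<close>.
\<close>
lemma closed_subspace_projection:
  fixes S :: "'h::{real_inner, complete_space} set"
  assumes S: "subspace S" "closed S"
  obtains p where "p \<in> S" "u - p \<in> S\<^sup>\<bottom>"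
proof -
  define d where "d = Inf ((\<lambda>s. (norm (u - s))\<^sup>2) ` S)"
  have bdd: "bdd_below ((\<lambda>s. (norm (u - s))\<^sup>2) ` S)"
    by (rule bdd_belowI[of _ 0]) auto
  have ne: "(\<lambda>s. (norm (u - s))\<^sup>2) ` S \<noteq> {}"
    using subspace_0[OF S(1)] by auto
  have d_le: "d \<le> (norm (u - s))\<^sup>2" if "s \<in> S" for s
    unfolding d_def using that bdd by (intro cINF_lower)
  have "\<exists>s\<in>S. (norm (u - s))\<^sup>2 < d + 1 / (Suc n)" for n
  proof -
    have "d < d + 1 / Suc n" by simp
    then show ?thesis unfolding d_def using cInf_lessD[OF ne] by fastforce
  qed
  then obtain f where f: "\<And>n. f n \<in> S" "\<And>n. (norm (u - f n))\<^sup>2 < d + 1 / Suc n"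
    by metis
  have par: "(norm (f m - f n))\<^sup>2 \<le> 2 / Suc m + 2 / Suc n" for m n
  proof -
    have "(1/2) *\<^sub>R (f m + f n) \<in> S"
      using f(1) S(1) by (simp add: subspace_add subspace_scale)
    from d_le[OF this] have "4 * d \<le> 4 * (norm (u - (1/2) *\<^sub>R (f m + f n)))\<^sup>2" by simp
    also have "\<dots> = 2 * (norm (u - f m))\<^sup>2 + 2 * (norm (u - f n))\<^sup>2 - (norm (f m - f n))\<^sup>2"
      by (simp add: power2_norm_eq_inner inner_diff_left inner_diff_right inner_add_left inner_add_right
          inner_commute algebra_simps)
    finally show ?thesis using f(2)[of m] f(2)[of n] by linarith
  qed
  have "Cauchy f"
  proof (rule metric_CauchyI)
    fix e :: real assume e: "e > 0"
    obtain N :: nat where N: "4 / e\<^sup>2 < N" using reals_Archimedean2 by blast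
    have "dist (f m) (f n) < e" if "m \<ge> N" "n \<ge> N" for m n
    proof -
      have N0: "N > 0" using N e by (metis divide_pos_pos gr0I not_less_iff_gr_or_eq of_nat_0 zero_less_numeral zero_less_power order.strict_trans)
      have "2 / Suc m \<le> 2 / N" "2 / Suc n \<le> 2 / N"
        using that N0 by (auto intro!: divide_left_mono)
      then have "(norm (f m - f n))\<^sup>2 \<le> 4 / N" using par[of m n] by simp
      also have "\<dots> < e\<^sup>2" using N N0 e by (simp add: field_simps)
      finally show ?thesis using e by (simp add: dist_norm power_less_imp_less_base)
    qed
    then show "\<exists>M. \<forall>m\<ge>M. \<forall>n\<ge>M. dist (f m) (f n) < e" by blast
  qed
  then obtain p where p: "f \<longlonglongrightarrow> p" using Cauchy_convergent convergent_def by blast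
  have pS: "p \<in> S" using S(2) f(1) p by (meson closed_sequentially)
  have "(\<lambda>n. (norm (u - f n))\<^sup>2) \<longlonglongrightarrow> (norm (u - p))\<^sup>2"
    by (intro tendsto_intros p)
  moreover have "(\<lambda>n. d + 1 / Suc n) \<longlonglongrightarrow> d + 0"
    by (intro tendsto_intros lim_1_over_n[THEN LIMSEQ_Suc])
  ultimately have "(norm (u - p))\<^sup>2 \<le> d + 0"
    by (rule LIMSEQ_le) (use f(2) less_imp_le in blast)
  then have min: "(norm (u - p))\<^sup>2 \<le> (norm (u - s))\<^sup>2" if "s \<in> S" for s
    using d_le[OF that] by linarith
  have "inner s (u - p) = 0" if s: "s \<in> S" for s
  proof (cases "s = 0")
    case False
    \<comment> \<open>the \<open>t\<close> for which \<open>p + t s\<close> is nearest to \<open>u\<close>\<close>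
    define t where "t = inner s (u - p) / (norm s)\<^sup>2"
    have "(norm (u - p))\<^sup>2 \<le> (norm (u - (p + t *\<^sub>R s)))\<^sup>2"
      using s pS S(1) by (intro min) (simp add: subspace_add subspace_scale)
    also have "u - (p + t *\<^sub>R s) = (u - p) - t *\<^sub>R s" by simp
    also have "(norm ((u - p) - t *\<^sub>R s))\<^sup>2 = (norm (u - p))\<^sup>2 - 2 * t * inner s (u - p) + t\<^sup>2 * (norm s)\<^sup>2"
      by (simp only: norm_diff_scaleR_power2) (simp add: inner_commute)
    also have "\<dots> = (norm (u - p))\<^sup>2 - (inner s (u - p))\<^sup>2 / (norm s)\<^sup>2"
      using False by (simp add: t_def power2_eq_square field_simps)
    finally have "(inner s (u - p))\<^sup>2 / (norm s)\<^sup>2 \<le> 0" by simp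
    then show ?thesis using False by (simp add: divide_le_0_iff)
  qed simp
  then show ?thesis using pS that by (auto simp: orthogonal_comp_def orthogonal_def)
qed

text \<open>
Any \<open>q \<noteq> 0\<close> orthogonal to the kernel of \<open>f\<close> represents \<open>f\<close> up to a factor, since \<open>v - (f v / f q) q\<close> lies in
the kernel.
\<close>
lemma riesz_representation:
  fixes f :: "'h::{real_inner, complete_space} \<Rightarrow> real"
  assumes "bounded_linear f"
  obtains w where "\<And>v. f v = inner w v"
proof (cases "\<exists>u. f u \<noteq> 0")
  case True
  then obtain u where u: "f u \<noteq> 0" by blast
  interpret bounded_linear f by fact
  let ?K = "{v. f v = 0}"
  have "subspace ?K" by (auto simp: subspace_def add scale)
  moreover have "closed ?K"
    by (intro closed_Collect_eq continuous_intros linear_continuous_on assms)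
  ultimately obtain p where p: "f p = 0" "u - p \<in> ?K\<^sup>\<bottom>"
    using closed_subspace_projection[of ?K u] by blast
  define q where "q = u - p"
  have fq: "f q = f u" using p by (simp add: q_def diff)
  have q0: "q \<noteq> 0" using fq u zero by auto
  have "f v = inner ((f q / (norm q)\<^sup>2) *\<^sub>R q) v" for v
  proof -
    have "f (v - (f v / f q) *\<^sub>R q) = 0" using fq u by (simp add: diff scale)
    then have "inner (v - (f v / f q) *\<^sub>R q) q = 0"
      using p(2) by (auto simp: orthogonal_comp_def orthogonal_def q_def)
    then have "inner q v = f v / f q * (norm q)\<^sup>2"
      using fq u by (simp add: inner_diff_right inner_commute power2_norm_eq_inner)
    then show ?thesis using fq u q0 by (simp add: field_simps)
  qed
  then show ?thesis using that by blast
next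
  case False
  then show ?thesis using that[of 0] by auto
qed

text \<open>
By compactness of a countable product of intervals some subsequence has convergent inner products
with every member of the sequence, hence with the vectors of the closed linear span, and it is orthogonal to
the complement of that span. The limit is a bounded functional, represented by a vector.
\<close>
lemma bounded_seq_weakly_convergent_subseq:
  fixes u :: "nat \<Rightarrow> 'h::{real_inner, complete_space}"
  assumes bd: "\<And>n. norm (u n) \<le> C"
  obtains r w where "strict_mono r" "\<And>v. (\<lambda>n. inner (u (r n)) v) \<longlonglongrightarrow> inner w v"
proof -
  have C0: "C \<ge> 0" using bd[of 0] norm_ge_zero order_trans by blast
  define K :: "(nat \<Rightarrow> real) set" where "K = PiE UNIV (\<lambda>_. {-C\<^sup>2..C\<^sup>2})"
  have "compactin (product_topology (\<lambda>_. euclideanreal) UNIV) K"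
    unfolding K_def by (subst compactin_PiE) auto
  then have "compact K" by (simp add: euclidean_product_topology)
  then have sc: "seq_compact K" by (rule compact_imp_seq_compact)
  have "\<forall>n. (\<lambda>k. inner (u n) (u k)) \<in> K"
  proof (intro allI)
    fix n
    have "\<bar>inner (u n) (u k)\<bar> \<le> C\<^sup>2" for k
      using Cauchy_Schwarz_ineq2[of "u n" "u k"] mult_mono[OF bd[of n] bd[of k]] C0
      by (simp add: power2_eq_square)
    then show "(\<lambda>k. inner (u n) (u k)) \<in> K"
      unfolding K_def by (intro PiE_I) (auto simp: abs_le_iff minus_le_iff)
  qed
  then obtain l r where r: "strict_mono r" and l: "((\<lambda>n k. inner (u n) (u k)) \<circ> r) \<longlonglongrightarrow> l"
    using seq_compactE[OF sc] by metis
  have lk: "(\<lambda>n. inner (u (r n)) (u k)) \<longlonglongrightarrow> l k" for k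
  proof -
    have "isCont (\<lambda>x::nat\<Rightarrow>real. x k) l"
      using continuous_on_product_coordinates[where i=k and 'b=real] unfolding continuous_on_eq_continuous_at[OF open_UNIV] by blast
    from isCont_tendsto_compose[OF this l] show ?thesis by (simp add: o_def)
  qed
  define D where "D = {v. convergent (\<lambda>n. inner (u (r n)) v)}"
  have subD: "subspace D"
    unfolding D_def subspace_def mem_Collect_eq
  proof (intro conjI ballI allI impI)
    show "convergent (\<lambda>n. inner (u (r n)) 0)" by (simp add: convergent_const)
    show "convergent (\<lambda>n. inner (u (r n)) (x + y))"
      if "x \<in> {v. convergent (\<lambda>n. inner (u (r n)) v)}" "y \<in> {v. convergent (\<lambda>n. inner (u (r n)) v)}" for x y
      using convergent_add[of "\<lambda>n. inner (u (r n)) x" "\<lambda>n. inner (u (r n)) y"] that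
      by (simp add: inner_add_right)
    show "convergent (\<lambda>n. inner (u (r n)) (c *\<^sub>R x))"
      if "x \<in> {v. convergent (\<lambda>n. inner (u (r n)) v)}" for c x
      using convergent_mult[OF convergent_const[of c], of "\<lambda>n. inner (u (r n)) x"] that by simp
  qed
  have bdl: "\<bar>inner (u (r n)) v\<bar> \<le> C * norm v" for n v
    using Cauchy_Schwarz_ineq2[of "u (r n)" v] mult_right_mono[OF bd[of "r n"], of "norm v"] by simp
  have clD: "closed D"
  proof -
    have "v \<in> D" if v: "\<And>e. e > 0 \<Longrightarrow> \<exists>d\<in>D. dist d v < e" for v
    proof -
      have "Cauchy (\<lambda>n. inner (u (r n)) v)"
      proof (rule metric_CauchyI)
        fix e :: real assume e: "e > 0"
        obtain d where d: "d \<in> D" "dist d v < e / (3 * (C + 1))" using v[of "e / (3 * (C + 1))"] e C0 by auto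
        have "C * dist d v \<le> C * (e / (3 * (C + 1)))" using d(2) C0 by (intro mult_left_mono) auto
        also have "\<dots> < e / 3" using C0 e by (simp add: field_simps)
        finally have s: "\<bar>inner (u (r n)) (d - v)\<bar> < e / 3" for n
          using bdl[of n "d - v"] by (simp add: dist_norm)
        have "Cauchy (\<lambda>n. inner (u (r n)) d)" using d(1) by (simp add: D_def convergent_Cauchy)
        then obtain M where M: "\<And>m n. m \<ge> M \<Longrightarrow> n \<ge> M \<Longrightarrow> dist (inner (u (r m)) d) (inner (u (r n)) d) < e / 3"
          using metric_CauchyD[of _ "e/3"] e by (metis divide_pos_pos zero_less_numeral)
        have "dist (inner (u (r m)) v) (inner (u (r n)) v) < e" if "m \<ge> M" "n \<ge> M" for m n
          using M[OF that] s[of m] s[of n] unfolding dist_real_def inner_diff_right by linarith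
        then show "\<exists>M. \<forall>m\<ge>M. \<forall>n\<ge>M. dist (inner (u (r m)) v) (inner (u (r n)) v) < e" by blast
      qed
      then show ?thesis by (simp add: D_def Cauchy_convergent)
    qed
    then show ?thesis
      unfolding closure_subset_eq[symmetric] by (auto simp: closure_approachable)
  qed
  have "u k \<in> D" for k using lk by (auto simp: D_def convergent_def)
  have "v \<in> D" for v
  proof -
    obtain p where p: "p \<in> D" "v - p \<in> D\<^sup>\<bottom>" using closed_subspace_projection[OF subD clD] by blast
    have "inner (u k) (v - p) = 0" for k
      using p(2) \<open>u k \<in> D\<close> by (auto simp: orthogonal_comp_def orthogonal_def)
    then have "v - p \<in> D" by (simp add: D_def convergent_const)
    then have "(v - p) + p \<in> D" using p(1) subD by (meson subspace_add)
    then show ?thesis by simp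
  qed
  then have conv: "(\<lambda>n. inner (u (r n)) v) \<longlonglongrightarrow> lim (\<lambda>n. inner (u (r n)) v)" for v
    by (simp add: D_def convergent_LIMSEQ_iff)
  define f where "f v = lim (\<lambda>n. inner (u (r n)) v)" for v
  have "bounded_linear f"
  proof (rule bounded_linear_intro)
    show "f (x + y) = f x + f y" for x y
      using tendsto_add[OF conv[of x] conv[of y]] conv[of "x + y"]
      by (simp add: inner_add_right f_def LIMSEQ_unique)
    show "f (c *\<^sub>R x) = c *\<^sub>R f x" for c x
      using tendsto_mult_left[OF conv[of x], of c] conv[of "c *\<^sub>R x"]
      by (simp add: f_def LIMSEQ_unique)
    show "norm (f x) \<le> norm x * C" for x
    proof -
      have "(\<lambda>n. \<bar>inner (u (r n)) x\<bar>) \<longlonglongrightarrow> \<bar>f x\<bar>"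
        using conv[of x] unfolding f_def by (rule tendsto_rabs)
      then have "\<bar>f x\<bar> \<le> C * norm x"
        by (rule LIMSEQ_le_const2) (use bdl in auto)
      then show ?thesis by (simp add: mult.commute)
    qed
  qed
  then obtain w where "\<And>v. f v = inner w v" using riesz_representation by blast
  then show ?thesis using that[OF r] conv unfolding f_def by metis
qed

section \<open>The closed graph theorem\<close>

text \<open>
Otherwise one could choose nested closed balls with centres in \<open>S\<close> and radii tending to \<open>0\<close>, the
\<open>n\<close>-th step avoiding \<open>E n\<close>; their common point would be a point of \<open>S\<close> outside the cover.
\<close>
lemma baire_closed_cover:
  fixes S :: "'a::complete_space set" and E :: "nat \<Rightarrow> 'a set"
  assumes S: "closed S" "S \<noteq> {}" and cover: "S \<subseteq> (\<Union>n. E n)"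
  shows "\<exists>n. \<exists>x\<in>S. \<exists>d>0. S \<inter> ball x d \<subseteq> closure (E n)"
proof (rule ccontr)
  assume "\<not> ?thesis"
  then have no: "\<exists>y. y \<in> S \<inter> ball x d \<and> y \<notin> closure (E n)" if "x \<in> S" "d > 0" for n x d
    using that by blast
  define Q where "Q n p q \<longleftrightarrow> cball (fst q) (snd q) \<subseteq> cball (fst p) (snd p) \<and> snd q \<le> (1/2) ^ n
      \<and> cball (fst q) (snd q) \<inter> E n = {}" for n and p q :: "'a \<times> real"
  obtain x0 where x0: "x0 \<in> S" using S by blast
  have step: "\<exists>q. (fst q \<in> S \<and> snd q > 0) \<and> Q n p q" if p: "fst p \<in> S \<and> snd p > 0" for n p
  proof -
    obtain y where y: "y \<in> S" "dist (fst p) y < snd p" "y \<notin> closure (E n)"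
      using no[of "fst p" "snd p" n] p by auto
    then obtain e where e: "e > 0" "\<And>z. z \<in> E n \<Longrightarrow> e \<le> dist z y"
      unfolding closure_approachable by (meson not_less)
    define r where "r = min (e / 2) (min (snd p - dist (fst p) y) ((1/2) ^ n))"
    have r: "r > 0" "r < e" "r \<le> snd p - dist (fst p) y" "r \<le> (1/2) ^ n"
      using e(1) y(2) by (auto simp: r_def min_def)
    have "cball y r \<subseteq> cball (fst p) (snd p)"
    proof
      fix z assume "z \<in> cball y r"
      then show "z \<in> cball (fst p) (snd p)" using r(3) dist_triangle[of "fst p" z y] by simp
    qed
    moreover have "cball y r \<inter> E n = {}"
      using e(2) r(2) by (force simp: dist_commute)
    ultimately show ?thesis using r y(1) by (intro exI[of _ "(y, r)"]) (auto simp: Q_def)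
  qed
  obtain f where f: "\<And>n. fst (f n) \<in> S \<and> snd (f n) > 0" "\<And>n. Q n (f n) (f (Suc n))"
    using dependent_nat_choice[of "\<lambda>_ p. fst p \<in> S \<and> snd p > 0" Q] step x0
    by (metis fst_conv snd_conv zero_less_one)
  let ?B = "\<lambda>n. cball (fst (f n)) (snd (f n))"
  have mono: "?B m \<subseteq> ?B n" if "n \<le> m" for n m
    using that
  proof (induction m rule: dec_induct)
    case (step m)
    then show ?case using f(2)[of m] by (auto simp: Q_def)
  qed simp
  have cen: "fst (f n) \<in> ?B n" for n using f(1)[of n] by simp
  have "Cauchy (\<lambda>n. fst (f n))"
  proof (rule metric_CauchyI)
    fix e :: real assume "e > 0"
    then obtain N where N: "(1/2 :: real) ^ N < e / 2" using real_arch_pow_inv[of "e/2" "1/2"] by auto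
    have "dist (fst (f m)) (fst (f n)) < e" if "m \<ge> Suc N" "n \<ge> Suc N" for m n
    proof -
      have "snd (f (Suc N)) \<le> (1/2) ^ N" using f(2)[of N] by (simp add: Q_def)
      moreover have "fst (f m) \<in> ?B (Suc N)" "fst (f n) \<in> ?B (Suc N)"
        using mono that cen by blast+
      ultimately show ?thesis
        using N dist_triangle2[of "fst (f m)" "fst (f n)" "fst (f (Suc N))"] by (simp add: dist_commute)
    qed
    then show "\<exists>M. \<forall>m\<ge>M. \<forall>n\<ge>M. dist (fst (f m)) (fst (f n)) < e" by blast
  qed
  then obtain x where x: "(\<lambda>n. fst (f n)) \<longlonglongrightarrow> x" using Cauchy_convergent convergent_def by blast
  have xS: "x \<in> S" using S(1) f(1) x by (meson closed_sequentially)
  have "x \<in> ?B (Suc n)" for n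
  proof (rule closed_sequentially[OF closed_cball])
    show "fst (f (m + Suc n)) \<in> ?B (Suc n)" for m
      using subsetD[OF mono[of "Suc n" "m + Suc n"] cen[of "m + Suc n"]] by simp
    show "(\<lambda>m. fst (f (m + Suc n))) \<longlonglongrightarrow> x" using x by (rule LIMSEQ_ignore_initial_segment)
  qed
  then have "x \<notin> E n" for n using f(2)[of n] unfolding Q_def by blast
  then show False using xS cover by blast
qed

text \<open>
By Baire the set of \<open>x \<in> S\<close> with \<open>\<parallel>T x\<parallel> \<le> n\<close> is dense in some ball of \<open>S\<close>; by translation and
homogeneity every \<open>x \<in> S\<close> is arbitrarily well approximated by some \<open>y\<close> with \<open>\<parallel>T y\<parallel> \<le> K \<parallel>x\<parallel>\<close>. Repeating this
with the remainder, the error being halved each time, writes \<open>x\<close> as a series whose image under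
\<open>T\<close> converges absolutely, and closedness of the graph identifies the sum. The theorem is stated on
a subspace because it is meant for the inverse of \<open>B(\<infinity>)\<close> on \<open>X\<^sup>\<plusminus>\<close>.
\<close>
lemma closed_graph_theorem:
  fixes T :: "'a::banach \<Rightarrow> 'b::banach"
  assumes S: "subspace S" "closed S"
    and add: "\<And>x y. x \<in> S \<Longrightarrow> y \<in> S \<Longrightarrow> T (x + y) = T x + T y"
    and scale: "\<And>c x. x \<in> S \<Longrightarrow> T (c *\<^sub>R x) = c *\<^sub>R T x"
    and graph: "\<And>f x y. (\<And>n::nat. f n \<in> S) \<Longrightarrow> f \<longlonglongrightarrow> x \<Longrightarrow> (\<lambda>n. T (f n)) \<longlonglongrightarrow> y \<Longrightarrow> T x = y"
  shows "\<exists>K\<ge>0. \<forall>x\<in>S. norm (T x) \<le> K * norm x"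
proof -
  note sub = subspace_add[OF S(1)] subspace_scale[OF S(1)] subspace_0[OF S(1)] subspace_diff[OF S(1)]
  have diff: "T (x - y) = T x - T y" if "x \<in> S" "y \<in> S" for x y
    using add[of x "(-1) *\<^sub>R y"] scale[of y "-1"] that sub(2)[of y "-1"] by simp
  have T0: "T 0 = 0" using scale[of 0 0] sub by simp
  define E where "E n = {x \<in> S. norm (T x) \<le> real n}" for n
  have cov: "S \<subseteq> (\<Union>n. E n)" using real_arch_simple by (fastforce simp: E_def)
  obtain n x0 d where x0: "x0 \<in> S" "d > 0" "S \<inter> ball x0 d \<subseteq> closure (E n)"
    using baire_closed_cover[OF S(2) _ cov] sub(3) by blast
  have near: "\<exists>y\<in>S. norm (T y) \<le> 2 * real n \<and> norm (x - y) < e" if x: "x \<in> S" "norm x < d" "e > 0" for x e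
  proof -
    have "x0 + x \<in> closure (E n)" using x0 x sub by (auto simp: dist_norm)
    then obtain a where a: "a \<in> E n" "dist a (x0 + x) < e / 2"
      using x(3) unfolding closure_approachable by (meson half_gt_zero)
    have "x0 \<in> closure (E n)" using x0 by auto
    then obtain b where b: "b \<in> E n" "dist b x0 < e / 2"
      using x(3) unfolding closure_approachable by (meson half_gt_zero)
    have "norm (T (a - b)) \<le> 2 * real n"
      using a(1) b(1) norm_triangle_ineq4[of "T a" "T b"] by (simp add: E_def diff)
    moreover have "norm (x - (a - b)) < e"
    proof -
      have "x - (a - b) = (b - x0) - (a - (x0 + x))" by simp
      then have "norm (x - (a - b)) \<le> norm (b - x0) + norm (a - (x0 + x))" by (metis norm_triangle_ineq4)
      then show ?thesis using a(2) b(2) by (simp add: dist_norm)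
    qed
    ultimately show ?thesis using a(1) b(1) sub by (intro bexI[of _ "a - b"]) (auto simp: E_def)
  qed
  \<comment> \<open>a vector of norm \<open>d / 2\<close> is approximated with bound \<open>2 n\<close>\<close>
  define K where "K = 4 * real n / d"
  have K0: "K \<ge> 0" using x0(2) by (simp add: K_def)
  have approx: "\<exists>y\<in>S. norm (T y) \<le> K * norm x \<and> norm (x - y) < e" if x: "x \<in> S" "e > 0" for x e
  proof (cases "x = 0")
    case True
    then show ?thesis using x T0 sub by (intro bexI[of _ 0]) auto
  next
    case False
    define t where "t = d / (2 * norm x)"
    have t: "t > 0" using x0(2) False by (simp add: t_def)
    have "norm (t *\<^sub>R x) < d" using x0(2) False by (simp add: t_def)
    then obtain y where y: "y \<in> S" "norm (T y) \<le> 2 * real n" "norm (t *\<^sub>R x - y) < t * e"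
      using near[of "t *\<^sub>R x" "t * e"] x sub t by auto
    have "norm (T ((1/t) *\<^sub>R y)) \<le> K * norm x"
      using y(1,2) t x0(2) False by (simp add: scale K_def t_def field_simps)
    moreover have "x - (1/t) *\<^sub>R y = (1/t) *\<^sub>R (t *\<^sub>R x - y)" using t by (simp add: scaleR_diff_right)
    then have "norm (x - (1/t) *\<^sub>R y) = (1/t) * norm (t *\<^sub>R x - y)" using t by (metis norm_scaleR abs_of_pos zero_less_divide_1_iff)
    then have "norm (x - (1/t) *\<^sub>R y) < e" using t mult_strict_left_mono[OF y(3), of "1/t"] by simp
    ultimately show ?thesis using y(1) sub by blast
  qed
  have "norm (T x) \<le> 2 * K * norm x" if x: "x \<in> S" for x
  proof (cases "x = 0")
    case False
    define Y where "Y n v = (SOME y. y \<in> S \<and> norm (T y) \<le> K * norm v \<and> norm (v - y) < norm x / 2 ^ Suc n)"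
      for n :: nat and v
    have Y: "Y n v \<in> S \<and> norm (T (Y n v)) \<le> K * norm v \<and> norm (v - Y n v) < norm x / 2 ^ Suc n"
      if "v \<in> S" for n v
      unfolding Y_def by (rule someI_ex) (use approx[of v "norm x / 2 ^ Suc n"] that False in auto)
    define v where "v = rec_nat x (\<lambda>n u. u - Y n u)"
    have v0: "v 0 = x" and vS: "v (Suc n) = v n - Y n (v n)" for n by (simp_all add: v_def)
    have vin: "v n \<in> S" for n by (induction n) (use x Y sub in \<open>auto simp: v0 vS\<close>)
    have vn: "norm (v n) \<le> norm x / 2 ^ n" for n
      by (cases n) (use Y vin v0 in \<open>auto simp: vS intro!: less_imp_le\<close>)
    define s where "s n = x - v n" for n
    have sin: "s n \<in> S" for n using vin x sub by (simp add: s_def)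
    have geo: "(\<lambda>n. (1 / 2 :: real) ^ n) \<longlonglongrightarrow> 0" by (intro LIMSEQ_power_zero) simp
    have "v \<longlonglongrightarrow> 0"
    proof (rule Lim_null_comparison)
      show "\<forall>\<^sub>F n in sequentially. norm (v n) \<le> norm x * (1/2) ^ n"
        using vn by (simp add: power_divide)
      show "(\<lambda>n. norm x * (1/2) ^ n) \<longlonglongrightarrow> 0" using tendsto_mult_right_zero[OF geo] by simp
    qed
    then have "s \<longlonglongrightarrow> x - 0" unfolding s_def by (intro tendsto_intros)
    then have sx: "s \<longlonglongrightarrow> x" by simp
    have Ts: "T (s n) = (\<Sum>k<n. T (Y k (v k)))" for n
    proof (induction n)
      case 0
      then show ?case by (simp add: s_def v0 T0)
    next
      case (Suc n)
      have "s (Suc n) = s n + Y n (v n)" by (simp add: s_def vS)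
      then show ?case using Suc add[OF sin[of n], of "Y n (v n)"] Y[OF vin[of n]] by simp
    qed
    have bnd: "norm (T (Y k (v k))) \<le> K * norm x * (1/2) ^ k" for k
      using Y[OF vin[of k], of k] mult_left_mono[OF vn[of k] K0] by (simp add: power_divide)
    have summ: "summable (\<lambda>k. K * norm x * (1/2) ^ k)" by (intro summable_mult summable_geometric) simp
    then have "summable (\<lambda>k. T (Y k (v k)))" using bnd by (rule summable_comparison_test')
    then have lim: "(\<lambda>n. T (s n)) \<longlonglongrightarrow> (\<Sum>k. T (Y k (v k)))" unfolding Ts by (rule summable_LIMSEQ)
    have "T x = (\<Sum>k. T (Y k (v k)))" using graph[OF sin sx lim] .
    also have "norm \<dots> \<le> (\<Sum>k. K * norm x * (1/2) ^ k)"
      using bnd summ by (rule norm_suminf_le)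
    also have "\<dots> = 2 * K * norm x" by (subst suminf_mult) (auto simp: suminf_geometric)
    finally show ?thesis .
  qed (use T0 in simp)
  then show ?thesis using K0 by (intro exI[of _ "2 * K"]) auto
qed

section \<open>Radial changes of variables and saddle functions\<close>

text \<open>
Along each ray, \<open>g z\<close> is strictly increasing: \<open>g z (a e) \<le> (a / b) g z (b e) < g z (b e)\<close> for \<open>a < b\<close>, where
the lower bound makes \<open>g\<close> positive. It takes every value in \<open>[0, \<infinity>)\<close>, so each ray contains exactly one
point \<open>s z w\<close> with \<open>g z (s z w) = \<parallel>w\<parallel>\<^sup>2\<close>, and \<open>k z e = (\<surd>(g z e) / \<parallel>e\<parallel>) e\<close> inverts \<open>s z\<close>. Off the
origin the continuity of \<open>s\<close> follows from strict monotonicity, which traps the radius between two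
values at which \<open>g - \<parallel>w\<parallel>\<^sup>2\<close> has opposite signs; at the origin it follows from the lower bound.
\<close>
lemma radial_homeomorphism:
  fixes g :: "'a::metric_space \<Rightarrow> 'b::real_normed_vector \<Rightarrow> real"
  assumes E: "subspace E" and c: "c > 0"
    and cont: "continuous_on (Z \<times> E) (\<lambda>(z, e). g z e)"
    and lower: "\<And>z e. z \<in> Z \<Longrightarrow> e \<in> E \<Longrightarrow> c * (norm e)\<^sup>2 \<le> g z e"
    and star: "\<And>z e t. z \<in> Z \<Longrightarrow> e \<in> E \<Longrightarrow> 0 \<le> t \<Longrightarrow> t \<le> 1 \<Longrightarrow> g z (t *\<^sub>R e) \<le> t * g z e"
  obtains k s where
    "continuous_on (Z \<times> E) (\<lambda>(z, e). k z e)" "continuous_on (Z \<times> E) (\<lambda>(z, e). s z e)"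
    "\<forall>z\<in>Z. \<forall>e\<in>E. s z (k z e) = e \<and> k z (s z e) = e \<and> g z (s z e) = (norm e)\<^sup>2"
    "\<forall>z e. (\<exists>r. s z e = r *\<^sub>R e) \<and> (\<exists>r. k z e = r *\<^sub>R e)"
proof -
  note sub = subspace_scale[OF E] subspace_0[OF E]
  have g0: "g z 0 = 0" if "z \<in> Z" for z
    using lower[of z 0] star[of z 0 0] that sub by simp
  have gpos: "g z e > 0" if "z \<in> Z" "e \<in> E" "e \<noteq> 0" for z e
  proof -
    have "0 < c * (norm e)\<^sup>2" using c that(3) by simp
    then show ?thesis using lower[OF that(1,2)] by linarith
  qed
  have gge: "g z e \<ge> 0" if "z \<in> Z" "e \<in> E" for z e
    using gpos[OF that] g0[OF that(1)] by (cases "e = 0") auto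
  have mono: "g z (a *\<^sub>R e) < g z (b *\<^sub>R e)" if "z \<in> Z" "e \<in> E" "e \<noteq> 0" "0 \<le> a" "a < b" for z e a b
  proof -
    have "g z ((a / b) *\<^sub>R (b *\<^sub>R e)) \<le> (a / b) * g z (b *\<^sub>R e)"
      using that sub by (intro star) auto
    also have "\<dots> < 1 * g z (b *\<^sub>R e)"
      using that sub gpos[of z "b *\<^sub>R e"] by (intro mult_strict_right_mono) auto
    finally show ?thesis using that by simp
  qed
  have cont2: "continuous_on D (\<lambda>x. g (p x) (q x))"
    if "continuous_on D p" "continuous_on D q" "p ` D \<subseteq> Z" "q ` D \<subseteq> E"
    for D :: "'c::topological_space set" and p q
    using continuous_on_compose2[OF cont continuous_on_Pair[OF that(1,2)]] that(3,4) by auto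
  have ex: "\<exists>r\<ge>0. g z (r *\<^sub>R w) = (norm w)\<^sup>2" if z: "z \<in> Z" "w \<in> E" for z w
  proof -
    \<comment> \<open>at this radius the lower bound already gives \<open>g \<ge> \<parallel>w\<parallel>\<^sup>2\<close>\<close>
    define b where "b = 1 / sqrt c"
    have b: "b > 0" using c by (simp add: b_def)
    have "(norm w)\<^sup>2 = c * (norm (b *\<^sub>R w))\<^sup>2" using c by (simp add: b_def power_mult_distrib power_divide)
    also have "\<dots> \<le> g z (b *\<^sub>R w)" using z sub by (intro lower) auto
    finally have "(norm w)\<^sup>2 \<le> g z (b *\<^sub>R w)" .
    moreover have "g z (0 *\<^sub>R w) \<le> (norm w)\<^sup>2" using g0 z by simp
    moreover have "continuous_on {0..b} (\<lambda>r. g z (r *\<^sub>R w))"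
      using z sub by (intro cont2 continuous_intros) auto
    ultimately have "\<exists>r\<ge>0. r \<le> b \<and> g z (r *\<^sub>R w) = (norm w)\<^sup>2"
      using b by (intro IVT') auto
    then show ?thesis by blast
  qed
  define R where "R z w = (SOME r. r \<ge> 0 \<and> g z (r *\<^sub>R w) = (norm w)\<^sup>2)" for z w
  have R: "R z w \<ge> 0" "g z (R z w *\<^sub>R w) = (norm w)\<^sup>2" if "z \<in> Z" "w \<in> E" for z w
    using someI_ex[OF ex[OF that, unfolded Bex_def]] unfolding R_def by auto
  define s where "s z w = R z w *\<^sub>R w" for z w
  define k where "k z e = (sqrt (g z e) / norm e) *\<^sub>R e" for z e
  have nk: "norm (k z e) = sqrt (g z e)" if "z \<in> Z" "e \<in> E" for z e
    using gge[OF that] g0[OF that(1)] by (cases "e = 0") (auto simp: k_def)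
  have sE: "s z e \<in> E" "k z e \<in> E" if "z \<in> Z" "e \<in> E" for z e
    using sub that by (auto simp: s_def k_def)
  have gs: "g z (s z w) = (norm w)\<^sup>2" if "z \<in> Z" "w \<in> E" for z w
    using R[OF that] by (simp add: s_def)
  have ks: "k z (s z w) = w" if "z \<in> Z" "w \<in> E" for z w
  proof (cases "w = 0")
    case False
    have "R z w \<noteq> 0" using R[OF that] False g0[OF that(1)] by auto
    then have "R z w > 0" using R[OF that] by simp
    then show ?thesis using gs[OF that] False by (simp add: k_def) (simp add: s_def)
  qed (simp add: s_def k_def)
  have sk: "s z (k z e) = e" if ze: "z \<in> Z" "e \<in> E" for z e
  proof (cases "e = 0")
    case False
    define u where "u = sqrt (g z e) / norm e"
    have u: "u > 0" using gpos[OF ze False] False by (simp add: u_def)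
    have *: "s z (k z e) = (R z (k z e) * u) *\<^sub>R e" by (simp add: s_def k_def u_def)
    have r0: "R z (k z e) * u \<ge> 0" using R[of z "k z e"] ze sE u by simp
    have eq: "g z ((R z (k z e) * u) *\<^sub>R e) = g z (1 *\<^sub>R e)"
      using gs[of z "k z e"] ze sE nk[OF ze] gge[OF ze] * by simp
    have "R z (k z e) * u = 1"
      using mono[OF ze False r0, of 1] mono[OF ze False, of 1 "R z (k z e) * u"] eq
      by (metis less_irrefl linorder_neqE_linordered_idom zero_le_one)
    then show ?thesis using * by simp
  qed (simp add: s_def k_def)
  have ck: "continuous_on (Z \<times> E) (\<lambda>(z, e). k z e)"
  proof (unfold continuous_on_def, clarify)
    fix z0 e0 assume ze: "z0 \<in> Z" "e0 \<in> E"
    have tg: "((\<lambda>(z, e). g z e) \<longlongrightarrow> g z0 e0) (at (z0, e0) within Z \<times> E)"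
      using cont ze unfolding continuous_on_def by auto
    show "((\<lambda>(z, e). k z e) \<longlongrightarrow> k z0 e0) (at (z0, e0) within Z \<times> E)"
    proof (cases "e0 = 0")
      case False
      have "((\<lambda>x. (sqrt (case x of (z, e) \<Rightarrow> g z e) / norm (snd x)) *\<^sub>R snd x) \<longlongrightarrow> (sqrt (g z0 e0) / norm e0) *\<^sub>R e0)
          (at (z0, e0) within Z \<times> E)"
        using False by (intro tendsto_intros tg) (auto intro!: tendsto_eq_intros)
      then show ?thesis by (simp add: k_def case_prod_unfold)
    next
      case True
      have "((\<lambda>x. sqrt (case x of (z, e) \<Rightarrow> g z e)) \<longlongrightarrow> sqrt (g z0 e0)) (at (z0, e0) within Z \<times> E)"
        by (intro tendsto_intros tg)
      then have "((\<lambda>x. sqrt (case x of (z, e) \<Rightarrow> g z e)) \<longlongrightarrow> 0) (at (z0, e0) within Z \<times> E)"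
        using True g0 ze by simp
      moreover have "\<forall>\<^sub>F x in at (z0, e0) within Z \<times> E.
          norm (case x of (z, e) \<Rightarrow> k z e) \<le> sqrt (case x of (z, e) \<Rightarrow> g z e)"
        unfolding eventually_at_filter by (rule always_eventually) (auto simp: nk)
      ultimately have "((\<lambda>(z, e). k z e) \<longlongrightarrow> 0) (at (z0, e0) within Z \<times> E)"
        by (rule Lim_null_comparison[rotated])
      then show ?thesis using True by (simp add: k_def)
    qed
  qed
  have cs: "continuous_on (Z \<times> E) (\<lambda>(z, w). s z w)"
  proof (unfold continuous_on_def, clarify)
    fix z0 w0 assume zw: "z0 \<in> Z" "w0 \<in> E"
    let ?F = "at (z0, w0) within Z \<times> E"
    have dom: "\<forall>\<^sub>F x in ?F. fst x \<in> Z \<and> snd x \<in> E"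
      unfolding eventually_at_filter by (rule always_eventually) auto
    have tw: "((\<lambda>x. snd x) \<longlongrightarrow> w0) ?F" by (auto intro!: tendsto_eq_intros)
    show "((\<lambda>(z, w). s z w) \<longlongrightarrow> s z0 w0) ?F"
    proof (cases "w0 = 0")
      case True
      have "\<forall>\<^sub>F x in ?F. norm (case x of (z, w) \<Rightarrow> s z w) \<le> norm (snd x) / sqrt c"
        using dom
      proof eventually_elim
        case (elim x)
        then have "c * (norm (s (fst x) (snd x)))\<^sup>2 \<le> (norm (snd x))\<^sup>2"
          using lower[of "fst x" "s (fst x) (snd x)"] gs[of "fst x" "snd x"] sE by auto
        then have "(norm (s (fst x) (snd x)))\<^sup>2 \<le> (norm (snd x) / sqrt c)\<^sup>2"
          using c by (simp add: power_divide field_simps)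
        then have "norm (s (fst x) (snd x)) \<le> norm (snd x) / sqrt c"
          by (rule power2_le_imp_le) (use c in auto)
        then show ?case by (simp add: case_prod_unfold)
      qed
      moreover have "((\<lambda>x. norm (snd x) / sqrt c) \<longlongrightarrow> 0) ?F"
        using c True by (auto intro!: tendsto_eq_intros tw)
      ultimately have "((\<lambda>(z, w). s z w) \<longlongrightarrow> 0) ?F" by (rule Lim_null_comparison)
      then show ?thesis using True by (simp add: s_def)
    next
      case False
      define r0 where "r0 = R z0 w0"
      have r0: "r0 > 0" using R[OF zw] False g0[OF zw(1)] unfolding r0_def
        by (metis less_eq_real_def norm_eq_zero scale_eq_0_iff zero_eq_power2)
      have tg: "((\<lambda>x. g (fst x) (a *\<^sub>R snd x)) \<longlongrightarrow> g z0 (a *\<^sub>R w0)) ?F" for a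
      proof -
        have "continuous_on (Z \<times> E) (\<lambda>x. g (fst x) (a *\<^sub>R snd x))"
          using sub by (intro cont2 continuous_intros) auto
        then show ?thesis using zw unfolding continuous_on_def by auto
      qed
      have tn: "((\<lambda>x. (norm (snd x))\<^sup>2) \<longlongrightarrow> (norm w0)\<^sup>2) ?F" by (intro tendsto_intros tw)
      have "((\<lambda>x. R (fst x) (snd x)) \<longlongrightarrow> r0) ?F"
      proof (rule tendstoI)
        fix e :: real assume e: "e > 0"
        define d where "d = min (e / 2) (r0 / 2)"
        have d: "d > 0" "d < e" "d < r0" using e r0 by (auto simp: d_def min_def)
        have lo: "g z0 ((r0 - d) *\<^sub>R w0) < (norm w0)\<^sup>2"
          using mono[OF zw False, of "r0 - d" r0] d R[OF zw] by (simp add: r0_def)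
        have hi: "(norm w0)\<^sup>2 < g z0 ((r0 + d) *\<^sub>R w0)"
          using mono[OF zw False, of r0 "r0 + d"] d r0 R[OF zw] by (simp add: r0_def)
        have ev1: "\<forall>\<^sub>F x in ?F. 0 < (norm (snd x))\<^sup>2 - g (fst x) ((r0 - d) *\<^sub>R snd x)"
          by (rule order_tendstoD(1)[OF tendsto_diff[OF tn tg]]) (use lo in simp)
        have ev2: "\<forall>\<^sub>F x in ?F. 0 < g (fst x) ((r0 + d) *\<^sub>R snd x) - (norm (snd x))\<^sup>2"
          by (rule order_tendstoD(1)[OF tendsto_diff[OF tg tn]]) (use hi in simp)
        have ev3: "\<forall>\<^sub>F x in ?F. snd x \<noteq> 0" using tw False by (rule tendsto_imp_eventually_ne)
        show "\<forall>\<^sub>F x in ?F. dist (R (fst x) (snd x)) r0 < e"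
          using dom ev1 ev2 ev3
        proof eventually_elim
          case (elim x)
          let ?r = "R (fst x) (snd x)"
          have Rx: "?r \<ge> 0" "g (fst x) (?r *\<^sub>R snd x) = (norm (snd x))\<^sup>2" using R elim by auto
          have "\<not> ?r < r0 - d"
            using mono[of "fst x" "snd x" ?r "r0 - d"] elim Rx by auto
          moreover have "\<not> r0 + d < ?r"
            using mono[of "fst x" "snd x" "r0 + d" ?r] elim Rx r0 d by auto
          ultimately show ?case using d by (simp add: dist_real_def abs_less_iff)
        qed
      qed
      then have "((\<lambda>x. R (fst x) (snd x) *\<^sub>R snd x) \<longlongrightarrow> r0 *\<^sub>R w0) ?F" by (intro tendsto_intros tw)
      then show ?thesis by (simp add: s_def case_prod_unfold r0_def)
    qed
  qed
  show ?thesis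
  proof (rule that[OF ck cs])
    show "\<forall>z\<in>Z. \<forall>e\<in>E. s z (k z e) = e \<and> k z (s z e) = e \<and> g z (s z e) = (norm e)\<^sup>2"
      using sk ks gs by blast
    show "\<forall>z e. (\<exists>r. s z e = r *\<^sub>R e) \<and> (\<exists>r. k z e = r *\<^sub>R e)"
      unfolding s_def k_def by blast
  qed
qed

text \<open>
Far from the origin strong concavity forces \<open>F z y \<le> F z 0\<close>, so the maximum over a compact ball is
global. Comparing with points near the maximizer on the segment to \<open>y\<close> gives the quadratic gap. The
gap makes the maximizer continuous: on the sphere of radius \<open>e\<close> about \<open>m z0\<close> the function \<open>F z0\<close> stays
below its maximum by \<open>a e\<^sup>2\<close>, by compactness \<open>F z\<close> does so by half of this for \<open>z\<close> near \<open>z0\<close>, and by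
concavity \<open>m z\<close> cannot lie on or outside the sphere.
\<close>
lemma strongly_concave_maximizer:
  fixes F :: "'a::metric_space \<Rightarrow> 'b::real_normed_vector \<Rightarrow> real"
  assumes N: "subspace N" "\<And>r. compact (N \<inter> cball 0 r)" and a: "a > 0"
    and cont: "continuous_on (Z \<times> N) (\<lambda>(z, y). F z y)"
    and conc: "\<And>z y1 y2 t. z \<in> Z \<Longrightarrow> y1 \<in> N \<Longrightarrow> y2 \<in> N \<Longrightarrow> 0 \<le> t \<Longrightarrow> t \<le> 1 \<Longrightarrow>
      (1 - t) * F z y1 + t * F z y2 + a * t * (1 - t) * (norm (y1 - y2))\<^sup>2 \<le> F z ((1 - t) *\<^sub>R y1 + t *\<^sub>R y2)"
  obtains m where "continuous_on Z m" "\<And>z. z \<in> Z \<Longrightarrow> m z \<in> N"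
    "\<And>z y. z \<in> Z \<Longrightarrow> y \<in> N \<Longrightarrow> a * (norm (y - m z))\<^sup>2 \<le> F z (m z) - F z y"
proof -
  note sub = subspace_scale[OF N(1)] subspace_0[OF N(1)] subspace_add[OF N(1)] subspace_diff[OF N(1)]
  have contz: "continuous_on N (F z)" if "z \<in> Z" for z
  proof -
    have "continuous_on N (\<lambda>y. (z, y))" by (intro continuous_intros)
    from continuous_on_compose2[OF cont this] show ?thesis using that by auto
  qed
  have ex: "\<exists>m\<in>N. \<forall>y\<in>N. F z y \<le> F z m" if z: "z \<in> Z" for z
  proof -
    have "compact (F z ` (N \<inter> cball 0 1))"
      by (intro compact_continuous_image N(2) continuous_on_subset[OF contz[OF z]]) auto
    then have "bounded (F z ` (N \<inter> cball 0 1))" by (rule compact_imp_bounded)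
    then obtain M where M: "\<And>y. y \<in> N \<Longrightarrow> norm y \<le> 1 \<Longrightarrow> \<bar>F z y\<bar> \<le> M"
      unfolding bounded_iff by force
    have M0: "M \<ge> 0" using M[of 0] sub by (auto intro: order_trans[OF abs_ge_zero])
    \<comment> \<open>for \<open>n = \<parallel>y\<parallel> > r\<close> the quadratic term \<open>a (n - 1) n\<close> exceeds the bound \<open>2 M n\<close> coming from the unit ball\<close>
    define r where "r = 1 + (2 * M + 1) / a"
    have r: "r \<ge> 1" using M0 a by (simp add: r_def)
    have far: "F z y \<le> F z 0" if y: "y \<in> N" "norm y > r" for y
    proof -
      define n where "n = norm y"
      have n: "n > 1" "n > r" using y r by (auto simp: n_def)
      have "(1 - 1/n) * F z 0 + (1/n) * F z y + a * (1/n) * (1 - 1/n) * (norm (0 - y))\<^sup>2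
          \<le> F z ((1 - 1/n) *\<^sub>R 0 + (1/n) *\<^sub>R y)"
        using z y sub n by (intro conc) auto
      also have "\<dots> \<le> M" using abs_le_D1[OF M[of "(1/n) *\<^sub>R y"]] y sub n by (auto simp: n_def)
      finally have le: "n * ((1 - 1/n) * F z 0 + (1/n) * F z y + a * (1/n) * (1 - 1/n) * n\<^sup>2) \<le> n * M"
        using n by (intro mult_left_mono) (auto simp: n_def)
      have *: "(n - 1) * F z 0 + F z y + a * (n - 1) * n \<le> n * M"
      proof -
        have "n * ((1 - 1/n) * F z 0 + (1/n) * F z y + a * (1/n) * (1 - 1/n) * n\<^sup>2)
            = (n * (1 - 1/n)) * F z 0 + (n * (1/n)) * F z y + a * (n * (1/n)) * ((1 - 1/n) * n) * n"
          by (simp only: power2_eq_square algebra_simps)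
        moreover have "n * (1/n) = 1" "n * (1 - 1/n) = n - 1" "(1 - 1/n) * n = n - 1" using n by (auto simp: field_simps)
        ultimately show ?thesis using le by simp
      qed
      have "F z 0 \<ge> - M" using M[of 0] sub by auto
      have "a * (n - 1) \<ge> 2 * M" using n a by (simp add: r_def field_simps)
      then have "a * (n - 1) * n \<ge> 2 * M * n" using n by (intro mult_right_mono) auto
      moreover have "n * F z 0 \<ge> n * (- M)" using \<open>F z 0 \<ge> - M\<close> n by (intro mult_left_mono) auto
      ultimately show ?thesis using * by (simp add: algebra_simps)
    qed
    have "\<exists>m\<in>N \<inter> cball 0 r. \<forall>y\<in>N \<inter> cball 0 r. F z y \<le> F z m"
      using r sub(2) by (intro continuous_attains_sup N(2) continuous_on_subset[OF contz[OF z]]) auto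
    then obtain m where m: "m \<in> N" "\<And>y. y \<in> N \<Longrightarrow> norm y \<le> r \<Longrightarrow> F z y \<le> F z m" by auto
    have "F z y \<le> F z m" if "y \<in> N" for y
      using m(2)[OF that] far[OF that] m(2)[of 0] sub(2) r by fastforce
    then show ?thesis using m(1) by blast
  qed
  then obtain m where mN: "\<And>z. z \<in> Z \<Longrightarrow> m z \<in> N" and mmax: "\<And>z y. z \<in> Z \<Longrightarrow> y \<in> N \<Longrightarrow> F z y \<le> F z (m z)"
    by metis
  have quad: "a * (norm (y - m z))\<^sup>2 \<le> F z (m z) - F z y" if zy: "z \<in> Z" "y \<in> N" for z y
  proof (rule tendsto_upperbound)
    show "((\<lambda>t. a * (1 - t) * (norm (y - m z))\<^sup>2) \<longlongrightarrow> a * (norm (y - m z))\<^sup>2) (at_right 0)"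
      by (auto intro!: tendsto_eq_intros)
    have "a * (1 - t) * (norm (y - m z))\<^sup>2 \<le> F z (m z) - F z y" if t: "0 < t" "t < 1" for t
    proof -
      have "(1 - t) * F z (m z) + t * F z y + a * t * (1 - t) * (norm (m z - y))\<^sup>2 \<le> F z (m z)"
        using conc[of z "m z" y t] mmax[of z "(1 - t) *\<^sub>R m z + t *\<^sub>R y"] zy mN sub t by fastforce
      then have "t * (a * (1 - t) * (norm (y - m z))\<^sup>2) \<le> t * (F z (m z) - F z y)"
        by (simp add: algebra_simps norm_minus_commute)
      then show ?thesis using t by simp
    qed
    then show "\<forall>\<^sub>F t in at_right 0. a * (1 - t) * (norm (y - m z))\<^sup>2 \<le> F z (m z) - F z y"
      by (intro eventually_at_rightI[of 0 1]) auto
  qed simp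
  have "continuous_on Z m"
  proof (unfold continuous_on_iff, intro ballI allI impI)
    fix z0 and e :: real assume z0: "z0 \<in> Z" and e: "e > 0"
    define S where "S = N \<inter> sphere (m z0) e"
    have "S = N \<inter> cball 0 (norm (m z0) + e) \<inter> sphere (m z0) e"
    proof -
      have "sphere (m z0) e \<subseteq> cball 0 (norm (m z0) + e)"
        by (auto simp: dist_norm) (metis add.commute add_diff_cancel_left' diff_le_eq norm_minus_commute norm_triangle_ineq2)
      then show ?thesis by (auto simp: S_def)
    qed
    moreover have "compact (N \<inter> cball 0 (norm (m z0) + e) \<inter> sphere (m z0) e)"
      unfolding sphere_def by (intro compact_Int_closed N(2) closed_Collect_eq continuous_intros)
    ultimately have S: "compact S" by metis
    define G where "G = (\<lambda>(z, y). F z (m z0) - F z y)"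
    have "continuous_on (Z \<times> S) G"
    proof -
      have "continuous_on (Z \<times> S) (\<lambda>x. (fst x, m z0))" by (intro continuous_intros)
      from continuous_on_compose2[OF cont this]
      have "continuous_on (Z \<times> S) (\<lambda>x. F (fst x) (m z0))" using mN[OF z0] by (simp add: image_subset_iff)
      moreover have "continuous_on (Z \<times> S) (\<lambda>x. F (fst x) (snd x))"
        using continuous_on_subset[OF cont, of "Z \<times> S"] by (auto simp: S_def case_prod_unfold)
      ultimately show ?thesis unfolding G_def case_prod_unfold by (intro continuous_intros)
    qed
    moreover have "a * e\<^sup>2 / 2 > 0" using a e by simp
    ultimately obtain U where U: "z0 \<in> U" "open U" "\<forall>z\<in>U \<inter> Z. \<forall>y\<in>S. dist (G (z, y)) (G (z0, y)) \<le> a * e\<^sup>2 / 2"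
      using continuous_on_prod_compactE[OF _ S z0, of G "a * e\<^sup>2 / 2"] by metis
    have near: "dist (m z) (m z0) < e" if z: "z \<in> U \<inter> Z" for z
    proof (rule ccontr)
      assume far: "\<not> dist (m z) (m z0) < e"
      \<comment> \<open>where the segment from \<open>m z0\<close> to \<open>m z\<close> meets the sphere\<close>
      define t where "t = e / dist (m z) (m z0)"
      have d: "dist (m z) (m z0) \<ge> e" "dist (m z) (m z0) > 0" using far e by auto
      have t: "0 < t" "t \<le> 1" using d e by (auto simp: t_def)
      define y where "y = (1 - t) *\<^sub>R m z0 + t *\<^sub>R m z"
      have "y - m z0 = t *\<^sub>R (m z - m z0)" by (simp add: y_def algebra_simps)
      then have ny: "norm (y - m z0) = e" using t d e by (simp add: t_def dist_norm)
      have "y \<in> N" unfolding y_def using z z0 by (intro sub(1,3) mN) auto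
      then have yS: "y \<in> S" using ny by (simp add: S_def dist_norm norm_minus_commute)
      have "a * e\<^sup>2 \<le> G (z0, y)" using quad[of z0 y] z0 yS ny by (simp add: G_def S_def)
      moreover have "dist (G (z, y)) (G (z0, y)) \<le> a * e\<^sup>2 / 2" using U(3) z yS by blast
      moreover have "a * e\<^sup>2 > 0" using a e by simp
      ultimately have "G (z, y) > 0" unfolding dist_real_def abs_le_iff by linarith
      moreover have "(1 - t) * F z (m z0) + t * F z (m z) \<le> F z y"
      proof -
        have "(1 - t) * F z (m z0) + t * F z (m z) + a * t * (1 - t) * (norm (m z0 - m z))\<^sup>2 \<le> F z y"
          using conc[of z "m z0" "m z" t] z z0 mN t by (auto simp: y_def)
        moreover have "0 \<le> a * t * (1 - t) * (norm (m z0 - m z))\<^sup>2" using a t by simp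
        ultimately show ?thesis by linarith
      qed
      moreover have "t * F z (m z0) \<le> t * F z (m z)"
        using mmax[of z "m z0"] z mN[OF z0] t by (intro mult_left_mono) auto
      ultimately show False by (simp add: G_def algebra_simps)
    qed
    obtain d where "d > 0" "ball z0 d \<subseteq> U" using U(1,2) open_contains_ball by blast
    then show "\<exists>d>0. \<forall>x'\<in>Z. dist x' z0 < d \<longrightarrow> dist (m x') (m z0) < e"
      using near by (intro exI[of _ d]) (auto simp: subset_iff dist_commute)
  qed
  then show ?thesis using that mN quad by blast
qed

text \<open>
A Morse lemma with parameters, based on convexity instead of derivatives. Let \<open>m(z, x)\<close> maximize \<open>J z x\<close>
over \<open>N\<close>. The function \<open>G z x = J z x (m(z, x))\<close> is a maximum of functions that are convex along rays
and \<open>\<le> 0\<close> at \<open>x = 0\<close>, hence starlike, and \<open>G z x \<ge> J z x 0 \<ge> a \<parallel>x\<parallel>\<^sup>2\<close>; concavity makes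
\<open>e \<mapsto> G z x - J z x (m(z, x) + e)\<close> starlike as well, with the quadratic lower bound of the maximizer.
Two radial changes of variables, the second one with \<open>(z, x)\<close> as parameter, turn these two functions
into \<open>\<parallel>p\<parallel>\<^sup>2\<close> and \<open>\<parallel>q\<parallel>\<^sup>2\<close>.
\<close>
lemma saddle_normal_form:
  fixes J :: "'a::metric_space \<Rightarrow> 'h::real_normed_vector \<Rightarrow> 'h \<Rightarrow> real"
  assumes E: "subspace E" and N: "subspace N" "\<And>r. compact (N \<inter> cball 0 r)" and a: "a > 0"
    and cont: "continuous_on (Z \<times> E \<times> N) (\<lambda>(z, x, y). J z x y)"
    and cvx: "\<And>z x y t. z \<in> Z \<Longrightarrow> x \<in> E \<Longrightarrow> y \<in> N \<Longrightarrow> 0 \<le> t \<Longrightarrow> t \<le> 1 \<Longrightarrow>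
      J z (t *\<^sub>R x) y \<le> t * J z x y + (1 - t) * J z 0 y"
    and conc: "\<And>z x y1 y2 t. z \<in> Z \<Longrightarrow> x \<in> E \<Longrightarrow> y1 \<in> N \<Longrightarrow> y2 \<in> N \<Longrightarrow> 0 \<le> t \<Longrightarrow> t \<le> 1 \<Longrightarrow>
      (1 - t) * J z x y1 + t * J z x y2 + a * t * (1 - t) * (norm (y1 - y2))\<^sup>2
        \<le> J z x ((1 - t) *\<^sub>R y1 + t *\<^sub>R y2)"
    and low: "\<And>z x. z \<in> Z \<Longrightarrow> x \<in> E \<Longrightarrow> a * (norm x)\<^sup>2 \<le> J z x 0"
    and up: "\<And>z y. z \<in> Z \<Longrightarrow> y \<in> N \<Longrightarrow> J z 0 y \<le> 0"
  obtains X Y K1 K2 where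
    "continuous_on (Z \<times> E) (\<lambda>(z, p). X z p)" "continuous_on (Z \<times> E \<times> N) (\<lambda>(z, p, q). Y z p q)"
    "continuous_on (Z \<times> E) (\<lambda>(z, x). K1 z x)" "continuous_on (Z \<times> E \<times> N) (\<lambda>(z, x, y). K2 z x y)"
    "\<forall>z p. (\<exists>r. X z p = r *\<^sub>R p) \<and> (\<exists>r. K1 z p = r *\<^sub>R p)"
    "\<forall>z\<in>Z. \<forall>p\<in>E. \<forall>q\<in>N. Y z p q \<in> N \<and> K1 z (X z p) = p \<and> K2 z (X z p) (Y z p q) = q
      \<and> J z (X z p) (Y z p q) = (norm p)\<^sup>2 - (norm q)\<^sup>2"
    "\<forall>z\<in>Z. \<forall>x\<in>E. \<forall>y\<in>N. K2 z x y \<in> N \<and> X z (K1 z x) = x \<and> Y z (K1 z x) (K2 z x y) = y"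
    "\<forall>z\<in>Z. Y z 0 0 = 0"
proof -
  note sub = subspace_scale[OF E] subspace_0[OF E] subspace_add[OF E]
  note subN = subspace_scale[OF N(1)] subspace_0[OF N(1)] subspace_add[OF N(1)] subspace_diff[OF N(1)]
  have contJ: "continuous_on D (\<lambda>w. J (f w) (g w) (k w))"
    if "continuous_on D f" "continuous_on D g" "continuous_on D k"
      "\<And>w. w \<in> D \<Longrightarrow> f w \<in> Z \<and> g w \<in> E \<and> k w \<in> N"
    for D :: "'c::topological_space set" and f g k
  proof -
    have "continuous_on D (\<lambda>w. (f w, g w, k w))" by (intro continuous_intros that)
    from continuous_on_compose2[OF cont this] show ?thesis using that(4) by (auto simp: image_subset_iff)
  qed
  have "continuous_on ((Z \<times> E) \<times> N) (\<lambda>(w, y). J (fst w) (snd w) y)"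
    unfolding case_prod_unfold by (rule contJ) (auto intro!: continuous_intros)
  then obtain m where m: "continuous_on (Z \<times> E) m" "\<And>w. w \<in> Z \<times> E \<Longrightarrow> m w \<in> N"
    "\<And>w y. w \<in> Z \<times> E \<Longrightarrow> y \<in> N \<Longrightarrow> a * (norm (y - m w))\<^sup>2 \<le> J (fst w) (snd w) (m w) - J (fst w) (snd w) y"
    by (rule strongly_concave_maximizer[OF N a, where Z = "Z \<times> E" and F = "\<lambda>w. J (fst w) (snd w)"])
      (use conc in auto)
  have mN: "m (z, x) \<in> N" if "z \<in> Z" "x \<in> E" for z x using m(2) that by simp
  have mq: "a * (norm (y - m (z, x)))\<^sup>2 \<le> J z x (m (z, x)) - J z x y" if "z \<in> Z" "x \<in> E" "y \<in> N" for z x y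
    using m(3)[of "(z, x)" y] that by simp
  have contm: "continuous_on D (\<lambda>w. m (f w, g w))"
    if "continuous_on D f" "continuous_on D g" "\<And>w. w \<in> D \<Longrightarrow> f w \<in> Z \<and> g w \<in> E"
    for D :: "'c::topological_space set" and f g
    by (rule continuous_on_compose2[OF m(1) continuous_on_Pair[OF that(1,2)]]) (use that(3) in auto)
  define G where "G z x = J z x (m (z, x))" for z x
  have J00: "J z 0 0 = 0" if "z \<in> Z" for z using low[of z 0] up[of z 0] that sub subN by simp
  have m0: "m (z, 0) = 0" if z: "z \<in> Z" for z
  proof -
    have "a * (norm (0 - m (z, 0)))\<^sup>2 \<le> 0"
      using mq[of z 0 0] up[of z "m (z, 0)"] J00[OF z] mN[of z 0] z sub subN by simp
    then have "(norm (0 - m (z, 0)))\<^sup>2 \<le> 0" using a by (simp add: mult_le_0_iff)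
    then show ?thesis by simp
  qed
  have G1: "continuous_on (Z \<times> E) (\<lambda>(z, e). G z e)"
    unfolding case_prod_unfold G_def by (rule contJ) (auto intro!: continuous_intros mN m(1))
  have G2: "a * (norm e)\<^sup>2 \<le> G z e" if "z \<in> Z" "e \<in> E" for z e
  proof -
    have "0 \<le> a * (norm (0 - m (z, e)))\<^sup>2" using a by simp
    then have "J z e 0 \<le> G z e" using mq[of z e 0] that subN by (simp add: G_def)
    then show ?thesis using low[OF that] by simp
  qed
  have G3: "G z (t *\<^sub>R e) \<le> t * G z e" if "z \<in> Z" "e \<in> E" "0 \<le> t" "t \<le> 1" for z e t
  proof -
    let ?y = "m (z, t *\<^sub>R e)"
    have y: "?y \<in> N" using mN that sub by simp
    have "0 \<le> a * (norm (?y - m (z, e)))\<^sup>2" using a by simp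
    then have J1: "J z e ?y \<le> G z e" using mq[of z e ?y] that y by (simp add: G_def)
    have t1: "t * J z e ?y \<le> t * G z e" using J1 that by (intro mult_left_mono) auto
    have t2: "(1 - t) * J z 0 ?y \<le> 0" using up[of z ?y] y that by (intro mult_nonneg_nonpos) auto
    have "J z (t *\<^sub>R e) ?y \<le> t * J z e ?y + (1 - t) * J z 0 ?y" using that y by (intro cvx)
    also have "\<dots> \<le> t * G z e" using t1 t2 by simp
    finally show ?thesis by (simp add: G_def)
  qed
  obtain k1 s1 where
    c1: "continuous_on (Z \<times> E) (\<lambda>(z, e). k1 z e)" "continuous_on (Z \<times> E) (\<lambda>(z, e). s1 z e)" and
    R1: "\<forall>z\<in>Z. \<forall>e\<in>E. s1 z (k1 z e) = e \<and> k1 z (s1 z e) = e \<and> G z (s1 z e) = (norm e)\<^sup>2"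
    "\<forall>z e. (\<exists>r. s1 z e = r *\<^sub>R e) \<and> (\<exists>r. k1 z e = r *\<^sub>R e)"
    by (rule radial_homeomorphism[OF E a G1]) ((rule G2; assumption), (rule G3; assumption), (rule that; assumption))
  have r1: "s1 z (k1 z e) = e" "k1 z (s1 z e) = e" "G z (s1 z e) = (norm e)\<^sup>2" if "z \<in> Z" "e \<in> E" for z e
    using R1(1) that by auto
  have r1s: "\<exists>r. s1 z e = r *\<^sub>R e" "\<exists>r. k1 z e = r *\<^sub>R e" for z e
    using R1(2) by auto
  have inE: "s1 z e \<in> E" "k1 z e \<in> E" if "e \<in> E" for z e
    using r1s(1)[of z e] r1s(2)[of z e] that sub by auto
  define g where "g w e = G (fst w) (snd w) - J (fst w) (snd w) (m w + e)" for w e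
  have g1: "continuous_on ((Z \<times> E) \<times> N) (\<lambda>(w, e). g w e)"
    unfolding case_prod_unfold g_def G_def
    by (intro continuous_on_diff contJ continuous_on_add contm) (auto intro!: continuous_intros mN subN
        continuous_on_compose2[OF m(1)])
  have g2: "a * (norm e)\<^sup>2 \<le> g w e" if "w \<in> Z \<times> E" "e \<in> N" for w e
    using mq[of "fst w" "snd w" "m w + e"] that m(2)[of w] subN by (auto simp: g_def G_def)
  have g3: "g w (t *\<^sub>R e) \<le> t * g w e" if w: "w \<in> Z \<times> E" "e \<in> N" "0 \<le> t" "t \<le> 1" for w e t
  proof -
    obtain z x where wz: "w = (z, x)" "z \<in> Z" "x \<in> E" using w by auto
    have mw: "m w \<in> N" using m(2) w by blast
    have eq: "(1 - t) *\<^sub>R m w + t *\<^sub>R (m w + e) = m w + t *\<^sub>R e" by (simp add: algebra_simps)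
    have "(1 - t) * J z x (m w) + t * J z x (m w + e) + a * t * (1 - t) * (norm (m w - (m w + e)))\<^sup>2
        \<le> J z x (m w + t *\<^sub>R e)"
      using conc[of z x "m w" "m w + e" t] wz w mw subN unfolding eq by auto
    moreover have "0 \<le> a * t * (1 - t) * (norm (m w - (m w + e)))\<^sup>2" using a w by simp
    ultimately show ?thesis by (simp add: g_def G_def wz algebra_simps)
  qed
  obtain k2 s2 where
    c2: "continuous_on ((Z \<times> E) \<times> N) (\<lambda>(z, e). k2 z e)" "continuous_on ((Z \<times> E) \<times> N) (\<lambda>(z, e). s2 z e)" and
    R2: "\<forall>w\<in>Z \<times> E. \<forall>e\<in>N. s2 w (k2 w e) = e \<and> k2 w (s2 w e) = e \<and> g w (s2 w e) = (norm e)\<^sup>2"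
    "\<forall>w e. (\<exists>r. s2 w e = r *\<^sub>R e) \<and> (\<exists>r. k2 w e = r *\<^sub>R e)"
    by (rule radial_homeomorphism[OF N(1) a g1]) ((rule g2; assumption), (rule g3; assumption), (rule that; assumption))
  have r2: "s2 w (k2 w e) = e" "k2 w (s2 w e) = e" "g w (s2 w e) = (norm e)\<^sup>2" if "w \<in> Z \<times> E" "e \<in> N" for w e
    using R2(1) that by auto
  have r2s: "\<exists>r. s2 w e = r *\<^sub>R e" "\<exists>r. k2 w e = r *\<^sub>R e" for w e
    using R2(2) by blast+
  have inN: "s2 z e \<in> N" "k2 z e \<in> N" if "e \<in> N" for z e
    using r2s(1)[of z e] r2s(2)[of z e] that subN by auto
  have conts1: "continuous_on D (\<lambda>w. s1 (f w) (h w))"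
    if "continuous_on D f" "continuous_on D h" "\<And>w. w \<in> D \<Longrightarrow> f w \<in> Z \<and> h w \<in> E"
    for D :: "'c::topological_space set" and f h
    using continuous_on_compose2[OF c1(2) continuous_on_Pair[OF that(1,2)]] that(3)
    by (auto simp: image_subset_iff)
  have conts2: "continuous_on D (\<lambda>w. s2 (f w) (h w))"
    if "continuous_on D f" "continuous_on D h" "\<And>w. w \<in> D \<Longrightarrow> f w \<in> Z \<times> E \<and> h w \<in> N"
    for D :: "'c::topological_space set" and f h
    using continuous_on_compose2[OF c2(2) continuous_on_Pair[OF that(1,2)]] that(3)
    by (auto simp: image_subset_iff)
  have contk2: "continuous_on D (\<lambda>w. k2 (f w) (h w))"
    if "continuous_on D f" "continuous_on D h" "\<And>w. w \<in> D \<Longrightarrow> f w \<in> Z \<times> E \<and> h w \<in> N"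
    for D :: "'c::topological_space set" and f h
    using continuous_on_compose2[OF c2(1) continuous_on_Pair[OF that(1,2)]] that(3)
    by (auto simp: image_subset_iff)
  define Y where "Y z p q = m (z, s1 z p) + s2 (z, s1 z p) q" for z p q
  define K2 where "K2 z x y = k2 (z, x) (y - m (z, x))" for z x y
  show ?thesis
  proof (rule that[of s1 Y k1 K2])
    show "continuous_on (Z \<times> E \<times> N) (\<lambda>(z, p, q). Y z p q)"
      unfolding Y_def case_prod_unfold
      by (intro continuous_on_add contm conts2 conts1 continuous_on_Pair) (auto intro!: continuous_intros inE)
    show "continuous_on (Z \<times> E \<times> N) (\<lambda>(z, p, q). K2 z p q)"
      unfolding K2_def case_prod_unfold
      by (intro contk2 contm continuous_on_Pair continuous_on_diff) (auto intro!: continuous_intros mN subN)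
    have "J z (s1 z p) (Y z p q) = (norm p)\<^sup>2 - (norm q)\<^sup>2" if "z \<in> Z" "p \<in> E" "q \<in> N" for z p q
      using r1(3)[of z p] r2(3)[of "(z, s1 z p)" q] that inE by (simp add: g_def Y_def)
    moreover have "Y z p q \<in> N" "K2 z (s1 z p) (Y z p q) = q" if "z \<in> Z" "p \<in> E" "q \<in> N" for z p q
      using that inE inN mN subN r2(2) by (auto simp: Y_def K2_def)
    ultimately show "\<forall>z\<in>Z. \<forall>p\<in>E. \<forall>q\<in>N. Y z p q \<in> N \<and> k1 z (s1 z p) = p \<and> K2 z (s1 z p) (Y z p q) = q
        \<and> J z (s1 z p) (Y z p q) = (norm p)\<^sup>2 - (norm q)\<^sup>2"
      using r1(2) by blast
    have "Y z 0 0 = 0" if "z \<in> Z" for z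
      using r1s(1)[of z 0] r2s(1)[of "(z, s1 z 0)" 0] m0[OF that] by (auto simp: Y_def)
    then show "\<forall>z\<in>Z. Y z 0 0 = 0" by blast
    have "K2 z x y \<in> N" "Y z (k1 z x) (K2 z x y) = y" if "z \<in> Z" "x \<in> E" "y \<in> N" for z x y
      using that inE inN mN subN r2(1) r1(1) by (auto simp: Y_def K2_def)
    then show "\<forall>z\<in>Z. \<forall>x\<in>E. \<forall>y\<in>N. K2 z x y \<in> N \<and> s1 z (k1 z x) = x \<and> Y z (k1 z x) (K2 z x y) = y"
      using r1(1) by blast
    show "\<forall>z p. (\<exists>r. s1 z p = r *\<^sub>R p) \<and> (\<exists>r. k1 z p = r *\<^sub>R p)" using r1s by blast
  qed (use c1 in auto)
qed

section \<open>Continuous directional derivatives\<close>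

lemma dir_deriv_tendsto:
  assumes "cont_dir_diff_on U f" "x \<in> U"
  shows "((\<lambda>t::real. (f (x + t *\<^sub>R u) - f x) /\<^sub>R t) \<longlongrightarrow> dir_deriv f x u) (at 0)"
proof -
  obtain d where d: "((\<lambda>t::real. (f (x + t *\<^sub>R u) - f x) /\<^sub>R t) \<longlongrightarrow> d) (at 0)"
    using assms unfolding cont_dir_diff_on_def by blast
  then have "dir_deriv f x u = d"
    unfolding dir_deriv_def by (intro tendsto_Lim) auto
  then show ?thesis using d by simp
qed

lemma dir_deriv_continuous:
  assumes "cont_dir_diff_on U f"
  shows "continuous_on U (\<lambda>x. dir_deriv f x u)"
  using assms unfolding cont_dir_diff_on_def by blast

lemma has_vector_derivative_0_iff_quotient:
  fixes f :: "'a::real_normed_vector \<Rightarrow> 'b::real_normed_vector"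
  shows "((\<lambda>t. f (x + t *\<^sub>R u)) has_vector_derivative d) (at s) \<longleftrightarrow>
    ((\<lambda>t::real. (f ((x + s *\<^sub>R u) + t *\<^sub>R u) - f (x + s *\<^sub>R u)) /\<^sub>R t) \<longlongrightarrow> d) (at 0)"
proof -
  have "((\<lambda>t. f (x + t *\<^sub>R u)) has_vector_derivative d) (at s) \<longleftrightarrow>
      ((\<lambda>h. (f (x + (s + h) *\<^sub>R u) - f (x + s *\<^sub>R u) - h *\<^sub>R d) /\<^sub>R \<bar>h\<bar>) \<longlongrightarrow> 0) (at 0)"
    unfolding has_vector_derivative_def has_derivative_at
    by (simp add: bounded_linear_scaleR_left tendsto_norm_zero_iff[symmetric, of "\<lambda>h. _ h /\<^sub>R \<bar>h\<bar>"] divide_inverse_commute)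
  also have "\<dots> \<longleftrightarrow> ((\<lambda>h. norm ((f (x + (s + h) *\<^sub>R u) - f (x + s *\<^sub>R u) - h *\<^sub>R d) /\<^sub>R \<bar>h\<bar>)) \<longlongrightarrow> 0) (at 0)"
    by (rule tendsto_norm_zero_iff[symmetric])
  also have "\<dots> \<longleftrightarrow> ((\<lambda>h. norm ((f ((x + s *\<^sub>R u) + h *\<^sub>R u) - f (x + s *\<^sub>R u)) /\<^sub>R h - d)) \<longlongrightarrow> 0) (at 0)"
  proof (rule tendsto_cong)
    have "norm ((f (x + (s + h) *\<^sub>R u) - f (x + s *\<^sub>R u) - h *\<^sub>R d) /\<^sub>R \<bar>h\<bar>)
        = norm ((f ((x + s *\<^sub>R u) + h *\<^sub>R u) - f (x + s *\<^sub>R u)) /\<^sub>R h - d)" if "h \<noteq> 0" for h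
    proof -
      have "(f ((x + s *\<^sub>R u) + h *\<^sub>R u) - f (x + s *\<^sub>R u)) /\<^sub>R h - d
          = (f (x + (s + h) *\<^sub>R u) - f (x + s *\<^sub>R u) - h *\<^sub>R d) /\<^sub>R h"
        using that by (simp add: algebra_simps)
      then show ?thesis by simp
    qed
    then show "\<forall>\<^sub>F h in at 0. norm ((f (x + (s + h) *\<^sub>R u) - f (x + s *\<^sub>R u) - h *\<^sub>R d) /\<^sub>R \<bar>h\<bar>)
        = norm ((f ((x + s *\<^sub>R u) + h *\<^sub>R u) - f (x + s *\<^sub>R u)) /\<^sub>R h - d)"
      unfolding eventually_at_filter by (intro always_eventually) auto
  qed
  also have "\<dots> \<longleftrightarrow> ((\<lambda>h. (f ((x + s *\<^sub>R u) + h *\<^sub>R u) - f (x + s *\<^sub>R u)) /\<^sub>R h) \<longlongrightarrow> d) (at 0)"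
    by (simp add: tendsto_norm_zero_iff LIM_zero_iff)
  finally show ?thesis .
qed

lemma dir_deriv_vector_derivative:
  assumes "cont_dir_diff_on U f" "x + s *\<^sub>R u \<in> U"
  shows "((\<lambda>t. f (x + t *\<^sub>R u)) has_vector_derivative dir_deriv f (x + s *\<^sub>R u) u) (at s)"
  unfolding has_vector_derivative_0_iff_quotient by (rule dir_deriv_tendsto[OF assms])

lemma increment_bound:
  fixes g :: "real \<Rightarrow> 'b::real_normed_vector"
  assumes "\<And>t. 0 \<le> t \<Longrightarrow> t \<le> 1 \<Longrightarrow> (g has_vector_derivative g' t) (at t)"
    and "\<And>t. 0 \<le> t \<Longrightarrow> t \<le> 1 \<Longrightarrow> norm (g' t - d) \<le> e"
  shows "norm (g 1 - g 0 - d) \<le> e"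
proof -
  have "norm ((g 1 - 1 *\<^sub>R d) - (g 0 - 0 *\<^sub>R d)) \<le> e * norm (1 - (0::real))"
  proof (rule differentiable_bound[of "{0..1::real}" "\<lambda>t. g t - t *\<^sub>R d" "\<lambda>t h. h *\<^sub>R (g' t - d)"])
    show "((\<lambda>t. g t - t *\<^sub>R d) has_derivative (\<lambda>h. h *\<^sub>R (g' t - d))) (at t within {0..1})" if "t \<in> {0..1}" for t
    proof -
      have "((\<lambda>t. g t - t *\<^sub>R d) has_vector_derivative g' t - d) (at t)"
        using assms(1)[of t] that by (auto intro!: derivative_eq_intros)
      then show ?thesis unfolding has_vector_derivative_def by (rule has_derivative_at_withinI)
    qed
    show "onorm (\<lambda>h. h *\<^sub>R (g' t - d)) \<le> e" if "t \<in> {0..1}" for t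
    proof (rule onorm_le)
      show "norm (x *\<^sub>R (g' t - d)) \<le> e * norm x" for x :: real
        using mult_right_mono[OF assms(2)[of t], of "\<bar>x\<bar>"] that by (simp add: mult.commute)
    qed
  qed auto
  then show ?thesis by (simp add: algebra_simps)
qed

text \<open>
The mean value inequality along the segment from \<open>z\<close> to \<open>y\<close>, which stays in \<open>W\<close> by relative openness,
upgrades directional derivatives that depend continuously on the point in operator norm to a
derivative relative to \<open>W\<close>. It is used with \<open>E\<close> the whole space and with \<open>E\<close> the kernel of \<open>B(\<infinity>)\<close>.
\<close>
lemma directional_imp_has_differential_on:
  fixes f :: "'a::real_normed_vector \<Rightarrow> 'b::real_normed_vector" and f' :: "'a \<Rightarrow> 'a \<Rightarrow>\<^sub>L 'b"
  assumes E: "subspace E" "W \<subseteq> E" and W: "\<And>z. z \<in> W \<Longrightarrow> \<exists>d>0. ball z d \<inter> E \<subseteq> W"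
    and cont: "continuous_on W f'"
    and dd: "\<And>z v. z \<in> W \<Longrightarrow> v \<in> E \<Longrightarrow> ((\<lambda>t::real. (f (z + t *\<^sub>R v) - f z) /\<^sub>R t) \<longlongrightarrow> f' z v) (at 0)"
  shows "has_differential_on W f f'"
  unfolding has_differential_on_def
proof
  fix z assume z: "z \<in> W"
  show "(f has_derivative blinfun_apply (f' z)) (at z within W)"
    unfolding has_derivative_within_alt
  proof (intro conjI allI impI)
    show "bounded_linear (blinfun_apply (f' z))" by (rule blinfun.bounded_linear_right)
    fix e :: real assume e: "e > 0"
    obtain d1 where d1: "d1 > 0" "ball z d1 \<inter> E \<subseteq> W" using W[OF z] by blast
    obtain d2 where d2: "d2 > 0" "\<And>y. y \<in> W \<Longrightarrow> dist y z < d2 \<Longrightarrow> dist (f' y) (f' z) < e"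
      using cont z e unfolding continuous_on_iff by blast
    have "norm (f y - f z - blinfun_apply (f' z) (y - z)) \<le> e * norm (y - z)"
      if y: "y \<in> W" "norm (y - z) < min d1 d2" for y
    proof -
      define v where "v = y - z"
      have v: "v \<in> E" using y(1) z E(2) subspace_diff[OF E(1)] unfolding v_def by blast
      have seg: "z + t *\<^sub>R v \<in> W" "dist (z + t *\<^sub>R v) z < d2" if "0 \<le> t" "t \<le> 1" for t
      proof -
        have n: "norm (t *\<^sub>R v) < min d1 d2"
          using y(2) that mult_left_le_one_le[of "norm v" t] by (simp add: v_def)
        have "z + t *\<^sub>R v \<in> E" using z v E by (auto intro: subspace_add subspace_scale)
        then show "z + t *\<^sub>R v \<in> W" using n d1 by (auto simp: dist_norm)
        show "dist (z + t *\<^sub>R v) z < d2" using n by (simp add: dist_norm)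
      qed
      have "norm ((\<lambda>t. f (z + t *\<^sub>R v)) 1 - (\<lambda>t. f (z + t *\<^sub>R v)) 0 - f' z v) \<le> e * norm v"
      proof (rule increment_bound[where g' = "\<lambda>t. f' (z + t *\<^sub>R v) v"])
        fix t :: real assume t: "0 \<le> t" "t \<le> 1"
        show "((\<lambda>t. f (z + t *\<^sub>R v)) has_vector_derivative f' (z + t *\<^sub>R v) v) (at t)"
          unfolding has_vector_derivative_0_iff_quotient by (rule dd) (use seg[OF t] v in auto)
        have "norm (f' (z + t *\<^sub>R v) v - f' z v) = norm ((f' (z + t *\<^sub>R v) - f' z) v)"
          by (simp add: blinfun.diff_left)
        also have "\<dots> \<le> norm (f' (z + t *\<^sub>R v) - f' z) * norm v" by (rule norm_blinfun)
        also have "\<dots> \<le> e * norm v"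
          using d2(2)[of "z + t *\<^sub>R v"] seg[OF t] by (intro mult_right_mono) (auto simp: dist_norm)
        finally show "norm (f' (z + t *\<^sub>R v) v - f' z v) \<le> e * norm v" .
      qed
      then show ?thesis by (simp add: v_def)
    qed
    then show "\<exists>d>0. \<forall>y\<in>W. norm (y - z) < d \<longrightarrow>
        norm (f y - f z - blinfun_apply (f' z) (y - z)) \<le> e * norm (y - z)"
      using d1 d2 by (intro exI[of _ "min d1 d2"]) auto
  qed
qed

text \<open>
Homogeneity is a substitution. For additivity, the increment in direction \<open>u + v\<close> is the
one in direction \<open>u\<close> followed by one in direction \<open>v\<close> that starts at the moving point \<open>x + t u\<close>; the
continuity of the directional derivative in the point allows to replace it by \<open>x\<close>.
\<close>
lemma dir_deriv_linear:
  fixes f :: "'a::real_normed_vector \<Rightarrow> 'b::real_normed_vector"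
  assumes U: "open U" and f: "cont_dir_diff_on U f" and x: "x \<in> U"
  shows "linear (dir_deriv f x)"
proof (rule linearI)
  show "dir_deriv f x (c *\<^sub>R u) = c *\<^sub>R dir_deriv f x u" for c u
  proof (cases "c = 0")
    case True
    then show ?thesis
      using tendsto_unique[OF _ dir_deriv_tendsto[OF f x, of 0], of 0] by simp
  next
    case False
    have "filterlim (\<lambda>t. t * c) (at 0) (at 0)"
      using False by (intro filterlim_atI) (auto intro!: tendsto_eq_intros simp: eventually_at_filter)
    from filterlim_compose[OF dir_deriv_tendsto[OF f x, of u] this]
    have "((\<lambda>t. c *\<^sub>R ((f (x + (t * c) *\<^sub>R u) - f x) /\<^sub>R (t * c))) \<longlongrightarrow> c *\<^sub>R dir_deriv f x u) (at 0)"
      by (intro tendsto_intros)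
    moreover have "(\<lambda>t. c *\<^sub>R ((f (x + (t * c) *\<^sub>R u) - f x) /\<^sub>R (t * c)))
        = (\<lambda>t. (f (x + t *\<^sub>R (c *\<^sub>R u)) - f x) /\<^sub>R t)"
      using False by (auto simp: fun_eq_iff divide_simps)
    ultimately show ?thesis
      using tendsto_unique[OF _ dir_deriv_tendsto[OF f x, of "c *\<^sub>R u"]] by simp
  qed
  show "dir_deriv f x (u + v) = dir_deriv f x u + dir_deriv f x v" for u v
  proof -
    have lim: "((\<lambda>t::real. (f (x + t *\<^sub>R (u + v)) - f (x + t *\<^sub>R u)) /\<^sub>R t) \<longlongrightarrow> dir_deriv f x v) (at 0)"
    proof (rule tendstoI)
      fix e :: real assume e: "e > 0"
      obtain d where d: "d > 0" "\<And>y. dist y x < d \<Longrightarrow> y \<in> U" "\<And>y. dist y x < d \<Longrightarrow> dist (dir_deriv f y v) (dir_deriv f x v) < e / 2"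
      proof -
        obtain d1 where "d1 > 0" "ball x d1 \<subseteq> U" using U x open_contains_ball by blast
        moreover obtain d2 where "d2 > 0" "\<And>y. y \<in> U \<Longrightarrow> dist y x < d2 \<Longrightarrow> dist (dir_deriv f y v) (dir_deriv f x v) < e / 2"
          using dir_deriv_continuous[OF f, of v] x e unfolding continuous_on_iff by (meson half_gt_zero)
        ultimately show ?thesis using that[of "min d1 d2"] by (auto simp: subset_iff dist_commute)
      qed
      \<comment> \<open>the path from \<open>x\<close> to \<open>x + t (u + v)\<close> via \<open>x + t u\<close> stays within distance \<open>\<bar>t\<bar> M\<close> of \<open>x\<close>\<close>
      define M where "M = norm u + norm v + 1"
      have M: "M > 0" by (simp add: M_def add_nonneg_pos)
      have *: "norm ((f (x + t *\<^sub>R (u + v)) - f (x + t *\<^sub>R u)) /\<^sub>R t - dir_deriv f x v) \<le> e / 2"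
        if t: "t \<noteq> 0" "\<bar>t\<bar> < d / M" for t
      proof -
        have near: "dist ((x + t *\<^sub>R u) + (s * t) *\<^sub>R v) x < d" if s: "0 \<le> s" "s \<le> 1" for s
        proof -
          have "norm (t *\<^sub>R u + (s * t) *\<^sub>R v) \<le> \<bar>t\<bar> * norm u + s * (\<bar>t\<bar> * norm v)"
            using norm_triangle_ineq[of "t *\<^sub>R u" "(s * t) *\<^sub>R v"] s by (simp add: abs_mult)
          also have "\<dots> \<le> \<bar>t\<bar> * norm u + 1 * (\<bar>t\<bar> * norm v)"
            using s by (intro add_left_mono mult_right_mono) auto
          also have "\<dots> \<le> \<bar>t\<bar> * M" by (simp add: M_def algebra_simps)
          also have "\<dots> < d" using t(2) M by (simp add: field_simps)
          finally show ?thesis by (simp add: dist_norm add.assoc)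
        qed
        have "norm ((\<lambda>s. f ((x + t *\<^sub>R u) + (s * t) *\<^sub>R v)) 1 - (\<lambda>s. f ((x + t *\<^sub>R u) + (s * t) *\<^sub>R v)) 0 - t *\<^sub>R dir_deriv f x v)
            \<le> \<bar>t\<bar> * (e / 2)"
        proof (rule increment_bound[where g' = "\<lambda>s. t *\<^sub>R dir_deriv f ((x + t *\<^sub>R u) + (s * t) *\<^sub>R v) v"])
          fix s :: real assume s: "0 \<le> s" "s \<le> 1"
          have "((\<lambda>r. f ((x + t *\<^sub>R u) + r *\<^sub>R v)) has_vector_derivative dir_deriv f ((x + t *\<^sub>R u) + (s * t) *\<^sub>R v) v) (at (s * t))"
            by (rule dir_deriv_vector_derivative[OF f]) (use d near[OF s] in blast)
          then have "(((\<lambda>r. f ((x + t *\<^sub>R u) + r *\<^sub>R v)) \<circ> (\<lambda>s. s * t)) has_vector_derivative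
              (t *\<^sub>R dir_deriv f ((x + t *\<^sub>R u) + (s * t) *\<^sub>R v) v)) (at s)"
            by (intro vector_diff_chain_at) (auto intro!: derivative_eq_intros)
          then show "((\<lambda>s. f ((x + t *\<^sub>R u) + (s * t) *\<^sub>R v)) has_vector_derivative
              (t *\<^sub>R dir_deriv f ((x + t *\<^sub>R u) + (s * t) *\<^sub>R v) v)) (at s)"
            by (simp add: o_def)
          have "norm (dir_deriv f ((x + t *\<^sub>R u) + (s * t) *\<^sub>R v) v - dir_deriv f x v) \<le> e / 2"
            using d(3)[OF near[OF s]] by (simp add: dist_norm)
          from mult_left_mono[OF this, of "\<bar>t\<bar>"]
          show "norm (t *\<^sub>R dir_deriv f ((x + t *\<^sub>R u) + (s * t) *\<^sub>R v) v - t *\<^sub>R dir_deriv f x v) \<le> \<bar>t\<bar> * (e / 2)"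
            by (simp flip: scaleR_diff_right)
        qed
        then have b: "norm (f (x + t *\<^sub>R (u + v)) - f (x + t *\<^sub>R u) - t *\<^sub>R dir_deriv f x v) \<le> \<bar>t\<bar> * (e / 2)"
          by (simp add: scaleR_add_right add.assoc)
        have "(f (x + t *\<^sub>R (u + v)) - f (x + t *\<^sub>R u)) /\<^sub>R t - dir_deriv f x v
            = (f (x + t *\<^sub>R (u + v)) - f (x + t *\<^sub>R u) - t *\<^sub>R dir_deriv f x v) /\<^sub>R t"
          using t(1) by (simp add: scaleR_diff_right)
        then show ?thesis using b t(1) by (simp add: divide_simps mult.commute)
      qed
      have "\<forall>\<^sub>F t in at 0. t \<noteq> 0 \<and> \<bar>t\<bar> < d / M"
        unfolding eventually_at using d(1) M by (intro exI[of _ "d / M"]) auto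
      then show "\<forall>\<^sub>F t in at 0. dist ((f (x + t *\<^sub>R (u + v)) - f (x + t *\<^sub>R u)) /\<^sub>R t) (dir_deriv f x v) < e"
      proof eventually_elim
        case (elim t)
        then show ?case using *[of t] e by (simp add: dist_norm)
      qed
    qed
    have "((\<lambda>t::real. (f (x + t *\<^sub>R (u + v)) - f (x + t *\<^sub>R u)) /\<^sub>R t + (f (x + t *\<^sub>R u) - f x) /\<^sub>R t)
        \<longlongrightarrow> dir_deriv f x v + dir_deriv f x u) (at 0)"
      by (intro tendsto_add lim dir_deriv_tendsto[OF f x])
    then have "((\<lambda>t::real. (f (x + t *\<^sub>R (u + v)) - f x) /\<^sub>R t) \<longlongrightarrow> dir_deriv f x v + dir_deriv f x u) (at 0)"
      by (simp flip: scaleR_add_right)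
    then show ?thesis
      using tendsto_unique[OF _ dir_deriv_tendsto[OF f x, of "u + v"]] by (simp add: add.commute)
  qed
qed

text \<open>
This and the next lemma translate between the limit along a product filter and an
\<open>\<epsilon>\<close>-\<open>R\<close> formulation.
\<close>
lemma strict_deriv_at_infinityI:
  assumes "\<And>e. e > 0 \<Longrightarrow> \<exists>R. \<forall>x1\<in>W. \<forall>x2\<in>W. norm x1 \<ge> R \<longrightarrow> norm x2 \<ge> R \<longrightarrow>
    norm (f x1 - f x2 - T (x1 - x2)) \<le> e * norm (x1 - x2)"
  shows "has_strict_deriv_at_infinity W f T"
  unfolding has_strict_deriv_at_infinity_def
proof (rule tendstoI)
  fix e :: real assume e: "e > 0"
  obtain R where R: "\<forall>x1\<in>W. \<forall>x2\<in>W. norm x1 \<ge> R \<longrightarrow> norm x2 \<ge> R \<longrightarrow>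
    norm (f x1 - f x2 - T (x1 - x2)) \<le> e / 2 * norm (x1 - x2)"
    using assms[of "e / 2"] e by auto
  have "\<forall>\<^sub>F x in at_infinity \<times>\<^sub>F at_infinity. norm (fst x :: 'a) \<ge> R \<and> norm (snd x :: 'a) \<ge> R"
  proof (rule eventually_prodI[of "\<lambda>x. norm x \<ge> R" _ "\<lambda>x. norm x \<ge> R", THEN eventually_mono])
    show "\<forall>\<^sub>F x :: 'a in at_infinity. R \<le> norm x" by (auto simp: eventually_at_infinity)
    show "\<forall>\<^sub>F x :: 'a in at_infinity. R \<le> norm x" by (auto simp: eventually_at_infinity)
  qed auto
  then show "\<forall>\<^sub>F x in inf (at_infinity \<times>\<^sub>F at_infinity) (principal {(x1, x2). x1 \<in> W \<and> x2 \<in> W \<and> x1 \<noteq> x2}).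
     dist (case x of (x1, x2) \<Rightarrow> norm (f x1 - f x2 - T (x1 - x2)) / norm (x1 - x2)) 0 < e"
    unfolding eventually_inf_principal
  proof eventually_elim
    case (elim x)
    show ?case
    proof (cases x)
      case (Pair x1 x2)
      have "norm (f x1 - f x2 - T (x1 - x2)) / norm (x1 - x2) < e" if "x1 \<in> W" "x2 \<in> W" "x1 \<noteq> x2"
      proof -
        have "norm (f x1 - f x2 - T (x1 - x2)) \<le> e / 2 * norm (x1 - x2)" using R that elim Pair by simp
        also have "\<dots> < e * norm (x1 - x2)" using e that by (intro mult_strict_right_mono) auto
        finally show ?thesis using that by (simp add: divide_simps)
      qed
      then show ?thesis by (simp add: Pair)
    qed
  qed
qed

lemma strict_deriv_at_infinityD:
  assumes "has_strict_deriv_at_infinity W f T" "linear T" "e > 0"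
  shows "\<exists>R. \<forall>x1\<in>W. \<forall>x2\<in>W. norm x1 \<ge> R \<longrightarrow> norm x2 \<ge> R \<longrightarrow>
    norm (f x1 - f x2 - T (x1 - x2)) \<le> e * norm (x1 - x2)"
proof -
  have "\<forall>\<^sub>F x in inf (at_infinity \<times>\<^sub>F at_infinity) (principal {(x1, x2). x1 \<in> W \<and> x2 \<in> W \<and> x1 \<noteq> x2}).
     dist (case x of (x1, x2) \<Rightarrow> norm (f x1 - f x2 - T (x1 - x2)) / norm (x1 - x2)) 0 < e"
    using assms(1,3) unfolding has_strict_deriv_at_infinity_def by (rule tendstoD)
  then obtain P Q where PQ: "eventually P at_infinity" "eventually Q at_infinity"
    "\<And>x y. P x \<Longrightarrow> Q y \<Longrightarrow> x \<in> W \<Longrightarrow> y \<in> W \<Longrightarrow> x \<noteq> y \<Longrightarrow> norm (f x - f y - T (x - y)) / norm (x - y) < e"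
    unfolding eventually_inf_principal eventually_prod_filter by auto
  obtain R1 R2 where R: "\<And>x. norm x \<ge> R1 \<Longrightarrow> P x" "\<And>x. norm x \<ge> R2 \<Longrightarrow> Q x"
    using PQ(1,2) unfolding eventually_at_infinity by metis
  have "norm (f x1 - f x2 - T (x1 - x2)) \<le> e * norm (x1 - x2)"
    if "x1 \<in> W" "x2 \<in> W" "norm x1 \<ge> max R1 R2" "norm x2 \<ge> max R1 R2" for x1 x2
  proof (cases "x1 = x2")
    case False
    then have "norm (f x1 - f x2 - T (x1 - x2)) / norm (x1 - x2) < e" using PQ(3) R that by simp
    then show ?thesis using False by (simp add: divide_simps split: if_splits)
  qed (use assms(2) in \<open>simp add: linear_0\<close>)
  then show ?thesis by (intro exI[of _ "max R1 R2"]) auto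
qed

section \<open>Self-adjoint operators that are coercive up to a compact operator\<close>

lemma orthogonal_compD: "u \<in> S\<^sup>\<bottom> \<Longrightarrow> v \<in> S \<Longrightarrow> inner v u = 0"
  by (simp add: orthogonal_comp_def orthogonal_def)

lemma orthogonal_compI: "(\<And>v. v \<in> S \<Longrightarrow> inner v u = 0) \<Longrightarrow> u \<in> S\<^sup>\<bottom>"
  by (simp add: orthogonal_comp_def orthogonal_def)

lemma closed_orthogonal_comp: "closed (S\<^sup>\<bottom> :: 'a::real_inner set)"
proof -
  have "S\<^sup>\<bottom> = (\<Inter>v\<in>S. {u. inner v u = 0})" by (auto simp: orthogonal_comp_def orthogonal_def)
  also have "closed \<dots>" by (intro closed_INT ballI closed_Collect_eq continuous_intros)
  finally show ?thesis .
qed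

lemma orthogonal_comp_span: "(span S)\<^sup>\<bottom> = (S\<^sup>\<bottom> :: 'a::real_inner set)"
proof
  show "(span S)\<^sup>\<bottom> \<subseteq> S\<^sup>\<bottom>" by (intro orthogonal_comp_anti_mono span_superset)
  show "S\<^sup>\<bottom> \<subseteq> (span S)\<^sup>\<bottom>"
  proof
    fix u assume u: "u \<in> S\<^sup>\<bottom>"
    have "inner v u = 0" if "v \<in> span S" for v
      using that
    proof (induction rule: span_induct_alt)
      case (step c x y)
      then show ?case using orthogonal_compD[OF u step(1)] by (simp add: inner_add_left)
    qed simp
    then show "u \<in> (span S)\<^sup>\<bottom>" by (rule orthogonal_compI)
  qed
qed

text \<open>
Evaluate the form at \<open>u - t T u \<in> S\<close> with \<open>t = 1 / \<parallel>T\<parallel>\<close>. The lemma converts smallness of the form at \<open>u\<close>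
into smallness of \<open>T u\<close>.
\<close>
lemma selfadjoint_positive_bound:
  fixes T :: "'h::real_inner \<Rightarrow>\<^sub>L 'h"
  assumes T: "selfadjoint_op T" and S: "subspace S" "\<And>u. u \<in> S \<Longrightarrow> T u \<in> S"
    and pos: "\<And>u. u \<in> S \<Longrightarrow> inner (T u) u \<ge> 0" and u: "u \<in> S"
  shows "(norm (T u))\<^sup>2 \<le> norm T * inner (T u) u"
proof (cases "norm T = 0")
  case False
  define t where "t = 1 / norm T"
  have t: "t > 0" "t * norm T = 1" using False by (auto simp: t_def)
  have sym: "inner (T (T u)) u = inner (T u) (T u)" using T unfolding selfadjoint_op_def by blast
  have e1: "0 \<le> inner (T (u - t *\<^sub>R T u)) (u - t *\<^sub>R T u)"
    using S u by (intro pos) (auto intro: subspace_diff subspace_scale)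
  have e2: "inner (T (u - t *\<^sub>R T u)) (u - t *\<^sub>R T u) = inner (T u) u - 2 * t * inner (T u) (T u) + t\<^sup>2 * inner (T (T u)) (T u)"
    using sym by (simp add: blinfun.diff_right blinfun.scaleR_right inner_diff_left inner_diff_right
        power2_eq_square algebra_simps)
  have e3: "inner (T (T u)) (T u) \<le> norm T * inner (T u) (T u)"
  proof -
    have "inner (T (T u)) (T u) \<le> norm (T (T u)) * norm (T u)" by (rule norm_cauchy_schwarz)
    also have "\<dots> \<le> (norm T * norm (T u)) * norm (T u)" by (intro mult_right_mono norm_blinfun) auto
    finally show ?thesis by (simp add: power2_norm_eq_inner[symmetric] power2_eq_square)
  qed
  have "t\<^sup>2 * inner (T (T u)) (T u) \<le> t\<^sup>2 * (norm T * inner (T u) (T u))"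
    using e3 by (intro mult_left_mono) auto
  also have "\<dots> = t * (t * norm T) * inner (T u) (T u)" by (simp add: power2_eq_square)
  finally have "t\<^sup>2 * inner (T (T u)) (T u) \<le> t * inner (T u) (T u)" using t by simp
  then have "t * inner (T u) (T u) \<le> inner (T u) u" using e1 e2 by simp
  then show ?thesis using t(1) by (simp add: t_def power2_norm_eq_inner field_simps)
qed simp

text \<open>
Being bounded below, \<open>T\<close> has closed range on \<open>S\<close>; a vector of \<open>S\<close> orthogonal to the range is
annihilated by \<open>T\<close>, by symmetry, hence zero.
\<close>
lemma selfadjoint_surj_on_closed_invariant:
  fixes T :: "'h::{real_inner, complete_space} \<Rightarrow>\<^sub>L 'h"
  assumes T: "selfadjoint_op T" and S: "subspace S" "closed S" "\<And>u. u \<in> S \<Longrightarrow> T u \<in> S"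
    and k: "k > 0" "\<And>u. u \<in> S \<Longrightarrow> k * norm u \<le> norm (T u)" and v: "v \<in> S"
  shows "\<exists>u\<in>S. T u = v"
proof -
  have sub: "subspace (T ` S)" using S(1) by (intro linear_subspace_image) (simp add: blinfun.bounded_linear_right bounded_linear.linear)
  have "complete (T ` S)"
    by (rule complete_isometric_image[OF k(1) S(1) _ _ ])
      (use k S complete_eq_closed blinfun.bounded_linear_right in \<open>auto simp: blinfun.bounded_linear_right\<close>)
  then have cl: "closed (T ` S)" by (rule complete_imp_closed)
  obtain p where p: "p \<in> T ` S" "v - p \<in> (T ` S)\<^sup>\<bottom>" using closed_subspace_projection[OF sub cl] by blast
  have vp: "v - p \<in> S" using p(1) v S by (auto intro: subspace_diff)
  have "inner (T (T (v - p))) (v - p) = 0" using p(2) vp S by (intro orthogonal_compD[of _ "T ` S"]) auto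
  then have "inner (T (v - p)) (T (v - p)) = 0" using T unfolding selfadjoint_op_def by metis
  then have "T (v - p) = 0" by simp
  then have "norm (v - p) \<le> 0" using k(1) k(2)[OF vp] by (simp add: mult_le_0_iff)
  then show ?thesis using p(1) by auto
qed

lemma compact_op_convergent_subseq:
  fixes Q :: "'a::real_normed_vector \<Rightarrow>\<^sub>L 'b::real_normed_vector"
  assumes "compact_op Q" "\<And>n. norm (u n) \<le> C"
  obtains r l where "strict_mono (r :: nat \<Rightarrow> nat)" "(\<lambda>n. Q (u (r n))) \<longlonglongrightarrow> l"
proof -
  have "compact (closure (Q ` cball 0 C))"
    using assms(1) unfolding compact_op_def by simp
  then have "seq_compact (closure (Q ` cball 0 C))" by (rule compact_imp_seq_compact)
  moreover have "\<forall>n. Q (u n) \<in> closure (Q ` cball 0 C)"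
    using assms(2) by (auto intro!: subsetD[OF closure_subset])
  ultimately obtain l r where "strict_mono r" "((\<lambda>n. Q (u n)) \<circ> r) \<longlonglongrightarrow> l"
    using seq_compactE by metis
  then show ?thesis using that by (simp add: o_def)
qed

text \<open>
The coercive operator is \<open>T - Q\<close>. Since subtracting \<open>r \<le> 0\<close> preserves coercivity, the part of the
spectrum of \<open>T\<close> in \<open>(-\<infinity>, 0]\<close> is governed by the compact operator \<open>Q\<close>.
\<close>
locale coercive_plus_compact =
  fixes T :: "'h::{real_inner, complete_space} \<Rightarrow>\<^sub>L 'h" and Q :: "'h \<Rightarrow>\<^sub>L 'h" and c :: real
  assumes T_selfadjoint: "selfadjoint_op T" and Q_compact_op: "compact_op Q"
    and c_pos: "c > 0" and coercive: "\<And>u. c * (norm u)\<^sup>2 \<le> inner (T u - Q u) u"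
begin

lemma T_sym: "inner (T u) v = inner u (T v)"
  using T_selfadjoint unfolding selfadjoint_op_def by blast

lemma coercive_difference:
  assumes "r \<le> 0"
  shows "c * norm (u - v) \<le> norm ((T u - r *\<^sub>R u - Q u) - (T v - r *\<^sub>R v - Q v))"
proof (cases "u = v")
  case False
  define d where "d = u - v"
  have eq: "(T u - r *\<^sub>R u - Q u) - (T v - r *\<^sub>R v - Q v) = (T d - Q d) - r *\<^sub>R d"
    by (simp add: d_def blinfun.diff_right algebra_simps)
  have "0 \<le> (- r) * (norm d)\<^sup>2" using assms by (intro mult_nonneg_nonneg) auto
  then have "c * (norm d)\<^sup>2 \<le> inner (T d - Q d) d + (- r) * (norm d)\<^sup>2"
    using coercive[of d] by linarith
  also have "\<dots> = inner ((T d - Q d) - r *\<^sub>R d) d"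
    by (simp add: inner_diff_left power2_norm_eq_inner)
  also have "\<dots> \<le> norm ((T d - Q d) - r *\<^sub>R d) * norm d" by (rule norm_cauchy_schwarz)
  finally have "(c * norm d) * norm d \<le> norm ((T d - Q d) - r *\<^sub>R d) * norm d"
    by (simp add: power2_eq_square mult.assoc)
  then show ?thesis using False unfolding eq by (simp add: d_def)
qed simp

text \<open>
Along a subsequence \<open>Q u\<close> converges, hence so does \<open>T u - r u - Q u\<close>, and this operator is bounded below.
\<close>
lemma approximate_eigenvectors_converge:
  assumes r: "r \<le> 0" and bd: "\<And>n. norm (u n) \<le> C" and lim: "(\<lambda>n. T (u n) - r *\<^sub>R u n) \<longlonglongrightarrow> 0"
  obtains s w where "strict_mono (s :: nat \<Rightarrow> nat)" "(\<lambda>n. u (s n)) \<longlonglongrightarrow> w"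
proof -
  obtain s l where s: "strict_mono (s :: nat \<Rightarrow> nat)" "(\<lambda>n. Q (u (s n))) \<longlonglongrightarrow> l"
    by (rule compact_op_convergent_subseq[OF Q_compact_op, of u C]) (use bd in auto)
  define g where "g n = T (u (s n)) - r *\<^sub>R u (s n) - Q (u (s n))" for n
  have "g \<longlonglongrightarrow> 0 - l"
    unfolding g_def using LIMSEQ_subseq_LIMSEQ[OF lim s(1)]
    by (intro tendsto_diff s(2)) (simp add: o_def)
  then have "Cauchy g" by (rule LIMSEQ_imp_Cauchy)
  have "Cauchy (\<lambda>n. u (s n))"
  proof (rule metric_CauchyI)
    fix e :: real assume "e > 0"
    then obtain M where M: "\<And>m n. m \<ge> M \<Longrightarrow> n \<ge> M \<Longrightarrow> dist (g m) (g n) < c * e"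
      using metric_CauchyD[OF \<open>Cauchy g\<close>, of "c * e"] c_pos by auto
    have "dist (u (s m)) (u (s n)) < e" if "m \<ge> M" "n \<ge> M" for m n
    proof -
      have "c * norm (u (s m) - u (s n)) < c * e"
        using coercive_difference[OF r, of "u (s m)" "u (s n)"] M[OF that] by (simp add: g_def dist_norm)
      then show ?thesis using c_pos by (simp add: dist_norm)
    qed
    then show "\<exists>M. \<forall>m\<ge>M. \<forall>n\<ge>M. dist (u (s m)) (u (s n)) < e" by blast
  qed
  then show ?thesis using that[OF s(1)] Cauchy_convergent convergent_def by blast
qed

text \<open>
Otherwise there are unit vectors in \<open>S\<close> whose images tend to \<open>0\<close>; these are approximate eigenvectors
for the eigenvalue \<open>0\<close>, and a limit point is a unit vector of \<open>S\<close> in the kernel.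
\<close>
lemma bounded_below_on_closed:
  assumes S: "subspace S" "closed S" and inj: "\<And>u. u \<in> S \<Longrightarrow> T u = 0 \<Longrightarrow> u = 0"
  shows "\<exists>k>0. \<forall>u\<in>S. k * norm u \<le> norm (T u)"
proof (rule ccontr)
  assume neg: "\<not> ?thesis"
  have "\<exists>u\<in>S. norm u = 1 \<and> norm (T u) < 1 / real (Suc n)" for n
  proof -
    have "1 / real (Suc n) > 0" by simp
    then obtain u where u: "u \<in> S" "\<not> (1 / real (Suc n)) * norm u \<le> norm (T u)" using neg by blast
    have u0: "u \<noteq> 0" using u(2) by auto
    have "norm (T ((1 / norm u) *\<^sub>R u)) = norm (T u) / norm u" by (simp add: blinfun.scaleR_right)
    also have "\<dots> < 1 / real (Suc n)" using u(2) u0 by (simp add: field_simps)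
    finally show ?thesis using u(1) u0 S(1)
      by (intro bexI[of _ "(1 / norm u) *\<^sub>R u"]) (auto simp: subspace_scale)
  qed
  then obtain u where u: "\<And>n. u n \<in> S" "\<And>n. norm (u n) = 1" "\<And>n. norm (T (u n)) < 1 / real (Suc n)"
    by metis
  have Tu: "(\<lambda>n. T (u n)) \<longlonglongrightarrow> 0"
  proof (rule Lim_null_comparison)
    show "\<forall>\<^sub>F n in sequentially. norm (T (u n)) \<le> 1 / real (Suc n)" using u(3) less_imp_le by (intro always_eventually) blast
    show "(\<lambda>n. 1 / real (Suc n)) \<longlonglongrightarrow> 0" by (intro lim_1_over_n[THEN LIMSEQ_Suc])
  qed
  obtain s w where s: "strict_mono (s :: nat \<Rightarrow> nat)" "(\<lambda>n. u (s n)) \<longlonglongrightarrow> w"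
    by (rule approximate_eigenvectors_converge[of 0 u 1]) (use u(2) Tu in auto)
  have "(\<lambda>n. T (u (s n))) \<longlonglongrightarrow> T w" by (intro tendsto_intros s)
  moreover have "(\<lambda>n. T (u (s n))) \<longlonglongrightarrow> 0" using LIMSEQ_subseq_LIMSEQ[OF Tu s(1)] by (simp add: o_def)
  ultimately have "T w = 0" by (rule LIMSEQ_unique)
  moreover have "w \<in> S" by (rule closed_sequentially[OF S(2) u(1) s(2)])
  moreover have "norm w = 1"
    using tendsto_norm[OF s(2)] u(2) by (simp add: LIMSEQ_const_iff)
  ultimately show False using inj[of w] by auto
qed

definition eigenframe :: "'h set \<Rightarrow> bool"
  where "eigenframe E \<longleftrightarrow> (\<forall>e\<in>E. norm e = 1 \<and> (\<exists>r\<le>0. T e = r *\<^sub>R e)) \<and> pairwise orthogonal E"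

text \<open>
For two distinct members, \<open>d = e - e'\<close> satisfies \<open>\<langle>T d, d\<rangle> \<le> 0\<close>, so coercivity gives
\<open>c \<parallel>d\<parallel>\<^sup>2 \<le> - \<langle>Q d, d\<rangle>\<close> and \<open>Q e\<close>, \<open>Q e'\<close> are at distance at least \<open>c\<close>. A compact operator has no
infinite separated set of images of unit vectors.
\<close>
lemma eigenframe_finite:
  assumes "eigenframe E"
  shows "finite E"
proof (rule ccontr)
  assume "infinite E"
  then obtain f :: "nat \<Rightarrow> 'h" where f: "inj f" "range f \<subseteq> E" using infinite_countable_subset by blast
  then have fE: "f n \<in> E" for n by auto
  have f1: "norm (f n) = 1" for n using assms fE by (auto simp: eigenframe_def)
  obtain s l where s: "strict_mono (s :: nat \<Rightarrow> nat)" "(\<lambda>n. Q (f (s n))) \<longlonglongrightarrow> l"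
    by (rule compact_op_convergent_subseq[OF Q_compact_op, of f 1]) (use f1 in auto)
  have "c \<le> dist (Q (f m)) (Q (f n))" if mn: "m \<noteq> n" for m n
  proof -
    define d where "d = f m - f n"
    obtain a b where ab: "a \<le> 0" "b \<le> 0" "T (f m) = a *\<^sub>R f m" "T (f n) = b *\<^sub>R f n"
      using assms fE unfolding eigenframe_def by metis
    have "f m \<noteq> f n" using mn inj_eq[OF f(1)] by simp
    then have orth: "inner (f m) (f n) = 0" "inner (f n) (f m) = 0"
      using assms pairwiseD[of orthogonal E "f m" "f n"] fE[of m] fE[of n]
      by (auto simp: eigenframe_def orthogonal_def inner_commute)
    have self: "inner (f m) (f m) = 1" "inner (f n) (f n) = 1"
      using f1 by (simp_all add: power2_norm_eq_inner[symmetric])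
    have "inner (T d) d = a + b"
      using ab orth self by (simp add: d_def blinfun.diff_right inner_diff_left inner_diff_right)
    then have "c * (norm d)\<^sup>2 \<le> - inner (Q d) d"
      using coercive[of d] ab by (simp add: inner_diff_left)
    also have "\<dots> \<le> norm (Q d) * norm d" using Cauchy_Schwarz_ineq2[of "Q d" d] by linarith
    finally have le: "c * norm d * norm d \<le> norm (Q d) * norm d" by (simp add: power2_eq_square mult.assoc)
    have d2: "(norm d)\<^sup>2 = 2"
      unfolding power2_norm_eq_inner d_def using orth self by (simp add: inner_diff_left inner_diff_right)
    then have d1: "norm d \<ge> 1" using power2_le_imp_le[of 1 "norm d"] by simp
    have "c * norm d \<le> norm (Q d)" by (rule mult_right_le_imp_le[OF le]) (use d1 in linarith)
    moreover have "c * 1 \<le> c * norm d" using d1 c_pos by (intro mult_left_mono) auto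
    ultimately show ?thesis by (simp add: d_def dist_norm blinfun.diff_right)
  qed
  moreover obtain M where "\<And>m n. m \<ge> M \<Longrightarrow> n \<ge> M \<Longrightarrow> dist (Q (f (s m))) (Q (f (s n))) < c"
    using metric_CauchyD[OF LIMSEQ_imp_Cauchy[OF s(2)] c_pos] by blast
  moreover have "s M \<noteq> s (Suc M)" using strict_monoD[OF s(1), of M "Suc M"] by simp
  ultimately show False by (metis le_refl not_le lessI less_imp_le)
qed

lemma eigenframe_invariant:
  assumes "eigenframe E" "u \<in> E\<^sup>\<bottom>"
  shows "T u \<in> E\<^sup>\<bottom>"
proof (rule orthogonal_compI)
  fix e assume e: "e \<in> E"
  then obtain r where "T e = r *\<^sub>R e" using assms(1) by (auto simp: eigenframe_def)
  then have "inner e (T u) = r * inner e u" using T_sym[of e u] by simp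
  then show "inner e (T u) = 0" using orthogonal_compD[OF assms(2) e] by simp
qed

text \<open>
By maximality (Zorn) the orthogonal complement contains no eigenvector with eigenvalue \<open>\<le> 0\<close>. If the
form were negative somewhere on it, its infimum \<open>r < 0\<close> over the unit sphere would be attained:
\<open>T - r\<close> is nonnegative, so a minimizing sequence consists of approximate eigenvectors and
accumulates at an eigenvector for \<open>r\<close>. Hence the form is nonnegative on the complement, where \<open>T\<close> is
also injective and therefore bounded below; together this is coercivity.
\<close>
lemma maximal_eigenframe:
  obtains E a where "eigenframe E" "a > 0" "\<And>u. u \<in> E\<^sup>\<bottom> \<Longrightarrow> a * (norm u)\<^sup>2 \<le> inner (T u) u"
proof -
  have "\<exists>E\<in>Collect eigenframe. \<forall>X\<in>Collect eigenframe. E \<subseteq> X \<longrightarrow> X = E"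
  proof (rule subset_Zorn')
    fix C assume C: "subset.chain (Collect eigenframe) C"
    have "pairwise orthogonal (\<Union>C)"
      unfolding pairwise_def
    proof (intro ballI impI)
      fix x y assume "x \<in> \<Union>C" "y \<in> \<Union>C" "x \<noteq> y"
      then obtain X1 X2 where X12: "X1 \<in> C" "x \<in> X1" "X2 \<in> C" "y \<in> X2" by blast
      then have "X1 \<subseteq> X2 \<or> X2 \<subseteq> X1" using C unfolding subset_chain_def by blast
      then obtain X where X: "X \<in> C" "x \<in> X" "y \<in> X" using X12 by blast
      then have "pairwise orthogonal X" using C by (auto simp: subset_chain_def eigenframe_def)
      then show "orthogonal x y" using X \<open>x \<noteq> y\<close> by (simp add: pairwiseD)
    qed
    moreover have "\<forall>e\<in>\<Union>C. norm e = 1 \<and> (\<exists>r\<le>0. T e = r *\<^sub>R e)"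
      using C unfolding subset_chain_def eigenframe_def by blast
    ultimately show "\<Union>C \<in> Collect eigenframe" by (simp add: eigenframe_def)
  qed
  then obtain E where E: "eigenframe E" and max: "\<And>X. eigenframe X \<Longrightarrow> E \<subseteq> X \<Longrightarrow> X = E" by blast
  have noeig: "u = 0" if u: "u \<in> E\<^sup>\<bottom>" "T u = r *\<^sub>R u" "r \<le> 0" for u r
  proof (rule ccontr)
    assume u0: "u \<noteq> 0"
    define w where "w = (1 / norm u) *\<^sub>R u"
    have w: "norm w = 1" "T w = r *\<^sub>R w" "w \<in> E\<^sup>\<bottom>"
      using u u0 subspace_scale[OF subspace_orthogonal_comp] by (auto simp: w_def blinfun.scaleR_right)
    have "eigenframe (insert w E)"
      using E w u(3) unfolding eigenframe_def
      by (auto simp: pairwise_insert orthogonal_def inner_commute dest: orthogonal_compD)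
    then have "w \<in> E" using max by blast
    then have "inner w w = 0" using w(3) by (simp add: orthogonal_compD)
    then show False using w(1) by auto
  qed
  let ?S = "E\<^sup>\<bottom>"
  have S: "subspace ?S" "closed ?S" "\<And>u. u \<in> ?S \<Longrightarrow> T u \<in> ?S"
    using subspace_orthogonal_comp closed_orthogonal_comp eigenframe_invariant[OF E] by auto
  have nonneg: "inner (T u) u \<ge> 0" if "u \<in> ?S" for u
  proof (rule ccontr)
    assume neg: "\<not> inner (T u) u \<ge> 0"
    define D where "D = (\<lambda>v. inner (T v) v) ` {v \<in> ?S. norm v = 1}"
    define r where "r = Inf D"
    have bdd: "bdd_below D"
    proof (rule bdd_belowI[of _ "- norm T"])
      fix x assume "x \<in> D"
      then obtain v where v: "norm v = 1" "x = inner (T v) v" by (auto simp: D_def)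
      have "\<bar>inner (T v) v\<bar> \<le> norm (T v) * norm v" by (rule Cauchy_Schwarz_ineq2)
      also have "\<dots> \<le> norm T" using norm_blinfun[of T v] v by simp
      finally show "- norm T \<le> x" using v by simp
    qed
    have hom: "inner (T v) v = (norm v)\<^sup>2 * inner (T ((1 / norm v) *\<^sub>R v)) ((1 / norm v) *\<^sub>R v)" for v
      by (cases "v = 0") (auto simp: blinfun.scaleR_right power2_eq_square)
    have unit: "v \<noteq> 0 \<Longrightarrow> v \<in> ?S \<Longrightarrow> inner (T ((1 / norm v) *\<^sub>R v)) ((1 / norm v) *\<^sub>R v) \<in> D" for v
      using subspace_scale[OF S(1)] unfolding D_def by (intro imageI) auto
    have u0: "u \<noteq> 0" using neg by auto
    have Dne: "D \<noteq> {}" using unit[OF u0 that] by auto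
    have "r \<le> inner (T ((1 / norm u) *\<^sub>R u)) ((1 / norm u) *\<^sub>R u)"
      unfolding r_def by (intro cInf_lower unit u0 that bdd)
    then have "(norm u)\<^sup>2 * r \<le> inner (T u) u" using hom[of u] by (metis mult_left_mono zero_le_power2)
    then have r0: "r < 0" using neg by (smt (verit) mult_nonneg_nonneg zero_le_power2)
    define T' where "T' = T - r *\<^sub>R id_blinfun"
    have T': "T' v = T v - r *\<^sub>R v" for v by (simp add: T'_def blinfun.diff_left blinfun.scaleR_left)
    have sa: "selfadjoint_op T'" unfolding selfadjoint_op_def T' by (simp add: inner_diff_left inner_diff_right T_sym)
    have pos': "inner (T' v) v \<ge> 0" if v: "v \<in> ?S" for v
    proof (cases "v = 0")
      case False
      have "r \<le> inner (T ((1 / norm v) *\<^sub>R v)) ((1 / norm v) *\<^sub>R v)"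
        unfolding r_def by (intro cInf_lower unit False v bdd)
      then have "(norm v)\<^sup>2 * r \<le> inner (T v) v" using hom[of v] by (metis mult_left_mono zero_le_power2)
      then show ?thesis by (simp add: T' inner_diff_left power2_norm_eq_inner mult.commute)
    qed simp
    have "\<exists>v\<in>?S. norm v = 1 \<and> inner (T v) v < r + 1 / real (Suc n)" for n
    proof -
      have "Inf D < r + 1 / real (Suc n)" by (simp add: r_def)
      then obtain x where "x \<in> D" "x < r + 1 / real (Suc n)" using cInf_lessD[OF Dne] by blast
      then show ?thesis by (auto simp: D_def)
    qed
    then obtain v where v: "\<And>n. v n \<in> ?S" "\<And>n. norm (v n) = 1" "\<And>n. inner (T (v n)) (v n) < r + 1 / real (Suc n)"
      by metis
    have lim: "(\<lambda>n. T (v n) - r *\<^sub>R v n) \<longlonglongrightarrow> 0"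
    proof (rule Lim_null_comparison)
      have "norm (T' (v n)) \<le> sqrt (norm T' * (1 / real (Suc n)))" for n
      proof -
        have vv: "inner (v n) (v n) = 1" using v(2)[of n] by (simp add: power2_norm_eq_inner[symmetric])
        have "(norm (T' (v n)))\<^sup>2 \<le> norm T' * inner (T' (v n)) (v n)"
          by (rule selfadjoint_positive_bound[OF sa S(1) _ pos' v(1)])
            (use S in \<open>auto simp: T' intro: subspace_diff subspace_scale\<close>)
        also have "\<dots> \<le> norm T' * (1 / real (Suc n))"
          using v(3)[of n] vv by (intro mult_left_mono) (auto simp: T' inner_diff_left)
        finally show ?thesis by (rule real_le_rsqrt)
      qed
      then show "\<forall>\<^sub>F n in sequentially. norm (T (v n) - r *\<^sub>R v n) \<le> sqrt (norm T' * (1 / real (Suc n)))"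
        by (simp add: T')
      have "(\<lambda>n. sqrt (norm T' * (1 / real (Suc n)))) \<longlonglongrightarrow> sqrt (norm T' * 0)"
        by (intro tendsto_intros lim_1_over_n[THEN LIMSEQ_Suc])
      then show "(\<lambda>n. sqrt (norm T' * (1 / real (Suc n)))) \<longlonglongrightarrow> 0" by simp
    qed
    obtain s w where s: "strict_mono (s :: nat \<Rightarrow> nat)" "(\<lambda>n. v (s n)) \<longlonglongrightarrow> w"
      by (rule approximate_eigenvectors_converge[of r v 1]) (use r0 v(2) lim in auto)
    have "(\<lambda>n. T (v (s n)) - r *\<^sub>R v (s n)) \<longlonglongrightarrow> T w - r *\<^sub>R w" by (intro tendsto_intros s)
    moreover have "(\<lambda>n. T (v (s n)) - r *\<^sub>R v (s n)) \<longlonglongrightarrow> 0" using LIMSEQ_subseq_LIMSEQ[OF lim s(1)] by (simp add: o_def)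
    ultimately have "T w = r *\<^sub>R w" using LIMSEQ_unique by fastforce
    moreover have "w \<in> ?S" by (rule closed_sequentially[OF S(2) v(1) s(2)])
    moreover have "norm w = 1" using tendsto_norm[OF s(2)] v(2) by (simp add: LIMSEQ_const_iff)
    ultimately show False using noeig[of w r] r0 by auto
  qed
  obtain k where k: "k > 0" "\<And>u. u \<in> ?S \<Longrightarrow> k * norm u \<le> norm (T u)"
    using bounded_below_on_closed[OF S(1,2)] noeig[of _ 0] by auto
  define a where "a = k\<^sup>2 / (norm T + 1)"
  have nT: "norm T + 1 > 0" by (simp add: add_nonneg_pos)
  have "a * (norm u)\<^sup>2 \<le> inner (T u) u" if u: "u \<in> ?S" for u
  proof -
    have "k\<^sup>2 * (norm u)\<^sup>2 = (k * norm u)\<^sup>2" by (simp add: power_mult_distrib)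
    also have "\<dots> \<le> (norm (T u))\<^sup>2" using k(1) k(2)[OF u] by (intro power_mono) auto
    also have "\<dots> \<le> norm T * inner (T u) u"
      by (rule selfadjoint_positive_bound[OF T_selfadjoint S(1) _ nonneg u]) (use S in auto)
    also have "\<dots> \<le> (norm T + 1) * inner (T u) u" using nonneg[OF u] by (intro mult_right_mono) auto
    finally show ?thesis using nT by (simp add: a_def field_simps)
  qed
  moreover have "a > 0" using k(1) nT by (simp add: a_def)
  ultimately show ?thesis using that[OF E] by blast
qed

end

definition frame_proj :: "'h::real_inner set \<Rightarrow> 'h \<Rightarrow> 'h"
  where "frame_proj F u = (\<Sum>e\<in>F. inner u e *\<^sub>R e)"

locale orthonormal_frame =
  fixes F :: "'h::real_inner set"
  assumes finite_frame: "finite F" and unit_frame: "\<And>e. e \<in> F \<Longrightarrow> norm e = 1"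
    and orthogonal_frame: "pairwise orthogonal F"
begin

lemma frame_proj_inner: "e \<in> F \<Longrightarrow> inner (frame_proj F u) e = inner u e"
proof -
  assume e: "e \<in> F"
  have "inner e' e = (if e' = e then 1 else 0)" if "e' \<in> F" for e'
    using orthogonal_frame that e unit_frame[of e]
    by (auto simp: pairwise_def orthogonal_def power2_norm_eq_inner[symmetric])
  then have "inner (frame_proj F u) e = (\<Sum>e'\<in>F. if e' = e then inner u e' else 0)"
    unfolding frame_proj_def inner_sum_left by (intro sum.cong) auto
  then show ?thesis using e finite_frame by simp
qed

lemma frame_proj_in_span: "frame_proj F u \<in> span F"
  unfolding frame_proj_def by (intro span_sum span_scale span_base)

lemma frame_proj_complement: "u - frame_proj F u \<in> F\<^sup>\<bottom>"
proof (rule orthogonal_compI)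
  fix e assume "e \<in> F"
  from frame_proj_inner[OF this, of u] show "inner e (u - frame_proj F u) = 0"
    by (simp add: inner_diff_right inner_commute)
qed

lemma bounded_linear_frame_proj: "bounded_linear (frame_proj F)"
  unfolding frame_proj_def
  by (rule bounded_linear_sum, rule bounded_linear_scaleR_const, rule bounded_linear_inner_left)

lemma frame_proj_orthogonal: "u \<in> F\<^sup>\<bottom> \<Longrightarrow> frame_proj F u = 0"
  unfolding frame_proj_def by (intro sum.neutral) (auto simp: inner_commute dest: orthogonal_compD)

lemma frame_proj_id: "u \<in> span F \<Longrightarrow> frame_proj F u = u"
proof -
  assume u: "u \<in> span F"
  have "u - frame_proj F u \<in> span F" using u frame_proj_in_span by (rule span_diff)
  moreover have "u - frame_proj F u \<in> (span F)\<^sup>\<bottom>" using frame_proj_complement by (simp add: orthogonal_comp_span)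
  ultimately have "inner (u - frame_proj F u) (u - frame_proj F u) = 0" by (rule orthogonal_compD[rotated])
  then show ?thesis by simp
qed

text \<open>
The span is the continuous image of the space of coefficient functions, and the coefficients of the
vectors in the ball form a product of compact intervals.
\<close>
lemma compact_span_cball: "compact (span F \<inter> cball 0 r)"
proof -
  define g where "g = (\<lambda>t::'h \<Rightarrow> real. \<Sum>e\<in>F. t e *\<^sub>R e)"
  define K where "K = PiE UNIV (\<lambda>_::'h. {-r..r})"
  have "compactin (product_topology (\<lambda>_. euclideanreal) UNIV) K"
    unfolding K_def by (subst compactin_PiE) auto
  then have "compact K" by (simp add: euclidean_product_topology)
  moreover have "continuous_on K g"
    unfolding g_def by (intro continuous_intros continuous_on_subset[OF continuous_on_product_coordinates]) auto
  ultimately have "compact (g ` K)" by (rule compact_continuous_image[rotated])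
  then have "compact (g ` K \<inter> cball 0 r)" by (rule compact_Int_closed) simp
  moreover have "span F \<inter> cball 0 r = g ` K \<inter> cball 0 r"
  proof -
    have "g t \<in> span F" for t unfolding g_def by (intro span_sum span_scale span_base)
    moreover have "u \<in> g ` K" if u: "u \<in> span F" "norm u \<le> r" for u
    proof -
      have r0: "r \<ge> 0" using u(2) norm_ge_zero order_trans by blast
      define t where "t = (\<lambda>e. if e \<in> F then inner u e else 0)"
      have "\<bar>inner u e\<bar> \<le> r" if "e \<in> F" for e
        using Cauchy_Schwarz_ineq2[of u e] unit_frame[OF that] u(2) by simp
      then have "t \<in> K" using r0 unfolding K_def t_def by (intro PiE_I) (auto simp: abs_le_iff minus_le_iff)
      moreover have "g t = frame_proj F u" unfolding g_def t_def frame_proj_def by (intro sum.cong) auto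
      ultimately show ?thesis using frame_proj_id[OF u(1)] by auto
    qed
    ultimately show ?thesis by auto
  qed
  ultimately show ?thesis by simp
qed

lemma closed_span_frame: "closed (span F)"
proof -
  interpret bounded_linear "frame_proj F" by (rule bounded_linear_frame_proj)
  have "span F = {u. frame_proj F u = u}" using frame_proj_id frame_proj_in_span by (metis (mono_tags, lifting) Collect_cong mem_Collect_eq Collect_mem_eq)
  also have "closed \<dots>" by (intro closed_Collect_eq continuous_on continuous_intros)
  finally show ?thesis .
qed

end

section \<open>The spectral splitting at zero\<close>

text \<open>
The orthogonal projection onto an invariant subspace commutes with \<open>T\<close>. This gives access to the
spectral subspaces, which are unions of arbitrary closed invariant subspaces on which \<open>T\<close> is definite.
\<close>
lemma proj_of_eigenvector_on_invariant:
  fixes T :: "'h::{real_inner, complete_space} \<Rightarrow>\<^sub>L 'h"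
  assumes T: "selfadjoint_op T" and S: "subspace S" "T ` S \<subseteq> S"
    and e: "T e = r *\<^sub>R e" and p: "p \<in> S" "e - p \<in> S\<^sup>\<bottom>"
  shows "T p = r *\<^sub>R p"
proof -
  have sym: "inner (T u) v = inner u (T v)" for u v using T unfolding selfadjoint_op_def by blast
  define d where "d = T p - r *\<^sub>R p"
  have dS: "d \<in> S" using S p(1) by (auto simp: d_def intro!: subspace_diff subspace_scale)
  have "d = r *\<^sub>R (e - p) - T (e - p)" by (simp add: d_def blinfun.diff_right e algebra_simps)
  moreover have "inner d (e - p) = 0" using p(2) dS by (simp add: orthogonal_compD)
  moreover have "inner d (T (e - p)) = 0"
    using orthogonal_compD[OF p(2), of "T d"] dS S(2) by (auto simp: sym)
  ultimately have "inner d d = 0" by (metis inner_diff_right inner_scaleR_right mult_zero_right diff_zero)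
  then show ?thesis by (simp add: d_def)
qed

context coercive_plus_compact
begin

definition frame :: "'h set"
  where "frame = (SOME E. eigenframe E \<and> (\<exists>a>0. \<forall>u\<in>E\<^sup>\<bottom>. a * (norm u)\<^sup>2 \<le> inner (T u) u))"

lemma frame: "eigenframe frame" "\<exists>a>0. \<forall>u\<in>frame\<^sup>\<bottom>. a * (norm u)\<^sup>2 \<le> inner (T u) u"
proof -
  have "\<exists>E. eigenframe E \<and> (\<exists>a>0. \<forall>u\<in>E\<^sup>\<bottom>. a * (norm u)\<^sup>2 \<le> inner (T u) u)"
    using maximal_eigenframe by metis
  from someI_ex[OF this, folded frame_def]
  show "eigenframe frame" "\<exists>a>0. \<forall>u\<in>frame\<^sup>\<bottom>. a * (norm u)\<^sup>2 \<le> inner (T u) u" by auto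
qed

definition ker_frame :: "'h set" where "ker_frame = {e \<in> frame. T e = 0}"
definition neg_frame :: "'h set" where "neg_frame = {e \<in> frame. T e \<noteq> 0}"

lemma frame_Un: "frame = ker_frame \<union> neg_frame" "ker_frame \<inter> neg_frame = {}"
  by (auto simp: ker_frame_def neg_frame_def)

lemma orthonormal_subframe: "F \<subseteq> frame \<Longrightarrow> orthonormal_frame F"
  using frame(1) finite_subset[OF _ eigenframe_finite[OF frame(1)]]
  by unfold_locales (auto simp: eigenframe_def intro: pairwise_subset)

end

sublocale coercive_plus_compact \<subseteq> fr: orthonormal_frame "frame"
  by (rule orthonormal_subframe) simp

sublocale coercive_plus_compact \<subseteq> kf: orthonormal_frame "ker_frame"
  by (rule orthonormal_subframe) (auto simp: ker_frame_def)

sublocale coercive_plus_compact \<subseteq> nf: orthonormal_frame "neg_frame"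
  by (rule orthonormal_subframe) (auto simp: neg_frame_def)

context coercive_plus_compact
begin

definition p0 :: "'h \<Rightarrow> 'h" where "p0 = frame_proj ker_frame"
definition pn :: "'h \<Rightarrow> 'h" where "pn = frame_proj neg_frame"
definition pp :: "'h \<Rightarrow> 'h" where "pp u = u - p0 u - pn u"

lemma bounded_linear_p0: "bounded_linear p0"
  unfolding p0_def by (rule kf.bounded_linear_frame_proj)
lemma bounded_linear_pn: "bounded_linear pn"
  unfolding pn_def by (rule nf.bounded_linear_frame_proj)
lemma bounded_linear_pp: "bounded_linear pp"
  unfolding pp_def by (intro bounded_linear_sub bounded_linear_p0 bounded_linear_pn bounded_linear_ident)

lemma frame_proj_split: "frame_proj frame u = p0 u + pn u"
  unfolding frame_proj_def p0_def pn_def frame_Un(1)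
  by (rule sum.union_disjoint) (use kf.finite_frame nf.finite_frame frame_Un(2) in auto)

lemma neg_frame_eigenvalue: "e \<in> neg_frame \<Longrightarrow> \<exists>r<0. T e = r *\<^sub>R e"
proof -
  assume e: "e \<in> neg_frame"
  then obtain r where "r \<le> 0" "T e = r *\<^sub>R e" using frame(1) by (auto simp: eigenframe_def neg_frame_def)
  moreover have "r \<noteq> 0" using e calculation by (auto simp: neg_frame_def)
  ultimately show ?thesis by (intro exI[of _ r]) auto
qed

lemma ker_neg_frame_orthogonal: "e \<in> ker_frame \<Longrightarrow> e' \<in> neg_frame \<Longrightarrow> inner e e' = 0"
  using frame(1) by (auto simp: eigenframe_def pairwise_def orthogonal_def ker_frame_def neg_frame_def)

text \<open>
Eigenvectors with different eigenvalues are orthogonal, so the projection of a kernel vector to the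
frame only involves the kernel frame; the remainder is in the kernel and in the complement of the
frame, where \<open>T\<close> is coercive.
\<close>
lemma ker_op_eq: "ker_op T = span ker_frame"
proof
  show "span ker_frame \<subseteq> ker_op T"
  proof (rule span_minimal)
    show "subspace (ker_op T)" by (auto simp: subspace_def ker_op_def blinfun.add_right blinfun.scaleR_right)
  qed (auto simp: ker_op_def ker_frame_def)
  show "ker_op T \<subseteq> span ker_frame"
  proof
    fix u assume "u \<in> ker_op T"
    then have Tu: "T u = 0" by (simp add: ker_op_def)
    have "inner u e = 0" if e: "e \<in> neg_frame" for e
    proof -
      obtain r where r: "r < 0" "T e = r *\<^sub>R e" using neg_frame_eigenvalue[OF e] by blast
      have "r * inner u e = inner (T u) e" unfolding T_sym r by simp
      then show ?thesis using r Tu by simp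
    qed
    then have "pn u = 0" unfolding pn_def frame_proj_def by (intro sum.neutral) auto
    then have fp: "frame_proj frame u = p0 u" by (simp add: frame_proj_split)
    have "T (p0 u) = 0"
      unfolding p0_def frame_proj_def blinfun.sum_right by (intro sum.neutral) (auto simp: ker_frame_def blinfun.scaleR_right)
    then have "T (u - p0 u) = 0" by (simp add: blinfun.diff_right Tu)
    moreover obtain a where "a > 0" "\<forall>u\<in>frame\<^sup>\<bottom>. a * (norm u)\<^sup>2 \<le> inner (T u) u" using frame(2) by blast
    moreover have "u - p0 u \<in> frame\<^sup>\<bottom>" using fr.frame_proj_complement[of u] by (simp add: fp)
    ultimately have "a * (norm (u - p0 u))\<^sup>2 \<le> 0" by fastforce
    then have "u = p0 u" using \<open>a > 0\<close> by (simp add: mult_le_0_iff)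
    then show "u \<in> span ker_frame" using kf.frame_proj_in_span[of u] by (simp add: p0_def)
  qed
qed

lemma ker_complement_eq: "(ker_op T)\<^sup>\<bottom> = ker_frame\<^sup>\<bottom>"
  by (simp add: ker_op_eq orthogonal_comp_span)

lemma neg_span_form: "\<exists>b>0. \<forall>u\<in>span neg_frame. inner (T u) u \<le> - b * (norm u)\<^sup>2"
proof -
  \<comment> \<open>the \<open>1\<close> keeps the minimum meaningful for an empty frame\<close>
  define b where "b = Min (insert 1 ((\<lambda>e. - inner (T e) e) ` neg_frame))"
  have fin: "finite (insert 1 ((\<lambda>e. - inner (T e) e) ` neg_frame))" using nf.finite_frame by simp
  have eig: "T e = inner (T e) e *\<^sub>R e" "inner (T e) e < 0" if e: "e \<in> neg_frame" for e
  proof -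
    obtain r where r: "r < 0" "T e = r *\<^sub>R e" using neg_frame_eigenvalue[OF e] by blast
    have "inner e e = 1" using nf.unit_frame[OF e] by (simp add: power2_norm_eq_inner[symmetric])
    then show "T e = inner (T e) e *\<^sub>R e" "inner (T e) e < 0" using r by simp_all
  qed
  have b: "b > 0" unfolding b_def using fin eig(2) by (subst Min_gr_iff) auto
  have bl: "inner (T e) e \<le> - b" if "e \<in> neg_frame" for e
    using Min_le[OF fin, of "- inner (T e) e"] that by (simp add: b_def)
  have "inner (T u) u \<le> - b * (norm u)\<^sup>2" if u: "u \<in> span neg_frame" for u
  proof -
    have ue: "u = (\<Sum>e\<in>neg_frame. inner u e *\<^sub>R e)" using nf.frame_proj_id[OF u] by (simp add: frame_proj_def)
    have "T u = (\<Sum>e\<in>neg_frame. inner u e *\<^sub>R T e)"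
      by (subst ue) (simp add: blinfun.sum_right blinfun.scaleR_right)
    then have "inner (T u) u = (\<Sum>e\<in>neg_frame. inner u e * inner (T e) u)" by (simp add: inner_sum_left)
    also have "\<dots> = (\<Sum>e\<in>neg_frame. (inner u e)\<^sup>2 * inner (T e) e)"
      by (intro sum.cong refl, subst eig(1)) (simp_all add: inner_commute power2_eq_square)
    also have "\<dots> \<le> (\<Sum>e\<in>neg_frame. (inner u e)\<^sup>2 * - b)"
      using bl by (intro sum_mono mult_left_mono) auto
    also have "\<dots> = - b * (\<Sum>e\<in>neg_frame. inner u e * inner e u)"
      by (simp add: sum_distrib_left inner_commute power2_eq_square mult.commute)
    also have "(\<Sum>e\<in>neg_frame. inner u e * inner e u) = inner (\<Sum>e\<in>neg_frame. inner u e *\<^sub>R e) u"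
      by (simp add: inner_sum_left)
    also have "\<dots> = (norm u)\<^sup>2" using ue by (simp add: power2_norm_eq_inner)
    finally show ?thesis .
  qed
  then show ?thesis using b by blast
qed

lemma span_invariant: "u \<in> span neg_frame \<Longrightarrow> T u \<in> span neg_frame"
proof (induction rule: span_induct_alt)
  case base
  then show ?case by (simp add: span_zero)
next
  case (step c x y)
  then obtain r where "T x = r *\<^sub>R x" using neg_frame_eigenvalue by blast
  then show ?case using step by (simp add: blinfun.add_right blinfun.scaleR_right span_add span_scale span_base)
qed

text \<open>
Both the projection of \<open>u\<close> to the frame and the remainder \<open>w\<close> satisfy the eigenvalue equation, and
coercivity off the frame is incompatible with \<open>\<langle>T w, w\<rangle> = r \<parallel>w\<parallel>\<^sup>2 \<le> 0\<close> unless \<open>w = 0\<close>.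
\<close>
lemma nonpos_eigenvector_in_span:
  assumes u: "T u = r *\<^sub>R u" "r \<le> 0"
  shows "u \<in> span frame"
proof -
  define w where "w = u - frame_proj frame u"
  have wperp: "w \<in> frame\<^sup>\<bottom>" unfolding w_def by (rule fr.frame_proj_complement)
  have "T (frame_proj frame u) = r *\<^sub>R frame_proj frame u"
  proof -
    have "T (inner u e *\<^sub>R e) = r *\<^sub>R (inner u e *\<^sub>R e)" if e: "e \<in> frame" for e
    proof -
      obtain q where q: "T e = q *\<^sub>R e" using frame(1) e by (auto simp: eigenframe_def)
      have "q * inner u e = inner (T u) e" unfolding T_sym q by simp
      also have "\<dots> = r * inner u e" using u by simp
      finally have "inner u e * q = r * inner u e" by (simp add: mult.commute)
      then show ?thesis by (simp add: blinfun.scaleR_right q)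
    qed
    then show ?thesis unfolding frame_proj_def blinfun.sum_right scaleR_sum_right by (intro sum.cong) auto
  qed
  then have Tw: "T w = r *\<^sub>R w" using u by (simp add: w_def blinfun.diff_right scaleR_diff_right)
  obtain a where "a > 0" "\<forall>u\<in>frame\<^sup>\<bottom>. a * (norm u)\<^sup>2 \<le> inner (T u) u" using frame(2) by blast
  then have "a * (norm w)\<^sup>2 \<le> r * inner w w" using wperp Tw by fastforce
  also have "\<dots> \<le> 0" using u(2) by (simp add: mult_nonpos_nonneg)
  finally have "w = 0" using \<open>a > 0\<close> by (simp add: mult_le_0_iff)
  then show ?thesis using fr.frame_proj_in_span[of u] by (simp add: w_def)
qed

text \<open>
Let \<open>S\<close> be an invariant subspace on which \<open>T\<close> is positive. The projection to \<open>S\<close> of a frame vector is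
again a solution of its eigenvalue equation with \<open>r \<le> 0\<close>, hence zero; so \<open>S\<close> is orthogonal to the frame.
\<close>
lemma pos_subspace_eq: "pos_subspace T = frame\<^sup>\<bottom>"
proof
  obtain a where a: "a > 0" "\<forall>u\<in>frame\<^sup>\<bottom>. a * (norm u)\<^sup>2 \<le> inner (T u) u" using frame(2) by blast
  have "inner (T u) u > 0" if "u \<in> frame\<^sup>\<bottom> - {0}" for u
  proof -
    have "0 < a * (norm u)\<^sup>2" using a that by simp
    then show ?thesis using a(2) that by fastforce
  qed
  then show "frame\<^sup>\<bottom> \<subseteq> pos_subspace T"
    unfolding pos_subspace_def
    by (intro Union_upper) (use eigenframe_invariant[OF frame(1)] subspace_orthogonal_comp closed_orthogonal_comp in auto)
  show "pos_subspace T \<subseteq> frame\<^sup>\<bottom>"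
  proof
    fix u assume "u \<in> pos_subspace T"
    then obtain S where S: "subspace S" "closed S" "T ` S \<subseteq> S" "\<And>v. v \<in> S - {0} \<Longrightarrow> inner (T v) v > 0" "u \<in> S"
      unfolding pos_subspace_def by auto
    show "u \<in> frame\<^sup>\<bottom>"
    proof (rule orthogonal_compI)
      fix e assume "e \<in> frame"
      then obtain r where r: "r \<le> 0" "T e = r *\<^sub>R e" using frame(1) by (auto simp: eigenframe_def)
      obtain p where p: "p \<in> S" "e - p \<in> S\<^sup>\<bottom>" using closed_subspace_projection[OF S(1,2)] by blast
      have "T p = r *\<^sub>R p" using proj_of_eigenvector_on_invariant[OF T_selfadjoint S(1,3) r(2) p] .
      then have "inner (T p) p \<le> 0" using r(1) by (simp add: mult_nonpos_nonneg)
      then have "p = 0" using S(4)[of p] p(1) by auto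
      then show "inner e u = 0" using orthogonal_compD[OF p(2) S(5)] by (simp add: inner_commute)
    qed
  qed
qed

text \<open>
Let \<open>S\<close> be an invariant subspace on which \<open>T\<close> is negative, \<open>u \<in> S\<close>, and \<open>w\<close> the part of \<open>u\<close> orthogonal to
the frame. Projections of frame vectors to \<open>S\<close> stay in the span of the frame; therefore the projection \<open>q\<close>
of \<open>w\<close> to \<open>S\<close> is orthogonal to the frame, where the form is coercive, and \<open>q \<in> S\<close> forces \<open>q = 0\<close>. So
\<open>\<parallel>w\<parallel>\<^sup>2 = \<langle>u, w\<rangle> = 0\<close>. Finally kernel vectors project to zero in \<open>S\<close>, so \<open>u\<close> has no component along them.
\<close>
lemma neg_subspace_eq: "neg_subspace T = span neg_frame"
proof
  obtain b where b: "b > 0" "\<forall>u\<in>span neg_frame. inner (T u) u \<le> - b * (norm u)\<^sup>2" using neg_span_form by blast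
  have "inner (T u) u < 0" if "u \<in> span neg_frame - {0}" for u
  proof -
    have "- b * (norm u)\<^sup>2 < 0" using b that by simp
    then show ?thesis using b(2) that by fastforce
  qed
  then show "span neg_frame \<subseteq> neg_subspace T"
    unfolding neg_subspace_def
    by (intro Union_upper) (use span_invariant nf.closed_span_frame in auto)
  show "neg_subspace T \<subseteq> span neg_frame"
  proof
    fix u assume "u \<in> neg_subspace T"
    then obtain S where S: "subspace S" "closed S" "T ` S \<subseteq> S" "\<And>v. v \<in> S - {0} \<Longrightarrow> inner (T v) v < 0" "u \<in> S"
      unfolding neg_subspace_def by auto
    have proj: "\<exists>p. p \<in> S \<and> e - p \<in> S\<^sup>\<bottom>" for e using closed_subspace_projection[OF S(1,2)] by metis
    obtain a where a: "a > 0" "\<forall>u\<in>frame\<^sup>\<bottom>. a * (norm u)\<^sup>2 \<le> inner (T u) u" using frame(2) by blast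
    define w where "w = u - frame_proj frame u"
    have wperp: "w \<in> frame\<^sup>\<bottom>" unfolding w_def by (rule fr.frame_proj_complement)
    obtain q where q: "q \<in> S" "w - q \<in> S\<^sup>\<bottom>" using proj by blast
    have "q \<in> frame\<^sup>\<bottom>"
    proof (rule orthogonal_compI)
      fix e assume e: "e \<in> frame"
      then obtain r where r: "r \<le> 0" "T e = r *\<^sub>R e" using frame(1) by (auto simp: eigenframe_def)
      obtain p where p: "p \<in> S" "e - p \<in> S\<^sup>\<bottom>" using proj by blast
      have "p \<in> span frame"
        using proj_of_eigenvector_on_invariant[OF T_selfadjoint S(1,3) r(2) p] r(1) by (rule nonpos_eigenvector_in_span)
      then have "inner p w = 0" using wperp by (simp add: orthogonal_compD flip: orthogonal_comp_span[of frame])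
      moreover have "inner p (w - q) = 0" using orthogonal_compD[OF q(2) p(1)] .
      moreover have "inner q (e - p) = 0" using orthogonal_compD[OF p(2) q(1)] .
      ultimately show "inner e q = 0" by (simp add: inner_diff_right inner_commute)
    qed
    then have "a * (norm q)\<^sup>2 \<le> inner (T q) q" using a by blast
    moreover have "inner (T q) q \<le> 0" using S(4)[of q] q(1) by (cases "q = 0") auto
    ultimately have "a * (norm q)\<^sup>2 \<le> 0" by linarith
    then have "q = 0" using a by (simp add: mult_le_0_iff)
    then have "inner u w = 0" using orthogonal_compD[OF q(2) S(5)] by simp
    moreover have "inner (frame_proj frame u) w = 0"
      using fr.frame_proj_in_span[of u] wperp by (simp add: orthogonal_compD flip: orthogonal_comp_span[of frame])
    ultimately have "inner w w = 0" unfolding w_def[symmetric] by (metis diff_self inner_diff_left w_def)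
    then have u: "u = p0 u + pn u" by (simp add: w_def frame_proj_split)
    have "inner u e = 0" if e: "e \<in> ker_frame" for e
    proof -
      have T0: "T e = 0 *\<^sub>R e" using e by (simp add: ker_frame_def)
      obtain p where p: "p \<in> S" "e - p \<in> S\<^sup>\<bottom>" using proj by blast
      have "T p = 0 *\<^sub>R p" using proj_of_eigenvector_on_invariant[OF T_selfadjoint S(1,3) T0 p] .
      then have "p = 0" using S(4)[of p] p(1) by auto
      then show ?thesis using orthogonal_compD[OF p(2) S(5)] by simp
    qed
    then have "p0 u = 0" unfolding p0_def frame_proj_def by (intro sum.neutral) auto
    then have "u = pn u" using u by simp
    then show "u \<in> span neg_frame" using nf.frame_proj_in_span[of u] by (simp add: pn_def)
  qed
qed

abbreviation "Hp \<equiv> pos_subspace T"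
abbreviation "Hm \<equiv> neg_subspace T"
abbreviation "Hpm \<equiv> (ker_op T)\<^sup>\<bottom>"

lemma subspaces: "subspace (ker_op T)" "subspace Hp" "subspace Hm" "subspace Hpm"
  by (simp_all add: ker_op_eq pos_subspace_eq neg_subspace_eq subspace_orthogonal_comp)

lemma closed_Hpm: "closed Hpm" by (rule closed_orthogonal_comp)

lemma Hp_subset: "Hp \<subseteq> Hpm"
  unfolding pos_subspace_eq ker_complement_eq
  by (intro orthogonal_comp_anti_mono) (auto simp: ker_frame_def)

lemma Hm_subset: "Hm \<subseteq> Hpm"
  unfolding neg_subspace_eq ker_complement_eq
proof (rule span_minimal)
  show "neg_frame \<subseteq> ker_frame\<^sup>\<bottom>" using ker_neg_frame_orthogonal by (auto intro: orthogonal_compI)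
qed (rule subspace_orthogonal_comp)

lemma p0_ker: "p0 u \<in> ker_op T" by (simp add: p0_def ker_op_eq kf.frame_proj_in_span)
lemma pn_Hm: "pn u \<in> Hm" by (simp add: pn_def neg_subspace_eq nf.frame_proj_in_span)
lemma pp_Hp: "pp u \<in> Hp"
  using fr.frame_proj_complement[of u] by (simp add: pp_def frame_proj_split pos_subspace_eq diff_diff_eq)

lemma projections_sum: "u = p0 u + pp u + pn u" by (simp add: pp_def)

lemma p0_id: "u \<in> ker_op T \<Longrightarrow> p0 u = u" by (simp add: p0_def ker_op_eq kf.frame_proj_id)
lemma p0_Hpm: "u \<in> Hpm \<Longrightarrow> p0 u = 0" by (simp add: p0_def ker_complement_eq kf.frame_proj_orthogonal)
lemma pn_id: "u \<in> Hm \<Longrightarrow> pn u = u" by (simp add: pn_def neg_subspace_eq nf.frame_proj_id)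
lemma pn_Hp: "u \<in> Hp \<Longrightarrow> pn u = 0"
  unfolding pn_def pos_subspace_eq
  using orthogonal_comp_anti_mono[of neg_frame frame] by (intro nf.frame_proj_orthogonal) (auto simp: neg_frame_def)
lemma pn_ker: "u \<in> ker_op T \<Longrightarrow> pn u = 0"
proof -
  assume u: "u \<in> ker_op T"
  have "u \<in> neg_frame\<^sup>\<bottom>"
  proof (rule orthogonal_compI)
    fix e assume "e \<in> neg_frame"
    then have "e \<in> Hpm" using Hm_subset by (auto simp: neg_subspace_eq span_base)
    then show "inner e u = 0" using orthogonal_compD[OF _ u] by (simp add: inner_commute)
  qed
  then show ?thesis unfolding pn_def by (rule nf.frame_proj_orthogonal)
qed

lemma pp_id: "u \<in> Hp \<Longrightarrow> pp u = u" using Hp_subset by (auto simp: pp_def pn_Hp p0_Hpm)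
lemma pp_Hm: "u \<in> Hm \<Longrightarrow> pp u = 0" using Hm_subset by (auto simp: pp_def pn_id p0_Hpm)
lemma pp_ker: "u \<in> ker_op T \<Longrightarrow> pp u = 0" by (simp add: pp_def pn_ker p0_id)

lemma Hp_Hm_orthogonal: "u \<in> Hp \<Longrightarrow> v \<in> Hm \<Longrightarrow> inner u v = 0"
  unfolding pos_subspace_eq neg_subspace_eq
proof -
  assume u: "u \<in> frame\<^sup>\<bottom>" and v: "v \<in> span neg_frame"
  have "v \<in> span frame" using v span_mono[of neg_frame frame] by (auto simp: neg_frame_def)
  moreover have "u \<in> (span frame)\<^sup>\<bottom>" using u by (simp add: orthogonal_comp_span)
  ultimately show ?thesis using orthogonal_compD[of u "span frame" v] by (simp add: inner_commute)
qed

lemma Hpm_decomp: "u \<in> Hpm \<Longrightarrow> u = pp u + pn u"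
  by (simp add: pp_def p0_Hpm)

lemma form_bounds:
  "\<exists>a>0. (\<forall>u\<in>Hp. a * (norm u)\<^sup>2 \<le> inner (T u) u) \<and> (\<forall>u\<in>Hm. inner (T u) u \<le> - a * (norm u)\<^sup>2)"
proof -
  obtain a where a: "a > 0" "\<forall>u\<in>frame\<^sup>\<bottom>. a * (norm u)\<^sup>2 \<le> inner (T u) u" using frame(2) by blast
  obtain b where b: "b > 0" "\<forall>u\<in>span neg_frame. inner (T u) u \<le> - b * (norm u)\<^sup>2" using neg_span_form by blast
  have "min a b * (norm u)\<^sup>2 \<le> a * (norm u)\<^sup>2" "- b * (norm u)\<^sup>2 \<le> - min a b * (norm u)\<^sup>2" for u :: 'h
    by (intro mult_right_mono; simp)+
  then show ?thesis using a b unfolding pos_subspace_eq neg_subspace_eq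
    by (intro exI[of _ "min a b"]) (auto intro: order_trans)
qed

lemma T_Hpm: "T u \<in> Hpm"
proof (rule orthogonal_compI)
  fix v assume "v \<in> ker_op T"
  then show "inner v (T u) = 0" using T_sym[of v u] by (simp add: ker_op_def)
qed

lemma T_Hpm_bij: "\<exists>k>0. \<forall>u\<in>Hpm. k * norm u \<le> norm (T u)" "v \<in> Hpm \<Longrightarrow> \<exists>u\<in>Hpm. T u = v"
proof -
  have "u = 0" if "u \<in> Hpm" "T u = 0" for u
    using orthogonal_compD[OF that(1), of u] that(2) by (simp add: ker_op_def)
  then show *: "\<exists>k>0. \<forall>u\<in>Hpm. k * norm u \<le> norm (T u)"
    by (intro bounded_below_on_closed subspaces closed_Hpm)
  show "\<exists>u\<in>Hpm. T u = v" if "v \<in> Hpm"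
    using * selfadjoint_surj_on_closed_invariant[OF T_selfadjoint subspaces(4) closed_Hpm T_Hpm] that by blast
qed

lemma orth_proj_ker: "orth_proj (ker_op T) u = p0 u"
  unfolding orth_proj_def
proof (rule the_equality)
  have "u - p0 u \<in> Hpm" unfolding p0_def ker_complement_eq by (rule kf.frame_proj_complement)
  then show "p0 u \<in> ker_op T \<and> u - p0 u \<in> Hpm" using p0_ker by blast
  fix p assume p: "p \<in> ker_op T \<and> u - p \<in> Hpm"
  have "p - p0 u \<in> ker_op T" using p p0_ker subspaces(1) by (auto intro: subspace_diff)
  moreover have "p - p0 u \<in> Hpm"
    using subspace_diff[OF subspaces(4) \<open>u - p0 u \<in> Hpm\<close>, of "u - p"] p by simp
  ultimately have "inner (p - p0 u) (p - p0 u) = 0" by (simp add: orthogonal_compD)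
  then show "p = p0 u" by simp
qed

text \<open>
Pythagoras. It keeps the whole affine space \<open>z + H\<^sup>\<plusminus>\<close> at least as far from the origin as \<open>z\<close>.
\<close>
lemma norm_ker_le: "z \<in> ker_op T \<Longrightarrow> u \<in> Hpm \<Longrightarrow> norm z \<le> norm (z + u)"
proof -
  assume zu: "z \<in> ker_op T" "u \<in> Hpm"
  then have "inner z u = 0" by (simp add: orthogonal_compD)
  then have "(norm (z + u))\<^sup>2 = (norm z)\<^sup>2 + (norm u)\<^sup>2"
    unfolding power2_norm_eq_inner by (simp add: inner_add_left inner_add_right inner_commute)
  then have "(norm z)\<^sup>2 \<le> (norm (z + u))\<^sup>2" by simp
  then show ?thesis by (rule power2_le_imp_le) simp
qed

end

section \<open>The operators \<open>B(x)\<close> far away\<close>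

locale splitting_setting =
  standing_hypotheses \<iota> V L A B Binf + decomposition_hypothesis \<iota> V B Binf P Pinf Q Qinf
  for \<iota> :: "'x::banach \<Rightarrow> 'h::{real_inner, complete_space}" and V L A B Binf P Pinf Q Qinf +
  assumes nullity: "dim (ker_op Binf) > 0"
begin

lemma bounded_linear_incl: "bounded_linear \<iota>"
  using incl_linear incl_norm by (intro bounded_linear_intro[of _ 1]) (auto simp: linear_add linear_scale)

sublocale incl: bounded_linear \<iota> by (rule bounded_linear_incl)

lemma ker_op_in_range: "u \<in> ker_op Binf \<Longrightarrow> u \<in> range \<iota>"
  using Binf_regular[of u] incl.zero by (auto simp: ker_op_def)

lemma subspace_ker_op: "subspace (ker_op Binf)"
  by (auto simp: subspace_def ker_op_def blinfun.add_right blinfun.scaleR_right)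

text \<open>
A nontrivial kernel supplies points of \<open>X\<close> arbitrarily far away, at which limits at infinity can be
tested.
\<close>
lemma ker_norm_exists:
  assumes "t \<ge> 0"
  shows "\<exists>z. \<iota> z \<in> ker_op Binf \<and> norm (\<iota> z) = t"
proof -
  have "\<exists>u\<in>ker_op Binf. u \<noteq> 0"
  proof (rule ccontr)
    assume "\<not> ?thesis"
    then have "ker_op Binf = {0}" using subspace_0[OF subspace_ker_op] by auto
    then have "span {} = span (ker_op Binf)" by simp
    from dim_eq_card[OF this independent_empty] have "dim (ker_op Binf) = 0" by simp
    then show False using nullity by simp
  qed
  then obtain u where u: "u \<in> ker_op Binf" "u \<noteq> 0" by blast
  have "(t / norm u) *\<^sub>R u \<in> ker_op Binf" using u subspace_ker_op by (simp add: subspace_scale)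
  moreover from ker_op_in_range[OF this] obtain z where "\<iota> z = (t / norm u) *\<^sub>R u" by auto
  ultimately show ?thesis using u assms by (intro exI[of _ z]) auto
qed

lemma V_contains_far: "\<exists>R>0. \<forall>u. norm u > R \<longrightarrow> u \<in> V"
  using V_nbhd_infinity by auto

lemma filterlim_norm_at_top:
  assumes "\<And>n. norm (\<iota> (s n)) > r + real n"
  shows "filterlim (\<lambda>n. norm (\<iota> (s n))) at_top sequentially"
proof (rule filterlim_at_top_mono)
  show "filterlim (\<lambda>n. r + real n) at_top sequentially"
    by (intro filterlim_tendsto_add_at_top[OF tendsto_const] filterlim_real_sequentially)
  show "\<forall>\<^sub>F n in sequentially. r + real n \<le> norm (\<iota> (s n))"
    using assms less_imp_le by (intro always_eventually) blast
qed

text \<open>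
The coercivity hypothesis speaks of one sequence at a time; it is applied to a sequence whose
\<open>n\<close>-th member would violate coercivity with constant \<open>1 / (n + 1)\<close>.
\<close>
lemma P_coercive_far: "\<exists>R>0. \<exists>c>0. \<forall>x. norm (\<iota> x) > R \<longrightarrow> \<iota> x \<in> V \<and> (\<forall>u. c * (norm u)\<^sup>2 \<le> inner (P x u) u)"
proof (rule ccontr)
  assume neg: "\<not> ?thesis"
  obtain R0 where R0: "R0 > 0" "\<And>u. norm u > R0 \<Longrightarrow> u \<in> V" using V_contains_far by blast
  have "\<exists>x u. norm (\<iota> x) > R0 + real n \<and> inner (P x u) u < (1 / real (Suc n)) * (norm u)\<^sup>2" for n
  proof -
    have "R0 + real n > 0" "1 / real (Suc n) > 0" using R0(1) by auto
    then obtain x where x: "norm (\<iota> x) > R0 + real n"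
      "\<not> (\<iota> x \<in> V \<and> (\<forall>u. 1 / real (Suc n) * (norm u)\<^sup>2 \<le> inner (P x u) u))"
      using neg by metis
    moreover have "\<iota> x \<in> V" using x(1) R0 by (intro R0(2)) auto
    ultimately show ?thesis by (meson not_le)
  qed
  then obtain s u where su: "\<And>n. norm (\<iota> (s n)) > R0 + real n"
    "\<And>n. inner (P (s n) (u n)) (u n) < (1 / real (Suc n)) * (norm (u n))\<^sup>2" by metis
  have "\<forall>k. \<iota> (s k) \<in> V" using su(1) R0(2) by (metis add_increasing2 le_less_trans less_eq_real_def of_nat_0_le_iff)
  from P_coercive[OF this filterlim_norm_at_top[OF su(1)]] obtain C0 n0 where
    C: "C0 > 0" "\<And>n u. n \<ge> n0 \<Longrightarrow> inner (P (s n) u) u \<ge> C0 * (norm u)\<^sup>2" by blast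
  obtain n1 :: nat where n1: "1 / C0 < real n1" using reals_Archimedean2 by blast
  define n where "n = max n0 n1"
  have "1 / C0 < real (Suc n)" using n1 by (simp add: n_def)
  then have "1 / real (Suc n) < C0" using C(1) by (simp add: field_simps)
  then have "(1 / real (Suc n)) * (norm (u n))\<^sup>2 \<le> C0 * (norm (u n))\<^sup>2" by (intro mult_right_mono) auto
  then show False using su(2)[of n] C(2)[of n "u n"] by (simp add: n_def)
qed

lemma Q_near_far:
  assumes "e > 0"
  shows "\<exists>R. \<forall>x. norm (\<iota> x) > R \<longrightarrow> norm (Q x - Qinf) \<le> e"
proof -
  obtain R0 where R0: "R0 > 0" "\<And>u. norm u > R0 \<Longrightarrow> u \<in> V" using V_contains_far by blast
  have "\<forall>\<^sub>F x in inf (filtercomap (\<lambda>x. norm (\<iota> x)) at_top) (principal (\<iota> -` V)). dist (norm (Q x - Qinf)) 0 < e"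
    using Q_norm_conv assms by (rule tendstoD)
  then obtain N where N: "\<And>x. norm (\<iota> x) \<ge> N \<Longrightarrow> \<iota> x \<in> V \<Longrightarrow> norm (Q x - Qinf) < e"
    unfolding eventually_inf_principal eventually_filtercomap eventually_at_top_linorder by auto
  show ?thesis
    by (rule exI[of _ "max R0 N"]) (use N R0 in \<open>auto intro!: less_imp_le\<close>)
qed

lemma P_pointwise_far:
  assumes e: "e > 0"
  shows "\<exists>R. \<forall>x. norm (\<iota> x) > R \<longrightarrow> norm (P x u - Pinf u) \<le> e"
proof (rule ccontr)
  assume neg: "\<not> ?thesis"
  obtain R0 where R0: "R0 > 0" "\<And>u. norm u > R0 \<Longrightarrow> u \<in> V" using V_contains_far by blast
  have "\<exists>x. norm (\<iota> x) > R0 + real n \<and> \<not> norm (P x u - Pinf u) \<le> e" for n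
    using neg by blast
  then obtain s where s: "\<And>n. norm (\<iota> (s n)) > R0 + real n" "\<And>n. \<not> norm (P (s n) u - Pinf u) \<le> e" by metis
  have "\<forall>k. \<iota> (s k) \<in> V" using s(1) R0(2) by (metis add_increasing2 le_less_trans less_eq_real_def of_nat_0_le_iff)
  from P_strong_conv[OF this filterlim_norm_at_top[OF s(1)], of u]
  have "\<forall>\<^sub>F k in sequentially. norm (P (s k) u - Pinf u) < e" using e by (rule order_tendstoD(2))
  then show False using s(2) by (auto simp: eventually_sequentially intro: less_imp_le)
qed

text \<open>
Coercivity with a uniform constant survives the pointwise limit at infinity.
\<close>
lemma Pinf_coercive: "\<exists>c>0. \<forall>u. c * (norm u)\<^sup>2 \<le> inner (Pinf u) u"
proof -
  obtain R c where R: "R > 0" "c > 0"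
    "\<And>x u. norm (\<iota> x) > R \<Longrightarrow> \<iota> x \<in> V \<and> c * (norm u)\<^sup>2 \<le> inner (P x u) u" using P_coercive_far by blast
  have "c * (norm u)\<^sup>2 \<le> inner (Pinf u) u" for u
  proof (rule field_le_epsilon)
    fix e :: real assume e: "e > 0"
    define e' where "e' = e / (norm u + 1)"
    have e': "e' > 0" using e by (simp add: e'_def add_nonneg_pos)
    obtain R' where R': "\<And>x. norm (\<iota> x) > R' \<Longrightarrow> norm (P x u - Pinf u) \<le> e'"
      using P_pointwise_far[OF e'] by blast
    obtain x where x: "norm (\<iota> x) = max R R' + 1" using ker_norm_exists[of "max R R' + 1"] R(1) by auto
    have "inner (P x u) u = inner (Pinf u) u + inner (P x u - Pinf u) u" by (simp add: inner_diff_left)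
    also have "inner (P x u - Pinf u) u \<le> norm (P x u - Pinf u) * norm u" by (rule norm_cauchy_schwarz)
    also have "\<dots> \<le> e' * norm u" using R'[of x] x by (intro mult_right_mono) auto
    also have "\<dots> \<le> e' * (norm u + 1)" using e' by simp
    also have "\<dots> = e" by (simp add: e'_def add_nonneg_eq_0_iff)
    finally have "inner (P x u) u \<le> inner (Pinf u) u + e" by simp
    moreover have "norm (\<iota> x) > R" using x max.cobounded1[of R R'] by linarith
    ultimately show "c * (norm u)\<^sup>2 \<le> inner (Pinf u) u + e" using R(3)[of x u] by auto
  qed
  then show ?thesis using R(2) by blast
qed

definition c0 :: real where "c0 = (SOME c. c > 0 \<and> (\<forall>u. c * (norm u)\<^sup>2 \<le> inner (Pinf u) u))"

lemma c0: "c0 > 0" "c0 * (norm u)\<^sup>2 \<le> inner (Pinf u) u"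
proof -
  have "c0 > 0 \<and> (\<forall>u. c0 * (norm u)\<^sup>2 \<le> inner (Pinf u) u)"
    unfolding c0_def by (rule someI_ex) (rule Pinf_coercive)
  then show "c0 > 0" "c0 * (norm u)\<^sup>2 \<le> inner (Pinf u) u" by auto
qed

sublocale coercive_plus_compact Binf Qinf c0
proof
  show "c0 * (norm u)\<^sup>2 \<le> inner (Binf u - Qinf u) u" for u
    using c0(2)[of u] Binf_decomp[of u] by simp
qed (fact Binf_selfadjoint Qinf_compact c0(1))+

lemma B_pointwise_far:
  assumes e: "e > 0"
  shows "\<exists>R. \<forall>x. norm (\<iota> x) > R \<longrightarrow> norm (B x u - Binf u) \<le> e"
proof -
  define d where "d = e / (2 * (norm u + 1))"
  have d: "d > 0" using e by (simp add: d_def add_nonneg_pos)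
  obtain R0 where R0: "R0 > 0" "\<And>u. norm u > R0 \<Longrightarrow> u \<in> V" using V_contains_far by blast
  obtain R1 where R1: "\<And>x. norm (\<iota> x) > R1 \<Longrightarrow> norm (P x u - Pinf u) \<le> e / 2"
    using P_pointwise_far[of "e / 2" u] e by auto
  obtain R2 where R2: "\<And>x. norm (\<iota> x) > R2 \<Longrightarrow> norm (Q x - Qinf) \<le> d" using Q_near_far[OF d] by blast
  have "norm (B x u - Binf u) \<le> e" if x: "norm (\<iota> x) > max R0 (max R1 R2)" for x
  proof -
    have "B x u - Binf u = (P x u - Pinf u) + (Q x - Qinf) u"
      using B_decomp[of x u] Binf_decomp[of u] R0(2)[of "\<iota> x"] x by (simp add: blinfun.diff_left)
    then have "norm (B x u - Binf u) \<le> norm (P x u - Pinf u) + norm ((Q x - Qinf) u)"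
      using norm_triangle_ineq by metis
    also have "norm ((Q x - Qinf) u) \<le> norm (Q x - Qinf) * norm u" by (rule norm_blinfun)
    also have "\<dots> \<le> d * (norm u + 1)" using R2[of x] x d by (intro mult_mono) auto
    also have "\<dots> = e / 2"
    proof -
      have nz: "norm u + 1 \<noteq> 0" using norm_ge_zero[of u] by linarith
      have "e / (2 * s) * s = e / 2" if "s \<noteq> 0" for s :: real using that by simp
      from this[OF nz] show ?thesis unfolding d_def .
    qed
    finally show ?thesis using R1[of x] x by simp
  qed
  then show ?thesis by blast
qed

text \<open>
On a finite dimensional subspace pointwise convergence is convergence in norm.
\<close>
lemma B_span_far:
  assumes F: "orthonormal_frame F" and e: "e > 0"
  shows "\<exists>R. \<forall>x. norm (\<iota> x) > R \<longrightarrow> (\<forall>v\<in>span F. norm (B x v - Binf v) \<le> e * norm v)"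
proof -
  interpret F: orthonormal_frame F by fact
  define d where "d = e / (real (card F) + 1)"
  have d: "d > 0" using e by (simp add: d_def add_nonneg_pos)
  obtain R where R: "\<And>f x. norm (\<iota> x) > R f \<Longrightarrow> norm (B x f - Binf f) \<le> d"
    using B_pointwise_far[OF d] by metis
  define M where "M = Max (insert 0 (R ` F))"
  have M: "R f \<le> M" if "f \<in> F" for f using that F.finite_frame by (simp add: M_def)
  have "norm (B x v - Binf v) \<le> e * norm v" if x: "norm (\<iota> x) > M" and v: "v \<in> span F" for x v
  proof -
    have ve: "v = (\<Sum>f\<in>F. inner v f *\<^sub>R f)" using F.frame_proj_id[OF v] by (simp add: frame_proj_def)
    have "B x v - Binf v = (\<Sum>f\<in>F. inner v f *\<^sub>R (B x f - Binf f))"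
    proof -
      have "(B x - Binf) v = (\<Sum>f\<in>F. inner v f *\<^sub>R (B x - Binf) f)"
        by (subst ve) (simp add: blinfun.sum_right blinfun.scaleR_right)
      then show ?thesis by (simp add: blinfun.diff_left)
    qed
    also have "norm \<dots> \<le> (\<Sum>f\<in>F. norm v * d)"
    proof (rule sum_norm_le)
      fix f assume f: "f \<in> F"
      have "\<bar>inner v f\<bar> \<le> norm v" using Cauchy_Schwarz_ineq2[of v f] F.unit_frame[OF f] by simp
      moreover have "norm (B x f - Binf f) \<le> d" using R[of f x] M[OF f] x by simp
      ultimately show "norm (inner v f *\<^sub>R (B x f - Binf f)) \<le> norm v * d"
        by (simp add: mult_mono)
    qed
    also have "\<dots> = (real (card F) * d) * norm v" by simp
    also have "\<dots> \<le> e * norm v"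
      using e by (intro mult_right_mono) (auto simp: d_def field_simps)
    finally show ?thesis .
  qed
  then show ?thesis by blast
qed

lemma B_small_on_ker_far:
  assumes "e > 0"
  shows "\<exists>R. \<forall>x. norm (\<iota> x) > R \<longrightarrow> (\<forall>v\<in>ker_op Binf. norm (B x v) \<le> e * norm v)"
proof -
  obtain R where "\<And>x v. norm (\<iota> x) > R \<Longrightarrow> v \<in> span ker_frame \<Longrightarrow> norm (B x v - Binf v) \<le> e * norm v"
    using B_span_far[OF kf.orthonormal_frame_axioms assms] by blast
  then show ?thesis by (intro exI[of _ R]) (fastforce simp: ker_op_eq[symmetric] ker_op_def)
qed

lemma B_negative_far: "\<exists>a>0. \<exists>R. \<forall>x. norm (\<iota> x) > R \<longrightarrow> (\<forall>u\<in>Hm. inner (B x u) u \<le> - a * (norm u)\<^sup>2)"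
proof -
  obtain a where a: "a > 0" "\<And>u. u \<in> Hm \<Longrightarrow> inner (Binf u) u \<le> - a * (norm u)\<^sup>2" using form_bounds by blast
  obtain R where R: "\<And>x v. norm (\<iota> x) > R \<Longrightarrow> v \<in> span neg_frame \<Longrightarrow> norm (B x v - Binf v) \<le> a / 2 * norm v"
    using B_span_far[OF nf.orthonormal_frame_axioms, of "a / 2"] a(1) by auto
  have "inner (B x u) u \<le> - (a / 2) * (norm u)\<^sup>2" if "norm (\<iota> x) > R" "u \<in> Hm" for x u
  proof -
    have "inner (B x u) u = inner (Binf u) u + inner (B x u - Binf u) u" by (simp add: inner_diff_left)
    also have "inner (B x u - Binf u) u \<le> norm (B x u - Binf u) * norm u" by (rule norm_cauchy_schwarz)
    also have "\<dots> \<le> (a / 2 * norm u) * norm u" using R[of x u] that by (intro mult_right_mono) (auto simp: neg_subspace_eq)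
    also have "\<dots> = (a / 2) * (norm u)\<^sup>2" by (simp add: power2_eq_square)
    finally show ?thesis using a(2)[OF that(2)] by (simp add: algebra_simps)
  qed
  then show ?thesis using a(1) by (intro exI[of _ "a / 2"] conjI exI[of _ R]) auto
qed

text \<open>
If the statement fails, there are points \<open>x\<^sub>n\<close> going to infinity and unit vectors \<open>u\<^sub>n \<in> H\<^sup>+\<close> with
\<open>\<langle>B(x\<^sub>n) u\<^sub>n, u\<^sub>n\<rangle> < 1 / (n + 1)\<close>. Pass to a weak limit \<open>w \<in> H\<^sup>+\<close> and put \<open>d\<^sub>n = u\<^sub>n - w\<close>. Expanding the form
\<open>B = P + Q\<close> at \<open>d\<^sub>n\<close> gives \<open>c \<parallel>d\<^sub>n\<parallel>\<^sup>2 \<le> h\<^sub>n\<close> with \<open>h\<^sub>n \<rightarrow> - \<langle>B(\<infinity>) w, w\<rangle>\<close>: the terms with \<open>w\<close> converge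
because \<open>B(x\<^sub>n) w\<close> converges in norm, and \<open>\<langle>Q(x\<^sub>n) d\<^sub>n, d\<^sub>n\<rangle> \<rightarrow> 0\<close> because \<open>Q(x\<^sub>n)\<close> converges in norm to a
compact operator and \<open>d\<^sub>n \<rightarrow> 0\<close> weakly. So \<open>\<langle>B(\<infinity>) w, w\<rangle> \<le> 0\<close>, that is \<open>w = 0\<close>; but then \<open>\<parallel>d\<^sub>n\<parallel> = 1\<close> while
\<open>h\<^sub>n \<rightarrow> 0\<close>.
\<close>
lemma B_positive_far: "\<exists>a>0. \<exists>R. \<forall>x. norm (\<iota> x) > R \<longrightarrow> (\<forall>u\<in>Hp. a * (norm u)\<^sup>2 \<le> inner (B x u) u)"
proof (rule ccontr)
  assume neg: "\<not> ?thesis"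
  obtain R0 c where R0: "R0 > 0" "c > 0"
    "\<And>x u. norm (\<iota> x) > R0 \<Longrightarrow> \<iota> x \<in> V \<and> c * (norm u)\<^sup>2 \<le> inner (P x u) u" using P_coercive_far by blast
  have "\<exists>x u. norm (\<iota> x) > R0 + real n \<and> u \<in> Hp \<and> norm u = 1 \<and> inner (B x u) u < 1 / real (Suc n)" for n
  proof -
    have "1 / real (Suc n) > 0" by simp
    then obtain x u where x: "norm (\<iota> x) > R0 + real n" and u: "u \<in> Hp" "inner (B x u) u < 1 / real (Suc n) * (norm u)\<^sup>2"
      using neg by (meson not_le)
    have u0: "u \<noteq> 0" using u(2) by auto
    define v where "v = (1 / norm u) *\<^sub>R u"
    have "inner (B x v) v = inner (B x u) u / (norm u)\<^sup>2" by (simp add: v_def blinfun.scaleR_right power2_eq_square)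
    also have "\<dots> < 1 / real (Suc n)" using u(2) u0 by (simp add: field_simps)
    finally show ?thesis using x u u0 subspace_scale[OF subspaces(2)]
      by (intro exI[of _ x] exI[of _ v]) (auto simp: v_def)
  qed
  then obtain x u where xu: "\<And>n. norm (\<iota> (x n)) > R0 + real n" "\<And>n. u n \<in> Hp" "\<And>n. norm (u n) = 1"
    "\<And>n. inner (B (x n) (u n)) (u n) < 1 / real (Suc n)" by metis
  obtain r1 w where r1: "strict_mono r1" "\<And>v. (\<lambda>n. inner (u (r1 n)) v) \<longlonglongrightarrow> inner w v"
    by (rule bounded_seq_weakly_convergent_subseq[of u 1]) (use xu(3) in auto)
  obtain r2 l where r2: "strict_mono r2" "(\<lambda>n. Qinf (u (r1 (r2 n)) - w)) \<longlonglongrightarrow> l"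
    by (rule compact_op_convergent_subseq[OF Qinf_compact, of "\<lambda>n. u (r1 n) - w" "1 + norm w"])
      (use xu(3) in \<open>auto intro: norm_triangle_ineq4[THEN order_trans]\<close>)
  define q where "q n = r1 (r2 n)" for n
  have q: "strict_mono q" unfolding q_def using r1(1) r2(1) by (simp add: strict_mono_def)
  define y v d where "y n = x (q n)" and "v n = u (q n)" and "d n = u (q n) - w" for n
  have vw: "(\<lambda>n. inner (v n) z) \<longlonglongrightarrow> inner w z" for z
    using LIMSEQ_subseq_LIMSEQ[OF r1(2) r2(1)] by (simp add: v_def q_def o_def)
  have dz: "(\<lambda>n. inner z (d n)) \<longlonglongrightarrow> 0" for z
    using tendsto_diff[OF vw[of z] tendsto_const[of "inner w z"]]
    by (simp add: d_def v_def inner_diff_right inner_commute)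
  have dbd: "norm (d n) \<le> 1 + norm w" for n
    unfolding d_def using norm_triangle_ineq4[of "u (q n)" w] xu(3) by simp
  have yfar: "norm (\<iota> (y n)) > R0 + real n" for n
    using xu(1)[of "q n"] seq_suble[OF q, of n] by (simp add: y_def)
  have Bw: "(\<lambda>n. B (y n) z) \<longlonglongrightarrow> Binf z" for z
  proof (rule metric_LIMSEQ_I)
    fix e :: real assume "e > 0"
    then obtain R where R: "\<And>x. norm (\<iota> x) > R \<Longrightarrow> norm (B x z - Binf z) \<le> e / 2"
      using B_pointwise_far[of "e / 2" z] by auto
    obtain N :: nat where "R < real N" using reals_Archimedean2 by blast
    then have "dist (B (y n) z) (Binf z) < e" if "n \<ge> N" for n
      using R[of "y n"] yfar[of n] that R0(1) \<open>e > 0\<close> by (simp add: dist_norm)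
    then show "\<exists>N. \<forall>n\<ge>N. dist (B (y n) z) (Binf z) < e" by blast
  qed
  have wHp: "w \<in> Hp"
    unfolding pos_subspace_eq
  proof (rule orthogonal_compI)
    fix e assume "e \<in> frame"
    then have "inner (v n) e = 0" for n
      using xu(2)[of "q n"] orthogonal_compD[of "v n" frame e] by (simp add: v_def pos_subspace_eq inner_commute)
    then show "inner e w = 0" using vw[of e] by (simp add: LIMSEQ_const_iff inner_commute)
  qed
  have Bwv: "(\<lambda>n. inner (B (y n) w) (v n)) \<longlonglongrightarrow> inner (Binf w) w"
  proof -
    have "(\<lambda>n. inner (B (y n) w - Binf w) (v n)) \<longlonglongrightarrow> 0"
    proof (rule Lim_null_comparison)
      show "\<forall>\<^sub>F n in sequentially. norm (inner (B (y n) w - Binf w) (v n)) \<le> norm (B (y n) w - Binf w)"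
      proof (intro always_eventually allI)
        fix n show "norm (inner (B (y n) w - Binf w) (v n)) \<le> norm (B (y n) w - Binf w)"
          using Cauchy_Schwarz_ineq2[of "B (y n) w - Binf w" "v n"] xu(3) by (simp add: v_def)
      qed
      show "(\<lambda>n. norm (B (y n) w - Binf w)) \<longlonglongrightarrow> 0" using Bw[of w] by (simp add: LIM_zero tendsto_norm_zero)
    qed
    from tendsto_add[OF this vw[of "Binf w"]]
    have "(\<lambda>n. inner (B (y n) w - Binf w) (v n) + inner (v n) (Binf w)) \<longlonglongrightarrow> inner (Binf w) w"
      by (simp add: inner_commute)
    moreover have "inner (B (y n) w - Binf w) (v n) + inner (v n) (Binf w) = inner (B (y n) w) (v n)" for n
      using inner_commute[of "v n" "Binf w"] by (simp add: inner_diff_left)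
    ultimately show ?thesis by simp
  qed
  have Qd: "(\<lambda>n. inner (Q (y n) (d n)) (d n)) \<longlonglongrightarrow> 0"
  proof -
    have Qy: "(\<lambda>n. norm (Q (y n) - Qinf)) \<longlonglongrightarrow> 0"
    proof (rule metric_LIMSEQ_I)
      fix e :: real assume "e > 0"
      then obtain R where R: "\<And>x. norm (\<iota> x) > R \<Longrightarrow> norm (Q x - Qinf) \<le> e / 2"
        using Q_near_far[of "e / 2"] by auto
      obtain N :: nat where "R < real N" using reals_Archimedean2 by blast
      then have "dist (norm (Q (y n) - Qinf)) 0 < e" if "n \<ge> N" for n
        using R[of "y n"] yfar[of n] that R0(1) \<open>e > 0\<close> by simp
      then show "\<exists>N. \<forall>n\<ge>N. dist (norm (Q (y n) - Qinf)) 0 < e" by blast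
    qed
    define g where "g n = norm (Q (y n) - Qinf) * (1 + norm w)\<^sup>2 + norm (Qinf (d n) - l) * (1 + norm w) + \<bar>inner l (d n)\<bar>" for n
    have "(\<lambda>n. norm (Qinf (d n) - l)) \<longlonglongrightarrow> 0" using r2(2) by (simp add: d_def q_def LIM_zero tendsto_norm_zero)
    then have "g \<longlonglongrightarrow> 0 * (1 + norm w)\<^sup>2 + 0 * (1 + norm w) + \<bar>0\<bar>"
      unfolding g_def by (intro tendsto_intros Qy dz)
    then have g0: "g \<longlonglongrightarrow> 0" by simp
    show ?thesis
    proof (rule Lim_null_comparison[OF _ g0], intro always_eventually allI)
      fix n
      have "inner (Q (y n) (d n)) (d n) = inner ((Q (y n) - Qinf) (d n)) (d n) + inner (Qinf (d n) - l) (d n) + inner l (d n)"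
        by (simp add: blinfun.diff_left inner_diff_left)
      then have "\<bar>inner (Q (y n) (d n)) (d n)\<bar> \<le> \<bar>inner ((Q (y n) - Qinf) (d n)) (d n)\<bar> + \<bar>inner (Qinf (d n) - l) (d n)\<bar> + \<bar>inner l (d n)\<bar>"
        by linarith
      moreover have "\<bar>inner ((Q (y n) - Qinf) (d n)) (d n)\<bar> \<le> norm (Q (y n) - Qinf) * (1 + norm w)\<^sup>2"
      proof -
        have "\<bar>inner ((Q (y n) - Qinf) (d n)) (d n)\<bar> \<le> norm ((Q (y n) - Qinf) (d n)) * norm (d n)" by (rule Cauchy_Schwarz_ineq2)
        also have "\<dots> \<le> (norm (Q (y n) - Qinf) * norm (d n)) * norm (d n)" by (intro mult_right_mono norm_blinfun) auto
        also have "\<dots> = norm (Q (y n) - Qinf) * (norm (d n))\<^sup>2" by (simp add: power2_eq_square)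
        also have "\<dots> \<le> norm (Q (y n) - Qinf) * (1 + norm w)\<^sup>2" using dbd by (intro mult_left_mono power_mono) auto
        finally show ?thesis .
      qed
      moreover have "\<bar>inner (Qinf (d n) - l) (d n)\<bar> \<le> norm (Qinf (d n) - l) * (1 + norm w)"
        by (rule order_trans[OF Cauchy_Schwarz_ineq2 mult_left_mono[OF dbd]]) simp
      ultimately show "norm (inner (Q (y n) (d n)) (d n)) \<le> g n" by (simp add: g_def)
    qed
  qed
  define h where "h n = 1 / real (Suc n) - 2 * inner (B (y n) w) (v n) + inner (B (y n) w) w - inner (Q (y n) (d n)) (d n)" for n
  have "h \<longlonglongrightarrow> 0 - 2 * inner (Binf w) w + inner (Binf w) w - 0"
    unfolding h_def by (intro tendsto_intros Bwv Bw Qd lim_1_over_n[THEN LIMSEQ_Suc])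
  then have hlim: "h \<longlonglongrightarrow> - inner (Binf w) w" by simp
  have key: "c * (norm (d n))\<^sup>2 \<le> h n" for n
  proof -
    have far: "norm (\<iota> (y n)) > R0" using yfar[of n] by simp
    then have yV: "\<iota> (y n) \<in> V" using R0(3) by blast
    have sym: "inner (B (y n) a) b = inner a (B (y n) b)" for a b
      using B_selfadjoint[OF yV] unfolding selfadjoint_op_def by blast
    have dd: "d n = v n - w" by (simp add: d_def v_def)
    have "c * (norm (d n))\<^sup>2 \<le> inner (P (y n) (d n)) (d n)" using R0(3)[OF far] by blast
    also have "\<dots> = inner (B (y n) (d n)) (d n) - inner (Q (y n) (d n)) (d n)"
      using B_decomp[OF yV, of "d n"] by (simp add: inner_add_left)
    also have "inner (B (y n) (d n)) (d n) = inner (B (y n) (v n)) (v n) - 2 * inner (B (y n) w) (v n) + inner (B (y n) w) w"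
      using sym[of "v n" w] unfolding dd
      by (simp add: blinfun.diff_right inner_diff_left inner_diff_right inner_commute)
    also have "inner (B (y n) (v n)) (v n) \<le> 1 / real (Suc n)"
    proof -
      have "inner (B (y n) (v n)) (v n) \<le> 1 / real (Suc (q n))" using xu(4)[of "q n"] by (simp add: y_def v_def)
      also have "\<dots> \<le> 1 / real (Suc n)" using seq_suble[OF q, of n] by (intro divide_left_mono) auto
      finally show ?thesis .
    qed
    finally show ?thesis by (simp add: h_def)
  qed
  have "0 \<le> h n" for n
  proof -
    have "0 \<le> c * (norm (d n))\<^sup>2" using R0(2) by simp
    then show ?thesis using key[of n] by linarith
  qed
  then have "0 \<le> - inner (Binf w) w"
    by (intro LIMSEQ_le_const[OF hlim]) auto
  moreover obtain a where a: "a > 0" "\<And>u. u \<in> Hp \<Longrightarrow> a * (norm u)\<^sup>2 \<le> inner (Binf u) u" using form_bounds by blast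
  ultimately have "a * (norm w)\<^sup>2 \<le> 0" using a(2)[OF wHp] by linarith
  then have w0: "w = 0" using a(1) by (simp add: mult_le_0_iff)
  have "norm (d n) = 1" for n using xu(3) by (simp add: d_def w0)
  then have "c \<le> - inner (Binf w) w"
    using key by (intro LIMSEQ_le_const[OF hlim]) auto
  then show False using w0 R0(2) by simp
qed

lemma B_definite_far:
  "\<exists>a>0. \<exists>R>0. \<forall>x. norm (\<iota> x) > R \<longrightarrow> \<iota> x \<in> V \<and> (\<forall>u\<in>Hp. a * (norm u)\<^sup>2 \<le> inner (B x u) u)
      \<and> (\<forall>u\<in>Hm. inner (B x u) u \<le> - a * (norm u)\<^sup>2)"
proof -
  obtain R0 where R0: "R0 > 0" "\<And>u. norm u > R0 \<Longrightarrow> u \<in> V" using V_contains_far by blast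
  obtain a R1 where 1: "a > 0" "\<And>x u. norm (\<iota> x) > R1 \<Longrightarrow> u \<in> Hp \<Longrightarrow> a * (norm u)\<^sup>2 \<le> inner (B x u) u" using B_positive_far by blast
  obtain b R2 where 2: "b > 0" "\<And>x u. norm (\<iota> x) > R2 \<Longrightarrow> u \<in> Hm \<Longrightarrow> inner (B x u) u \<le> - b * (norm u)\<^sup>2" using B_negative_far by blast
  have le: "min a b * (norm u)\<^sup>2 \<le> a * (norm u)\<^sup>2" "- b * (norm u)\<^sup>2 \<le> - min a b * (norm u)\<^sup>2" for u :: 'h
    by (intro mult_right_mono; simp)+
  show ?thesis
  proof (rule exI[of _ "min a b"], intro conjI exI[of _ "max R0 (max R1 R2)"] allI impI ballI)
    fix x u assume x: "max R0 (max R1 R2) < norm (\<iota> x)"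
    show "\<iota> x \<in> V" using R0 x by simp
    show "min a b * (norm u)\<^sup>2 \<le> inner (B x u) u" if "u \<in> Hp"
      using 1(2)[of x u] x that le(1)[of u] by simp
    show "inner (B x u) u \<le> - min a b * (norm u)\<^sup>2" if "u \<in> Hm"
      using 2(2)[of x u] x that le(2)[of u] by simp
  qed (use 1 2 R0 in auto)
qed

section \<open>Passing from \<open>H\<close> to \<open>X\<close>\<close>

text \<open>
For a frame \<open>F\<close> contained in \<open>X\<close> this is the projection onto its span, read as a map into \<open>X\<close>. It is
bounded from the norm of \<open>H\<close> to the norm of \<open>X\<close>, which makes the projections onto \<open>H\<^sup>0\<close> and \<open>H\<^sup>-\<close>
available on both spaces.
\<close>
definition lift :: "'h set \<Rightarrow> 'h \<Rightarrow> 'x"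
  where "lift F u = (\<Sum>e\<in>F. inner u e *\<^sub>R inv \<iota> e)"

lemma bounded_linear_lift: "bounded_linear (lift F)"
  unfolding lift_def by (intro bounded_linear_sum bounded_linear_scaleR_const bounded_linear_inner_left)

lemma incl_lift: "F \<subseteq> range \<iota> \<Longrightarrow> \<iota> (lift F u) = frame_proj F u"
  unfolding lift_def frame_proj_def incl.sum incl.scaleR by (intro sum.cong) (auto simp: f_inv_into_f)

abbreviation "j0 \<equiv> lift ker_frame"
abbreviation "jn \<equiv> lift neg_frame"

lemma ker_frame_range: "ker_frame \<subseteq> range \<iota>"
  using ker_op_in_range by (auto simp: ker_op_def ker_frame_def)

lemma neg_frame_range: "neg_frame \<subseteq> range \<iota>"
proof
  fix e assume "e \<in> neg_frame"
  then obtain r where "r < 0" "Binf e = r *\<^sub>R e" using neg_frame_eigenvalue by blast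
  then show "e \<in> range \<iota>" by (rule neg_eigenvectors)
qed

lemma incl_j0: "\<iota> (j0 u) = p0 u" by (simp add: incl_lift ker_frame_range p0_def)
lemma incl_jn: "\<iota> (jn u) = pn u" by (simp add: incl_lift neg_frame_range pn_def)

lemma inv_incl: "inv \<iota> (\<iota> x) = x" using incl_inj by simp

lemma Hm_in_range: "u \<in> Hm \<Longrightarrow> u \<in> range \<iota>"
  using incl_jn[of u] pn_id[of u] by (metis rangeI)

abbreviation "Xker \<equiv> X_ker \<iota> Binf"
abbreviation "Xpm \<equiv> X_pm \<iota> Binf"

lemma mem_Xker: "z \<in> Xker \<longleftrightarrow> \<iota> z \<in> ker_op Binf" by (simp add: X_ker_def)
lemma mem_Xpm: "x \<in> Xpm \<longleftrightarrow> \<iota> x \<in> Hpm" by (simp add: X_pm_def)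

lemma subspace_Xker: "subspace Xker"
  using subspaces(1) by (auto simp: subspace_def mem_Xker incl.add incl.scaleR incl.zero)

lemma subspace_Xpm: "subspace Xpm"
  using subspaces(4) by (auto simp: subspace_def mem_Xpm incl.add incl.scaleR incl.zero)

lemma closed_Xpm: "closed Xpm"
  unfolding X_pm_def by (intro closed_vimage closed_Hpm incl.continuous_on continuous_on_id)

lemma j0_Xker: "j0 u \<in> Xker" by (simp add: mem_Xker incl_j0 p0_ker)
lemma j0_id: "z \<in> Xker \<Longrightarrow> j0 (\<iota> z) = z"
  using incl_j0[of "\<iota> z"] by (simp add: mem_Xker p0_id inj_eq[OF incl_inj])

lemma restrict_orth_proj: "restrict_X \<iota> (orth_proj (ker_op Binf)) x = j0 (\<iota> x)"
  unfolding restrict_X_def by (simp add: orth_proj_ker inv_incl flip: incl_j0)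

abbreviation "co \<equiv> co_proj \<iota> Binf"

lemma co_eq: "co x = x - j0 (\<iota> x)" by (simp add: co_proj_def restrict_orth_proj)

lemma bounded_linear_co: "bounded_linear co"
  unfolding co_eq
  by (intro bounded_linear_sub bounded_linear_ident bounded_linear_compose[OF bounded_linear_lift bounded_linear_incl])

sublocale co: bounded_linear co by (rule bounded_linear_co)

lemma incl_co: "\<iota> (co x) = \<iota> x - p0 (\<iota> x)" by (simp add: co_eq incl.diff incl_j0)

lemma co_Xpm: "co x \<in> Xpm"
  using kf.frame_proj_complement[of "\<iota> x"] by (simp add: mem_Xpm incl_co p0_def ker_complement_eq)

lemma co_id: "x \<in> Xpm \<Longrightarrow> co x = x"
proof -
  assume x: "x \<in> Xpm"
  have "\<iota> (j0 (\<iota> x)) = \<iota> 0" using x by (simp add: incl_j0 mem_Xpm p0_Hpm incl.zero)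
  then have "j0 (\<iota> x) = 0" by (rule injD[OF incl_inj])
  then show ?thesis by (simp add: co_eq)
qed

lemma co_zero_iff: "co x = 0 \<longleftrightarrow> x \<in> Xker"
proof
  assume "co x = 0"
  then have "x = j0 (\<iota> x)" by (simp add: co_eq)
  then show "x \<in> Xker" using j0_Xker by metis
qed (simp add: co_eq j0_id)

abbreviation "BX \<equiv> restrict_X \<iota> Binf"

lemma incl_BX: "\<iota> (BX x) = Binf (\<iota> x)"
  unfolding restrict_X_def using Binf_preserves by (intro f_inv_into_f) auto

lemma linear_BX: "linear BX"
  by (rule linearI; rule injD[OF incl_inj]) (simp_all add: incl_BX incl.add incl.scaleR blinfun.add_right blinfun.scaleR_right)

lemma BX_Xpm: "BX x \<in> Xpm" by (simp add: mem_Xpm incl_BX T_Hpm)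
lemma BX_Xker: "z \<in> Xker \<Longrightarrow> BX z = 0"
  by (rule injD[OF incl_inj]) (simp add: incl_BX mem_Xker ker_op_def incl.zero)

text \<open>
Surjectivity is the regularity hypothesis: the solution \<open>u \<in> H\<^sup>\<plusminus>\<close> of \<open>B(\<infinity>) u = y\<close> lies in \<open>X\<close> if \<open>y\<close> does.
\<close>
lemma bij_BX: "bij_betw BX Xpm Xpm"
  unfolding bij_betw_def
proof
  obtain k where k: "k > 0" "\<forall>u\<in>Hpm. k * norm u \<le> norm (Binf u)" using T_Hpm_bij(1) by blast
  show "inj_on BX Xpm"
  proof (rule inj_onI)
    fix x y assume xy: "x \<in> Xpm" "y \<in> Xpm" "BX x = BX y"
    have "Binf (\<iota> (x - y)) = 0" using xy(3) incl_BX[of x] incl_BX[of y] by (simp add: incl.diff blinfun.diff_right)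
    moreover have "\<iota> (x - y) \<in> Hpm" using subspace_diff[OF subspace_Xpm xy(1,2)] by (simp add: mem_Xpm)
    ultimately have "k * norm (\<iota> (x - y)) \<le> 0" using k(2) by fastforce
    then have "\<iota> (x - y) = 0" using k(1) by (simp add: mult_le_0_iff)
    then show "x = y" using incl_inj by (simp add: incl.diff inj_eq)
  qed
  show "BX ` Xpm = Xpm"
  proof
    show "BX ` Xpm \<subseteq> Xpm" using BX_Xpm by blast
    show "Xpm \<subseteq> BX ` Xpm"
    proof
      fix y assume "y \<in> Xpm"
      then obtain u where u: "u \<in> Hpm" "Binf u = \<iota> y" using T_Hpm_bij(2) by (auto simp: mem_Xpm)
      then obtain x where x: "u = \<iota> x" using Binf_regular[of u] by auto
      have "BX x = y" using u x by (intro injD[OF incl_inj]) (simp add: incl_BX)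
      then show "y \<in> BX ` Xpm" using u x by (auto simp: mem_Xpm)
    qed
  qed
qed

abbreviation "Binv \<equiv> inv_into Xpm BX"

lemma Binv: "y \<in> Xpm \<Longrightarrow> Binv y \<in> Xpm" "y \<in> Xpm \<Longrightarrow> BX (Binv y) = y" "x \<in> Xpm \<Longrightarrow> Binv (BX x) = x"
  using bij_BX unfolding bij_betw_def by (auto simp: inv_into_into f_inv_into_f)

lemma Binv_unique: "x \<in> Xpm \<Longrightarrow> BX x = y \<Longrightarrow> Binv y = x"
  using Binv(3) by blast

lemma Binv_linear:
  assumes "x \<in> Xpm" "y \<in> Xpm"
  shows "Binv (x + y) = Binv x + Binv y" "Binv (c *\<^sub>R x) = c *\<^sub>R Binv x" "Binv (x - y) = Binv x - Binv y"
proof -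
  note s = subspace_add[OF subspace_Xpm] subspace_scale[OF subspace_Xpm] subspace_diff[OF subspace_Xpm]
  show "Binv (x + y) = Binv x + Binv y"
    by (rule Binv_unique) (use assms s Binv in \<open>auto simp: linear_add[OF linear_BX]\<close>)
  show "Binv (c *\<^sub>R x) = c *\<^sub>R Binv x"
    by (rule Binv_unique) (use assms s Binv in \<open>auto simp: linear_scale[OF linear_BX]\<close>)
  show "Binv (x - y) = Binv x - Binv y"
    by (rule Binv_unique) (use assms s Binv in \<open>auto simp: linear_diff[OF linear_BX]\<close>)
qed

abbreviation "C1 \<equiv> C1_inf \<iota> Binf"

text \<open>
The closed graph theorem shows that the supremum defining the constant is finite; the graph is closed
because \<open>B(\<infinity>)\<close> is continuous for the weaker norm of \<open>H\<close>.
\<close>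
lemma Binv_bound: "C1 \<ge> 0" "y \<in> Xpm \<Longrightarrow> norm (Binv y) \<le> C1 * norm y"
proof -
  have "\<exists>K\<ge>0. \<forall>y\<in>Xpm. norm (Binv y) \<le> K * norm y"
  proof (rule closed_graph_theorem[OF subspace_Xpm closed_Xpm])
    fix f x y assume f: "\<And>n::nat. f n \<in> Xpm" "f \<longlonglongrightarrow> x" "(\<lambda>n. Binv (f n)) \<longlonglongrightarrow> y"
    have "(\<lambda>n. Binf (\<iota> (Binv (f n)))) \<longlonglongrightarrow> Binf (\<iota> y)" by (intro tendsto_intros incl.tendsto f(3))
    moreover have "Binf (\<iota> (Binv (f n))) = \<iota> (f n)" for n using Binv(2)[OF f(1)] by (metis incl_BX)
    moreover have "(\<lambda>n. \<iota> (f n)) \<longlonglongrightarrow> \<iota> x" by (intro incl.tendsto f(2))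
    ultimately have "Binf (\<iota> y) = \<iota> x" using LIMSEQ_unique by auto
    moreover have "y \<in> Xpm" by (rule closed_sequentially[OF closed_Xpm Binv(1)[OF f(1)] f(3)])
    ultimately show "Binv x = y" by (intro Binv_unique injD[OF incl_inj]) (auto simp: incl_BX)
  qed (use Binv_linear in auto)
  then obtain K where K: "K \<ge> 0" "\<And>y. y \<in> Xpm \<Longrightarrow> norm (Binv y) \<le> K * norm y" by blast
  have bdd: "bdd_above ((\<lambda>y. norm (Binv y) / norm y) ` Xpm)"
  proof (rule bdd_aboveI2)
    fix y assume "y \<in> Xpm"
    then show "norm (Binv y) / norm y \<le> K" using K by (cases "y = 0") (auto simp: divide_le_eq)
  qed
  have le: "norm (Binv y) / norm y \<le> C1" if "y \<in> Xpm" for y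
    unfolding C1_inf_def onorm_on_def using bdd that by (intro cSUP_upper)
  show "C1 \<ge> 0" using le[of 0] subspace_0[OF subspace_Xpm] by simp
  show "norm (Binv y) \<le> C1 * norm y" if "y \<in> Xpm"
  proof (cases "y = 0")
    case True
    then show ?thesis using K(2)[OF that] by simp
  next
    case False
    then show ?thesis using le[OF that] by (simp add: divide_le_eq)
  qed
qed

text \<open>
The projection onto \<open>H\<^sup>+\<close> maps \<open>X\<close> into itself because the projections onto the two other
spectral subspaces do.
\<close>
lemma Hp_dense: "u \<in> Hp \<Longrightarrow> \<exists>f. (\<forall>n::nat. \<iota> (f n) \<in> Hp) \<and> (\<lambda>n. \<iota> (f n)) \<longlonglongrightarrow> u"
proof -
  assume u: "u \<in> Hp"
  have "u \<in> closure (range \<iota>)" using incl_dense by simp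
  then obtain g where g: "\<And>n::nat. g n \<in> range \<iota>" "g \<longlonglongrightarrow> u" unfolding closure_sequential by blast
  have "\<forall>n. \<exists>y. g n = \<iota> y" using g(1) by blast
  then obtain y where y: "\<And>n. g n = \<iota> (y n)" by metis
  define f where "f n = y n - j0 (\<iota> (y n)) - jn (\<iota> (y n))" for n
  have f: "\<iota> (f n) = pp (g n)" for n by (simp add: f_def incl.diff incl_j0 incl_jn pp_def y)
  have "(\<lambda>n. pp (g n)) \<longlonglongrightarrow> pp u" by (intro bounded_linear.tendsto[OF bounded_linear_pp] g(2))
  then show ?thesis using pp_Hp pp_id[OF u] by (intro exI[of _ f]) (simp add: f)
qed

end

section \<open>The reduction map\<close>

text \<open>
The radius \<open>R\<close> is so large that all estimates at infinity hold beyond it. The last assumption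
provides room for the fixed point argument: the ball of \<open>X\<^sup>\<plusminus>\<close> that the contraction maps to
itself has radius below \<open>\<rho>\<close>.
\<close>
locale reduction_setting = splitting_setting \<iota> V L A B Binf P Pinf Q Qinf
  for \<iota> :: "'x::banach \<Rightarrow> 'h::{real_inner, complete_space}" and V L A B Binf P Pinf Q Qinf +
  fixes \<rho> :: ereal and \<kappa> R1 R a :: real
  assumes kappa: "\<kappa> > 1" and R1_le: "R1 \<le> R" and R_pos: "R > 0" and a_pos: "a > 0"
    and weak: "weak_inequality \<iota> V Binf A R1 \<kappa> \<rho>"
    and far_V: "\<And>u. norm u > R \<Longrightarrow> u \<in> V"
    and far_Hp: "\<And>x u. norm (\<iota> x) > R \<Longrightarrow> u \<in> Hp \<Longrightarrow> a * (norm u)\<^sup>2 \<le> inner (B x u) u"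
    and far_Hm: "\<And>x u. norm (\<iota> x) > R \<Longrightarrow> u \<in> Hm \<Longrightarrow> inner (B x u) u \<le> - a * (norm u)\<^sup>2"
    and far_ker: "\<And>x v. norm (\<iota> x) > R \<Longrightarrow> v \<in> ker_op Binf \<Longrightarrow> norm (B x v) \<le> norm v"
    and radius: "\<And>z. z \<in> Xker \<Longrightarrow> norm (\<iota> z) > R \<Longrightarrow> ereal (\<kappa> / (\<kappa> - 1) * (C1 * norm (co (A z)))) < \<rho>"
begin

abbreviation "W \<equiv> ker_outside \<iota> Binf R"

lemma mem_W: "z \<in> W \<longleftrightarrow> z \<in> Xker \<and> norm (\<iota> z) > R"
  by (simp add: ker_outside_def)

lemma W_norm: "z \<in> W \<Longrightarrow> x \<in> Xpm \<Longrightarrow> norm (\<iota> (z + x)) > R"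
  using norm_ker_le[of "\<iota> z" "\<iota> x"] by (simp add: mem_W mem_Xker mem_Xpm incl.add)

lemma W_V: "z \<in> W \<Longrightarrow> x \<in> Xpm \<Longrightarrow> \<iota> (z + x) \<in> V"
  using W_norm far_V by blast

lemma open_U: "open (\<iota> -` V)"
  by (intro open_vimage V_open incl.continuous_on continuous_on_id)

lemma A_tendsto:
  assumes "(f \<longlongrightarrow> w) F" "\<iota> w \<in> V"
  shows "((\<lambda>s. A (f s)) \<longlongrightarrow> A w) F"
proof -
  have "isCont A w" using A_cont open_U assms(2) by (simp add: continuous_on_eq_continuous_at)
  then show ?thesis using assms(1) by (rule isCont_tendsto_compose)
qed

lemma dirA_tendsto:
  assumes "(f \<longlongrightarrow> w) F" "\<iota> w \<in> V"
  shows "((\<lambda>s. dir_deriv A (f s) u) \<longlongrightarrow> dir_deriv A w u) F"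
proof -
  have "isCont (\<lambda>x. dir_deriv A x u) w"
    using dir_deriv_continuous[OF A_diff] open_U assms(2) by (simp add: continuous_on_eq_continuous_at)
  then show ?thesis using assms(1) by (rule isCont_tendsto_compose)
qed

lemma rho_pos: "z \<in> W \<Longrightarrow> 0 < \<rho>"
proof -
  assume z: "z \<in> W"
  have "0 \<le> ereal (\<kappa> / (\<kappa> - 1) * (C1 * norm (co (A z))))" using kappa Binv_bound(1) by simp
  also have "\<dots> < \<rho>" using z by (intro radius) (auto simp: mem_W)
  finally show ?thesis .
qed

definition N :: "'x \<Rightarrow> 'x \<Rightarrow> 'x" where "N z x = co (A (z + x)) - BX x"

lemma N_Xpm: "N z x \<in> Xpm"
  unfolding N_def by (intro subspace_diff[OF subspace_Xpm] co_Xpm BX_Xpm)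

lemma N_lip:
  assumes "z \<in> W" "x1 \<in> Xpm" "x2 \<in> Xpm" "ereal (norm x1) < \<rho>" "ereal (norm x2) < \<rho>"
  shows "norm (N z x1 - N z x2) \<le> 1 / (\<kappa> * C1) * norm (x1 - x2)"
  using weak assms R1_le unfolding weak_inequality_def contraction_domain_def N_map_def N_def[abs_def]
  by (auto simp: mem_W)

text \<open>
The contraction estimate extends to the closed ball by approaching \<open>x\<^sub>i\<close> through \<open>t x\<^sub>i\<close>, \<open>t < 1\<close>.
\<close>
lemma N_lip_closed:
  assumes z: "z \<in> W" and x: "x1 \<in> Xpm" "x2 \<in> Xpm" "ereal (norm x1) \<le> \<rho>" "ereal (norm x2) \<le> \<rho>"
  shows "norm (N z x1 - N z x2) \<le> 1 / (\<kappa> * C1) * norm (x1 - x2)"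
proof (rule tendsto_le[of "at_left 1"])
  have NN: "((\<lambda>t. N z (t *\<^sub>R x)) \<longlongrightarrow> N z x) (at_left 1)" if "x \<in> Xpm" for x
  proof -
    have "((\<lambda>t. A (z + t *\<^sub>R x)) \<longlongrightarrow> A (z + x)) (at_left (1::real))"
      using z that by (intro A_tendsto W_V) (auto intro!: tendsto_eq_intros)
    moreover have "((\<lambda>t. t *\<^sub>R BX x) \<longlongrightarrow> 1 *\<^sub>R BX x) (at_left (1::real))" by (intro tendsto_intros)
    ultimately show ?thesis unfolding N_def by (intro tendsto_diff co.tendsto) (auto simp: linear_scale[OF linear_BX])
  qed
  show "((\<lambda>t. norm (N z (t *\<^sub>R x1) - N z (t *\<^sub>R x2))) \<longlongrightarrow> norm (N z x1 - N z x2)) (at_left 1)"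
    by (intro tendsto_intros NN x)
  show "((\<lambda>t. 1 / (\<kappa> * C1) * norm (t *\<^sub>R x1 - t *\<^sub>R x2)) \<longlongrightarrow> 1 / (\<kappa> * C1) * norm (x1 - x2)) (at_left 1)"
  proof -
    have "((\<lambda>t. t *\<^sub>R x1 - t *\<^sub>R x2) \<longlongrightarrow> 1 *\<^sub>R x1 - 1 *\<^sub>R x2) (at_left (1::real))" by (intro tendsto_intros)
    from tendsto_mult_left[OF tendsto_norm[OF this], of "1 / (\<kappa> * C1)"] show ?thesis by simp
  qed
  have lt: "ereal (norm (t *\<^sub>R x)) < \<rho>" if "0 < t" "t < 1" "ereal (norm x) \<le> \<rho>" for t and x :: 'x
  proof (cases "x = 0")
    case False
    then have "norm (t *\<^sub>R x) < norm x" using that by simp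
    then show ?thesis using that(3) by (metis less_ereal.simps(1) less_le_trans)
  qed (use rho_pos[OF z] in \<open>simp add: zero_ereal_def\<close>)
  have "norm (N z (t *\<^sub>R x1) - N z (t *\<^sub>R x2)) \<le> 1 / (\<kappa> * C1) * norm (t *\<^sub>R x1 - t *\<^sub>R x2)" if "0 < t" "t < 1" for t
    using z x lt that subspace_scale[OF subspace_Xpm] by (intro N_lip) auto
  then show "\<forall>\<^sub>F t in at_left 1. norm (N z (t *\<^sub>R x1) - N z (t *\<^sub>R x2)) \<le> 1 / (\<kappa> * C1) * norm (t *\<^sub>R x1 - t *\<^sub>R x2)"
    by (intro eventually_at_leftI[of 0 1]) auto
qed simp

text \<open>
An inequality rather than an equation because \<open>C1 = 0\<close> is possible, namely if \<open>X\<^sup>\<plusminus> = 0\<close>.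
\<close>
lemma kappa_C1: "C1 * (1 / (\<kappa> * C1) * t) \<le> 1 / \<kappa> * t" if "t \<ge> 0" for t
  using kappa Binv_bound(1) that by (cases "C1 = 0") auto

lemma Binv_contraction:
  assumes "u \<in> Xpm" "norm u \<le> 1 / (\<kappa> * C1) * t" "t \<ge> 0"
  shows "norm (Binv u) \<le> 1 / \<kappa> * t"
proof -
  have "norm (Binv u) \<le> C1 * norm u" using Binv_bound(2) assms(1) .
  also have "\<dots> \<le> C1 * (1 / (\<kappa> * C1) * t)" using assms(2) Binv_bound(1) by (intro mult_left_mono)
  also have "\<dots> \<le> 1 / \<kappa> * t" using kappa_C1 assms(3) .
  finally show ?thesis .
qed

text \<open>
Applying the inverse of \<open>B(\<infinity>)\<close> to the increment of \<open>p A(z + x) = B(\<infinity>) x + N(z, x)\<close>, where \<open>p\<close> projects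
onto \<open>X\<^sup>\<plusminus>\<close>, gives \<open>x1 - x2\<close> up to a term of norm at most \<open>\<parallel>x1 - x2\<parallel> / \<kappa>\<close>.
\<close>
lemma reduced_gradient_lower:
  assumes z: "z \<in> W" and x: "x1 \<in> Xpm" "x2 \<in> Xpm" "ereal (norm x1) \<le> \<rho>" "ereal (norm x2) \<le> \<rho>"
  shows "(1 - 1 / \<kappa>) * norm (x1 - x2) \<le> C1 * norm (co (A (z + x1)) - co (A (z + x2)))"
proof -
  let ?F = "co (A (z + x1)) - co (A (z + x2))"
  have F: "?F \<in> Xpm" by (intro subspace_diff[OF subspace_Xpm] co_Xpm)
  have NN: "N z x1 - N z x2 \<in> Xpm" by (intro subspace_diff[OF subspace_Xpm] N_Xpm)
  have d: "x1 - x2 \<in> Xpm" using x by (intro subspace_diff[OF subspace_Xpm])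
  have "?F - (N z x1 - N z x2) = BX (x1 - x2)" by (simp add: N_def linear_diff[OF linear_BX])
  then have eq: "x1 - x2 = Binv ?F - Binv (N z x1 - N z x2)"
    using Binv(3)[OF d] Binv_linear(3)[OF F NN] by simp
  then have "norm (x1 - x2) \<le> norm (Binv ?F) + norm (Binv (N z x1 - N z x2))"
    using norm_triangle_ineq4[of "Binv ?F" "Binv (N z x1 - N z x2)"] by simp
  also have "norm (Binv ?F) \<le> C1 * norm ?F" by (rule Binv_bound(2)[OF F])
  also have "norm (Binv (N z x1 - N z x2)) \<le> 1 / \<kappa> * norm (x1 - x2)"
    using Binv_contraction[OF NN N_lip_closed[OF z x]] by simp
  finally show ?thesis by (simp add: algebra_simps)
qed

lemma kappa_pos: "1 - 1 / \<kappa> > 0" "1 / \<kappa> < 1" "0 \<le> 1 / \<kappa>" using kappa by auto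

lemma reduction_unique:
  assumes z: "z \<in> W" and x: "x1 \<in> Xpm" "x2 \<in> Xpm" "ereal (norm x1) \<le> \<rho>" "ereal (norm x2) \<le> \<rho>"
    and F: "co (A (z + x1)) = 0" "co (A (z + x2)) = 0"
  shows "x1 = x2"
proof -
  have "(1 - 1 / \<kappa>) * norm (x1 - x2) \<le> 0" using reduced_gradient_lower[OF z x] F by simp
  then show ?thesis using kappa_pos(1) by (simp add: mult_le_0_iff)
qed

text \<open>
\<open>x \<mapsto> - B(\<infinity>)\<^sup>-\<^sup>1 N(z, x)\<close> is a contraction with factor \<open>1 / \<kappa>\<close>, and it moves the origin by at most
\<open>(1 - 1 / \<kappa>) r\<close>; so it maps the ball of radius \<open>r\<close> into itself.
\<close>
lemma reduction_exists:
  assumes z: "z \<in> W"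
  shows "\<exists>x\<in>Xpm. norm x \<le> \<kappa> / (\<kappa> - 1) * (C1 * norm (co (A z))) \<and> co (A (z + x)) = 0"
proof -
  define r where "r = \<kappa> / (\<kappa> - 1) * (C1 * norm (co (A z)))"
  have r0: "r \<ge> 0" unfolding r_def using kappa Binv_bound(1) by simp
  have r\<rho>: "ereal r < \<rho>" using radius[of z] z by (simp add: r_def mem_W)
  define S where "S = Xpm \<inter> cball 0 r"
  define T where "T x = - Binv (N z x)" for x
  have small: "ereal (norm x) \<le> \<rho>" if "x \<in> S" for x
  proof -
    have "ereal (norm x) \<le> ereal r" using that by (simp add: S_def)
    then show ?thesis using r\<rho> by (meson le_less_trans less_imp_le)
  qed
  have lip: "norm (T x1 - T x2) \<le> 1 / \<kappa> * norm (x1 - x2)" if "x1 \<in> S" "x2 \<in> S" for x1 x2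
  proof -
    have "T x1 - T x2 = - Binv (N z x1 - N z x2)" by (simp add: T_def Binv_linear(3)[OF N_Xpm N_Xpm])
    then show ?thesis
      using Binv_contraction[OF _ N_lip_closed[OF z _ _ small[OF that(1)] small[OF that(2)]]] that
      by (simp add: S_def subspace_diff[OF subspace_Xpm N_Xpm N_Xpm])
  qed
  have zS: "0 \<in> S" using subspace_0[OF subspace_Xpm] r0 by (simp add: S_def)
  have T0: "norm (T 0) \<le> (1 - 1 / \<kappa>) * r"
  proof -
    have "N z 0 = co (A z)" by (simp add: N_def linear_0[OF linear_BX])
    then have "norm (T 0) \<le> C1 * norm (co (A z))" using Binv_bound(2)[OF co_Xpm] by (simp add: T_def)
    also have "\<dots> = (1 - 1 / \<kappa>) * r" using kappa by (simp add: r_def field_simps)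
    finally show ?thesis .
  qed
  have "\<exists>!x\<in>S. T x = x"
  proof (rule Banach_fix)
    show "complete S" unfolding S_def by (simp add: complete_eq_closed closed_Int closed_Xpm)
    show "S \<noteq> {}" using zS by blast
    show "0 \<le> 1 / \<kappa>" "1 / \<kappa> < 1" by (rule kappa_pos)+
    show "dist (T x) (T y) \<le> 1 / \<kappa> * dist x y" if "x \<in> S" "y \<in> S" for x y
      using lip[OF that] by (simp add: dist_norm)
    show "T ` S \<subseteq> S"
    proof
      fix y assume "y \<in> T ` S"
      then obtain x where x: "x \<in> S" "y = T x" by blast
      have "norm (T x) \<le> norm (T x - T 0) + norm (T 0)" using norm_triangle_ineq[of "T x - T 0" "T 0"] by simp
      also have "\<dots> \<le> 1 / \<kappa> * norm x + (1 - 1 / \<kappa>) * r" using lip[OF x(1) zS] T0 by simp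
      also have "\<dots> \<le> 1 / \<kappa> * r + (1 - 1 / \<kappa>) * r" using x(1) kappa by (intro add_right_mono mult_left_mono) (auto simp: S_def)
      also have "\<dots> = r" by (simp add: algebra_simps)
      finally have "norm (T x) \<le> r" .
      moreover have "T x \<in> Xpm" unfolding T_def by (intro subspace_neg[OF subspace_Xpm] Binv(1) N_Xpm)
      ultimately show "y \<in> S" using x by (simp add: S_def)
    qed
  qed
  then obtain x where x: "x \<in> S" "T x = x" by blast
  have "BX x = - N z x"
  proof -
    have "BX (- Binv (N z x)) = - N z x" by (simp add: linear_neg[OF linear_BX] Binv(2)[OF N_Xpm])
    then show ?thesis using x(2) by (simp add: T_def)
  qed
  then have "co (A (z + x)) = 0" by (simp add: N_def)
  then show ?thesis using x(1) by (intro bexI[of _ x]) (auto simp: S_def r_def)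
qed

definition h :: "'x \<Rightarrow> 'x"
  where "h z = (SOME x. x \<in> Xpm \<and> norm x \<le> \<kappa> / (\<kappa> - 1) * (C1 * norm (co (A z))) \<and> co (A (z + x)) = 0)"

lemma h:
  assumes "z \<in> W"
  shows "h z \<in> Xpm" "norm (h z) \<le> \<kappa> / (\<kappa> - 1) * (C1 * norm (co (A z)))" "co (A (z + h z)) = 0"
    "ereal (norm (h z)) < \<rho>" "ereal (norm (h z)) \<le> \<rho>"
proof -
  show 1: "h z \<in> Xpm" and 2: "norm (h z) \<le> \<kappa> / (\<kappa> - 1) * (C1 * norm (co (A z)))" and 3: "co (A (z + h z)) = 0"
    using someI_ex[OF reduction_exists[OF assms, unfolded Bex_def]] unfolding h_def by auto
  have "ereal (norm (h z)) \<le> ereal (\<kappa> / (\<kappa> - 1) * (C1 * norm (co (A z))))" using 2 by simp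
  also have "\<dots> < \<rho>" using assms by (intro radius) (auto simp: mem_W)
  finally show "ereal (norm (h z)) < \<rho>" .
  then show "ereal (norm (h z)) \<le> \<rho>" by simp
qed

lemma A_h_Xker: "z \<in> W \<Longrightarrow> A (z + h z) \<in> Xker"
  using h(3) co_zero_iff by blast

lemma h_V: "z \<in> W \<Longrightarrow> \<iota> (z + h z) \<in> V" using W_V h(1) by blast

text \<open>
Compare \<open>h z\<close> with the fixed point \<open>h z0\<close>: the lower bound for the reduced gradient estimates their
distance by \<open>p A(z + h z0)\<close>, which tends to \<open>p A(z0 + h z0) = 0\<close>.
\<close>
lemma h_continuous: "continuous_on W h"
  unfolding continuous_on_def
proof
  fix z0 assume z0: "z0 \<in> W"
  let ?F = "at z0 within W"
  have "((\<lambda>z. co (A (z + h z0))) \<longlongrightarrow> co (A (z0 + h z0))) ?F"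
    using z0 by (intro co.tendsto A_tendsto h_V) (auto intro!: tendsto_eq_intros)
  then have "((\<lambda>z. C1 / (1 - 1 / \<kappa>) * norm (co (A (z + h z0)))) \<longlongrightarrow> C1 / (1 - 1 / \<kappa>) * norm (0::'x)) ?F"
    using h(3)[OF z0] by (intro tendsto_intros) auto
  then have lim: "((\<lambda>z. C1 / (1 - 1 / \<kappa>) * norm (co (A (z + h z0)))) \<longlongrightarrow> 0) ?F" by simp
  have "norm (h z - h z0) \<le> C1 / (1 - 1 / \<kappa>) * norm (co (A (z + h z0)))" if "z \<in> W" for z
  proof -
    have "(1 - 1 / \<kappa>) * norm (h z - h z0) \<le> C1 * norm (co (A (z + h z0)))"
      using reduced_gradient_lower[OF that h(1)[OF that] h(1)[OF z0] h(5)[OF that] h(5)[OF z0]] h(3)[OF that] by simp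
    then show ?thesis using kappa_pos(1) by (metis mult.commute pos_le_divide_eq times_divide_eq_left)
  qed
  then have "\<forall>\<^sub>F z in ?F. norm (h z - h z0) \<le> C1 / (1 - 1 / \<kappa>) * norm (co (A (z + h z0)))"
    unfolding eventually_at_filter by (intro always_eventually) blast
  then have "((\<lambda>z. h z - h z0) \<longlongrightarrow> 0) ?F" using lim by (rule Lim_null_comparison)
  then show "(h \<longlongrightarrow> h z0) ?F" by (rule LIM_zero_cancel)
qed

section \<open>The derivative of the reduction map\<close>

definition S :: "'x \<Rightarrow> 'x \<Rightarrow> 'x" where "S w v = co (dir_deriv A w v)"

lemma S_Xpm: "S w v \<in> Xpm" unfolding S_def by (rule co_Xpm)

lemma linear_S: "\<iota> w \<in> V \<Longrightarrow> linear (S w)"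
proof -
  assume "\<iota> w \<in> V"
  then have "linear (dir_deriv A w)" using dir_deriv_linear[OF open_U A_diff] by simp
  then show ?thesis unfolding S_def[abs_def]
    using linear_compose[of "dir_deriv A w" co] co.linear_axioms by (simp add: o_def)
qed

lemma S_quotient:
  assumes "\<iota> w \<in> V"
  shows "((\<lambda>t. (co (A (w + t *\<^sub>R v)) - co (A w)) /\<^sub>R t) \<longlongrightarrow> S w v) (at 0)"
  using co.tendsto[OF dir_deriv_tendsto[OF A_diff, of w v]] assms
  by (simp add: S_def co.diff co.scaleR)

lemma eventually_norm_less_rho:
  assumes "ereal (norm x) < \<rho>" "(f \<longlongrightarrow> x) F"
  shows "\<forall>\<^sub>F t in F. ereal (norm (f t)) < \<rho>"
proof -
  have "((\<lambda>t. ereal (norm (f t))) \<longlongrightarrow> ereal (norm x)) F" by (intro tendsto_intros assms)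
  then show ?thesis using assms(1) by (rule order_tendstoD(2))
qed

text \<open>
The difference quotients of \<open>p A - B(\<infinity>) = N(z, \<cdot>)\<close> inherit the Lipschitz bound of \<open>N\<close>.
\<close>
lemma S_near_BX:
  assumes z: "z \<in> W" and x: "x \<in> Xpm" "ereal (norm x) < \<rho>" and v: "v \<in> Xpm"
  shows "norm (S (z + x) v - BX v) \<le> 1 / (\<kappa> * C1) * norm v"
proof (rule tendsto_upperbound)
  show "((\<lambda>t. norm ((co (A (z + x + t *\<^sub>R v)) - co (A (z + x))) /\<^sub>R t - BX v)) \<longlongrightarrow> norm (S (z + x) v - BX v)) (at 0)"
    by (intro tendsto_intros S_quotient W_V z x)
  have "\<forall>\<^sub>F t in at 0. ereal (norm (x + t *\<^sub>R v)) < \<rho>"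
    by (rule eventually_norm_less_rho[OF x(2)]) (auto intro!: tendsto_eq_intros)
  moreover have "\<forall>\<^sub>F t in at (0::real). t \<noteq> 0" by (simp add: eventually_at_filter)
  ultimately show "\<forall>\<^sub>F t in at 0. norm ((co (A (z + x + t *\<^sub>R v)) - co (A (z + x))) /\<^sub>R t - BX v) \<le> 1 / (\<kappa> * C1) * norm v"
  proof eventually_elim
    case (elim t)
    have xt: "x + t *\<^sub>R v \<in> Xpm" using x v by (intro subspace_add[OF subspace_Xpm] subspace_scale[OF subspace_Xpm])
    have "norm (N z (x + t *\<^sub>R v) - N z x) \<le> 1 / (\<kappa> * C1) * norm ((x + t *\<^sub>R v) - x)"
      using elim(1) x xt z by (intro N_lip)
    then have n: "norm (N z (x + t *\<^sub>R v) - N z x) \<le> \<bar>t\<bar> * (1 / (\<kappa> * C1) * norm v)" by (simp add: mult.commute mult.left_commute)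
    have "(co (A (z + x + t *\<^sub>R v)) - co (A (z + x))) /\<^sub>R t - BX v = (N z (x + t *\<^sub>R v) - N z x) /\<^sub>R t"
      using elim(2) by (simp add: N_def linear_add[OF linear_BX] linear_scale[OF linear_BX] algebra_simps)
    then have "norm ((co (A (z + x + t *\<^sub>R v)) - co (A (z + x))) /\<^sub>R t - BX v) = norm (N z (x + t *\<^sub>R v) - N z x) / \<bar>t\<bar>"
      by (simp add: divide_inverse mult.commute)
    also have "\<dots> \<le> 1 / (\<kappa> * C1) * norm v" using n elim(2) by (simp add: pos_divide_le_eq mult.commute)
    finally show ?case .
  qed
qed simp

lemma S_lower:
  assumes z: "z \<in> W" and v: "v \<in> Xpm"
  shows "(1 - 1 / \<kappa>) * norm v \<le> C1 * norm (S (z + h z) v)"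
proof -
  let ?s = "S (z + h z) v"
  have d: "?s - BX v \<in> Xpm" by (intro subspace_diff[OF subspace_Xpm] S_Xpm BX_Xpm)
  have "Binv ?s - Binv (?s - BX v) = v"
    using Binv_linear(3)[OF S_Xpm d, symmetric] Binv(3)[OF v] by simp
  then have "norm v \<le> norm (Binv ?s) + norm (Binv (?s - BX v))"
    using norm_triangle_ineq4[of "Binv ?s" "Binv (?s - BX v)"] by simp
  also have "norm (Binv ?s) \<le> C1 * norm ?s" by (rule Binv_bound(2)[OF S_Xpm])
  also have "norm (Binv (?s - BX v)) \<le> 1 / \<kappa> * norm v"
    using Binv_contraction[OF d S_near_BX[OF z h(1,4)[OF z] v]] by simp
  finally show ?thesis by (simp add: algebra_simps)
qed

text \<open>
\<open>S\<close> is a perturbation of \<open>B(\<infinity>)\<close> that is small compared with its inverse; the solution of \<open>S v = y\<close> is the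
fixed point of \<open>v \<mapsto> B(\<infinity>)\<^sup>-\<^sup>1 (y - (S v - B(\<infinity>) v))\<close>.
\<close>
lemma S_bij:
  assumes z: "z \<in> W"
  shows "bij_betw (S (z + h z)) Xpm Xpm"
proof -
  let ?S = "S (z + h z)"
  note lin = linear_S[OF h_V[OF z]]
  have "inj_on ?S Xpm"
  proof (rule inj_onI)
    fix x y assume xy: "x \<in> Xpm" "y \<in> Xpm" "?S x = ?S y"
    have "(1 - 1 / \<kappa>) * norm (x - y) \<le> C1 * norm (?S (x - y))"
      by (rule S_lower[OF z]) (use xy subspace_diff[OF subspace_Xpm] in auto)
    then have "(1 - 1 / \<kappa>) * norm (x - y) \<le> 0" using xy(3) by (simp add: linear_diff[OF lin])
    then show "x = y" using kappa_pos(1) by (simp add: mult_le_0_iff)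
  qed
  moreover have "\<exists>v\<in>Xpm. ?S v = y" if y: "y \<in> Xpm" for y
  proof -
    define T where "T v = Binv (y - (?S v - BX v))" for v
    have in1: "y - (?S v - BX v) \<in> Xpm" for v
      by (intro subspace_diff[OF subspace_Xpm] S_Xpm BX_Xpm y)
    have "\<exists>!v\<in>Xpm. T v = v"
    proof (rule Banach_fix[OF _ _ kappa_pos(3,2)])
      show "complete Xpm" by (simp add: complete_eq_closed closed_Xpm)
      show "Xpm \<noteq> {}" using subspace_0[OF subspace_Xpm] by blast
      show "T ` Xpm \<subseteq> Xpm" using Binv(1)[OF in1] by (auto simp: T_def)
      show "dist (T v1) (T v2) \<le> 1 / \<kappa> * dist v1 v2" if v: "v1 \<in> Xpm" "v2 \<in> Xpm" for v1 v2
      proof -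
        have d: "v2 - v1 \<in> Xpm" using v by (intro subspace_diff[OF subspace_Xpm])
        have "T v1 - T v2 = Binv (?S (v2 - v1) - BX (v2 - v1))"
          unfolding T_def Binv_linear(3)[OF in1 in1, symmetric]
          by (simp add: linear_diff[OF lin] linear_diff[OF linear_BX] algebra_simps)
        also have "norm \<dots> \<le> 1 / \<kappa> * norm (v2 - v1)"
          by (rule Binv_contraction[OF _ S_near_BX[OF z h(1,4)[OF z] d]])
            (auto intro: subspace_diff[OF subspace_Xpm] S_Xpm BX_Xpm)
        finally show ?thesis by (simp add: dist_norm norm_minus_commute)
      qed
    qed
    then obtain v where v: "v \<in> Xpm" "T v = v" by blast
    have "BX v = y - (?S v - BX v)" using Binv(2)[OF in1[of v]] v(2) by (simp add: T_def)
    then show ?thesis using v(1) by (intro bexI[of _ v]) auto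
  qed
  ultimately show ?thesis unfolding bij_betw_def using S_Xpm by blast
qed

definition dh :: "'x \<Rightarrow> 'x \<Rightarrow> 'x" where "dh z v = - inv_into Xpm (S (z + h z)) (S (z + h z) v)"

lemma dh:
  assumes z: "z \<in> W"
  shows "dh z v \<in> Xpm" "S (z + h z) (v + dh z v) = 0"
proof -
  let ?S = "S (z + h z)"
  have i: "inv_into Xpm ?S (?S v) \<in> Xpm" "?S (inv_into Xpm ?S (?S v)) = ?S v"
    using S_bij[OF z] S_Xpm[of "z + h z" v] unfolding bij_betw_def by (auto simp: inv_into_into f_inv_into_f)
  show "dh z v \<in> Xpm" unfolding dh_def using i(1) by (rule subspace_neg[OF subspace_Xpm])
  show "?S (v + dh z v) = 0"
    using i(2) by (simp add: dh_def linear_add[OF linear_S[OF h_V[OF z]]] linear_neg[OF linear_S[OF h_V[OF z]]]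
        linear_diff[OF linear_S[OF h_V[OF z]]])
qed

lemma dh_unique:
  assumes z: "z \<in> W" and d: "d \<in> Xpm" "S (z + h z) (v + d) = 0"
  shows "dh z v = d"
proof -
  note lin = linear_S[OF h_V[OF z]]
  have "S (z + h z) (dh z v) = S (z + h z) d"
    using dh(2)[OF z, of v] d(2) by (simp add: linear_add[OF lin] eq_neg_iff_add_eq_0[symmetric])
  then show ?thesis using S_bij[OF z] dh(1)[OF z] d(1) unfolding bij_betw_def by (auto dest: inj_onD)
qed

lemma linear_dh: "z \<in> W \<Longrightarrow> linear (dh z)"
proof -
  assume z: "z \<in> W"
  note lin = linear_S[OF h_V[OF z]]
  show ?thesis
  proof (rule linearI)
    show "dh z (x + y) = dh z x + dh z y" for x y
    proof (rule dh_unique[OF z])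
      show "dh z x + dh z y \<in> Xpm" by (intro subspace_add[OF subspace_Xpm] dh(1)[OF z])
      have "x + y + (dh z x + dh z y) = (x + dh z x) + (y + dh z y)" by simp
      then show "S (z + h z) (x + y + (dh z x + dh z y)) = 0"
        using dh(2)[OF z] by (simp only: linear_add[OF lin, of "x + dh z x"]) simp
    qed
    show "dh z (c *\<^sub>R x) = c *\<^sub>R dh z x" for c x
    proof (rule dh_unique[OF z])
      show "c *\<^sub>R dh z x \<in> Xpm" by (intro subspace_scale[OF subspace_Xpm] dh(1)[OF z])
      have "c *\<^sub>R x + c *\<^sub>R dh z x = c *\<^sub>R (x + dh z x)" by (simp add: scaleR_add_right)
      then show "S (z + h z) (c *\<^sub>R x + c *\<^sub>R dh z x) = 0"
        using dh(2)[OF z, of x] by (simp only: linear_scale[OF lin]) simp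
    qed
  qed
qed

lemma W_open:
  assumes z: "z \<in> W"
  shows "\<exists>d>0. ball z d \<inter> Xker \<subseteq> W"
proof (intro exI conjI)
  show "norm (\<iota> z) - R > 0" using z by (simp add: mem_W)
  show "ball z (norm (\<iota> z) - R) \<inter> Xker \<subseteq> W"
  proof
    fix y assume y: "y \<in> ball z (norm (\<iota> z) - R) \<inter> Xker"
    have "norm (\<iota> z) \<le> norm (\<iota> y) + norm (\<iota> (z - y))"
      using norm_triangle_ineq[of "\<iota> y" "\<iota> (z - y)"] by (simp flip: incl.add)
    moreover have "norm (\<iota> (z - y)) < norm (\<iota> z) - R"
      using incl_norm[of "z - y"] y by (simp add: dist_norm)
    ultimately show "y \<in> W" using y by (simp add: mem_W)
  qed
qed

text \<open>
The difference between \<open>h (z + t v)\<close> and its candidate \<open>h z + t d\<close> is bounded by the reduced gradient at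
\<open>z + t v + h z + t d = w + t (v + d)\<close> with \<open>w = z + h z\<close>. There it is \<open>o(t)\<close>, because it vanishes
at \<open>w\<close> and its derivative \<open>S w (v + d)\<close> vanishes by the choice of \<open>d\<close>.
\<close>
lemma h_directional:
  assumes z: "z \<in> W" and v: "v \<in> Xker"
  shows "((\<lambda>t::real. (h (z + t *\<^sub>R v) - h z) /\<^sub>R t) \<longlongrightarrow> dh z v) (at 0)"
proof -
  let ?d = "dh z v" and ?w = "z + h z"
  let ?g = "\<lambda>t::real. C1 / (1 - 1 / \<kappa>) * norm ((co (A (?w + t *\<^sub>R (v + ?d))) - co (A ?w)) /\<^sub>R t)"
  have "(?g \<longlongrightarrow> C1 / (1 - 1 / \<kappa>) * norm (S ?w (v + ?d))) (at 0)"
    by (intro tendsto_intros S_quotient h_V z)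
  then have g0: "(?g \<longlongrightarrow> 0) (at 0)" using dh(2)[OF z] by simp
  obtain e where e: "e > 0" "ball z e \<inter> Xker \<subseteq> W" using W_open[OF z] by blast
  have "((\<lambda>t. z + t *\<^sub>R v) \<longlongrightarrow> z) (at (0::real))" by (auto intro!: tendsto_eq_intros)
  then have "\<forall>\<^sub>F t in at 0. dist (z + t *\<^sub>R v) z < e" using e(1) by (rule tendstoD)
  moreover have "\<forall>\<^sub>F t in at 0. ereal (norm (h z + t *\<^sub>R ?d)) < \<rho>"
    by (rule eventually_norm_less_rho[OF h(4)[OF z]]) (auto intro!: tendsto_eq_intros)
  moreover have "\<forall>\<^sub>F t in at (0::real). t \<noteq> 0" by (simp add: eventually_at_filter)
  ultimately have "\<forall>\<^sub>F t in at 0. norm ((h (z + t *\<^sub>R v) - h z) /\<^sub>R t - ?d) \<le> ?g t"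
  proof eventually_elim
    case (elim t)
    have "z + t *\<^sub>R v \<in> Xker"
      using z v by (intro subspace_add[OF subspace_Xker] subspace_scale[OF subspace_Xker]) (auto simp: mem_W)
    then have zt: "z + t *\<^sub>R v \<in> W" using e(2) elim(1) by (auto simp: dist_commute)
    have xt: "h z + t *\<^sub>R ?d \<in> Xpm"
      using h(1)[OF z] dh(1)[OF z] by (intro subspace_add[OF subspace_Xpm] subspace_scale[OF subspace_Xpm])
    have eq: "z + t *\<^sub>R v + (h z + t *\<^sub>R ?d) = ?w + t *\<^sub>R (v + ?d)" by (simp add: algebra_simps)
    have "(1 - 1 / \<kappa>) * norm (h (z + t *\<^sub>R v) - (h z + t *\<^sub>R ?d))
        \<le> C1 * norm (co (A (z + t *\<^sub>R v + h (z + t *\<^sub>R v))) - co (A (z + t *\<^sub>R v + (h z + t *\<^sub>R ?d))))"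
      using elim(2) by (intro reduced_gradient_lower zt h xt) auto
    then have "(1 - 1 / \<kappa>) * norm (h (z + t *\<^sub>R v) - (h z + t *\<^sub>R ?d))
        \<le> C1 * norm (co (A (?w + t *\<^sub>R (v + ?d))) - co (A ?w))"
      unfolding eq using h(3)[OF zt] h(3)[OF z] by simp
    then have 1: "norm (h (z + t *\<^sub>R v) - (h z + t *\<^sub>R ?d))
        \<le> C1 / (1 - 1 / \<kappa>) * norm (co (A (?w + t *\<^sub>R (v + ?d))) - co (A ?w))"
      using kappa_pos(1) by (metis mult.commute pos_le_divide_eq times_divide_eq_left)
    have "(h (z + t *\<^sub>R v) - h z) /\<^sub>R t - ?d = (h (z + t *\<^sub>R v) - (h z + t *\<^sub>R ?d)) /\<^sub>R t"
      using elim(3) by (simp add: algebra_simps)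
    then have "norm ((h (z + t *\<^sub>R v) - h z) /\<^sub>R t - ?d) = inverse \<bar>t\<bar> * norm (h (z + t *\<^sub>R v) - (h z + t *\<^sub>R ?d))"
      by simp
    also have "\<dots> \<le> inverse \<bar>t\<bar> * (C1 / (1 - 1 / \<kappa>) * norm (co (A (?w + t *\<^sub>R (v + ?d))) - co (A ?w)))"
      by (intro mult_left_mono 1) simp
    also have "\<dots> = ?g t" by simp
    finally show ?case .
  qed
  from Lim_null_comparison[OF this g0] show ?thesis by (rule LIM_zero_cancel)
qed

lemma h_plus_continuous: "continuous_on W (\<lambda>z. z + h z)"
  by (intro continuous_intros h_continuous)

text \<open>
As for \<open>h\<close> itself: insert the solution \<open>dh z0 v\<close> of the linearised equation at \<open>z0\<close> into the one at \<open>z\<close> and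
use that \<open>S (z + h z)\<close> is bounded below uniformly in \<open>z\<close>.
\<close>
lemma dh_continuous: "continuous_on W (\<lambda>z. dh z v)"
  unfolding continuous_on_def
proof
  fix z0 assume z0: "z0 \<in> W"
  let ?F = "at z0 within W"
  let ?g = "\<lambda>z. C1 / (1 - 1 / \<kappa>) * norm (S (z + h z) (v + dh z0 v))"
  have hp: "((\<lambda>z. z + h z) \<longlongrightarrow> z0 + h z0) ?F" using h_plus_continuous z0 by (auto simp: continuous_on_def)
  have "((\<lambda>z. S (z + h z) (v + dh z0 v)) \<longlongrightarrow> S (z0 + h z0) (v + dh z0 v)) ?F"
    unfolding S_def by (rule co.tendsto[OF dirA_tendsto[OF hp h_V[OF z0]]])
  then have "(?g \<longlongrightarrow> C1 / (1 - 1 / \<kappa>) * norm (S (z0 + h z0) (v + dh z0 v))) ?F"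
    by (intro tendsto_intros)
  then have g0: "(?g \<longlongrightarrow> 0) ?F" using dh(2)[OF z0] by simp
  have "norm (dh z v - dh z0 v) \<le> ?g z" if z: "z \<in> W" for z
  proof -
    note lin = linear_S[OF h_V[OF z]]
    have d: "dh z v - dh z0 v \<in> Xpm" by (intro subspace_diff[OF subspace_Xpm] dh z z0)
    have "S (z + h z) (dh z v - dh z0 v) = - S (z + h z) (v + dh z0 v)"
      using dh(2)[OF z, of v] by (simp add: linear_diff[OF lin] linear_add[OF lin] add_eq_0_iff)
    then have "(1 - 1 / \<kappa>) * norm (dh z v - dh z0 v) \<le> C1 * norm (S (z + h z) (v + dh z0 v))"
      using S_lower[OF z d] by simp
    then show ?thesis using kappa_pos(1) by (metis mult.commute pos_le_divide_eq times_divide_eq_left)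
  qed
  then have "\<forall>\<^sub>F z in ?F. norm (dh z v - dh z0 v) \<le> ?g z"
    unfolding eventually_at_filter by (intro always_eventually) blast
  from Lim_null_comparison[OF this g0] show "((\<lambda>z. dh z v) \<longlongrightarrow> dh z0 v) ?F" by (rule LIM_zero_cancel)
qed

text \<open>
The finite frame of the kernel serves two purposes: it extends \<open>dh z\<close> from the kernel to a bounded operator on
\<open>X\<close>, and it reduces continuity in operator norm to continuity of \<open>z \<mapsto> dh z v\<close> for finitely many \<open>v\<close>.
\<close>
definition Dh :: "'x \<Rightarrow> 'x \<Rightarrow>\<^sub>L 'x"
  where "Dh z = (\<Sum>e\<in>ker_frame. blinfun_scaleR_left (dh z (inv \<iota> e)) o\<^sub>L (blinfun_inner_right e o\<^sub>L Blinfun \<iota>))"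

lemma Dh_apply: "z \<in> W \<Longrightarrow> Dh z v = dh z (j0 (\<iota> v))"
proof -
  assume z: "z \<in> W"
  have "Dh z v = (\<Sum>e\<in>ker_frame. inner e (\<iota> v) *\<^sub>R dh z (inv \<iota> e))"
    by (simp add: Dh_def blinfun.sum_left bounded_linear_Blinfun_apply[OF bounded_linear_incl])
  also have "\<dots> = dh z (j0 (\<iota> v))"
    unfolding lift_def linear_sum[OF linear_dh[OF z]] linear_scale[OF linear_dh[OF z]] by (simp add: inner_commute)
  finally show ?thesis .
qed

lemma Dh_Xker: "z \<in> W \<Longrightarrow> v \<in> Xker \<Longrightarrow> Dh z v = dh z v"
  by (simp add: Dh_apply j0_id)

lemma Dh_Xpm: "z \<in> W \<Longrightarrow> Dh z v \<in> Xpm"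
  by (simp add: Dh_apply dh)

lemma Dh_continuous: "continuous_on W Dh"
  unfolding Dh_def[abs_def]
  by (intro continuous_on_sum bounded_bilinear.continuous_on[OF bounded_bilinear_blinfun_compose] continuous_on_const
      bounded_linear.continuous_on[OF bounded_linear_blinfun_scaleR_left] dh_continuous)

lemma h_differential: "has_differential_on W h Dh"
proof (rule directional_imp_has_differential_on[OF subspace_Xker _ W_open Dh_continuous])
  show "W \<subseteq> Xker" by (auto simp: mem_W)
  show "((\<lambda>t::real. (h (z + t *\<^sub>R v) - h z) /\<^sub>R t) \<longlongrightarrow> Dh z v) (at 0)" if "z \<in> W" "v \<in> Xker" for z v
    using h_directional[OF that] Dh_Xker[OF that] by simp
qed

lemma h_C1: "C1_on W h"
  unfolding C1_on_def using h_differential Dh_continuous by blast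

lemma incl_h_C1: "C1_on W (\<lambda>z. \<iota> (h z))"
  unfolding C1_on_def
proof (intro exI conjI)
  show "has_differential_on W (\<lambda>z. \<iota> (h z)) (\<lambda>z. Blinfun \<iota> o\<^sub>L Dh z)"
    unfolding has_differential_on_def
  proof
    fix z assume "z \<in> W"
    then have "(h has_derivative Dh z) (at z within W)" using h_differential by (auto simp: has_differential_on_def)
    from incl.has_derivative[OF this]
    show "((\<lambda>z. \<iota> (h z)) has_derivative blinfun_apply (Blinfun \<iota> o\<^sub>L Dh z)) (at z within W)"
      by (simp add: bounded_linear_Blinfun_apply[OF bounded_linear_incl] blinfun_compose.rep_eq o_def)
  qed
  show "continuous_on W (\<lambda>z. Blinfun \<iota> o\<^sub>L Dh z)"
    by (intro bounded_bilinear.continuous_on[OF bounded_bilinear_blinfun_compose] continuous_on_const Dh_continuous)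
qed

section \<open>The reduced functional\<close>

text \<open>
The functional \<open>(x, \<cdot>)\<^sub>H\<close> on \<open>X\<close>; the differential of \<open>\<L>\<close> on \<open>X\<close> is \<open>x \<mapsto> K (A x)\<close>.
\<close>
definition K :: "'x \<Rightarrow> 'x \<Rightarrow>\<^sub>L real" where "K x = blinfun_inner_right (\<iota> x) o\<^sub>L Blinfun \<iota>"

lemma K_apply: "K x v = inner (\<iota> x) (\<iota> v)"
  by (simp add: K_def bounded_linear_Blinfun_apply[OF bounded_linear_incl])

lemma bounded_linear_K: "bounded_linear K"
  unfolding K_def[abs_def]
  by (intro bounded_linear_compose[OF bounded_bilinear.bounded_linear_left[OF bounded_bilinear_blinfun_compose]]
      bounded_linear_compose[OF bounded_linear_blinfun_inner_right] bounded_linear_incl)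

lemma norm_K: "norm (K x) \<le> norm (\<iota> x)"
proof (rule norm_blinfun_bound)
  show "norm (K x v) \<le> norm (\<iota> x) * norm v" for v
  proof -
    have "norm (K x v) \<le> norm (\<iota> x) * norm (\<iota> v)" unfolding K_apply real_norm_def by (rule Cauchy_Schwarz_ineq2)
    also have "\<dots> \<le> norm (\<iota> x) * norm v" by (intro mult_left_mono incl_norm) simp
    finally show ?thesis .
  qed
qed simp

lemma L_incl_differential: "has_differential_on (\<iota> -` V) (\<lambda>x. L (\<iota> x)) (\<lambda>x. K (A x))"
proof (rule directional_imp_has_differential_on[where E = UNIV])
  show "\<exists>d>0. ball z d \<inter> UNIV \<subseteq> \<iota> -` V" if "z \<in> \<iota> -` V" for z
    using open_contains_ball[of "\<iota> -` V"] open_U that by auto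
  show "continuous_on (\<iota> -` V) (\<lambda>x. K (A x))"
    by (intro bounded_linear.continuous_on[OF bounded_linear_K] A_cont)
  show "((\<lambda>t::real. (L (\<iota> (x + t *\<^sub>R v)) - L (\<iota> x)) /\<^sub>R t) \<longlongrightarrow> K (A x) v) (at 0)" if "x \<in> \<iota> -` V" for x v
    using dir_deriv_tendsto[OF L_diff, of "\<iota> x" "\<iota> v"] that A_gradient[of x v]
    by (simp add: K_apply incl.add incl.scaleR)
qed auto

definition Linf :: "'x \<Rightarrow> real" where "Linf z = L (\<iota> (z + h z))"

text \<open>
By the chain rule the differential is \<open>v \<mapsto> (A(z + h z), v + Dh z v)\<close>. The second term vanishes, as \<open>A(z + h z)\<close>
lies in the kernel of \<open>B(\<infinity>)\<close> and \<open>Dh z v\<close> is orthogonal to it.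
\<close>
lemma Linf_differential: "has_differential_on W Linf (\<lambda>z. K (A (z + h z)))"
  unfolding has_differential_on_def
proof
  fix z assume z: "z \<in> W"
  have 1: "((\<lambda>z. z + h z) has_derivative (\<lambda>v. v + Dh z v)) (at z within W)"
    using h_differential z by (auto simp: has_differential_on_def intro!: derivative_eq_intros)
  have "((\<lambda>x. L (\<iota> x)) has_derivative K (A (z + h z))) (at (z + h z) within \<iota> -` V)"
    using L_incl_differential h_V[OF z] by (auto simp: has_differential_on_def)
  then have "((\<lambda>x. L (\<iota> x)) has_derivative K (A (z + h z))) (at (z + h z) within (\<lambda>z. z + h z) ` W)"
    by (rule has_derivative_subset) (use h_V in auto)
  from has_derivative_in_compose[OF 1 this]
  have "(Linf has_derivative (\<lambda>v. K (A (z + h z)) (v + Dh z v))) (at z within W)"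
    by (simp add: Linf_def[abs_def])
  moreover have "K (A (z + h z)) (Dh z v) = 0" for v
    using orthogonal_compD[of "\<iota> (Dh z v)" "ker_op Binf"] Dh_Xpm[OF z] A_h_Xker[OF z]
    by (simp add: K_apply mem_Xpm mem_Xker)
  ultimately show "(Linf has_derivative K (A (z + h z))) (at z within W)"
    by (simp add: blinfun.add_right)
qed

lemma dLinf_continuous: "continuous_on W (\<lambda>z. K (A (z + h z)))"
  by (intro bounded_linear.continuous_on[OF bounded_linear_K] continuous_on_compose2[OF A_cont h_plus_continuous])
    (use h_V in auto)

lemma Linf_C1: "C1_on W Linf"
  unfolding C1_on_def using Linf_differential dLinf_continuous by blast

lemma Linf_formula: "z \<in> W \<Longrightarrow> (Linf has_derivative (\<lambda>v. inner (\<iota> (A (z + h z))) (\<iota> v))) (at z within W)"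
  using Linf_differential by (simp add: has_differential_on_def K_apply[abs_def])

lemma A'_dir_deriv:
  assumes A': "has_differential_on (\<iota> -` V) A A'" and w: "\<iota> w \<in> V"
  shows "A' w v = dir_deriv A w v"
proof -
  have "(A has_derivative A' w) (at w within \<iota> -` V)" using A' w by (auto simp: has_differential_on_def)
  moreover have "at w within \<iota> -` V = at w" using w open_U by (intro at_within_open) auto
  ultimately have d: "(A has_derivative A' w) (at w)" by (simp only:)
  have "((\<lambda>t::real. A (w + t *\<^sub>R v)) has_derivative (\<lambda>t. A' w (t *\<^sub>R v))) (at 0)"
    by (rule has_derivative_compose[of "\<lambda>t::real. w + t *\<^sub>R v" "\<lambda>t. t *\<^sub>R v" _ _ A])
      (auto intro!: derivative_eq_intros simp: d)
  then have "((\<lambda>t::real. A (w + t *\<^sub>R v)) has_vector_derivative A' w v) (at 0)"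
    by (simp add: has_vector_derivative_def blinfun.scaleR_right)
  moreover have "((\<lambda>t::real. A (w + t *\<^sub>R v)) has_vector_derivative dir_deriv A w v) (at 0)"
    using dir_deriv_vector_derivative[OF A_diff, of w 0 v] w by simp
  ultimately show ?thesis by (rule vector_derivative_unique_at)
qed

text \<open>
The differential \<open>z \<mapsto> K (A (z + h z))\<close> contains \<open>h\<close> but not its derivative, so the chain rule applies once more.
\<close>
lemma Linf_C2:
  assumes A': "has_differential_on (\<iota> -` V) A A'" "continuous_on (\<iota> -` V) A'"
  shows "C2_on W Linf"
  unfolding C2_on_def
proof (intro exI conjI)
  show "has_differential_on W Linf (\<lambda>z. K (A (z + h z)))" by (rule Linf_differential)
  let ?D = "\<lambda>z. Blinfun K o\<^sub>L (A' (z + h z) o\<^sub>L (id_blinfun + Dh z))"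
  show "C1_on W (\<lambda>z. K (A (z + h z)))"
    unfolding C1_on_def
  proof (intro exI conjI)
    show "has_differential_on W (\<lambda>z. K (A (z + h z))) ?D"
      unfolding has_differential_on_def
    proof
      fix z assume z: "z \<in> W"
      have 1: "((\<lambda>z. z + h z) has_derivative (\<lambda>v. v + Dh z v)) (at z within W)"
        using h_differential z by (auto simp: has_differential_on_def intro!: derivative_eq_intros)
      have "(A has_derivative A' (z + h z)) (at (z + h z) within \<iota> -` V)"
        using A'(1) h_V[OF z] by (auto simp: has_differential_on_def)
      then have "(A has_derivative A' (z + h z)) (at (z + h z) within (\<lambda>z. z + h z) ` W)"
        by (rule has_derivative_subset) (use h_V in auto)
      from bounded_linear.has_derivative[OF bounded_linear_K has_derivative_in_compose[OF 1 this]]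
      show "((\<lambda>z. K (A (z + h z))) has_derivative ?D z) (at z within W)"
        by (simp add: bounded_linear_Blinfun_apply[OF bounded_linear_K] blinfun_compose.rep_eq o_def blinfun.add_left)
    qed
    show "continuous_on W ?D"
      by (intro bounded_bilinear.continuous_on[OF bounded_bilinear_blinfun_compose] continuous_on_const
          continuous_on_add Dh_continuous continuous_on_compose2[OF A'(2) h_plus_continuous]) (use h_V in auto)
  qed
qed

section \<open>Strict derivatives at infinity of the reduction\<close>

lemma A_line_deriv:
  assumes V: "\<iota> (w + t *\<^sub>R u) \<in> V"
  shows "((\<lambda>t. inner (\<iota> (A (w + t *\<^sub>R u))) (\<iota> k)) has_real_derivative inner (B (w + t *\<^sub>R u) (\<iota> u)) (\<iota> k)) (at t)"
proof -
  have "((\<lambda>t. A (w + t *\<^sub>R u)) has_vector_derivative dir_deriv A (w + t *\<^sub>R u) u) (at t)"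
    by (rule dir_deriv_vector_derivative[OF A_diff]) (use V in simp)
  from bounded_linear.has_vector_derivative[OF bounded_linear_compose[OF bounded_linear_inner_left bounded_linear_incl] this]
  have "((\<lambda>t. inner (\<iota> (A (w + t *\<^sub>R u))) (\<iota> k)) has_vector_derivative inner (\<iota> (dir_deriv A (w + t *\<^sub>R u) u)) (\<iota> k)) (at t)" .
  then show ?thesis unfolding B_hessian[OF V] has_real_derivative_iff_has_vector_derivative .
qed

text \<open>
The mean value theorem for a scalar component of \<open>A\<close>; \<open>B\<close> describes the derivative
of \<open>A\<close> after pairing with a vector of \<open>X\<close> in \<open>H\<close>.
\<close>
lemma A_increment:
  assumes seg: "\<And>t. 0 \<le> t \<Longrightarrow> t \<le> 1 \<Longrightarrow> \<iota> (w2 + t *\<^sub>R (w1 - w2)) \<in> V"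
  obtains t where "0 < t" "t < 1"
    "inner (\<iota> (A w1) - \<iota> (A w2)) (\<iota> k) = inner (B (w2 + t *\<^sub>R (w1 - w2)) (\<iota> (w1 - w2))) (\<iota> k)"
proof -
  define u where "u = w1 - w2"
  have "((\<lambda>t. inner (\<iota> (A (w2 + t *\<^sub>R u))) (\<iota> k)) has_real_derivative inner (B (w2 + t *\<^sub>R u) (\<iota> u)) (\<iota> k)) (at t)"
    if "0 \<le> t" "t \<le> 1" for t
    by (rule A_line_deriv) (use seg[OF that] in \<open>simp add: u_def\<close>)
  from MVT2[of 0 1 "\<lambda>t. inner (\<iota> (A (w2 + t *\<^sub>R u))) (\<iota> k)", OF _ this]
  obtain t where "0 < t" "t < 1"
    "inner (\<iota> (A (w2 + 1 *\<^sub>R u))) (\<iota> k) - inner (\<iota> (A (w2 + 0 *\<^sub>R u))) (\<iota> k) = (1 - 0) * inner (B (w2 + t *\<^sub>R u) (\<iota> u)) (\<iota> k)"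
    by auto
  then show ?thesis using that[of t] by (simp add: u_def inner_diff_left)
qed

text \<open>
The component in the kernel of a point on the segment from \<open>z2 + x2\<close> to \<open>z1 + x1\<close> lies on the segment from \<open>z2\<close> to
\<open>z1\<close>.
\<close>
lemma segment_far:
  assumes z: "z1 \<in> W" "z2 \<in> W" and x: "x1 \<in> Xpm" "x2 \<in> Xpm"
    and seg: "norm (\<iota> (z2 + t *\<^sub>R (z1 - z2))) > r"
  shows "norm (\<iota> ((z2 + x2) + t *\<^sub>R ((z1 + x1) - (z2 + x2)))) > r"
proof -
  have "z2 + t *\<^sub>R (z1 - z2) \<in> Xker"
    using z by (intro subspace_add[OF subspace_Xker] subspace_scale[OF subspace_Xker] subspace_diff[OF subspace_Xker]) (auto simp: mem_W)
  moreover have "x2 + t *\<^sub>R (x1 - x2) \<in> Xpm"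
    using x by (intro subspace_add[OF subspace_Xpm] subspace_scale[OF subspace_Xpm] subspace_diff[OF subspace_Xpm])
  ultimately have "norm (\<iota> (z2 + t *\<^sub>R (z1 - z2))) \<le> norm (\<iota> (z2 + t *\<^sub>R (z1 - z2)) + \<iota> (x2 + t *\<^sub>R (x1 - x2)))"
    by (intro norm_ker_le) (auto simp: mem_Xker mem_Xpm)
  also have "\<iota> (z2 + t *\<^sub>R (z1 - z2)) + \<iota> (x2 + t *\<^sub>R (x1 - x2)) = \<iota> ((z2 + x2) + t *\<^sub>R ((z1 + x1) - (z2 + x2)))"
    unfolding incl.add[symmetric] by (simp add: algebra_simps)
  finally show ?thesis using seg by simp
qed

lemma reduced_graph_increment:
  assumes z: "z1 \<in> W" "z2 \<in> W" and r: "r \<ge> R"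
    and seg: "\<And>t. 0 \<le> t \<Longrightarrow> t \<le> 1 \<Longrightarrow> norm (\<iota> (z2 + t *\<^sub>R (z1 - z2))) > r"
  obtains x where "norm (\<iota> x) > r" "\<iota> x \<in> V"
    "inner (\<iota> (A (z1 + h z1)) - \<iota> (A (z2 + h z2))) (\<iota> k) = inner (B x (\<iota> ((z1 + h z1) - (z2 + h z2)))) (\<iota> k)"
proof -
  let ?w1 = "z1 + h z1" and ?w2 = "z2 + h z2"
  have far: "norm (\<iota> (?w2 + t *\<^sub>R (?w1 - ?w2))) > r" if "0 \<le> t" "t \<le> 1" for t
    by (rule segment_far[OF z h(1)[OF z(1)] h(1)[OF z(2)] seg[OF that]])
  have farV: "\<iota> (?w2 + t *\<^sub>R (?w1 - ?w2)) \<in> V" if "0 \<le> t" "t \<le> 1" for t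
    using far[OF that] r by (intro far_V) simp
  obtain t where t: "0 < t" "t < 1"
    "inner (\<iota> (A ?w1) - \<iota> (A ?w2)) (\<iota> k) = inner (B (?w2 + t *\<^sub>R (?w1 - ?w2)) (\<iota> (?w1 - ?w2))) (\<iota> k)"
    by (rule A_increment[of ?w2 ?w1 k]) (use farV in auto)
  show ?thesis using that[OF far farV t(3)] t by simp
qed

text \<open>
Let \<open>u = h z1 - h z2\<close> and \<open>k = u\<^sup>+ - u\<^sup>-\<close>. The values of \<open>A\<close> on the graph lie in the kernel, so its
increment is orthogonal to \<open>k\<close>; by the mean value theorem \<open>\<langle>B(x) u, k\<rangle> = - \<langle>B(x) (z1 - z2), k\<rangle>\<close> at
some far point \<open>x\<close>. By symmetry of \<open>B(x)\<close> the mixed terms on the left cancel and what remains is at least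
\<open>a \<parallel>u\<parallel>\<^sup>2\<close>, whereas on the right \<open>B(x)\<close> is small on the kernel.
\<close>
lemma h_segment_estimate:
  assumes z: "z1 \<in> W" "z2 \<in> W" and r: "r \<ge> R"
    and small: "\<And>x v. norm (\<iota> x) > r \<Longrightarrow> v \<in> ker_op Binf \<Longrightarrow> norm (B x v) \<le> e * norm v"
    and seg: "\<And>t. 0 \<le> t \<Longrightarrow> t \<le> 1 \<Longrightarrow> norm (\<iota> (z2 + t *\<^sub>R (z1 - z2))) > r"
  shows "a * norm (\<iota> (h z1 - h z2)) \<le> e * norm (\<iota> (z1 - z2))"
proof -
  let ?w1 = "z1 + h z1" and ?w2 = "z2 + h z2"
  have zk: "z1 - z2 \<in> Xker" using z by (intro subspace_diff[OF subspace_Xker]) (auto simp: mem_W)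
  have hx: "h z1 - h z2 \<in> Xpm" using h(1) z by (intro subspace_diff[OF subspace_Xpm]) auto
  define u where "u = \<iota> (h z1 - h z2)"
  define k where "k = (h z1 - h z2) - 2 *\<^sub>R jn u"
  have uH: "u \<in> Hpm" using hx by (simp add: u_def mem_Xpm)
  have u_split: "u = pp u + pn u" by (rule Hpm_decomp[OF uH])
  have ik: "\<iota> k = pp u - pn u"
  proof -
    have "\<iota> k = u - 2 *\<^sub>R pn u" by (simp add: k_def incl.diff incl.scaleR incl_jn u_def)
    then show ?thesis using u_split by (metis add_diff_cancel_right diff_diff_eq2 scaleR_2 add.commute diff_add_eq_diff_diff_swap)
  qed
  have pq: "inner (pp u) (pn u) = 0" "inner (pn u) (pp u) = 0"
    using Hp_Hm_orthogonal[OF pp_Hp pn_Hm] by (auto simp: inner_commute)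
  have nk: "norm (\<iota> k) = norm u" and nu: "(norm u)\<^sup>2 = (norm (pp u))\<^sup>2 + (norm (pn u))\<^sup>2"
  proof -
    have 1: "(norm (pp u - pn u))\<^sup>2 = (norm (pp u))\<^sup>2 + (norm (pn u))\<^sup>2"
      unfolding power2_norm_eq_inner by (simp add: inner_diff_left inner_diff_right pq)
    have 2: "(norm (pp u + pn u))\<^sup>2 = (norm (pp u))\<^sup>2 + (norm (pn u))\<^sup>2"
      unfolding power2_norm_eq_inner by (simp add: inner_add_left inner_add_right pq)
    show "(norm u)\<^sup>2 = (norm (pp u))\<^sup>2 + (norm (pn u))\<^sup>2" using 2 u_split by simp
    then have "(norm (\<iota> k))\<^sup>2 = (norm u)\<^sup>2" using 1 ik by simp
    then show "norm (\<iota> k) = norm u" by simp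
  qed
  have kH: "\<iota> k \<in> Hpm" unfolding ik using pp_Hp pn_Hm Hp_subset Hm_subset by (intro subspace_diff[OF subspaces(4)]) auto
  obtain x where xfar: "norm (\<iota> x) > r" and xV: "\<iota> x \<in> V"
    and mv: "inner (\<iota> (A ?w1) - \<iota> (A ?w2)) (\<iota> k) = inner (B x (\<iota> (?w1 - ?w2))) (\<iota> k)"
    by (rule reduced_graph_increment[OF z r seg])
  have sym: "inner (B x p) q = inner p (B x q)" for p q
    using B_selfadjoint[OF xV] by (simp add: selfadjoint_op_def)
  have "\<iota> (A ?w1) - \<iota> (A ?w2) \<in> ker_op Binf"
    using A_h_Xker z by (intro subspace_diff[OF subspaces(1)]) (auto simp: mem_Xker)
  then have "inner (\<iota> (A ?w1) - \<iota> (A ?w2)) (\<iota> k) = 0" by (rule orthogonal_compD[OF kH])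
  then have "inner (B x (\<iota> (?w1 - ?w2))) (\<iota> k) = 0" using mv by simp
  moreover have "\<iota> (?w1 - ?w2) = \<iota> (z1 - z2) + u" by (simp add: u_def incl.add incl.diff)
  ultimately have bal: "inner (B x u) (\<iota> k) = - inner (B x (\<iota> (z1 - z2))) (\<iota> k)"
    by (simp add: blinfun.add_right inner_add_left)
  have "a * (norm u)\<^sup>2 \<le> inner (B x (pp u)) (pp u) - inner (B x (pn u)) (pn u)"
    using far_Hp[of x "pp u"] far_Hm[of x "pn u"] pp_Hp pn_Hm xfar r unfolding nu by (simp add: distrib_left)
  also have "\<dots> = inner (B x (pp u + pn u)) (pp u - pn u)"
  proof -
    have "inner (B x (pp u)) (pn u) = inner (B x (pn u)) (pp u)"
      using sym[of "pp u" "pn u"] by (simp add: inner_commute)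
    then show ?thesis by (simp add: blinfun.add_right inner_add_left inner_diff_right)
  qed
  also have "\<dots> = inner (B x u) (\<iota> k)" using u_split ik by simp
  also have "\<dots> \<le> norm (B x (\<iota> (z1 - z2))) * norm (\<iota> k)"
    unfolding bal using Cauchy_Schwarz_ineq2[of "B x (\<iota> (z1 - z2))" "\<iota> k"] by linarith
  also have "\<dots> \<le> (e * norm (\<iota> (z1 - z2))) * norm u"
    unfolding nk using small[OF xfar, of "\<iota> (z1 - z2)"] zk by (intro mult_right_mono) (auto simp: mem_Xker)
  finally have "(a * norm u) * norm u \<le> (e * norm (\<iota> (z1 - z2))) * norm u"
    by (simp add: power2_eq_square mult.assoc)
  then have "a * norm u \<le> e * norm (\<iota> (z1 - z2)) \<or> norm u = 0"
    by (metis mult_right_le_imp_le norm_ge_zero order_le_less)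
  moreover have "0 \<le> e * norm (\<iota> (z1 - z2))"
    using small[OF xfar, of "\<iota> (z1 - z2)"] zk by (auto simp: mem_Xker intro: order_trans[OF norm_ge_zero])
  ultimately show "a * norm (\<iota> (h z1 - h z2)) \<le> e * norm (\<iota> (z1 - z2))" by (auto simp: u_def)
qed

text \<open>
Test the increment of \<open>A\<close> along the graph with itself. It lies in the kernel, and moving
the symmetric operator \<open>B(x)\<close> onto it makes it small.
\<close>
lemma gradient_segment_estimate:
  assumes z: "z1 \<in> W" "z2 \<in> W" and r: "r \<ge> R"
    and small: "\<And>x v. norm (\<iota> x) > r \<Longrightarrow> v \<in> ker_op Binf \<Longrightarrow> norm (B x v) \<le> e * norm v"
    and seg: "\<And>t. 0 \<le> t \<Longrightarrow> t \<le> 1 \<Longrightarrow> norm (\<iota> (z2 + t *\<^sub>R (z1 - z2))) > r"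
  shows "norm (\<iota> (A (z1 + h z1) - A (z2 + h z2))) \<le> e * norm (\<iota> ((z1 + h z1) - (z2 + h z2)))"
proof -
  let ?w1 = "z1 + h z1" and ?w2 = "z2 + h z2"
  define k where "k = A ?w1 - A ?w2"
  have kk: "\<iota> k \<in> ker_op Binf"
    using subspace_diff[OF subspace_Xker A_h_Xker[OF z(1)] A_h_Xker[OF z(2)]] by (simp add: k_def mem_Xker)
  obtain x where xfar: "norm (\<iota> x) > r" and xV: "\<iota> x \<in> V"
    and mv: "inner (\<iota> (A ?w1) - \<iota> (A ?w2)) (\<iota> k) = inner (B x (\<iota> (?w1 - ?w2))) (\<iota> k)"
    by (rule reduced_graph_increment[OF z r seg])
  have "norm (\<iota> k) * norm (\<iota> k) = inner (\<iota> (A ?w1) - \<iota> (A ?w2)) (\<iota> k)"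
    by (simp add: k_def incl.diff power2_norm_eq_inner[symmetric] power2_eq_square[symmetric])
  also have "\<dots> = inner (\<iota> (?w1 - ?w2)) (B x (\<iota> k))"
    using mv B_selfadjoint[OF xV] by (simp add: selfadjoint_op_def)
  also have "\<dots> \<le> norm (\<iota> (?w1 - ?w2)) * norm (B x (\<iota> k))" by (rule norm_cauchy_schwarz)
  also have "\<dots> \<le> norm (\<iota> (?w1 - ?w2)) * (e * norm (\<iota> k))" by (intro mult_left_mono small xfar kk) simp
  finally have "norm (\<iota> k) * norm (\<iota> k) \<le> (e * norm (\<iota> (?w1 - ?w2))) * norm (\<iota> k)" by (simp add: ac_simps)
  then have "norm (\<iota> k) \<le> e * norm (\<iota> (?w1 - ?w2)) \<or> norm (\<iota> k) = 0"
    by (metis mult_right_le_imp_le norm_ge_zero order_le_less)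
  moreover have "0 \<le> e * norm (\<iota> (?w1 - ?w2))"
  proof (cases "norm (\<iota> k) = 0")
    case True
    obtain v where v: "\<iota> v \<in> ker_op Binf" "norm (\<iota> v) = 1" using ker_norm_exists[of 1] by auto
    have "0 \<le> norm (B x (\<iota> v))" by simp
    also have "\<dots> \<le> e" using small[OF xfar v(1)] v(2) by simp
    finally have "0 \<le> e" .
    then show ?thesis by simp
  qed (use calculation in \<open>auto intro: order_trans[OF norm_ge_zero]\<close>)
  ultimately show "norm (\<iota> (A ?w1 - A ?w2)) \<le> e * norm (\<iota> (?w1 - ?w2))" by (auto simp: k_def)
qed

lemma dLinf_segment_estimate:
  assumes z: "z1 \<in> W" "z2 \<in> W" and r: "r \<ge> R" and e: "e \<ge> 0"
    and small: "\<And>x v. norm (\<iota> x) > r \<Longrightarrow> v \<in> ker_op Binf \<Longrightarrow> norm (B x v) \<le> e * norm v"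
    and seg: "\<And>t. 0 \<le> t \<Longrightarrow> t \<le> 1 \<Longrightarrow> norm (\<iota> (z2 + t *\<^sub>R (z1 - z2))) > r"
  shows "norm (K (A (z1 + h z1)) - K (A (z2 + h z2))) \<le> e * (1 + e / a) * norm (\<iota> (z1 - z2))"
proof -
  have "norm (\<iota> (h z1 - h z2)) \<le> e / a * norm (\<iota> (z1 - z2))"
    using h_segment_estimate[OF z r small seg] a_pos by (simp add: pos_le_divide_eq mult.commute)
  moreover have "\<iota> ((z1 + h z1) - (z2 + h z2)) = \<iota> (z1 - z2) + \<iota> (h z1 - h z2)" by (simp add: incl.add incl.diff)
  ultimately have 1: "norm (\<iota> ((z1 + h z1) - (z2 + h z2))) \<le> (1 + e / a) * norm (\<iota> (z1 - z2))"
    using norm_triangle_ineq[of "\<iota> (z1 - z2)" "\<iota> (h z1 - h z2)"] by (simp add: algebra_simps)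
  have "norm (K (A (z1 + h z1)) - K (A (z2 + h z2))) \<le> norm (\<iota> (A (z1 + h z1) - A (z2 + h z2)))"
    using norm_K[of "A (z1 + h z1) - A (z2 + h z2)"] by (simp add: linear_diff[OF bounded_linear.linear[OF bounded_linear_K]])
  also have "\<dots> \<le> e * norm (\<iota> ((z1 + h z1) - (z2 + h z2)))" by (rule gradient_segment_estimate[OF z r small seg])
  also have "\<dots> \<le> e * ((1 + e / a) * norm (\<iota> (z1 - z2)))" by (intro mult_left_mono 1 e)
  finally show ?thesis by (simp add: mult.assoc)
qed

lemma dLinf_locally_lipschitz: "locally_lipschitz_on W (\<lambda>z. K (A (z + h z)))"
  unfolding locally_lipschitz_on_def
proof
  fix z assume z: "z \<in> W"
  obtain d where d: "d > 0" "ball z d \<inter> Xker \<subseteq> W" using W_open[OF z] by blast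
  have "(1 + 1 / a)-lipschitz_on (W \<inter> ball z d) (\<lambda>z. K (A (z + h z)))"
  proof (rule lipschitz_onI)
    fix z1 z2 assume z12: "z1 \<in> W \<inter> ball z d" "z2 \<in> W \<inter> ball z d"
    have "norm (K (A (z1 + h z1)) - K (A (z2 + h z2))) \<le> 1 * (1 + 1 / a) * norm (\<iota> (z1 - z2))"
    proof (rule dLinf_segment_estimate)
      fix t :: real assume t: "0 \<le> t" "t \<le> 1"
      have "z2 + t *\<^sub>R (z1 - z2) = (1 - t) *\<^sub>R z2 + t *\<^sub>R z1" by (simp add: algebra_simps)
      then have "z2 + t *\<^sub>R (z1 - z2) \<in> ball z d" using convexD[OF convex_ball[of z d], of z2 z1 "1 - t" t] z12 t by auto
      moreover have "z2 + t *\<^sub>R (z1 - z2) \<in> Xker"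
        using z12 by (intro subspace_add[OF subspace_Xker] subspace_scale[OF subspace_Xker] subspace_diff[OF subspace_Xker]) (auto simp: mem_W)
      ultimately show "norm (\<iota> (z2 + t *\<^sub>R (z1 - z2))) > R" using d(2) by (auto simp: mem_W)
    qed (use z12 far_ker in auto)
    also have "\<dots> \<le> (1 + 1 / a) * norm (z1 - z2)" using incl_norm[of "z1 - z2"] a_pos by (simp add: mult_left_mono)
    finally show "dist (K (A (z1 + h z1))) (K (A (z2 + h z2))) \<le> (1 + 1 / a) * dist z1 z2" by (simp add: dist_norm)
  qed (use a_pos in simp)
  then show "\<exists>r>0. \<exists>C. C-lipschitz_on (W \<inter> ball z r) (\<lambda>z. K (A (z + h z)))" using d(1) by blast
qed

text \<open>
Equivalence of the two norms on the kernel, since the projection onto it is bounded from \<open>H\<close> to \<open>X\<close>.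
\<close>
lemma Xker_norm_bound: "\<exists>c>0. \<forall>z\<in>Xker. norm z \<le> c * norm (\<iota> z)"
proof -
  obtain c where c: "c > 0" "\<And>u. norm (j0 u) \<le> norm u * c"
    using bounded_linear.pos_bounded[OF bounded_linear_lift[of ker_frame]] by blast
  have "norm z \<le> c * norm (\<iota> z)" if "z \<in> Xker" for z
    using c(2)[of "\<iota> z"] j0_id[OF that] by (simp add: mult.commute)
  then show ?thesis using c(1) by blast
qed

text \<open>
The exterior of a ball in the kernel is not convex, and it is disconnected if the kernel is a line, so a Lipschitz
bound along far segments does not directly compare arbitrary far points. But if the segment meets the
ball of radius \<open>r\<close>, then \<open>\<parallel>z1 - z2\<parallel> \<ge> \<parallel>z1\<parallel> + \<parallel>z2\<parallel> - 2 r\<close>; and radial segments bound \<open>\<parallel>f z\<parallel>\<close> by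
\<open>(\<epsilon> / 2) \<parallel>z\<parallel> + M\<close>, where \<open>M\<close> bounds \<open>f\<close> on a compact sphere.
\<close>
lemma strict_deriv_zero_from_segments:
  fixes f :: "'x \<Rightarrow> 'b::real_normed_vector"
  assumes cont: "continuous_on W f"
    and seg: "\<And>e. e > 0 \<Longrightarrow> \<exists>r. \<forall>z1\<in>W. \<forall>z2\<in>W. (\<forall>t. 0 \<le> t \<longrightarrow> t \<le> 1 \<longrightarrow> norm (\<iota> (z2 + t *\<^sub>R (z1 - z2))) > r) \<longrightarrow>
        norm (f z1 - f z2) \<le> e * norm (\<iota> (z1 - z2))"
  shows "has_strict_deriv_at_infinity W f (\<lambda>_. 0)"
proof (rule strict_deriv_at_infinityI)
  fix e :: real assume e: "e > 0"
  obtain r0 where r0: "\<And>z1 z2. z1 \<in> W \<Longrightarrow> z2 \<in> W \<Longrightarrow>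
      (\<And>t. 0 \<le> t \<Longrightarrow> t \<le> 1 \<Longrightarrow> norm (\<iota> (z2 + t *\<^sub>R (z1 - z2))) > r0) \<Longrightarrow>
        norm (f z1 - f z2) \<le> e / 2 * norm (\<iota> (z1 - z2))"
    using seg[of "e / 2"] e by auto
  define r where "r = max r0 R"
  have r: "r \<ge> R" "r > 0" "r \<ge> r0" using R_pos by (auto simp: r_def)
  \<comment> \<open>the sphere must lie strictly outside the ball of radius \<open>r\<close>\<close>
  define m where "m = r + 1"
  define Sp where "Sp = j0 ` (span ker_frame \<inter> cball 0 m \<inter> sphere 0 m)"
  have "compact (span ker_frame \<inter> cball 0 m \<inter> sphere 0 m)"
    unfolding sphere_def by (intro compact_Int_closed kf.compact_span_cball closed_Collect_eq continuous_intros)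
  then have "compact Sp" unfolding Sp_def
    by (rule compact_continuous_image[rotated]) (intro bounded_linear.continuous_on[OF bounded_linear_lift] continuous_on_id)
  moreover have SpW: "q \<in> W" if "q \<in> Sp" for q
    using that r by (auto simp: Sp_def mem_W j0_Xker incl_j0 p0_def kf.frame_proj_id m_def)
  ultimately have "compact (f ` Sp)"
    by (intro compact_continuous_image continuous_on_subset[OF cont]) auto
  then have "bounded (f ` Sp)" by (rule compact_imp_bounded)
  then obtain M where M: "\<And>q. q \<in> Sp \<Longrightarrow> norm (f q) \<le> M" unfolding bounded_iff by blast
  have Sp_mem: "q \<in> Sp" if "q \<in> Xker" "norm (\<iota> q) = m" for q
    using that j0_id[of q] unfolding Sp_def
    by (intro image_eqI[of _ _ "\<iota> q"]) (auto simp: mem_Xker ker_op_eq)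
  have growth: "norm (f z) \<le> e / 2 * norm (\<iota> z) + M" if z: "z \<in> W" "norm (\<iota> z) \<ge> m" for z
  proof -
    define q where "q = (m / norm (\<iota> z)) *\<^sub>R z"
    have nz: "norm (\<iota> z) > 0" using z(2) r unfolding m_def by linarith
    have q: "q \<in> Xker" "norm (\<iota> q) = m"
      using z nz r subspace_scale[OF subspace_Xker] by (auto simp: q_def mem_W incl.scaleR m_def)
    have "norm (f z - f q) \<le> e / 2 * norm (\<iota> (z - q))"
    proof (rule r0[OF z(1) SpW[OF Sp_mem[OF q]]])
      fix t :: real assume t: "0 \<le> t" "t \<le> 1"
      define s where "s = m / norm (\<iota> z)"
      have s: "0 < s" "s \<le> 1" using nz z(2) r by (auto simp: s_def m_def)
      have "q + t *\<^sub>R (z - q) = (s + t * (1 - s)) *\<^sub>R z" by (simp add: q_def s_def[symmetric] algebra_simps)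
      then have "norm (\<iota> (q + t *\<^sub>R (z - q))) = (s + t * (1 - s)) * norm (\<iota> z)"
        using s t by (simp add: incl.scaleR)
      also have "\<dots> \<ge> s * norm (\<iota> z)" using s t by (intro mult_right_mono) auto
      also have "s * norm (\<iota> z) = m" using nz by (simp add: s_def)
      finally show "norm (\<iota> (q + t *\<^sub>R (z - q))) > r0" using r by (simp add: m_def)
    qed
    also have "norm (\<iota> (z - q)) \<le> norm (\<iota> z)"
    proof -
      define s where "s = m / norm (\<iota> z)"
      have s: "0 < s" "s \<le> 1" using nz z(2) r by (auto simp: s_def m_def)
      have "z - q = (1 - s) *\<^sub>R z" by (simp add: q_def s_def algebra_simps)
      then have "norm (\<iota> (z - q)) = (1 - s) * norm (\<iota> z)" using s by (simp add: incl.scaleR)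
      also have "\<dots> \<le> 1 * norm (\<iota> z)" using s by (intro mult_right_mono) auto
      finally show ?thesis by simp
    qed
    finally have "norm (f z - f q) \<le> e / 2 * norm (\<iota> z)" using e by simp
    then show ?thesis using M[OF Sp_mem[OF q]] norm_triangle_ineq[of "f z - f q" "f q"] by simp
  qed
  \<comment> \<open>beyond this radius half of \<open>\<epsilon> (\<parallel>z1\<parallel> + \<parallel>z2\<parallel>)\<close> absorbs \<open>2 M + 2 r \<epsilon>\<close>\<close>
  define Nn where "Nn = max m ((2 * M + 2 * r * e) / e)"
  obtain c where c: "c > 0" "\<And>z. z \<in> Xker \<Longrightarrow> norm z \<le> c * norm (\<iota> z)" using Xker_norm_bound by blast
  have "norm (f z1 - f z2 - 0) \<le> e * norm (z1 - z2)"
    if z: "z1 \<in> W" "z2 \<in> W" and big: "norm z1 \<ge> c * Nn" "norm z2 \<ge> c * Nn" for z1 z2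
  proof -
    have N1: "norm (\<iota> z) \<ge> Nn" if "z \<in> W" "norm z \<ge> c * Nn" for z
    proof -
      have "c * Nn \<le> c * norm (\<iota> z)" using c(2)[of z] that by (simp add: mem_W)
      then show ?thesis using c(1) by simp
    qed
    have n1: "norm (\<iota> z1) \<ge> Nn" and n2: "norm (\<iota> z2) \<ge> Nn" using N1 z big by auto
    have fin: "norm (f z1 - f z2) \<le> e * norm (\<iota> (z1 - z2))"
    proof (cases "\<forall>t. 0 \<le> t \<longrightarrow> t \<le> 1 \<longrightarrow> norm (\<iota> (z2 + t *\<^sub>R (z1 - z2))) > r")
      case True
      then have "norm (f z1 - f z2) \<le> e / 2 * norm (\<iota> (z1 - z2))"
        using r(3) by (intro r0[OF z]) (auto intro: le_less_trans)
      also have "\<dots> \<le> e * norm (\<iota> (z1 - z2))" using e by (intro mult_right_mono) auto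
      finally show ?thesis .
    next
      case False
      then obtain t where t: "0 \<le> t" "t \<le> 1" "norm (\<iota> (z2 + t *\<^sub>R (z1 - z2))) \<le> r" by (auto simp: not_less)
      define p where "p = z2 + t *\<^sub>R (z1 - z2)"
      have "z1 - p = (1 - t) *\<^sub>R (z1 - z2)" "p - z2 = t *\<^sub>R (z1 - z2)" by (simp_all add: p_def algebra_simps)
      then have "norm (\<iota> (z1 - p)) = (1 - t) * norm (\<iota> (z1 - z2))" "norm (\<iota> (p - z2)) = t * norm (\<iota> (z1 - z2))"
        using t by (simp_all add: incl.scaleR)
      then have sum: "norm (\<iota> (z1 - p)) + norm (\<iota> (p - z2)) = norm (\<iota> (z1 - z2))" by (simp add: algebra_simps)
      have "norm (\<iota> z1) - r \<le> norm (\<iota> (z1 - p))" "norm (\<iota> z2) - r \<le> norm (\<iota> (p - z2))"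
        using norm_triangle_ineq2[of "\<iota> z1" "\<iota> p"] norm_triangle_ineq2[of "\<iota> z2" "\<iota> p"] t(3)
        by (simp_all add: p_def[symmetric] incl.diff norm_minus_commute)
      then have low: "norm (\<iota> z1) + norm (\<iota> z2) - 2 * r \<le> norm (\<iota> (z1 - z2))" using sum by linarith
      have "norm (f z1 - f z2) \<le> norm (f z1) + norm (f z2)" by (rule norm_triangle_ineq4)
      also have "\<dots> \<le> e / 2 * (norm (\<iota> z1) + norm (\<iota> z2)) + 2 * M"
        using growth[OF z(1)] growth[OF z(2)] n1 n2 by (simp add: Nn_def algebra_simps)
      also have "\<dots> \<le> e * (norm (\<iota> z1) + norm (\<iota> z2) - 2 * r)"
      proof -
        have "(2 * M + 2 * r * e) / e \<le> norm (\<iota> z1)" "(2 * M + 2 * r * e) / e \<le> norm (\<iota> z2)"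
          using n1 n2 by (auto simp: Nn_def)
        then have "2 * M + 2 * r * e \<le> e * norm (\<iota> z1)" "2 * M + 2 * r * e \<le> e * norm (\<iota> z2)"
          using e by (simp_all add: pos_divide_le_eq mult.commute)
        then show ?thesis by (simp add: algebra_simps)
      qed
      also have "\<dots> \<le> e * norm (\<iota> (z1 - z2))" using low e by (intro mult_left_mono) auto
      finally show ?thesis .
    qed
    also have "\<dots> \<le> e * norm (z1 - z2)" using e incl_norm by (intro mult_left_mono) auto
    finally show ?thesis by simp
  qed
  then show "\<exists>N. \<forall>x1\<in>W. \<forall>x2\<in>W. N \<le> norm x1 \<longrightarrow> N \<le> norm x2 \<longrightarrow> norm (f x1 - f x2 - 0) \<le> e * norm (x1 - x2)"
    by (intro exI[of _ "c * Nn"]) auto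
qed

lemma incl_h_strict: "has_strict_deriv_at_infinity W (\<lambda>z. \<iota> (h z)) (\<lambda>_. 0)"
proof (rule strict_deriv_zero_from_segments)
  show "continuous_on W (\<lambda>z. \<iota> (h z))" by (intro incl.continuous_on h_continuous)
  fix e :: real assume e: "e > 0"
  then obtain r where r: "\<And>x v. norm (\<iota> x) > r \<Longrightarrow> v \<in> ker_op Binf \<Longrightarrow> norm (B x v) \<le> (a * e) * norm v"
    using B_small_on_ker_far[of "a * e"] a_pos by auto
  have "norm (\<iota> (h z1) - \<iota> (h z2)) \<le> e * norm (\<iota> (z1 - z2))"
    if "z1 \<in> W" "z2 \<in> W" "\<forall>t. 0 \<le> t \<longrightarrow> t \<le> 1 \<longrightarrow> norm (\<iota> (z2 + t *\<^sub>R (z1 - z2))) > max r R" for z1 z2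
  proof -
    have "a * norm (\<iota> (h z1 - h z2)) \<le> (a * e) * norm (\<iota> (z1 - z2))"
      by (rule h_segment_estimate[OF that(1,2), of "max r R"]) (use r that(3) in auto)
    then show ?thesis using a_pos by (simp add: incl.diff mult.assoc)
  qed
  then show "\<exists>r. \<forall>z1\<in>W. \<forall>z2\<in>W. (\<forall>t. 0 \<le> t \<longrightarrow> t \<le> 1 \<longrightarrow> norm (\<iota> (z2 + t *\<^sub>R (z1 - z2))) > r) \<longrightarrow>
        norm (\<iota> (h z1) - \<iota> (h z2)) \<le> e * norm (\<iota> (z1 - z2))"
    by (intro exI[of _ "max r R"]) blast
qed

lemma dLinf_strict: "has_strict_deriv_at_infinity W (\<lambda>z. K (A (z + h z))) (\<lambda>_. 0)"
proof (rule strict_deriv_zero_from_segments[OF dLinf_continuous])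
  fix e :: real assume e: "e > 0"
  \<comment> \<open>\<open>d \<le> 1\<close> allows to bound the factor \<open>1 + d / a\<close> by \<open>1 + 1 / a\<close>\<close>
  define d where "d = min 1 (e / (1 + 1 / a))"
  have d: "d > 0" "d \<le> 1" "d * (1 + 1 / a) \<le> e"
    using e a_pos by (auto simp: d_def min_def field_simps add_pos_pos)
  obtain r where r: "\<And>x v. norm (\<iota> x) > r \<Longrightarrow> v \<in> ker_op Binf \<Longrightarrow> norm (B x v) \<le> d * norm v"
    using B_small_on_ker_far[OF d(1)] by auto
  have "norm (K (A (z1 + h z1)) - K (A (z2 + h z2))) \<le> e * norm (\<iota> (z1 - z2))"
    if "z1 \<in> W" "z2 \<in> W" "\<forall>t. 0 \<le> t \<longrightarrow> t \<le> 1 \<longrightarrow> norm (\<iota> (z2 + t *\<^sub>R (z1 - z2))) > max r R" for z1 z2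
  proof -
    have "norm (K (A (z1 + h z1)) - K (A (z2 + h z2))) \<le> d * (1 + d / a) * norm (\<iota> (z1 - z2))"
      by (rule dLinf_segment_estimate[OF that(1,2), of "max r R"]) (use r that(3) d in auto)
    also have "d * (1 + d / a) \<le> d * (1 + 1 / a)"
      using d a_pos by (intro mult_left_mono add_left_mono divide_right_mono) auto
    also have "\<dots> \<le> e" by (rule d(3))
    finally show ?thesis by (simp add: mult_right_mono)
  qed
  then show "\<exists>r. \<forall>z1\<in>W. \<forall>z2\<in>W. (\<forall>t. 0 \<le> t \<longrightarrow> t \<le> 1 \<longrightarrow> norm (\<iota> (z2 + t *\<^sub>R (z1 - z2))) > r) \<longrightarrow>
        norm (K (A (z1 + h z1)) - K (A (z2 + h z2))) \<le> e * norm (\<iota> (z1 - z2))"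
    by (intro exI[of _ "max r R"]) blast
qed

end

context reduction_setting
begin

section \<open>Convexity and concavity of the functional\<close>

lemma L_tendsto:
  assumes "(f \<longlongrightarrow> u) F" "u \<in> V"
  shows "((\<lambda>s. L (f s)) \<longlongrightarrow> L u) F"
proof -
  have "isCont L u" using L_cont V_open assms(2) by (simp add: continuous_on_eq_continuous_at)
  then show ?thesis using assms(1) by (rule isCont_tendsto_compose)
qed

lemma L_line_deriv:
  assumes "\<iota> (w + t *\<^sub>R k) \<in> V"
  shows "((\<lambda>t. L (\<iota> (w + t *\<^sub>R k))) has_real_derivative inner (\<iota> (A (w + t *\<^sub>R k))) (\<iota> k)) (at t)"
proof -
  have "((\<lambda>t. L (\<iota> w + t *\<^sub>R \<iota> k)) has_vector_derivative dir_deriv L (\<iota> w + t *\<^sub>R \<iota> k) (\<iota> k)) (at t)"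
    using assms by (intro dir_deriv_vector_derivative[OF L_diff]) (simp add: incl.add incl.scaleR)
  then show ?thesis
    using A_gradient[OF assms, of k] unfolding has_real_derivative_iff_has_vector_derivative
    by (simp add: incl.add incl.scaleR)
qed

text \<open>
The second derivative of \<open>t \<mapsto> s \<L>(w + t k)\<close> is \<open>s \<langle>B(w + t k) k, k\<rangle>\<close>, so this function minus
\<open>(a / 2) \<parallel>k\<parallel>\<^sup>2 t\<^sup>2\<close> is convex. The sign \<open>s\<close> covers convexity on \<open>H\<^sup>+\<close> and concavity on \<open>H\<^sup>-\<close> at once.
\<close>
lemma line_second_order:
  assumes V: "\<And>t. 0 \<le> t \<Longrightarrow> t \<le> 1 \<Longrightarrow> \<iota> (w + t *\<^sub>R k) \<in> V"
    and form: "\<And>t. 0 \<le> t \<Longrightarrow> t \<le> 1 \<Longrightarrow> a * (norm (\<iota> k))\<^sup>2 \<le> s * inner (B (w + t *\<^sub>R k) (\<iota> k)) (\<iota> k)"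
  shows "0 \<le> t \<Longrightarrow> t \<le> 1 \<Longrightarrow> s * L (\<iota> (w + t *\<^sub>R k)) + a / 2 * t * (1 - t) * (norm (\<iota> k))\<^sup>2
            \<le> (1 - t) * (s * L (\<iota> w)) + t * (s * L (\<iota> (w + k)))"
    and "s * inner (\<iota> (A w)) (\<iota> k) + a / 2 * (norm (\<iota> k))\<^sup>2 \<le> s * L (\<iota> (w + k)) - s * L (\<iota> w)"
proof -
  define c where "c = (norm (\<iota> k))\<^sup>2"
  define f where "f t = s * L (\<iota> (w + t *\<^sub>R k)) - a / 2 * c * t\<^sup>2" for t
  define f' where "f' t = s * inner (\<iota> (A (w + t *\<^sub>R k))) (\<iota> k) - a * c * t" for t
  define f'' where "f'' t = s * inner (B (w + t *\<^sub>R k) (\<iota> k)) (\<iota> k) - a * c" for t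
  have d1: "(f has_real_derivative f' t) (at t)" if t: "t \<in> {0..1}" for t
    unfolding f_def f'_def
    by (rule derivative_eq_intros L_line_deriv V refl | use t in simp)+
  have d2: "(f' has_real_derivative f'' t) (at t)" if t: "t \<in> {0..1}" for t
    unfolding f'_def f''_def
    by (rule derivative_eq_intros A_line_deriv V refl | use t in simp)+
  have pos: "f'' t \<ge> 0" if "t \<in> {0..1}" for t
    using form[of t] that by (simp add: f''_def c_def)
  have "convex_on {0..1} f" by (rule f''_ge0_imp_convex[OF _ d1 d2 pos]) auto
  then have cvx: "f ((1 - t) * 0 + t * 1) \<le> (1 - t) * f 0 + t * f 1" if "0 \<le> t" "t \<le> 1" for t
    using convex_onD[of "{0..1}" f t 0 1] that by simp
  show "s * L (\<iota> (w + t *\<^sub>R k)) + a / 2 * t * (1 - t) * (norm (\<iota> k))\<^sup>2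
            \<le> (1 - t) * (s * L (\<iota> w)) + t * (s * L (\<iota> (w + k)))" if t: "0 \<le> t" "t \<le> 1"
  proof -
    have "s * L (\<iota> (w + t *\<^sub>R k)) - a / 2 * c * t\<^sup>2 \<le> (1 - t) * (s * L (\<iota> w)) + t * (s * L (\<iota> (w + k)) - a / 2 * c)"
      using cvx[OF t] by (simp add: f_def)
    moreover have "a / 2 * t * (1 - t) * c = t * (a / 2 * c) - a / 2 * c * t\<^sup>2"
      by (simp add: power2_eq_square field_simps)
    ultimately show ?thesis unfolding c_def[symmetric] by (simp add: right_diff_distrib)
  qed
  have "f' 0 * (1 - 0) \<le> f 1 - f 0"
    by (rule f''_imp_f'[of "{0..1}" f f' f'' 0 1, OF _ d1 d2 pos]) auto
  then show "s * inner (\<iota> (A w)) (\<iota> k) + a / 2 * (norm (\<iota> k))\<^sup>2 \<le> s * L (\<iota> (w + k)) - s * L (\<iota> w)"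
    by (simp add: f_def f'_def c_def)
qed

text \<open>
\<open>\<L>\<close> on the affine space \<open>z + H\<^sup>\<plusminus>\<close>, with the critical point \<open>z + h z\<close> of this restriction as
origin.
\<close>
definition J :: "'x \<Rightarrow> 'h \<Rightarrow> 'h \<Rightarrow> real"
  where "J z x y = L (\<iota> (z + h z) + x + y) - L (\<iota> (z + h z))"

lemma Hp_Hpm: "x \<in> Hp \<Longrightarrow> x \<in> Hpm" and Hm_Hpm: "y \<in> Hm \<Longrightarrow> y \<in> Hpm"
  using Hp_subset Hm_subset by blast+

lemma point_far: "z \<in> W \<Longrightarrow> u \<in> Hpm \<Longrightarrow> norm (\<iota> (z + h z) + u) > R"
  using norm_ker_le[of "\<iota> z" "\<iota> (h z) + u"] subspace_add[OF subspaces(4), of "\<iota> (h z)" u] h(1)[of z]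
  by (simp add: mem_W mem_Xker mem_Xpm incl.add add.assoc)

lemma point_V: "z \<in> W \<Longrightarrow> x \<in> Hp \<Longrightarrow> y \<in> Hm \<Longrightarrow> \<iota> (z + h z) + x + y \<in> V"
  using point_far[of z "x + y"] subspace_add[OF subspaces(4) Hp_Hpm Hm_Hpm, of x y]
  by (intro far_V) (simp add: add.assoc)

lemma Hm_lift: "y \<in> Hm \<Longrightarrow> \<iota> (jn y) = y"
  by (simp add: incl_jn pn_id)

lemma line_far:
  assumes "z \<in> W" "\<iota> x \<in> Hpm"
  shows "norm (\<iota> (z + h z + x)) > R" "\<iota> (z + h z + x) \<in> V"
  using point_far[OF assms] far_V by (simp_all add: incl.add)

text \<open>
On \<open>H\<^sup>+ \<inter> X\<close> this is the second order estimate along a segment of \<open>X\<close>; both sides are continuous in \<open>x\<close> for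
the norm of \<open>H\<close>, and \<open>H\<^sup>+ \<inter> X\<close> is dense in \<open>H\<^sup>+\<close>.
\<close>
lemma J_convex:
  assumes z: "z \<in> W" and x: "x \<in> Hp" and y: "y \<in> Hm" and t: "0 \<le> t" "t \<le> 1"
  shows "J z (t *\<^sub>R x) y \<le> t * J z x y + (1 - t) * J z 0 y"
proof -
  obtain f where f: "\<And>n::nat. \<iota> (f n) \<in> Hp" "(\<lambda>n. \<iota> (f n)) \<longlonglongrightarrow> x" using Hp_dense[OF x] by blast
  note s = subspace_add[OF subspaces(4)] subspace_scale[OF subspaces(4)]
  let ?p = "\<iota> (z + h z)"
  have "L (?p + t *\<^sub>R \<iota> (f n) + y) \<le> (1 - t) * L (?p + 0 + y) + t * L (?p + \<iota> (f n) + y)" for n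
  proof -
    let ?w = "z + h z + jn y"
    have H: "\<iota> (jn y + r *\<^sub>R f n) \<in> Hpm" for r
      using Hp_Hpm[OF f(1)] Hm_Hpm[OF y] by (simp add: incl.add incl.scaleR Hm_lift[OF y] s)
    have "1 * L (\<iota> (?w + t *\<^sub>R f n)) + a / 2 * t * (1 - t) * (norm (\<iota> (f n)))\<^sup>2
        \<le> (1 - t) * (1 * L (\<iota> ?w)) + t * (1 * L (\<iota> (?w + f n)))"
    proof (rule line_second_order(1)[OF _ _ t])
      fix r :: real
      have 1: "norm (\<iota> (?w + r *\<^sub>R f n)) > R" "\<iota> (?w + r *\<^sub>R f n) \<in> V"
        using line_far[OF z H[of r]] by (simp_all add: add.assoc)
      show "\<iota> (?w + r *\<^sub>R f n) \<in> V" by (rule 1)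
      show "a * (norm (\<iota> (f n)))\<^sup>2 \<le> 1 * inner (B (?w + r *\<^sub>R f n) (\<iota> (f n))) (\<iota> (f n))"
        using far_Hp[OF 1(1) f(1)] by simp
    qed
    moreover have "0 \<le> a / 2 * t * (1 - t) * (norm (\<iota> (f n)))\<^sup>2" using a_pos t by simp
    ultimately have "L (\<iota> (?w + t *\<^sub>R f n)) \<le> (1 - t) * L (\<iota> ?w) + t * L (\<iota> (?w + f n))" by linarith
    then show ?thesis by (simp add: incl.add incl.scaleR Hm_lift[OF y] add_ac)
  qed
  moreover have "(\<lambda>n. L (?p + t *\<^sub>R \<iota> (f n) + y)) \<longlonglongrightarrow> L (?p + t *\<^sub>R x + y)"
    by (intro L_tendsto tendsto_intros f point_V z y subspace_scale[OF subspaces(2)] x)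
  moreover have "(\<lambda>n. (1 - t) * L (?p + 0 + y) + t * L (?p + \<iota> (f n) + y)) \<longlonglongrightarrow> (1 - t) * L (?p + 0 + y) + t * L (?p + x + y)"
    by (intro L_tendsto tendsto_intros f point_V z y x)
  ultimately have "L (?p + t *\<^sub>R x + y) \<le> (1 - t) * L (?p + 0 + y) + t * L (?p + x + y)"
    by (intro LIMSEQ_le[of "\<lambda>n. L (?p + t *\<^sub>R \<iota> (f n) + y)"]) auto
  then show ?thesis by (simp add: J_def algebra_simps)
qed

lemma J_concave:
  assumes z: "z \<in> W" and x: "x \<in> Hp" and y: "y1 \<in> Hm" "y2 \<in> Hm" and t: "0 \<le> t" "t \<le> 1"
  shows "(1 - t) * J z x y1 + t * J z x y2 + a / 2 * t * (1 - t) * (norm (y1 - y2))\<^sup>2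
        \<le> J z x ((1 - t) *\<^sub>R y1 + t *\<^sub>R y2)"
proof -
  obtain f where f: "\<And>n::nat. \<iota> (f n) \<in> Hp" "(\<lambda>n. \<iota> (f n)) \<longlonglongrightarrow> x" using Hp_dense[OF x] by blast
  note s = subspace_add[OF subspaces(4)] subspace_scale[OF subspaces(4)]
  let ?p = "\<iota> (z + h z)"
  define k where "k = jn y2 - jn y1"
  have ik: "\<iota> k = y2 - y1" by (simp add: k_def incl.diff Hm_lift y)
  have kH: "\<iota> k \<in> Hm" unfolding ik by (intro subspace_diff[OF subspaces(3)] y)
  have yt: "(1 - t) *\<^sub>R y1 + t *\<^sub>R y2 = y1 + t *\<^sub>R (y2 - y1)" by (simp add: algebra_simps)
  have ytH: "(1 - t) *\<^sub>R y1 + t *\<^sub>R y2 \<in> Hm"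
    by (intro subspace_add[OF subspaces(3)] subspace_scale[OF subspaces(3)] y)
  have "(1 - t) * L (?p + \<iota> (f n) + y1) + t * L (?p + \<iota> (f n) + y2) + a / 2 * t * (1 - t) * (norm (y1 - y2))\<^sup>2
      \<le> L (?p + \<iota> (f n) + ((1 - t) *\<^sub>R y1 + t *\<^sub>R y2))" for n
  proof -
    let ?w = "z + h z + (f n + jn y1)"
    have H: "\<iota> (f n + jn y1 + r *\<^sub>R k) \<in> Hpm" for r
      using Hp_Hpm[OF f(1)] Hm_Hpm[OF y(1)] Hm_Hpm[OF kH] by (simp add: incl.add incl.scaleR Hm_lift[OF y(1)] s)
    have "- 1 * L (\<iota> (?w + t *\<^sub>R k)) + a / 2 * t * (1 - t) * (norm (\<iota> k))\<^sup>2
        \<le> (1 - t) * (- 1 * L (\<iota> ?w)) + t * (- 1 * L (\<iota> (?w + k)))"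
    proof (rule line_second_order(1)[OF _ _ t])
      fix r :: real
      have 1: "norm (\<iota> (?w + r *\<^sub>R k)) > R" "\<iota> (?w + r *\<^sub>R k) \<in> V"
        using line_far[OF z H[of r]] by (simp_all add: add.assoc)
      show "\<iota> (?w + r *\<^sub>R k) \<in> V" by (rule 1)
      show "a * (norm (\<iota> k))\<^sup>2 \<le> - 1 * inner (B (?w + r *\<^sub>R k) (\<iota> k)) (\<iota> k)"
        using far_Hm[OF 1(1) kH] by simp
    qed
    moreover have "\<iota> (?w + t *\<^sub>R k) = ?p + \<iota> (f n) + ((1 - t) *\<^sub>R y1 + t *\<^sub>R y2)"
      unfolding yt by (simp add: incl.add incl.scaleR ik Hm_lift y add_ac)
    moreover have "\<iota> ?w = ?p + \<iota> (f n) + y1" by (simp add: incl.add Hm_lift y add_ac)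
    moreover have "\<iota> (?w + k) = ?p + \<iota> (f n) + y2" by (simp add: incl.add ik Hm_lift y add_ac)
    ultimately show ?thesis by (simp add: ik norm_minus_commute)
  qed
  moreover have "(\<lambda>n. L (?p + \<iota> (f n) + ((1 - t) *\<^sub>R y1 + t *\<^sub>R y2))) \<longlonglongrightarrow> L (?p + x + ((1 - t) *\<^sub>R y1 + t *\<^sub>R y2))"
    by (rule L_tendsto) (intro tendsto_intros f, rule point_V[OF z x ytH])
  moreover have "(\<lambda>n. (1 - t) * L (?p + \<iota> (f n) + y1) + t * L (?p + \<iota> (f n) + y2) + a / 2 * t * (1 - t) * (norm (y1 - y2))\<^sup>2)
      \<longlonglongrightarrow> (1 - t) * L (?p + x + y1) + t * L (?p + x + y2) + a / 2 * t * (1 - t) * (norm (y1 - y2))\<^sup>2"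
    by (intro L_tendsto tendsto_intros f point_V z y x)
  ultimately have "(1 - t) * L (?p + x + y1) + t * L (?p + x + y2) + a / 2 * t * (1 - t) * (norm (y1 - y2))\<^sup>2
      \<le> L (?p + x + ((1 - t) *\<^sub>R y1 + t *\<^sub>R y2))"
    by (intro LIMSEQ_le[of "\<lambda>n. (1 - t) * L (?p + \<iota> (f n) + y1) + t * L (?p + \<iota> (f n) + y2) + a / 2 * t * (1 - t) * (norm (y1 - y2))\<^sup>2"]) auto
  then show ?thesis by (simp add: J_def algebra_simps)
qed

lemma gradient_vanishes: "z \<in> W \<Longrightarrow> \<iota> k \<in> Hpm \<Longrightarrow> inner (\<iota> (A (z + h z))) (\<iota> k) = 0"
  using orthogonal_compD[of "\<iota> k" "ker_op Binf" "\<iota> (A (z + h z))"] A_h_Xker[of z] by (simp add: mem_Xker)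

text \<open>
At \<open>z + h z\<close> the derivative of \<open>\<L>\<close> in directions of \<open>X\<^sup>\<plusminus>\<close> vanishes, so only the second
order term of the estimate remains; density extends it from \<open>X\<close>.
\<close>
lemma J_lower:
  assumes z: "z \<in> W" and x: "x \<in> Hp"
  shows "a / 2 * (norm x)\<^sup>2 \<le> J z x 0"
proof -
  obtain f where f: "\<And>n::nat. \<iota> (f n) \<in> Hp" "(\<lambda>n. \<iota> (f n)) \<longlonglongrightarrow> x" using Hp_dense[OF x] by blast
  let ?p = "\<iota> (z + h z)"
  have "a / 2 * (norm (\<iota> (f n)))\<^sup>2 \<le> L (?p + \<iota> (f n) + 0) - L ?p" for n
  proof -
    have H: "\<iota> (r *\<^sub>R f n) \<in> Hpm" for r
      using Hp_Hpm[OF f(1)] by (simp add: incl.scaleR subspace_scale[OF subspaces(4)])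
    have "1 * inner (\<iota> (A (z + h z))) (\<iota> (f n)) + a / 2 * (norm (\<iota> (f n)))\<^sup>2 \<le> 1 * L (\<iota> (z + h z + f n)) - 1 * L ?p"
    proof (rule line_second_order(2))
      fix r :: real
      show "\<iota> (z + h z + r *\<^sub>R f n) \<in> V" by (rule line_far[OF z H[of r]])
      show "a * (norm (\<iota> (f n)))\<^sup>2 \<le> 1 * inner (B (z + h z + r *\<^sub>R f n) (\<iota> (f n))) (\<iota> (f n))"
        using far_Hp[OF line_far(1)[OF z H[of r]] f(1)] by simp
    qed
    then show ?thesis using gradient_vanishes[OF z Hp_Hpm[OF f(1)]] by (simp add: incl.add)
  qed
  moreover have "(\<lambda>n. a / 2 * (norm (\<iota> (f n)))\<^sup>2) \<longlonglongrightarrow> a / 2 * (norm x)\<^sup>2" by (intro tendsto_intros f)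
  moreover have "(\<lambda>n. L (?p + \<iota> (f n) + 0) - L ?p) \<longlonglongrightarrow> L (?p + x + 0) - L ?p"
    by (intro L_tendsto tendsto_intros f point_V z x subspace_0[OF subspaces(3)])
  ultimately have "a / 2 * (norm x)\<^sup>2 \<le> L (?p + x + 0) - L ?p"
    by (intro LIMSEQ_le[of "\<lambda>n. a / 2 * (norm (\<iota> (f n)))\<^sup>2"]) auto
  then show ?thesis by (simp add: J_def)
qed

lemma J_upper:
  assumes z: "z \<in> W" and y: "y \<in> Hm"
  shows "J z 0 y \<le> 0"
proof -
  have H: "\<iota> (r *\<^sub>R jn y) \<in> Hpm" for r
    using Hm_Hpm[OF y] by (simp add: incl.scaleR Hm_lift[OF y] subspace_scale[OF subspaces(4)])
  have "- 1 * inner (\<iota> (A (z + h z))) (\<iota> (jn y)) + a / 2 * (norm (\<iota> (jn y)))\<^sup>2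
      \<le> - 1 * L (\<iota> (z + h z + jn y)) - (- 1) * L (\<iota> (z + h z))"
  proof (rule line_second_order(2))
    fix r :: real
    show "\<iota> (z + h z + r *\<^sub>R jn y) \<in> V" by (rule line_far[OF z H[of r]])
    show "a * (norm (\<iota> (jn y)))\<^sup>2 \<le> - 1 * inner (B (z + h z + r *\<^sub>R jn y) (\<iota> (jn y))) (\<iota> (jn y))"
      using far_Hm[OF line_far(1)[OF z H[of r]], of y] y by (simp add: Hm_lift[OF y])
  qed
  moreover have "inner (\<iota> (A (z + h z))) (\<iota> (jn y)) = 0" using gradient_vanishes[OF z H[of 1]] by simp
  moreover have "0 \<le> a / 2 * (norm y)\<^sup>2" using a_pos by simp
  ultimately show ?thesis by (simp add: J_def incl.add Hm_lift[OF y])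
qed

lemma J_continuous: "continuous_on (W \<times> Hp \<times> Hm) (\<lambda>(z, x, y). J z x y)"
proof -
  have hc: "continuous_on (W \<times> Hp \<times> Hm) (\<lambda>p. fst p + h (fst p))"
    by (intro continuous_intros continuous_on_compose2[OF h_continuous]) auto
  have "continuous_on (W \<times> Hp \<times> Hm) (\<lambda>p. L (\<iota> (fst p + h (fst p)) + fst (snd p) + snd (snd p)))"
    by (rule continuous_on_compose2[OF L_cont]) (auto intro!: continuous_intros incl.continuous_on hc point_V)
  moreover have "continuous_on (W \<times> Hp \<times> Hm) (\<lambda>p. L (\<iota> (fst p + h (fst p))))"
    by (rule continuous_on_compose2[OF L_cont]) (auto intro!: incl.continuous_on hc h_V)
  ultimately show ?thesis unfolding J_def case_prod_unfold by (intro continuous_on_diff)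
qed

section \<open>The splitting homeomorphism\<close>

abbreviation "D \<equiv> ker_outside_plus Binf R Hpm"
abbreviation "Dm \<equiv> ker_outside_plus Binf R Hm"

lemma Hpm_zero_projections: "u \<in> Hpm \<Longrightarrow> j0 u = 0"
  by (rule injD[OF incl_inj]) (simp add: incl_j0 p0_Hpm incl.zero)

lemma projections_of_sum:
  assumes z: "z \<in> Xker" and x: "x \<in> Hp" and y: "y \<in> Hm"
  shows "p0 (\<iota> z + x + y) = \<iota> z" "j0 (\<iota> z + x + y) = z" "pp (\<iota> z + x + y) = x" "pn (\<iota> z + x + y) = y"
proof -
  interpret l0: bounded_linear p0 by (rule bounded_linear_p0)
  interpret lp: bounded_linear pp by (rule bounded_linear_pp)
  interpret ln: bounded_linear pn by (rule bounded_linear_pn)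
  interpret lj: bounded_linear j0 by (rule bounded_linear_lift)
  have zk: "\<iota> z \<in> ker_op Binf" using z by (simp add: mem_Xker)
  show "p0 (\<iota> z + x + y) = \<iota> z" by (simp add: l0.add p0_id[OF zk] p0_Hpm Hp_Hpm[OF x] Hm_Hpm[OF y])
  show "j0 (\<iota> z + x + y) = z" by (simp add: lj.add j0_id[OF z] Hpm_zero_projections Hp_Hpm[OF x] Hm_Hpm[OF y])
  show "pp (\<iota> z + x + y) = x" by (simp add: lp.add pp_ker[OF zk] pp_id[OF x] pp_Hm[OF y])
  show "pn (\<iota> z + x + y) = y" by (simp add: ln.add pn_ker[OF zk] pn_id[OF y] pn_Hp[OF x])
qed

lemma D_iff: "w \<in> D \<longleftrightarrow> j0 w \<in> W"
proof
  assume "w \<in> D"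
  then obtain z u where zu: "w = z + u" "z \<in> ker_op Binf" "norm z > R" "u \<in> Hpm" by (auto simp: ker_outside_plus_def)
  obtain x where x: "z = \<iota> x" using ker_op_in_range[OF zu(2)] by auto
  have "j0 w = x"
    using projections_of_sum(2)[of x "pp u" "pn u"] Hpm_decomp[OF zu(4)] zu x pp_Hp pn_Hm
    by (simp add: mem_Xker add.assoc)
  then show "j0 w \<in> W" using zu x by (simp add: mem_W mem_Xker)
next
  assume w: "j0 w \<in> W"
  have "w = p0 w + (pp w + pn w)" using projections_sum[of w] by (simp add: add.assoc)
  moreover have "pp w + pn w \<in> Hpm" by (intro subspace_add[OF subspaces(4)] Hp_Hpm Hm_Hpm pp_Hp pn_Hm)
  moreover have "norm (p0 w) > R" using w by (simp add: mem_W incl_j0)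
  ultimately show "w \<in> D" unfolding ker_outside_plus_def using p0_ker by blast
qed

lemma Dm_iff: "w \<in> Dm \<longleftrightarrow> j0 w \<in> W \<and> pp w = 0"
proof
  assume "w \<in> Dm"
  then obtain z u where zu: "w = z + u" "z \<in> ker_op Binf" "norm z > R" "u \<in> Hm" by (auto simp: ker_outside_plus_def)
  obtain x where x: "z = \<iota> x" using ker_op_in_range[OF zu(2)] by auto
  have "j0 w = x \<and> pp w = 0"
    using projections_of_sum(2,3)[of x 0 u] zu x subspace_0[OF subspaces(2)] by (simp add: mem_Xker)
  then show "j0 w \<in> W \<and> pp w = 0" using zu x by (simp add: mem_W mem_Xker)
next
  assume w: "j0 w \<in> W \<and> pp w = 0"
  have "w = p0 w + pn w" using projections_sum[of w] w by simp
  moreover have "norm (p0 w) > R" using w by (simp add: mem_W incl_j0)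
  ultimately show "w \<in> Dm" unfolding ker_outside_plus_def using p0_ker pn_Hm by blast
qed

lemma D_V: "D \<subseteq> V"
proof
  fix w assume "w \<in> D"
  then obtain z u where zu: "w = z + u" "z \<in> ker_op Binf" "norm z > R" "u \<in> Hpm" by (auto simp: ker_outside_plus_def)
  then have "norm w > R" using norm_ker_le[of z u] by simp
  then show "w \<in> V" by (rule far_V)
qed

lemma Dm_D: "Dm \<subseteq> D" by (auto simp: D_iff Dm_iff)

lemma Dm_range: "Dm \<subseteq> range \<iota>"
proof
  fix w assume "w \<in> Dm"
  then have "w = \<iota> (j0 w + jn w)" using projections_sum[of w] by (simp add: Dm_iff incl.add incl_j0 incl_jn)
  then show "w \<in> range \<iota>" by (metis rangeI)
qed

lemma pp_range: "\<exists>k. \<iota> k = pp (\<iota> x)"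
  by (rule exI[of _ "x - j0 (\<iota> x) - jn (\<iota> x)"]) (simp add: incl.diff incl_j0 incl_jn pp_def)

text \<open>
Apply the saddle normal form with \<open>z\<close> as parameter and move the origin to \<open>z + h z\<close>; as the kernel component is preserved,
the inverses of the two changes of variables assemble to an inverse of \<open>\<Phi>\<close>. The \<open>H\<^sup>+\<close> component is
only rescaled along rays and the other ones take values in \<open>X\<close>, so \<open>\<Phi>\<close> preserves \<open>X\<close>. If
\<open>u\<^sup>+ = 0\<close>, all components of \<open>\<Phi>\<close> other than \<open>h\<close> are in finite dimensional spaces, on which continuity for the
norm of \<open>H\<close> implies continuity for the norm of \<open>X\<close>.
\<close>
lemma splitting_homeomorphism:
  obtains \<Phi> :: "'h \<Rightarrow> 'h" and \<phi> :: "'x \<Rightarrow> 'h \<Rightarrow> 'h" where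
    "\<exists>\<Psi>. homeomorphism D D \<Phi> \<Psi>"
    "\<forall>z\<in>W. \<forall>up\<in>Hp. \<forall>um\<in>Hm. \<Phi> (\<iota> z + up + um) = \<iota> z + \<iota> (h z) + \<phi> z (up + um) \<and> \<phi> z (up + um) \<in> Hpm"
    "\<forall>z\<in>W. \<forall>x\<in>Xpm. \<Phi> (\<iota> z + \<iota> x) \<in> range \<iota>"
    "\<forall>z\<in>W. \<forall>up\<in>Hp. \<forall>um\<in>Hm. L (\<Phi> (\<iota> z + up + um)) = (norm up)\<^sup>2 - (norm um)\<^sup>2 + Linf z"
    "\<forall>z\<in>W. \<Phi> (\<iota> z) = \<iota> z + \<iota> (h z) \<and> (\<forall>up\<in>Hp. \<forall>um\<in>Hm. \<phi> z (up + um) \<in> Hm \<longleftrightarrow> up = 0)"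
    "\<Phi> ` Dm \<subseteq> range \<iota>"
    "\<exists>\<Psi>. homeomorphism Dm (\<Phi> ` Dm) \<Phi> \<Psi>"
    "\<exists>\<Psi>. homeomorphism (\<iota> -` Dm) (\<iota> -` (\<Phi> ` Dm)) (restrict_X \<iota> \<Phi>) \<Psi>"
proof -
  have a2: "a / 2 > 0" using a_pos by simp
  have cN: "compact (Hm \<inter> cball 0 r)" for r unfolding neg_subspace_eq by (rule nf.compact_span_cball)
  obtain X Y K1 K2 where
    cX: "continuous_on (W \<times> Hp) (\<lambda>(z, p). X z p)" and cY: "continuous_on (W \<times> Hp \<times> Hm) (\<lambda>(z, p, q). Y z p q)"
    and cK1: "continuous_on (W \<times> Hp) (\<lambda>(z, x). K1 z x)" and cK2: "continuous_on (W \<times> Hp \<times> Hm) (\<lambda>(z, x, y). K2 z x y)"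
    and ray: "\<forall>z p. (\<exists>r. X z p = r *\<^sub>R p) \<and> (\<exists>r. K1 z p = r *\<^sub>R p)"
    and fwd: "\<forall>z\<in>W. \<forall>p\<in>Hp. \<forall>q\<in>Hm. Y z p q \<in> Hm \<and> K1 z (X z p) = p \<and> K2 z (X z p) (Y z p q) = q
        \<and> J z (X z p) (Y z p q) = (norm p)\<^sup>2 - (norm q)\<^sup>2"
    and bwd: "\<forall>z\<in>W. \<forall>x\<in>Hp. \<forall>y\<in>Hm. K2 z x y \<in> Hm \<and> X z (K1 z x) = x \<and> Y z (K1 z x) (K2 z x y) = y"
    and Y00: "\<forall>z\<in>W. Y z 0 0 = 0"
    by (rule saddle_normal_form[OF subspaces(2,3) cN a2 J_continuous])
      ((rule J_convex; assumption), (rule J_concave; assumption), (rule J_lower; assumption),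
        (rule J_upper; assumption), (rule that; assumption))
  note s0 = subspace_0[OF subspaces(2)] subspace_0[OF subspaces(3)]
  have XHp: "X z p \<in> Hp" "K1 z p \<in> Hp" if "p \<in> Hp" for z p
    using ray subspace_scale[OF subspaces(2) that] by metis+
  have X0: "X z 0 = 0" "K1 z 0 = 0" for z
    using ray by (metis scaleR_zero_right)+
  define \<phi> where "\<phi> z u = X z (pp u) + Y z (pp u) (pn u)" for z u
  define \<Phi> where "\<Phi> w = p0 w + \<iota> (h (j0 w)) + \<phi> (j0 w) w" for w
  define \<Psi> where "\<Psi> v = p0 v + K1 (j0 v) (pp (v - \<iota> (h (j0 v)))) + K2 (j0 v) (pp (v - \<iota> (h (j0 v)))) (pn (v - \<iota> (h (j0 v))))" for v
  have \<Phi>: "\<Phi> (\<iota> z + p + q) = \<iota> z + \<iota> (h z) + X z p + Y z p q" if "z \<in> W" "p \<in> Hp" "q \<in> Hm" for z p q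
    using projections_of_sum[of z p q] that by (simp add: \<Phi>_def \<phi>_def mem_W add.assoc)
  have h_split: "\<iota> (h z) \<in> Hpm" if "z \<in> W" for z using h(1)[OF that] by (simp add: mem_Xpm)
  have \<Psi>: "\<Psi> (\<iota> z + \<iota> (h z) + x + y) = \<iota> z + K1 z x + K2 z x y" "p0 (\<iota> z + \<iota> (h z) + x + y) = \<iota> z"
    "j0 (\<iota> z + \<iota> (h z) + x + y) = z" if z: "z \<in> W" and xy: "x \<in> Hp" "y \<in> Hm" for z x y
  proof -
    have eq: "\<iota> z + \<iota> (h z) + x + y = \<iota> z + (pp (\<iota> (h z)) + x) + (pn (\<iota> (h z)) + y)"
      by (subst Hpm_decomp[OF h_split[OF z]]) (simp add: add_ac)
    have H: "pp (\<iota> (h z)) + x \<in> Hp" "pn (\<iota> (h z)) + y \<in> Hm"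
      by (intro subspace_add[OF subspaces(2)] subspace_add[OF subspaces(3)] pp_Hp pn_Hm xy)+
    have zk: "z \<in> Xker" using z by (simp add: mem_W)
    show p: "p0 (\<iota> z + \<iota> (h z) + x + y) = \<iota> z" and j: "j0 (\<iota> z + \<iota> (h z) + x + y) = z"
      unfolding eq by (rule projections_of_sum[OF zk H])+
    have d: "\<iota> z + \<iota> (h z) + x + y - \<iota> (h z) = \<iota> z + x + y" by simp
    show "\<Psi> (\<iota> z + \<iota> (h z) + x + y) = \<iota> z + K1 z x + K2 z x y"
      unfolding \<Psi>_def j p d using projections_of_sum(3,4)[OF zk xy] by simp
  qed
  have D_form: "\<exists>z\<in>W. \<exists>p\<in>Hp. \<exists>q\<in>Hm. w = \<iota> z + p + q" if "w \<in> D" for w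
    using that projections_sum[of w] pp_Hp pn_Hm by (metis D_iff incl_j0)
  have D_form': "\<exists>z\<in>W. \<exists>x\<in>Hp. \<exists>y\<in>Hm. v = \<iota> z + \<iota> (h z) + x + y" if v: "v \<in> D" for v
  proof -
    let ?z = "j0 v"
    have z: "?z \<in> W" using v by (simp add: D_iff)
    interpret lp: bounded_linear pp by (rule bounded_linear_pp)
    interpret ln: bounded_linear pn by (rule bounded_linear_pn)
    have "v = \<iota> ?z + \<iota> (h ?z) + pp (v - \<iota> (h ?z)) + pn (v - \<iota> (h ?z))"
    proof -
      have "pp (v - \<iota> (h ?z)) + pn (v - \<iota> (h ?z)) = (pp v + pn v) - (pp (\<iota> (h ?z)) + pn (\<iota> (h ?z)))"
        by (simp add: lp.diff ln.diff)
      also have "\<dots> = (v - p0 v) - \<iota> (h ?z)"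
        using projections_sum[of v] Hpm_decomp[OF h_split[OF z]] by (simp add: algebra_simps)
      finally show ?thesis by (simp add: incl_j0 add.assoc)
    qed
    then show ?thesis using z pp_Hp pn_Hm by blast
  qed
  have inD: "\<iota> z + p + q \<in> D" "\<iota> z + \<iota> (h z) + p + q \<in> D" if "z \<in> W" "p \<in> Hp" "q \<in> Hm" for z p q
    using that projections_of_sum(2)[of z p q] \<Psi>(3)[OF that] by (auto simp: D_iff mem_W)
  have cj0: "continuous_on D j0" by (intro bounded_linear.continuous_on[OF bounded_linear_lift] continuous_on_id)
  have cp0: "continuous_on D p0" by (intro bounded_linear.continuous_on[OF bounded_linear_p0] continuous_on_id)
  have ch: "continuous_on D (\<lambda>w. \<iota> (h (j0 w)))"
    by (intro incl.continuous_on continuous_on_compose2[OF h_continuous cj0]) (auto simp: D_iff)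
  have cont2: "continuous_on D (\<lambda>w. F (j0 w) (pp (g w)))" if "continuous_on (W \<times> Hp) (\<lambda>(z, p). F z p)" "continuous_on D g"
    for F :: "'x \<Rightarrow> 'h \<Rightarrow> 'h" and g
  proof -
    have "continuous_on D (\<lambda>w. (j0 w, pp (g w)))"
      by (intro continuous_on_Pair cj0 bounded_linear.continuous_on[OF bounded_linear_pp] that(2))
    from continuous_on_compose2[OF that(1) this] show ?thesis using pp_Hp by (auto simp: D_iff image_subset_iff)
  qed
  have cont3: "continuous_on D (\<lambda>w. F (j0 w) (pp (g w)) (pn (g w)))"
    if "continuous_on (W \<times> Hp \<times> Hm) (\<lambda>(z, p, q). F z p q)" "continuous_on D g"
    for F :: "'x \<Rightarrow> 'h \<Rightarrow> 'h \<Rightarrow> 'h" and g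
  proof -
    have "continuous_on D (\<lambda>w. (j0 w, pp (g w), pn (g w)))"
      by (intro continuous_on_Pair cj0 bounded_linear.continuous_on[OF bounded_linear_pp]
          bounded_linear.continuous_on[OF bounded_linear_pn] that(2))
    from continuous_on_compose2[OF that(1) this] show ?thesis using pp_Hp pn_Hm by (auto simp: D_iff image_subset_iff)
  qed
  have c\<Phi>: "continuous_on D \<Phi>"
    unfolding \<Phi>_def \<phi>_def by (intro continuous_on_add cp0 ch cont2 cX cont3 cY continuous_on_id)
  have c\<Psi>: "continuous_on D \<Psi>"
    unfolding \<Psi>_def by (intro continuous_on_add cp0 ch cont2 cK1 cont3 cK2 continuous_on_diff continuous_on_id)
  have homeo: "homeomorphism D D \<Phi> \<Psi>"
  proof (rule homeomorphismI[OF c\<Phi> c\<Psi>])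
    show "\<Phi> ` D \<subseteq> D"
    proof
      fix v assume "v \<in> \<Phi> ` D"
      then obtain z p q where "z \<in> W" "p \<in> Hp" "q \<in> Hm" "v = \<Phi> (\<iota> z + p + q)" using D_form by blast
      then show "v \<in> D" using inD(2)[of z "X z p" "Y z p q"] XHp fwd \<Phi> by auto
    qed
    show "\<Psi> ` D \<subseteq> D"
    proof
      fix w assume "w \<in> \<Psi> ` D"
      then obtain z x y where "z \<in> W" "x \<in> Hp" "y \<in> Hm" "w = \<Psi> (\<iota> z + \<iota> (h z) + x + y)" using D_form' by blast
      then show "w \<in> D" using inD(1)[of z "K1 z x" "K2 z x y"] XHp bwd \<Psi> by auto
    qed
    show "\<Psi> (\<Phi> w) = w" if w: "w \<in> D" for w
    proof -
      obtain z p q where zpq: "z \<in> W" "p \<in> Hp" "q \<in> Hm" "w = \<iota> z + p + q" using D_form[OF w] by blast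
      have "\<Psi> (\<Phi> w) = \<iota> z + K1 z (X z p) + K2 z (X z p) (Y z p q)"
        unfolding zpq(4) \<Phi>[OF zpq(1-3)] using zpq XHp fwd by (intro \<Psi>(1)) auto
      then show ?thesis using zpq fwd by auto
    qed
    show "\<Phi> (\<Psi> v) = v" if v: "v \<in> D" for v
    proof -
      obtain z x y where zxy: "z \<in> W" "x \<in> Hp" "y \<in> Hm" "v = \<iota> z + \<iota> (h z) + x + y" using D_form'[OF v] by blast
      have "\<Phi> (\<Psi> v) = \<iota> z + \<iota> (h z) + X z (K1 z x) + Y z (K1 z x) (K2 z x y)"
        unfolding zxy(4) \<Psi>(1)[OF zxy(1-3)] using zxy XHp bwd by (intro \<Phi>) auto
      then show ?thesis using zxy bwd by auto
    qed
  qed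
  have homeoDm: "homeomorphism Dm (\<Phi> ` Dm) \<Phi> \<Psi>"
    using homeomorphism_of_subsets[OF homeo Dm_D, of "\<Phi> ` Dm"] homeomorphism_image1[OF homeo] Dm_D by blast
  have range_\<Phi>: "\<Phi> w \<in> range \<iota>" if w: "w \<in> D" "w \<in> range \<iota>" for w
  proof -
    obtain x where x: "w = \<iota> x" using w by auto
    have z: "j0 w \<in> W" using w by (simp add: D_iff)
    obtain k where k: "\<iota> k = pp w" using pp_range x by blast
    obtain r where r: "X (j0 w) (pp w) = r *\<^sub>R pp w" using ray by blast
    have "Y (j0 w) (pp w) (pn w) \<in> Hm" using fwd z pp_Hp pn_Hm by blast
    then obtain l where l: "\<iota> l = Y (j0 w) (pp w) (pn w)" using Hm_in_range by (metis imageE)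
    have "\<Phi> w = \<iota> (j0 w + h (j0 w) + (r *\<^sub>R k + l))"
      by (simp add: \<Phi>_def \<phi>_def incl.add incl.scaleR k l r incl_j0)
    then show ?thesis by (metis rangeI)
  qed
  have Dm_form: "\<Phi> (\<iota> x) = \<iota> (j0 (\<iota> x) + h (j0 (\<iota> x)) + jn (Y (j0 (\<iota> x)) 0 (pn (\<iota> x))))" if x: "\<iota> x \<in> Dm" for x
  proof -
    have z: "j0 (\<iota> x) \<in> W" "pp (\<iota> x) = 0" using x by (auto simp: Dm_iff)
    have "Y (j0 (\<iota> x)) 0 (pn (\<iota> x)) \<in> Hm" using fwd z s0 pn_Hm by blast
    then show ?thesis by (simp add: \<Phi>_def \<phi>_def z X0 incl.add incl_j0 Hm_lift)
  qed
  have rX: "restrict_X \<iota> \<Phi> x = j0 (\<iota> x) + h (j0 (\<iota> x)) + jn (Y (j0 (\<iota> x)) 0 (pn (\<iota> x)))" if "\<iota> x \<in> Dm" for x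
    unfolding restrict_X_def Dm_form[OF that] by (rule inv_incl)
  \<comment> \<open>the inverse only meets \<open>H\<^sup>0 \<oplus> H\<^sup>-\<close>, where lifting to \<open>X\<close> is continuous\<close>
  define \<Psi>X where "\<Psi>X x = j0 (\<Psi> (\<iota> x)) + jn (\<Psi> (\<iota> x))" for x
  have \<Psi>X: "\<iota> (\<Psi>X x) = \<Psi> (\<iota> x)" if x: "\<iota> x \<in> \<Phi> ` Dm" for x
  proof -
    have "\<Psi> (\<iota> x) \<in> Dm" using homeomorphism_image2[OF homeoDm] x by blast
    then have "pp (\<Psi> (\<iota> x)) = 0" by (simp add: Dm_iff)
    then show ?thesis using projections_sum[of "\<Psi> (\<iota> x)"] by (simp add: \<Psi>X_def incl.add incl_j0 incl_jn)
  qed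
  have homeoX: "homeomorphism (\<iota> -` Dm) (\<iota> -` (\<Phi> ` Dm)) (restrict_X \<iota> \<Phi>) \<Psi>X"
  proof (rule homeomorphismI)
    have ci: "continuous_on (\<iota> -` Dm) \<iota>" by (intro incl.continuous_on continuous_on_id)
    have cj: "continuous_on (\<iota> -` Dm) (\<lambda>x. j0 (\<iota> x))"
      by (intro bounded_linear.continuous_on[OF bounded_linear_lift] ci)
    have "continuous_on (\<iota> -` Dm) (\<lambda>x. (j0 (\<iota> x), 0 :: 'h, pn (\<iota> x)))"
      by (intro continuous_on_Pair cj continuous_on_const bounded_linear.continuous_on[OF bounded_linear_pn] ci)
    from continuous_on_compose2[OF cY this]
    have "continuous_on (\<iota> -` Dm) (\<lambda>x. Y (j0 (\<iota> x)) 0 (pn (\<iota> x)))"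
      using s0 pn_Hm by (auto simp: Dm_iff image_subset_iff)
    then have "continuous_on (\<iota> -` Dm) (\<lambda>x. j0 (\<iota> x) + h (j0 (\<iota> x)) + jn (Y (j0 (\<iota> x)) 0 (pn (\<iota> x))))"
      by (intro continuous_on_add cj bounded_linear.continuous_on[OF bounded_linear_lift]
          continuous_on_compose2[OF h_continuous cj]) (auto simp: Dm_iff)
    then show "continuous_on (\<iota> -` Dm) (restrict_X \<iota> \<Phi>)"
      by (rule continuous_on_cong[THEN iffD1, rotated -1]) (use rX in auto)
    have "\<Phi> ` Dm \<subseteq> D" using homeomorphism_image1[OF homeo] Dm_D by blast
    then have "continuous_on (\<iota> -` (\<Phi> ` Dm)) (\<lambda>x. \<Psi> (\<iota> x))"
      by (intro continuous_on_compose2[OF c\<Psi> incl.continuous_on[OF continuous_on_id]]) auto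
    then show "continuous_on (\<iota> -` (\<Phi> ` Dm)) \<Psi>X"
      unfolding \<Psi>X_def by (intro continuous_on_add bounded_linear.continuous_on[OF bounded_linear_lift])
    have \<Phi>r: "\<iota> (restrict_X \<iota> \<Phi> x) = \<Phi> (\<iota> x)" if "\<iota> x \<in> Dm" for x
      unfolding rX[OF that] Dm_form[OF that] ..
    show "restrict_X \<iota> \<Phi> ` (\<iota> -` Dm) \<subseteq> \<iota> -` (\<Phi> ` Dm)" using \<Phi>r by auto
    show "\<Psi>X ` (\<iota> -` (\<Phi> ` Dm)) \<subseteq> \<iota> -` Dm" using \<Psi>X homeomorphism_image2[OF homeoDm] by auto
    show "\<Psi>X (restrict_X \<iota> \<Phi> x) = x" if "x \<in> \<iota> -` Dm" for x
    proof (rule injD[OF incl_inj])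
      have "\<iota> (restrict_X \<iota> \<Phi> x) \<in> \<Phi> ` Dm" using \<Phi>r[of x] that by auto
      then show "\<iota> (\<Psi>X (restrict_X \<iota> \<Phi> x)) = \<iota> x"
        using \<Psi>X \<Phi>r[of x] that homeomorphism_apply1[OF homeoDm] by auto
    qed
    show "restrict_X \<iota> \<Phi> (\<Psi>X x) = x" if x: "x \<in> \<iota> -` (\<Phi> ` Dm)" for x
    proof (rule injD[OF incl_inj])
      have e: "\<iota> (\<Psi>X x) = \<Psi> (\<iota> x)" using \<Psi>X[of x] x by simp
      then have "\<iota> (\<Psi>X x) \<in> Dm" using homeomorphism_image2[OF homeoDm] x by auto
      from \<Phi>r[OF this] show "\<iota> (restrict_X \<iota> \<Phi> (\<Psi>X x)) = \<iota> x"
        using e homeomorphism_apply2[OF homeoDm] x by auto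
    qed
  qed
  show ?thesis
  proof (rule that[of \<Phi> \<phi>])
    show "\<exists>\<Psi>. homeomorphism D D \<Phi> \<Psi>" using homeo by blast
    have \<phi>: "\<phi> z (p + q) = X z p + Y z p q" if "p \<in> Hp" "q \<in> Hm" for z p q
      using projections_of_sum(3,4)[of 0 p q] that subspace_0[OF subspace_Xker] by (simp add: \<phi>_def incl.zero)
    show "\<forall>z\<in>W. \<forall>up\<in>Hp. \<forall>um\<in>Hm. \<Phi> (\<iota> z + up + um) = \<iota> z + \<iota> (h z) + \<phi> z (up + um) \<and> \<phi> z (up + um) \<in> Hpm"
      using \<Phi> \<phi> XHp fwd subspace_add[OF subspaces(4) Hp_Hpm Hm_Hpm] by (auto simp: add.assoc)
    show "\<forall>z\<in>W. \<forall>x\<in>Xpm. \<Phi> (\<iota> z + \<iota> x) \<in> range \<iota>"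
    proof (intro ballI range_\<Phi>)
      fix z x assume "z \<in> W" "x \<in> Xpm"
      then show "\<iota> z + \<iota> x \<in> D" unfolding ker_outside_plus_def by (auto simp: mem_W mem_Xker mem_Xpm)
      show "\<iota> z + \<iota> x \<in> range \<iota>" by (simp flip: incl.add)
    qed
    show "\<forall>z\<in>W. \<forall>up\<in>Hp. \<forall>um\<in>Hm. L (\<Phi> (\<iota> z + up + um)) = (norm up)\<^sup>2 - (norm um)\<^sup>2 + Linf z"
    proof (intro ballI)
      fix z p q assume zpq: "z \<in> W" "p \<in> Hp" "q \<in> Hm"
      have "L (\<Phi> (\<iota> z + p + q)) = J z (X z p) (Y z p q) + L (\<iota> (z + h z))"
        unfolding \<Phi>[OF zpq] J_def by (simp add: incl.add)
      then show "L (\<Phi> (\<iota> z + p + q)) = (norm p)\<^sup>2 - (norm q)\<^sup>2 + Linf z" using fwd zpq by (simp add: Linf_def)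
    qed
    show "\<forall>z\<in>W. \<Phi> (\<iota> z) = \<iota> z + \<iota> (h z) \<and> (\<forall>up\<in>Hp. \<forall>um\<in>Hm. \<phi> z (up + um) \<in> Hm \<longleftrightarrow> up = 0)"
    proof (intro ballI conjI)
      fix z assume z: "z \<in> W"
      show "\<Phi> (\<iota> z) = \<iota> z + \<iota> (h z)" using \<Phi>[OF z s0] X0 Y00 z by simp
      fix p q assume pq: "p \<in> Hp" "q \<in> Hm"
      have Y: "Y z p q \<in> Hm" using fwd z pq by blast
      show "\<phi> z (p + q) \<in> Hm \<longleftrightarrow> p = 0"
      proof
        assume "\<phi> z (p + q) \<in> Hm"
        then have "X z p \<in> Hm" using subspace_diff[OF subspaces(3) _ Y] by (fastforce simp: \<phi>[OF pq])
        then have "inner (X z p) (X z p) = 0" using Hp_Hm_orthogonal[OF XHp(1)[OF pq(1)]] by blast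
        then have "X z p = 0" by simp
        then show "p = 0" using fwd z pq X0 by metis
      next
        assume "p = 0"
        then show "\<phi> z (p + q) \<in> Hm" using Y X0 \<phi>[OF pq] by simp
      qed
    qed
    show "\<Phi> ` Dm \<subseteq> range \<iota>" using range_\<Phi> Dm_D Dm_range by blast
    show "\<exists>\<Psi>. homeomorphism Dm (\<Phi> ` Dm) \<Phi> \<Psi>" using homeoDm by blast
    show "\<exists>\<Psi>. homeomorphism (\<iota> -` Dm) (\<iota> -` (\<Phi> ` Dm)) (restrict_X \<iota> \<Phi>) \<Psi>" using homeoX by blast
  qed
qed

end

section \<open>The constant \<open>M(A)\<close> and the contraction hypotheses\<close>

lemma antimono_tendsto_INF_at_top:
  fixes f :: "real \<Rightarrow> 'a::{complete_linorder, linorder_topology}"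
  assumes "antimono f"
  shows "(f \<longlongrightarrow> (INF r. f r)) at_top"
proof (rule order_tendstoI)
  show "\<forall>\<^sub>F r in at_top. a < f r" if "a < (INF r. f r)" for a
    using that by (intro always_eventually allI) (meson INF_lower UNIV_I less_le_trans)
  show "\<forall>\<^sub>F r in at_top. f r < a" if a: "(INF r. f r) < a" for a
  proof -
    obtain r0 where "f r0 < a" using a by (auto simp: INF_less_iff)
    then show ?thesis
      unfolding eventually_at_top_linorder using antimonoD[OF assms] le_less_trans by blast
  qed
qed

context splitting_setting
begin

text \<open>
The suprema decrease with the radius, so their limit is their infimum.
\<close>
lemma M_inf_eq: "M_inf \<iota> Binf A = (INF r. SUP z\<in>{z \<in> Xker. norm z \<ge> r}. ereal (norm (co (A z))))"
  unfolding M_inf_def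
  by (intro tendsto_Lim antimono_tendsto_INF_at_top antimonoI SUP_subset_mono) auto

lemma M_inf_lessD:
  assumes "M_inf \<iota> Binf A < ereal m"
  shows "\<exists>r. \<forall>z\<in>Xker. norm z \<ge> r \<longrightarrow> norm (co (A z)) < m"
proof -
  obtain r where r: "(SUP z\<in>{z \<in> Xker. norm z \<ge> r}. ereal (norm (co (A z)))) < ereal m"
    using assms unfolding M_inf_eq by (auto simp: INF_less_iff)
  have "norm (co (A z)) < m" if "z \<in> Xker" "norm z \<ge> r" for z
  proof -
    have "ereal (norm (co (A z))) \<le> (SUP z\<in>{z \<in> Xker. norm z \<ge> r}. ereal (norm (co (A z))))"
      using that by (intro SUP_upper) auto
    also have "\<dots> < ereal m" by (rule r)
    finally show ?thesis by simp
  qed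
  then show ?thesis by blast
qed

lemma M_inf_nonneg: "0 \<le> M_inf \<iota> Binf A"
  unfolding M_inf_eq
proof (rule INF_greatest)
  fix r :: real
  obtain z where z: "\<iota> z \<in> ker_op Binf" "norm (\<iota> z) = max 0 r" using ker_norm_exists[of "max 0 r"] by auto
  have "norm z \<ge> r" using z(2) incl_norm[of z] by simp
  then have "ereal (norm (co (A z))) \<le> (SUP z\<in>{z \<in> Xker. norm z \<ge> r}. ereal (norm (co (A z))))"
    using z(1) by (intro SUP_upper) (auto simp: mem_Xker)
  moreover have "0 \<le> ereal (norm (co (A z)))" by simp
  ultimately show "0 \<le> (SUP z\<in>{z \<in> Xker. norm z \<ge> r}. ereal (norm (co (A z))))" by (rule order_trans[rotated])
qed

text \<open>
The strict inequality between \<open>\<rho>\<close> and the constant built from \<open>M(A)\<close> leaves room to replace \<open>M(A)\<close> by a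
slightly larger number, which bounds \<open>p A(z)\<close> for all far \<open>z\<close>.
\<close>
lemma radius_exists:
  assumes k: "\<kappa> > 1" and adm: "admissible_radius \<iota> Binf A \<kappa> \<rho>"
  shows "\<exists>r. \<forall>z\<in>Xker. norm (\<iota> z) > r \<longrightarrow> ereal (\<kappa> / (\<kappa> - 1) * (C1 * norm (co (A z)))) < \<rho>"
proof (cases "\<rho> = \<infinity>")
  case True
  then show ?thesis by auto
next
  case False
  define q where "q = \<kappa> / (\<kappa> - 1) * C1"
  have q: "q \<ge> 0" using k Binv_bound(1) by (simp add: q_def)
  have adm': "M_inf \<iota> Binf A < \<infinity>" "ereal q * M_inf \<iota> Binf A < \<rho>" "\<rho> < \<infinity>"
    using adm False by (auto simp: admissible_radius_def q_def)
  obtain m where m: "M_inf \<iota> Binf A = ereal m" using adm'(1) M_inf_nonneg by (cases "M_inf \<iota> Binf A") auto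
  have \<rho>q: "ereal (q * m) < \<rho>" using adm'(2) m by simp
  then obtain p where p: "\<rho> = ereal p" using adm'(3) by (cases \<rho>) auto
  have qm: "q * m < p" using \<rho>q p by simp
  \<comment> \<open>some \<open>m' > m\<close> with still \<open>q m' < p\<close>; the denominator \<open>q + 1\<close> covers \<open>q = 0\<close>\<close>
  define m' where "m' = m + (p - q * m) / (q + 1)"
  have m': "m < m'" using qm q by (simp add: m'_def)
  have "q * ((p - q * m) / (q + 1)) < p - q * m" using qm q by (simp add: field_simps)
  then have qm': "q * m' < p" by (simp add: m'_def distrib_left)
  obtain r where r: "\<And>z. z \<in> Xker \<Longrightarrow> norm z \<ge> r \<Longrightarrow> norm (co (A z)) < m'"
    using M_inf_lessD[of m'] m m' by auto
  have "ereal (\<kappa> / (\<kappa> - 1) * (C1 * norm (co (A z)))) < \<rho>" if z: "z \<in> Xker" "norm (\<iota> z) > r" for z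
  proof -
    have "norm (co (A z)) \<le> m'" using r[OF z(1)] z(2) incl_norm[of z] by simp
    then have "q * norm (co (A z)) \<le> q * m'" using q by (intro mult_left_mono)
    then show ?thesis using qm' by (simp add: p q_def mult.assoc)
  qed
  then show ?thesis by blast
qed

text \<open>
As \<open>B(\<infinity>)\<close> annihilates the kernel and maps into \<open>X\<^sup>\<plusminus>\<close>, \<open>N(z, x)\<close> is the projection of \<open>(A - B(\<infinity>)) (z + x)\<close>,
and the strict derivative says that \<open>A - B(\<infinity>)\<close> has arbitrarily small Lipschitz constants far away.
\<close>
lemma strong_inequality_from_strict_deriv:
  assumes sd: "has_strict_deriv_at_infinity (\<iota> -` V) A BX"
    and k: "\<kappa> > 1" and p: "p > 0"
  shows "\<exists>R1>0. strong_inequality \<iota> V Binf A R1 \<kappa> (ereal p)"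
proof -
  obtain c where c: "c > 0" "\<And>x. norm (co x) \<le> norm x * c" using co.pos_bounded by blast
  \<comment> \<open>\<open>C1 + 1\<close> instead of \<open>C1\<close>, which may be \<open>0\<close>\<close>
  define d where "d = 1 / (\<kappa> * (C1 + 1) * c)"
  have d: "d > 0" using k c(1) Binv_bound(1) by (simp add: d_def)
  obtain R0 where R0: "R0 > 0" "\<And>u. norm u > R0 \<Longrightarrow> u \<in> V" using V_contains_far by blast
  obtain r where r: "\<And>x1 x2. \<iota> x1 \<in> V \<Longrightarrow> \<iota> x2 \<in> V \<Longrightarrow> norm x1 \<ge> r \<Longrightarrow> norm x2 \<ge> r \<Longrightarrow>
      norm (A x1 - A x2 - BX (x1 - x2)) \<le> d * norm (x1 - x2)"
    using strict_deriv_at_infinityD[OF sd linear_BX d] by auto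
  \<comment> \<open>the summand \<open>p\<close> keeps \<open>\<parallel>z + x\<parallel>\<^sub>X \<ge> r\<close> for \<open>\<parallel>x\<parallel>\<^sub>X < p\<close>\<close>
  define R1 where "R1 = max (R0 + 1) (r + p)"
  have inV: "\<iota> (z + x) \<in> V" and big: "norm (z + x) \<ge> r" if zx: "(z, x) \<in> contraction_domain \<iota> Binf R1 (ereal p)" for z x
  proof -
    have z: "z \<in> Xker" "norm (\<iota> z) \<ge> R1" and x: "x \<in> Xpm" "norm x < p"
      using zx by (auto simp: contraction_domain_def)
    have "norm (\<iota> z) \<le> norm (\<iota> (z + x))" using norm_ker_le[of "\<iota> z" "\<iota> x"] z x by (simp add: mem_Xker mem_Xpm incl.add)
    then show "\<iota> (z + x) \<in> V" using z(2) by (intro R0(2)) (simp add: R1_def)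
    have "norm z \<le> norm (z + x) + norm x" using norm_triangle_ineq4[of "z + x" x] by simp
    then show "norm (z + x) \<ge> r" using z(2) x(2) incl_norm[of z] by (simp add: R1_def)
  qed
  have "norm (N_map \<iota> Binf A z1 x1 - N_map \<iota> Binf A z2 x2) \<le> 1 / (\<kappa> * C1) * norm (z1 + x1 - z2 - x2)"
    if zx: "(z1, x1) \<in> contraction_domain \<iota> Binf R1 (ereal p)" "(z2, x2) \<in> contraction_domain \<iota> Binf R1 (ereal p)" for z1 x1 z2 x2
  proof -
    have mem: "z1 \<in> Xker" "z2 \<in> Xker" "x1 \<in> Xpm" "x2 \<in> Xpm" using zx by (auto simp: contraction_domain_def)
    have N: "N_map \<iota> Binf A z x = co (A (z + x) - BX (z + x))" if "z \<in> Xker" for z x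
      by (simp add: N_map_def co.diff co_id[OF BX_Xpm] linear_add[OF linear_BX] BX_Xker[OF that])
    define e where "e = z1 + x1 - z2 - x2"
    have "N_map \<iota> Binf A z1 x1 - N_map \<iota> Binf A z2 x2 = co (A (z1 + x1) - A (z2 + x2) - BX ((z1 + x1) - (z2 + x2)))"
      unfolding N[OF mem(1)] N[OF mem(2)] co.diff[symmetric] by (simp add: linear_diff[OF linear_BX] algebra_simps)
    moreover have e': "(z1 + x1) - (z2 + x2) = e" by (simp add: e_def)
    ultimately have eq: "N_map \<iota> Binf A z1 x1 - N_map \<iota> Binf A z2 x2 = co (A (z1 + x1) - A (z2 + x2) - BX e)" by simp
    have n: "norm (A (z1 + x1) - A (z2 + x2) - BX e) \<le> d * norm e"
      using r[OF inV[OF zx(1)] inV[OF zx(2)] big[OF zx(1)] big[OF zx(2)]] by (simp add: e')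
    show ?thesis
    proof (cases "C1 = 0")
      case True
      have "Binv y = 0" if "y \<in> Xpm" for y using Binv_bound(2)[OF that] True by simp
      then have "co y = 0" for y using Binv(2)[OF co_Xpm[of y]] co_Xpm linear_0[OF linear_BX] by metis
      then show ?thesis unfolding eq using True by simp
    next
      case False
      then have C1: "C1 > 0" using Binv_bound(1) by simp
      have "norm (co (A (z1 + x1) - A (z2 + x2) - BX e)) \<le> (d * norm e) * c"
        using c(2)[of "A (z1 + x1) - A (z2 + x2) - BX e"] mult_right_mono[OF n, of c] c(1) by linarith
      also have "\<dots> = (d * c) * norm e" by simp
      also have "d * c = 1 / (\<kappa> * (C1 + 1))" using c(1) by (simp add: d_def)
      also have "\<dots> \<le> 1 / (\<kappa> * C1)" using C1 k by (intro divide_left_mono mult_left_mono mult_pos_pos) auto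
      finally show ?thesis unfolding eq e_def[symmetric] by (simp add: mult_right_mono)
    qed
  qed
  then have "strong_inequality \<iota> V Binf A R1 \<kappa> (ereal p)"
    unfolding strong_inequality_def using inV by blast
  moreover have "R1 > 0" using R0(1) by (simp add: R1_def)
  ultimately show ?thesis by blast
qed

end

context reduction_setting
begin

lemma h_fixed_point: "z \<in> W \<Longrightarrow> h z = - Binv (N z (h z))"
proof -
  assume z: "z \<in> W"
  have "BX (h z) = - N z (h z)" using h(3)[OF z] by (simp add: N_def)
  then have "h z = Binv (- N z (h z))" using Binv(3)[OF h(1)[OF z]] by simp
  also have "\<dots> = - Binv (N z (h z))" using Binv_linear(2)[OF N_Xpm N_Xpm, of "-1"] by simp
  finally show ?thesis .
qed

text \<open>
Subtract the fixed point equations \<open>h z = - B(\<infinity>)\<^sup>-\<^sup>1 N(z, h z)\<close>.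
\<close>
lemma h_difference:
  assumes "z1 \<in> W" "z2 \<in> W"
  shows "norm (h z1 - h z2) \<le> C1 * norm (N z1 (h z1) - N z2 (h z2))"
proof -
  have "h z1 - h z2 = - Binv (N z1 (h z1)) - (- Binv (N z2 (h z2)))"
    by (rule arg_cong2[where f = "(-)", OF h_fixed_point[OF assms(1)] h_fixed_point[OF assms(2)]])
  also have "\<dots> = - (Binv (N z1 (h z1)) - Binv (N z2 (h z2)))" by simp
  also have "\<dots> = - Binv (N z1 (h z1) - N z2 (h z2))" by (simp add: Binv_linear(3)[OF N_Xpm N_Xpm])
  finally have "norm (h z1 - h z2) = norm (Binv (N z1 (h z1) - N z2 (h z2)))" by simp
  then show ?thesis using Binv_bound(2)[OF subspace_diff[OF subspace_Xpm N_Xpm N_Xpm]] by simp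
qed

lemma contraction_bound_solve:
  fixes x y t :: real
  assumes "x \<le> t * (y + x)" "0 \<le> t" "t < 1"
  shows "x \<le> t / (1 - t) * y"
  using assms by (simp add: field_simps)

text \<open>
The strong inequality bounds the difference of the two values of \<open>N\<close> by a multiple of \<open>\<parallel>z1 - z2\<parallel> + \<parallel>h z1 - h z2\<parallel>\<close>
such that the second summand can be absorbed.
\<close>
lemma h_lipschitz:
  assumes k: "\<kappa>' > 1" and R: "R1' \<le> R" and strong: "strong_inequality \<iota> V Binf A R1' \<kappa>' \<rho>"
  shows "\<exists>C. C-lipschitz_on W h"
proof -
  define t where "t = 1 / \<kappa>'"
  have t: "0 \<le> t" "t < 1" using k by (auto simp: t_def)
  have "(t / (1 - t))-lipschitz_on W h"
  proof (rule lipschitz_onI)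
    fix z1 z2 assume z: "z1 \<in> W" "z2 \<in> W"
    have dom: "(z, h z) \<in> contraction_domain \<iota> Binf R1' \<rho>" if "z \<in> W" for z
      using that h[OF that] R by (simp add: contraction_domain_def mem_W)
    have "norm (N z1 (h z1) - N z2 (h z2)) \<le> 1 / (\<kappa>' * C1) * norm (z1 + h z1 - z2 - h z2)"
      using strong dom[OF z(1)] dom[OF z(2)] unfolding strong_inequality_def N_def N_map_def by fast
    then have "norm (h z1 - h z2) \<le> C1 * (1 / (\<kappa>' * C1) * norm (z1 + h z1 - z2 - h z2))"
      using h_difference[OF z] Binv_bound(1) by (meson mult_left_mono order_trans)
    also have "\<dots> \<le> t * norm (z1 + h z1 - z2 - h z2)"
      using k by (cases "C1 = 0") (auto simp: t_def)
    also have "\<dots> \<le> t * (norm (z1 - z2) + norm (h z1 - h z2))"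
      using norm_triangle_ineq[of "z1 - z2" "h z1 - h z2"] t(1) by (intro mult_left_mono) (simp_all add: algebra_simps)
    finally show "dist (h z1) (h z2) \<le> t / (1 - t) * dist z1 z2"
      unfolding dist_norm by (rule contraction_bound_solve[OF _ t])
  qed (use t in simp)
  then show ?thesis by blast
qed

text \<open>
As for the Lipschitz bound, but with the small Lipschitz constant \<open>d\<close> of \<open>A - B(\<infinity>)\<close> far away instead of the
constant of the strong inequality.
\<close>
lemma h_strict:
  assumes sd: "has_strict_deriv_at_infinity (\<iota> -` V) A BX"
  shows "has_strict_deriv_at_infinity W h (\<lambda>_. 0)"
proof (rule strict_deriv_at_infinityI)
  fix e :: real assume e: "e > 0"
  obtain c where c: "c > 0" "\<And>x. norm (co x) \<le> norm x * c" using co.pos_bounded by blast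
  \<comment> \<open>chosen such that absorbing turns the factor \<open>t\<close> into \<open>t / (1 - t) = e\<close>\<close>
  define t where "t = e / (1 + e)"
  have t: "0 < t" "t < 1" "t / (1 - t) = e" using e by (auto simp: t_def field_simps)
  define d where "d = t / ((C1 + 1) * c)"
  have d: "d > 0" using t c(1) Binv_bound(1) by (simp add: d_def)
  obtain r where r: "\<And>x1 x2. \<iota> x1 \<in> V \<Longrightarrow> \<iota> x2 \<in> V \<Longrightarrow> norm x1 \<ge> r \<Longrightarrow> norm x2 \<ge> r \<Longrightarrow>
      norm (A x1 - A x2 - BX (x1 - x2)) \<le> d * norm (x1 - x2)"
    using strict_deriv_at_infinityD[OF sd linear_BX d] by auto
  obtain c' where c': "c' > 0" "\<And>z. z \<in> Xker \<Longrightarrow> norm z \<le> c' * norm (\<iota> z)" using Xker_norm_bound by blast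
  have "norm (h z1 - h z2 - 0) \<le> e * norm (z1 - z2)"
    if z: "z1 \<in> W" "z2 \<in> W" and big: "norm z1 \<ge> c' * r" "norm z2 \<ge> c' * r" for z1 z2
  proof -
    have far: "norm (z + h z) \<ge> r" if "z \<in> W" "norm z \<ge> c' * r" for z
    proof -
      have "c' * r \<le> c' * norm (\<iota> z)" using c'(2)[of z] that by (simp add: mem_W)
      then have "r \<le> norm (\<iota> z)" using c'(1) by simp
      also have "\<dots> \<le> norm (\<iota> (z + h z))"
        using norm_ker_le[of "\<iota> z" "\<iota> (h z)"] that h(1)[of z] by (simp add: mem_W mem_Xker mem_Xpm incl.add)
      also have "\<dots> \<le> norm (z + h z)" by (rule incl_norm)
      finally show ?thesis .
    qed
    let ?w1 = "z1 + h z1" and ?w2 = "z2 + h z2"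
    have N: "N z x = co (A (z + x) - BX (z + x))" if "z \<in> W" for z x
      using that by (simp add: N_def co.diff co_id[OF BX_Xpm] linear_add[OF linear_BX] BX_Xker mem_W)
    have "N z1 (h z1) - N z2 (h z2) = co (A ?w1 - A ?w2 - BX (?w1 - ?w2))"
      unfolding N[OF z(1)] N[OF z(2)] co.diff[symmetric] by (simp add: linear_diff[OF linear_BX] algebra_simps)
    then have "norm (N z1 (h z1) - N z2 (h z2)) \<le> norm (A ?w1 - A ?w2 - BX (?w1 - ?w2)) * c" using c(2) by simp
    also have "\<dots> \<le> (d * norm (?w1 - ?w2)) * c"
      using r[OF h_V[OF z(1)] h_V[OF z(2)] far[OF z(1) big(1)] far[OF z(2) big(2)]] c(1) by (intro mult_right_mono) auto
    finally have "C1 * norm (N z1 (h z1) - N z2 (h z2)) \<le> C1 * ((d * norm (?w1 - ?w2)) * c)"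
      using Binv_bound(1) by (intro mult_left_mono)
    also have "\<dots> = (C1 * (d * c)) * norm (?w1 - ?w2)" by simp
    also have "\<dots> \<le> t * norm (?w1 - ?w2)"
    proof (rule mult_right_mono)
      have "C1 * (d * c) = C1 / (C1 + 1) * t" using c(1) by (simp add: d_def)
      also have "\<dots> \<le> 1 * t" using Binv_bound(1) t by (intro mult_right_mono) (auto simp: divide_le_eq)
      finally show "C1 * (d * c) \<le> t" by simp
    qed simp
    also have "\<dots> \<le> t * (norm (z1 - z2) + norm (h z1 - h z2))"
      using norm_triangle_ineq[of "z1 - z2" "h z1 - h z2"] t(1) by (intro mult_left_mono) (simp_all add: algebra_simps)
    finally have "norm (h z1 - h z2) \<le> t * (norm (z1 - z2) + norm (h z1 - h z2))" using h_difference[OF z] by linarith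
    from contraction_bound_solve[OF this] show ?thesis using t by simp
  qed
  then show "\<exists>N. \<forall>x1\<in>W. \<forall>x2\<in>W. N \<le> norm x1 \<longrightarrow> N \<le> norm x2 \<longrightarrow> norm (h x1 - h x2 - 0) \<le> e * norm (x1 - x2)"
    by (intro exI[of _ "c' * r"]) auto
qed

lemma h_vanishes:
  assumes "M_inf \<iota> Binf A = 0"
  shows "((\<lambda>z. norm (h z)) \<longlongrightarrow> 0) (inf at_infinity (principal W))"
proof (rule tendstoI)
  fix e :: real assume e: "e > 0"
  define q where "q = \<kappa> / (\<kappa> - 1) * C1"
  have q: "q \<ge> 0" using kappa Binv_bound(1) by (simp add: q_def)
  have "M_inf \<iota> Binf A < ereal (e / (q + 1))" using assms e q by simp
  then obtain r where r: "\<And>z. z \<in> Xker \<Longrightarrow> norm z \<ge> r \<Longrightarrow> norm (co (A z)) < e / (q + 1)"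
    using M_inf_lessD by blast
  have "dist (norm (h z)) 0 < e" if z: "z \<in> W" "norm z \<ge> r" for z
  proof -
    have "norm (h z) \<le> q * norm (co (A z))" using h(2)[OF z(1)] by (simp add: q_def mult.assoc)
    also have "\<dots> \<le> q * (e / (q + 1))" using r[of z] z q by (intro mult_left_mono) (auto simp: mem_W)
    also have "\<dots> < e" using q e by (simp add: field_simps)
    finally show ?thesis by simp
  qed
  then show "\<forall>\<^sub>F z in inf at_infinity (principal W). dist (norm (h z)) 0 < e"
    unfolding eventually_inf_principal eventually_at_infinity by (intro exI[of _ r]) auto
qed

lemma is_reduction_map_h: "is_reduction_map \<iota> Binf A \<rho> R h"
  unfolding is_reduction_map_def using h_continuous h by blast

lemma reduction_map_unique: "is_reduction_map \<iota> Binf A \<rho> R g \<Longrightarrow> z \<in> W \<Longrightarrow> g z = h z"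
  unfolding is_reduction_map_def using h reduction_unique[of z "g z" "h z"] by blast

lemma h_derivative_formula:
  assumes A': "has_differential_on (\<iota> -` V) A A'" and z: "z \<in> W"
  shows "bij_betw (\<lambda>v. co (A' (z + h z) v)) Xpm Xpm"
    and "\<exists>D. (h has_derivative D) (at z within W) \<and>
      (\<forall>v\<in>Xker. D v = - inv_into Xpm (\<lambda>v. co (A' (z + h z) v)) (co (A' (z + h z) v)))"
proof -
  have S: "(\<lambda>v. co (A' (z + h z) v)) = S (z + h z)"
    using A'_dir_deriv[OF A' h_V[OF z]] by (simp add: S_def[abs_def])
  show "bij_betw (\<lambda>v. co (A' (z + h z) v)) Xpm Xpm" unfolding S by (rule S_bij[OF z])
  have S': "co (A' (z + h z) v) = S (z + h z) v" for v using fun_cong[OF S] .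
  have "(h has_derivative Dh z) (at z within W)" using h_differential z by (simp add: has_differential_on_def)
  then show "\<exists>D. (h has_derivative D) (at z within W) \<and>
      (\<forall>v\<in>Xker. D v = - inv_into Xpm (\<lambda>v. co (A' (z + h z) v)) (co (A' (z + h z) v)))"
    using Dh_Xker[OF z] unfolding S' by (intro exI[of _ "blinfun_apply (Dh z)"]) (simp add: dh_def)
qed

end

theorem theorem1p1:
  fixes \<iota> :: "'x::banach \<Rightarrow> 'h::{real_inner, complete_space}"
    and V :: "'h set"
    and L :: "'h \<Rightarrow> real"
    and A :: "'x \<Rightarrow> 'x"
    and B :: "'x \<Rightarrow> 'h \<Rightarrow>\<^sub>L 'h"
    and Binf :: "'h \<Rightarrow>\<^sub>L 'h"
    and P :: "'x \<Rightarrow> 'h \<Rightarrow> 'h"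
    and Pinf :: "'h \<Rightarrow> 'h"
    and Q :: "'x \<Rightarrow> 'h \<Rightarrow>\<^sub>L 'h"
    and Qinf :: "'h \<Rightarrow>\<^sub>L 'h"
    and \<rho> :: ereal
  assumes standing: "standing_hypotheses \<iota> V L A B Binf"
    and decomposition: "decomposition_hypothesis \<iota> V B Binf P Pinf Q Qinf"
    and nullity: "dim (ker_op Binf) > 0"
    and weak: "weak_contraction_hypothesis \<iota> V Binf A \<rho>"
    and asymptotics:
      "((\<lambda>u. (L u - 1/2 * inner (Binf u) u) / (norm u)\<^sup>2) \<longlongrightarrow> 0) at_infinity"
  shows "\<exists>R>0. \<exists>(h :: 'x \<Rightarrow> 'x) (\<Phi> :: 'h \<Rightarrow> 'h) (\<phi> :: 'x \<Rightarrow> 'h \<Rightarrow> 'h).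
    let W = ker_outside \<iota> Binf R;
        Hpm = (ker_op Binf)\<^sup>\<bottom>;
        Hp = pos_subspace Binf;
        Hm = neg_subspace Binf;
        D = ker_outside_plus Binf R Hpm;
        Dm = ker_outside_plus Binf R Hm;
        Linf = (\<lambda>z. L (\<iota> (z + h z)));
        dLinf_formula = (\<forall>z0\<in>W. (Linf has_derivative (\<lambda>z. inner (\<iota> (A (z0 + h z0))) (\<iota> z)))
                                  (at z0 within W))
    in
      D \<subseteq> V
    \<and> is_reduction_map \<iota> Binf A \<rho> R h
    \<and> (\<forall>g. is_reduction_map \<iota> Binf A \<rho> R g \<longrightarrow> (\<forall>z\<in>W. g z = h z))
    \<and> (\<exists>\<Psi>. homeomorphism D D \<Phi> \<Psi>)
    \<and> (\<forall>z\<in>W. \<forall>up\<in>Hp. \<forall>um\<in>Hm.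
         \<Phi> (\<iota> z + up + um) = \<iota> z + \<iota> (h z) + \<phi> z (up + um) \<and> \<phi> z (up + um) \<in> Hpm)
    \<and> (\<forall>z\<in>W. \<forall>x\<in>X_pm \<iota> Binf. \<Phi> (\<iota> z + \<iota> x) \<in> range \<iota>)
    \<and> (\<forall>z\<in>W. \<forall>up\<in>Hp. \<forall>um\<in>Hm.
         L (\<Phi> (\<iota> z + up + um)) = (norm up)\<^sup>2 - (norm um)\<^sup>2 + Linf z)
    \<comment> \<open>(a)\<close>
    \<and> (\<forall>z\<in>W. \<Phi> (\<iota> z) = \<iota> z + \<iota> (h z) \<and>
         (\<forall>up\<in>Hp. \<forall>um\<in>Hm. \<phi> z (up + um) \<in> Hm \<longleftrightarrow> up = 0))
    \<comment> \<open>(b)\<close>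
    \<and> Dm \<subseteq> range \<iota> \<and> \<Phi> ` Dm \<subseteq> range \<iota>
    \<and> (\<exists>\<Psi>. homeomorphism Dm (\<Phi> ` Dm) \<Phi> \<Psi>)
    \<and> (\<exists>\<Psi>. homeomorphism (\<iota> -` Dm) (\<iota> -` (\<Phi> ` Dm)) (restrict_X \<iota> \<Phi>) \<Psi>)
    \<comment> \<open>(i)\<close>
    \<and> (M_inf \<iota> Binf A = 0 \<longrightarrow> ((\<lambda>z. norm (h z)) \<longlongrightarrow> 0) (inf at_infinity (principal W)))
    \<comment> \<open>(ii)\<close>
    \<and> (\<forall>A'. has_differential_on (\<iota> -` V) A A' \<and> continuous_on (\<iota> -` V) A' \<longrightarrow>
         C1_on W h
       \<and> (\<forall>z\<in>W. let S = (\<lambda>v. co_proj \<iota> Binf (A' (z + h z) v)) in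
            bij_betw S (X_pm \<iota> Binf) (X_pm \<iota> Binf)
          \<and> (\<exists>dh. (h has_derivative dh) (at z within W) \<and>
               (\<forall>v\<in>X_ker \<iota> Binf. dh v = - inv_into (X_pm \<iota> Binf) S (S v))))
       \<and> C2_on W Linf \<and> dLinf_formula)
    \<comment> \<open>(iii)\<close>
    \<and> (C2_on V L \<longrightarrow> C1_on W (\<lambda>z. \<iota> (h z)) \<and> C1_on W h)
    \<and> (strong_contraction_hypothesis \<iota> V Binf A \<rho> \<longrightarrow>
      \<comment> \<open>(iv); strict derivative of \<open>h\<close> as a map into \<open>H\<^sup>\<plusminus>\<close>, see also (vi)\<close>
         (\<exists>C. C-lipschitz_on W h)
       \<and> has_strict_deriv_at_infinity W (\<lambda>z. \<iota> (h z)) (\<lambda>_. 0)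
      \<comment> \<open>(v)\<close>
       \<and> C1_on W Linf \<and> dLinf_formula
      \<comment> \<open>(vi)\<close>
       \<and> (bounded_linear (restrict_X \<iota> Binf) \<and>
          has_strict_deriv_at_infinity (\<iota> -` V) A (restrict_X \<iota> Binf) \<longrightarrow>
            has_strict_deriv_at_infinity W h (\<lambda>_. 0)
          \<and> (\<exists>dLinf. has_differential_on W Linf dLinf \<and> locally_lipschitz_on W dLinf \<and>
               has_strict_deriv_at_infinity W dLinf (\<lambda>_. 0))
          \<and> (\<forall>\<rho>'>0. \<forall>\<kappa>>1. \<exists>R1>0. strong_inequality \<iota> V Binf A R1 \<kappa> (ereal \<rho>'))))"
proof -
  interpret sp: splitting_setting \<iota> V L A B Binf P Pinf Q Qinf
    by (intro splitting_setting.intro splitting_setting_axioms.intro standing decomposition nullity)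
  obtain R1 \<kappa> where w: "\<kappa> > 1" "admissible_radius \<iota> Binf A \<kappa> \<rho>" "weak_inequality \<iota> V Binf A R1 \<kappa> \<rho>"
    using weak unfolding weak_contraction_hypothesis_def by blast
  \<comment> \<open>\<open>R\<close> has to exceed the radii of both contraction hypotheses; without the strong one, \<open>R1'\<close> is an arbitrary number\<close>
  obtain R1' \<kappa>' where s: "strong_contraction_hypothesis \<iota> V Binf A \<rho> \<Longrightarrow> \<kappa>' > 1 \<and> strong_inequality \<iota> V Binf A R1' \<kappa>' \<rho>"
    unfolding strong_contraction_hypothesis_def by metis
  obtain a R2 where a: "a > 0" "\<And>x u. norm (\<iota> x) > R2 \<Longrightarrow> u \<in> sp.Hp \<Longrightarrow> a * (norm u)\<^sup>2 \<le> inner (B x u) u"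
    "\<And>x u. norm (\<iota> x) > R2 \<Longrightarrow> u \<in> sp.Hm \<Longrightarrow> inner (B x u) u \<le> - a * (norm u)\<^sup>2"
    using sp.B_definite_far by blast
  obtain R3 where R3: "R3 > 0" "\<And>u. norm u > R3 \<Longrightarrow> u \<in> V" using sp.V_contains_far by blast
  obtain R4 where R4: "\<And>x v. norm (\<iota> x) > R4 \<Longrightarrow> v \<in> ker_op Binf \<Longrightarrow> norm (B x v) \<le> 1 * norm v"
    using sp.B_small_on_ker_far[of 1] by auto
  obtain R5 where R5: "\<And>z. z \<in> sp.Xker \<Longrightarrow> norm (\<iota> z) > R5 \<Longrightarrow> ereal (\<kappa> / (\<kappa> - 1) * (sp.C1 * norm (sp.co (A z)))) < \<rho>"
    using sp.radius_exists[OF w(1,2)] by blast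
  define R where "R = Max {R1, R1', R2, R3, R4, R5}"
  have R: "R1 \<le> R" "R1' \<le> R" "R2 \<le> R" "R3 \<le> R" "R4 \<le> R" "R5 \<le> R" by (simp_all add: R_def)
  interpret r: reduction_setting \<iota> V L A B Binf P Pinf Q Qinf \<rho> \<kappa> R1 R a
  proof unfold_locales
    show "R > 0" using R R3(1) by simp
    show "u \<in> V" if "norm u > R" for u using that R R3(2)[of u] by simp
    show "a * (norm u)\<^sup>2 \<le> inner (B x u) u" if "norm (\<iota> x) > R" "u \<in> sp.Hp" for x u using a(2)[of x u] that R by simp
    show "inner (B x u) u \<le> - a * (norm u)\<^sup>2" if "norm (\<iota> x) > R" "u \<in> sp.Hm" for x u using a(3)[of x u] that R by simp
    show "norm (B x v) \<le> norm v" if "norm (\<iota> x) > R" "v \<in> ker_op Binf" for x v using R4[of x v] that R by simp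
    show "ereal (\<kappa> / (\<kappa> - 1) * (sp.C1 * norm (sp.co (A z)))) < \<rho>" if "z \<in> sp.Xker" "norm (\<iota> z) > R" for z
      using R5[of z] that R by simp
  qed (use w a R in auto)
  obtain \<Phi> :: "'h \<Rightarrow> 'h" and \<phi> :: "'x \<Rightarrow> 'h \<Rightarrow> 'h" where \<Phi>:
    "\<exists>\<Psi>. homeomorphism r.D r.D \<Phi> \<Psi>"
    "\<forall>z\<in>r.W. \<forall>up\<in>sp.Hp. \<forall>um\<in>sp.Hm. \<Phi> (\<iota> z + up + um) = \<iota> z + \<iota> (r.h z) + \<phi> z (up + um) \<and> \<phi> z (up + um) \<in> sp.Hpm"
    "\<forall>z\<in>r.W. \<forall>x\<in>sp.Xpm. \<Phi> (\<iota> z + \<iota> x) \<in> range \<iota>"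
    "\<forall>z\<in>r.W. \<forall>up\<in>sp.Hp. \<forall>um\<in>sp.Hm. L (\<Phi> (\<iota> z + up + um)) = (norm up)\<^sup>2 - (norm um)\<^sup>2 + r.Linf z"
    "\<forall>z\<in>r.W. \<Phi> (\<iota> z) = \<iota> z + \<iota> (r.h z) \<and> (\<forall>up\<in>sp.Hp. \<forall>um\<in>sp.Hm. \<phi> z (up + um) \<in> sp.Hm \<longleftrightarrow> up = 0)"
    "\<Phi> ` r.Dm \<subseteq> range \<iota>"
    "\<exists>\<Psi>. homeomorphism r.Dm (\<Phi> ` r.Dm) \<Phi> \<Psi>"
    "\<exists>\<Psi>. homeomorphism (\<iota> -` r.Dm) (\<iota> -` (\<Phi> ` r.Dm)) (restrict_X \<iota> \<Phi>) \<Psi>"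
    by (rule r.splitting_homeomorphism)
  have formula: "\<forall>z0\<in>r.W. (r.Linf has_derivative (\<lambda>z. inner (\<iota> (A (z0 + r.h z0))) (\<iota> z))) (at z0 within r.W)"
    using r.Linf_formula by blast
  have dLinf: "\<exists>dLinf. has_differential_on r.W r.Linf dLinf \<and> locally_lipschitz_on r.W dLinf \<and>
      has_strict_deriv_at_infinity r.W dLinf (\<lambda>_. 0)"
    using r.Linf_differential r.dLinf_locally_lipschitz r.dLinf_strict by blast
  show ?thesis
    unfolding Let_def
  proof (rule exI[of _ R], rule conjI[OF r.R_pos], rule exI[of _ r.h], rule exI[of _ \<Phi>], rule exI[of _ \<phi>],
      unfold r.Linf_def[symmetric], intro conjI)
    show "r.D \<subseteq> V" by (rule r.D_V)
    show "is_reduction_map \<iota> Binf A \<rho> R r.h" by (rule r.is_reduction_map_h)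
    show "\<forall>g. is_reduction_map \<iota> Binf A \<rho> R g \<longrightarrow> (\<forall>z\<in>r.W. g z = r.h z)" using r.reduction_map_unique by blast
    show "r.Dm \<subseteq> range \<iota>" by (rule r.Dm_range)
    show "M_inf \<iota> Binf A = 0 \<longrightarrow> ((\<lambda>z. norm (r.h z)) \<longlongrightarrow> 0) (inf at_infinity (principal r.W))"
      using r.h_vanishes by blast
    show "\<forall>A'. has_differential_on (\<iota> -` V) A A' \<and> continuous_on (\<iota> -` V) A' \<longrightarrow>
         C1_on r.W r.h
       \<and> (\<forall>z\<in>r.W. bij_betw (\<lambda>v. sp.co (A' (z + r.h z) v)) sp.Xpm sp.Xpm
          \<and> (\<exists>dh. (r.h has_derivative dh) (at z within r.W) \<and>
               (\<forall>v\<in>sp.Xker. dh v = - inv_into sp.Xpm (\<lambda>v. sp.co (A' (z + r.h z) v)) (sp.co (A' (z + r.h z) v)))))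
       \<and> C2_on r.W r.Linf
       \<and> (\<forall>z0\<in>r.W. (r.Linf has_derivative (\<lambda>z. inner (\<iota> (A (z0 + r.h z0))) (\<iota> z))) (at z0 within r.W))"
      using r.h_C1 r.h_derivative_formula r.Linf_C2 formula by blast
    show "C2_on V L \<longrightarrow> C1_on r.W (\<lambda>z. \<iota> (r.h z)) \<and> C1_on r.W r.h"
      using r.incl_h_C1 r.h_C1 by blast
    show "strong_contraction_hypothesis \<iota> V Binf A \<rho> \<longrightarrow>
         (\<exists>C. C-lipschitz_on r.W r.h)
       \<and> has_strict_deriv_at_infinity r.W (\<lambda>z. \<iota> (r.h z)) (\<lambda>_. 0)
       \<and> C1_on r.W r.Linf
       \<and> (\<forall>z0\<in>r.W. (r.Linf has_derivative (\<lambda>z. inner (\<iota> (A (z0 + r.h z0))) (\<iota> z))) (at z0 within r.W))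
       \<and> (bounded_linear (restrict_X \<iota> Binf) \<and>
          has_strict_deriv_at_infinity (\<iota> -` V) A (restrict_X \<iota> Binf) \<longrightarrow>
            has_strict_deriv_at_infinity r.W r.h (\<lambda>_. 0)
          \<and> (\<exists>dLinf. has_differential_on r.W r.Linf dLinf \<and> locally_lipschitz_on r.W dLinf \<and>
               has_strict_deriv_at_infinity r.W dLinf (\<lambda>_. 0))
          \<and> (\<forall>\<rho>'>0. \<forall>\<kappa>>1. \<exists>R1>0. strong_inequality \<iota> V Binf A R1 \<kappa> (ereal \<rho>')))"
      using r.h_lipschitz[OF _ R(2)] s r.incl_h_strict r.Linf_C1 formula r.h_strict dLinf
        sp.strong_inequality_from_strict_deriv by blast
  qed (fact \<Phi>)+
qed

end
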